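(* Let $\varphi:\mathbb{D}\to\mathbb{D}$ be a holomorphic function such that there exists a hyperbolic holomorphic semiflow $(\varphi_t)_{t\ge0}$ with $\varphi=\varphi_1$. Let $\Omega$ be its Koenigs domain and assume that $\operatorname{int}(\overline{\Omega})=\Omega$ and that $\mathbb{C}\setminus\overline{\Omega}$ has at most two connected components. Let $1\le p<\infty$ and consider $C_\varphi\in\mathcal{L}(H^p)$. Then: (a) Assume that $\Omega$ does not contain any horizontal strip, and let $\rho=\inf\{\operatorname{Re}(z):z\in\Omega\}$. (i) If $\rho>-\infty$, then $\operatorname{Ext}(C_\varphi)=\overline{\mathbb{D}}\setminus\{0\}$. (ii) If $\rho=-\infty$, then $\mathbb{T}\subseteq\operatorname{Ext}(C_\varphi)\subseteq\overline{\mathbb{D}}\setminus\{0\}$. (b) Assume that $\Omega$ contains a horizontal strip. Then $\operatorname{Ext}(C_\varphi)=\mathbb{T}$.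
   Context: $\mathbb{D}$ is the open unit disc of $\mathbb{C}$ and $\mathbb{T}$ the unit circle. For $1\le p<\infty$, $H^p$ is the Banach space of holomorphic $f:\mathbb{D}\to\mathbb{C}$ with $\|f\|_{H^p}=\left(\sup_{0<r<1}\int_0^{2\pi}|f(re^{i\theta})|^p\,d\theta\right)^{1/p}<\infty$. For holomorphic $\varphi:\mathbb{D}\to\mathbb{D}$, $C_\varphi f=f\circ\varphi$, a bounded operator on $H^p$. For a complex Banach space $X$, $\mathcal{L}(X)$ is the algebra of bounded linear operators on $X$. For $T\in\mathcal{L}(X)$, a number $\lambda\in\mathbb{C}$ is an extended eigenvalue of $T$ if there exists a non-zero $A\in\mathcal{L}(X)$ with $TA=\lambda AT$; $\operatorname{Ext}(T)$ is the set of extended eigenvalues of $T$. Semiflows. A holomorphic semiflow is a family $(\varphi_t)_{t\ge0}$ of holomorphic self-maps of $\mathbb{D}$ with $\varphi_0(z)=z$, $\varphi_{t+s}=\varphi_t\circ\varphi_s$ for all $t,s\geq 0$, and $\varphi_t\to\varphi_s$ uniformly on compact subsets of $\mathbb{D}$ as $t\to s$. It is elliptic if $\varphi_{t_0}(z_0)=z_0$ for some $t_0>0$ and $z_0\in\mathbb{D}$. If it is not elliptic, there is a unique $\tau\in\mathbb{T}$ (the Denjoy–Wolff point) such that $\varphi_t\to\tau$ uniformly on compact subsets as $t\to\infty$, and there is $\alpha\le 0$ such that $\varphi_t'$ has non-tangential limit $e^{t\alpha}$ at $\tau$ for all $t\geq 0$; the semiflow is hyperbolic if $\alpha<0$ and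 parabolic if $\alpha=0$. For a non-elliptic semiflow there is a univalent function $h:\mathbb{D}\to\mathbb{C}$ (the Koenigs function), unique up to an additive constant, with $\varphi_t(z)=h^{-1}(h(z)+t)$ for all $z\in\mathbb{D}$, $t\ge0$. The Koenigs domain is $\Omega=h(\mathbb{D})$. A horizontal strip is a set $\{w\in\mathbb{C}: a<\operatorname{Im}(w)<b\}$ with $-\infty<a<b<\infty$. Interior and closure are taken in $\mathbb{C}$. *)

theory Defs
  imports "HOL-Complex_Analysis.Complex_Analysis"
begin

abbreviation unit_disc :: "complex set" where
  "unit_disc \<equiv> ball 0 1"

section \<open>Hardy spaces\<close>

definition Hp_integral :: "real \<Rightarrow> (complex \<Rightarrow> complex) \<Rightarrow> real \<Rightarrow> real" where
  "Hp_integral p f r =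
     integral {0..2 * pi} (\<lambda>\<theta>. cmod (f (of_real r * exp (\<i> * of_real \<theta>))) powr p)"

text \<open>
  HOL functions are total, so a function on the disc is represented by its extension by zero.
  In this way equality in \<open>Hp p\<close> is equality of functions on the disc.
\<close>

definition Hp :: "real \<Rightarrow> (complex \<Rightarrow> complex) set" where
  "Hp p = {f. f holomorphic_on unit_disc \<and> (\<forall>z. z \<notin> unit_disc \<longrightarrow> f z = 0) \<and>
              bdd_above (Hp_integral p f ` {0<..<1})}"

definition Hp_norm :: "real \<Rightarrow> (complex \<Rightarrow> complex) \<Rightarrow> real" where
  "Hp_norm p f = (SUP r\<in>{0<..<1}. Hp_integral p f r) powr (1 / p)"

definition composition_operator ::
    "(complex \<Rightarrow> complex) \<Rightarrow> (complex \<Rightarrow> complex) \<Rightarrow> complex \<Rightarrow> complex" where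
  "composition_operator \<phi> f = (\<lambda>z. if z \<in> unit_disc then f (\<phi> z) else 0)"

section \<open>Bounded operators and extended eigenvalues\<close>

text \<open>
  A complex normed space of functions is given by its carrier \<open>X\<close>, with pointwise operations,
  and its norm \<open>N\<close>. Operators are only relevant on \<open>X\<close>; their values elsewhere are arbitrary.
\<close>

definition bounded_operator_on ::
    "('a \<Rightarrow> complex) set \<Rightarrow> (('a \<Rightarrow> complex) \<Rightarrow> real) \<Rightarrow>
     (('a \<Rightarrow> complex) \<Rightarrow> ('a \<Rightarrow> complex)) \<Rightarrow> bool" where
  "bounded_operator_on X N A \<longleftrightarrow>
     (\<forall>f\<in>X. A f \<in> X) \<and>
     (\<forall>f\<in>X. \<forall>g\<in>X. A (\<lambda>z. f z + g z) = (\<lambda>z. A f z + A g z)) \<and>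
     (\<forall>c. \<forall>f\<in>X. A (\<lambda>z. c * f z) = (\<lambda>z. c * A f z)) \<and>
     (\<exists>K. \<forall>f\<in>X. N (A f) \<le> K * N f)"

definition extended_eigenvalues ::
    "('a \<Rightarrow> complex) set \<Rightarrow> (('a \<Rightarrow> complex) \<Rightarrow> real) \<Rightarrow>
     (('a \<Rightarrow> complex) \<Rightarrow> ('a \<Rightarrow> complex)) \<Rightarrow> complex set" where
  "extended_eigenvalues X N T =
     {\<mu>. \<exists>A. bounded_operator_on X N A \<and> (\<exists>f\<in>X. A f \<noteq> (\<lambda>z. 0)) \<and>
             (\<forall>f\<in>X. T (A f) = (\<lambda>z. \<mu> * A (T f) z))}"

section \<open>Holomorphic semiflows\<close>

definition holomorphic_semiflow :: "(real \<Rightarrow> complex \<Rightarrow> complex) \<Rightarrow> bool" where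
  "holomorphic_semiflow \<Phi> \<longleftrightarrow>
     (\<forall>t\<ge>0. \<Phi> t holomorphic_on unit_disc \<and> \<Phi> t ` unit_disc \<subseteq> unit_disc) \<and>
     (\<forall>z\<in>unit_disc. \<Phi> 0 z = z) \<and>
     (\<forall>t\<ge>0. \<forall>s\<ge>0. \<forall>z\<in>unit_disc. \<Phi> (t + s) z = \<Phi> t (\<Phi> s z)) \<and>
     (\<forall>s\<ge>0. \<forall>K. compact K \<and> K \<subseteq> unit_disc \<longrightarrow>
        uniform_limit K \<Phi> (\<Phi> s) (at s within {0..}))"

definition elliptic :: "(real \<Rightarrow> complex \<Rightarrow> complex) \<Rightarrow> bool" where
  "elliptic \<Phi> \<longleftrightarrow> (\<exists>t>0. \<exists>z\<in>unit_disc. \<Phi> t z = z)"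

definition denjoy_wolff_point :: "(real \<Rightarrow> complex \<Rightarrow> complex) \<Rightarrow> complex \<Rightarrow> bool" where
  "denjoy_wolff_point \<Phi> \<tau> \<longleftrightarrow> \<tau> \<in> sphere 0 1 \<and>
     (\<forall>K. compact K \<and> K \<subseteq> unit_disc \<longrightarrow> uniform_limit K \<Phi> (\<lambda>z. \<tau>) at_top)"

definition stolz_region :: "complex \<Rightarrow> real \<Rightarrow> complex set" where
  "stolz_region \<tau> M = {z \<in> unit_disc. cmod (z - \<tau>) < M * (1 - cmod z)}"

definition nontangential_limit :: "(complex \<Rightarrow> complex) \<Rightarrow> complex \<Rightarrow> complex \<Rightarrow> bool" where
  "nontangential_limit f \<tau> L \<longleftrightarrow> (\<forall>M>1. (f \<longlongrightarrow> L) (at \<tau> within stolz_region \<tau> M))"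

definition hyperbolic_semiflow :: "(real \<Rightarrow> complex \<Rightarrow> complex) \<Rightarrow> bool" where
  "hyperbolic_semiflow \<Phi> \<longleftrightarrow> holomorphic_semiflow \<Phi> \<and> \<not> elliptic \<Phi> \<and>
     (\<exists>\<tau> \<alpha>. denjoy_wolff_point \<Phi> \<tau> \<and> \<alpha> < 0 \<and>
        (\<forall>t\<ge>0. nontangential_limit (deriv (\<Phi> t)) \<tau> (of_real (exp (t * \<alpha>)))))"

text \<open>
  The condition \<open>h z + t \<in> h ` unit_disc\<close> states that the inverse of \<open>h\<close> is applied to a point
  of its domain; it is implicit in the formula \<open>\<phi>\<^sub>t(z) = h\<^sup>-\<^sup>1(h(z) + t)\<close>.
\<close>

definition koenigs_function ::
    "(real \<Rightarrow> complex \<Rightarrow> complex) \<Rightarrow> (complex \<Rightarrow> complex) \<Rightarrow> bool" where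
  "koenigs_function \<Phi> h \<longleftrightarrow> h holomorphic_on unit_disc \<and> inj_on h unit_disc \<and>
     (\<forall>t\<ge>0. \<forall>z\<in>unit_disc. h z + of_real t \<in> h ` unit_disc \<and>
        \<Phi> t z = inv_into unit_disc h (h z + of_real t))"

definition horizontal_strip :: "complex set \<Rightarrow> bool" where
  "horizontal_strip S \<longleftrightarrow> (\<exists>a b. a < b \<and> S = {w. a < Im w \<and> Im w < b})"

end

theory Submission
  imports Defs "HOL-Computational_Algebra.Fundamental_Theorem_Algebra"
begin

text \<open>
  Since \<open>h \<circ> \<phi> = h + 1\<close>, the function \<open>e\<^bsup>\<zeta>h\<^esup>\<close> is formally an eigenfunction of \<open>C\<^sub>\<phi>\<close> with eigenvalue \<open>e\<^sup>\<zeta>\<close>, and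
  multiplication by it intertwines \<open>C\<^sub>\<phi>\<close> with \<open>e\<^sup>\<zeta> C\<^sub>\<phi>\<close>.  For a hyperbolic semiflow \<open>Im h\<close> is bounded
  (Julia's inequality at the Denjoy-Wolff point against Harnack's inequality on large discs of the
  Koenigs domain, \<open>hyperbolic_koenigs_width_bounded\<close>).  Hence the multiplier is bounded for imaginary
  \<open>\<zeta>\<close>, and for \<open>Re \<zeta> \<le> 0\<close> if also \<open>Re h\<close> is bounded below; this gives the unit circle and the punctured
  disc as extended eigenvalues.  The value \<open>0\<close> is excluded because \<open>\<phi>\<close> is injective.

  For the other inclusions let \<open>C\<^sub>\<phi> A = \<mu> A C\<^sub>\<phi>\<close>.  If \<open>e\<^bsup>\<zeta>h\<^esup>\<close> belongs to \<open>H\<^sup>p\<close>, then \<open>A e\<^bsup>\<zeta>h\<^esup>\<close> is an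
  eigenfunction with eigenvalue \<open>\<mu> e\<^sup>\<zeta>\<close>.  A function in \<open>H\<^sup>p\<close> grows at most like \<open>(1 - |z|)\<^bsup>-1/p\<^esup>\<close>, and along
  an orbit in a half-strip of width \<open>2d\<close> in the domain the distance to the circle decays at most like
  \<open>e\<^bsup>-\<pi>n/(2d)\<^esup>\<close>; so the eigenvalue of a nonzero eigenfunction has modulus at most \<open>e\<^bsup>\<pi>/(2dp)\<^esup>\<close>
  (\<open>eigenfunction_zero\<close>).  Let \<open>b - a\<close> be the least width of a horizontal strip that contains the domain.
  Then \<open>e\<^bsup>\<zeta>h\<^esup>\<close> belongs to \<open>H\<^sup>p\<close> for \<open>|Re \<zeta>| < \<pi>/(p(b - a))\<close>, and far to the right the domain contains
  half-strips of every width below \<open>b - a\<close>.  If \<open>|\<mu>| > 1\<close>, then \<open>A\<close> must annihilate \<open>e\<^bsup>\<zeta>h\<^esup>\<close> for \<open>Re \<zeta>\<close> in an open interval below \<open>\<pi>/(p(b - a))\<close>.  If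
  the domain contains a horizontal strip, the same argument along backward orbits in the maximal one
  works for \<open>0 < |\<mu>| < 1\<close>, because far to the left the domain is nearly contained in that strip
  (\<open>maximal_strip\<close>).  By analytic continuation in \<open>\<zeta>\<close>, \<open>A\<close> annihilates \<open>e\<^bsup>\<zeta>h\<^esup>\<close> for all \<open>\<zeta>\<close> near the
  imaginary axis, and \<open>A = 0\<close> follows from the completeness of these exponentials in \<open>H\<^sup>p\<close>
  (\<open>vanishes_on_exponentials_imp_vanishes\<close>).

  Completeness is where the shape of the domain matters.  A continuous functional \<open>\<Lambda>\<close> that annihilates
  the exponentials annihilates the resolvents \<open>1/(\<xi> - h)\<close> for \<open>\<xi>\<close> off the strip (\<open>resolvent_off_strip\<close>),
  then, by summation over the translates of \<open>\<xi>\<close> by multiples of \<open>2\<pi>\<i>\<close>, the functions \<open>1/(x - H)\<close> with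
  \<open>H = tanh(h/2)\<close> and \<open>|x| > 1\<close>; here \<open>h\<close> is scaled to have \<open>|Im h| \<le> \<beta> < \<pi>/2\<close>.  The hypothesis on the
  components of the complement makes the complement of the closure \<open>K\<close> of \<open>H(\<D>)\<close> connected, so \<open>\<Lambda>\<close>
  annihilates \<open>1/(x - H)\<close> for all \<open>x \<notin> K\<close>.  The regularity of the domain gives \<open>int K = H(\<D>)\<close>, and then
  the Riemann maps of shrinking neighbourhoods of \<open>K\<close> show that the powers of \<open>z\<close> are limits of
  rational functions of \<open>H\<close> (\<open>vanishes_on_rational_imp_vanishes_on_powers\<close>).  Polynomials are dense.
\<close>

section \<open>Integral means\<close>

lemma Hp_integral_eq:
  "Hp_integral p f r = integral {0..2 * pi} (\<lambda>t. cmod (f (of_real r * cis t)) powr p)"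
  by (simp add: Hp_integral_def cis_conv_exp)

text \<open>
  The tangent line of \<open>t\<^sup>p\<close> at \<open>s\<close>, in a form without division that includes \<open>s = 0\<close>.
\<close>
lemma powr_tangent:
  fixes p s t :: real
  assumes "1 \<le> p" "0 \<le> s" "0 \<le> t"
  shows "t * s powr (p - 1) \<le> t powr p / p + (1 - 1 / p) * s powr p"
proof (cases "p = 1")
  case True
  then show ?thesis using assms by (cases "s = 0") auto
next
  case False
  with assms have p: "p > 1" by simp
  define q where "q = p / (p - 1)"
  have q: "q > 1" "1 / p + 1 / q = 1" "1 / q = 1 - 1 / p" using p by (auto simp: q_def field_simps)
  have "t * s powr (p - 1) \<le> t powr p / p + (s powr (p - 1)) powr q / q"
    by (rule Youngs_inequality) (use p q assms in auto)
  also have "(s powr (p - 1)) powr q = s powr p"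
    using p by (simp add: powr_powr q_def)
  also have "s powr p / q = (1 - 1 / p) * s powr p"
    using q(3) by (metis divide_inverse inverse_eq_divide mult.commute)
  finally show ?thesis by simp
qed

lemma continuous_on_circle:
  assumes "f holomorphic_on ball 0 B" "0 \<le> r" "r < B"
  shows "continuous_on A (\<lambda>t. f (of_real r * cis t))"
proof -
  have "continuous_on (ball 0 B) f" using assms(1) by (rule holomorphic_on_imp_continuous_on)
  then show ?thesis
    by (rule continuous_on_compose2) (use assms in \<open>auto intro!: continuous_intros simp: norm_mult\<close>)
qed

lemma continuous_on_circle_powr:
  assumes "f holomorphic_on ball 0 B" "0 \<le> r" "r < B" "0 < p"
  shows "continuous_on A (\<lambda>t. cmod (f (of_real r * cis t)) powr p)"
  using assms by (intro continuous_on_powr' continuous_on_norm continuous_on_circle continuous_on_const) auto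

lemma circle_powr_integrable:
  assumes "f holomorphic_on ball 0 B" "0 \<le> r" "r < B" "0 < p"
  shows "(\<lambda>t. cmod (f (of_real r * cis t)) powr p) integrable_on {0..2*pi}"
  by (intro integrable_continuous_real continuous_on_circle_powr[OF assms])

lemma Hp_integral_nonneg [simp]: "0 \<le> Hp_integral p f r"
  by (cases "(\<lambda>t. cmod (f (of_real r * cis t)) powr p) integrable_on {0..2*pi}")
     (auto simp: Hp_integral_eq not_integrable_integral intro: integral_nonneg)

definition poisson :: "real \<Rightarrow> complex \<Rightarrow> real \<Rightarrow> real" where
  "poisson R z t = (R\<^sup>2 - (cmod z)\<^sup>2) / (cmod (of_real R * cis t - z))\<^sup>2"

lemma poisson_nonneg: "cmod z < R \<Longrightarrow> 0 \<le> poisson R z t"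
  by (simp add: poisson_def power_mono)

lemma poisson_denom: "cmod z < R \<Longrightarrow> of_real R * cis t - z \<noteq> 0"
  by (metis abs_of_pos eq_iff_diff_eq_0 le_less_trans less_irrefl mult.right_neutral norm_cis norm_ge_zero norm_mult norm_of_real)

lemma poisson_formula:
  fixes f :: "complex \<Rightarrow> complex"
  assumes f: "f holomorphic_on ball 0 B" and R: "R < B" and z: "cmod z < R"
  shows "((\<lambda>t. of_real (poisson R z t) * f (of_real R * cis t)) has_integral (2 * pi * f z)) {0..2*pi}"
proof -
  have R0: "R > 0" using z by (metis le_less_trans norm_ge_zero)
  define k where "k u = f u * (of_real (R\<^sup>2 - (cmod z)\<^sup>2) / (of_real (R\<^sup>2) - cnj z * u))" for u
  have zR: "(cmod z)\<^sup>2 < R\<^sup>2" using z by (simp add: power_strict_mono)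
  have nz: "of_real (R\<^sup>2) - cnj z * u \<noteq> 0" if "cmod u \<le> R" for u
  proof -
    have "cmod (cnj z * u) < R\<^sup>2"
      using z that R0 by (simp add: norm_mult power2_eq_square) (meson le_less_trans mult_left_mono mult_strict_right_mono norm_ge_zero)
    then show ?thesis by (metis abs_of_nonneg eq_iff_diff_eq_0 less_irrefl norm_of_real zero_le_power2)
  qed
  have "k holomorphic_on cball 0 R"
    unfolding k_def using nz R by (intro holomorphic_intros holomorphic_on_subset[OF f]) auto
  from Cauchy_integral_circlepath_simple[OF this, of z] z
  have "((\<lambda>u. k u / (u - z)) has_contour_integral (2 * of_real pi * \<i> * k z)) (part_circlepath 0 R 0 (2*pi))"
    by (simp add: circlepath_def)
  then have "((\<lambda>t. k (0 + R * cis t) / (0 + R * cis t - z) * R * \<i> * cis t) has_integral (2 * of_real pi * \<i> * k z)) {0..2*pi}"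
    by (subst (asm) has_contour_integral_part_circlepath_iff) auto
  from has_integral_mult_right[OF this, of "-\<i>"]
  have I: "((\<lambda>t. - \<i> * (k (R * cis t) / (R * cis t - z) * R * \<i> * cis t)) has_integral (- \<i> * (2 * of_real pi * \<i> * k z))) {0..2*pi}"
    by simp
  have kz: "k z = f z"
    using nz[of z] z by (simp add: k_def complex_norm_square[symmetric] mult.commute)
  have "- \<i> * (k (R * cis t) / (R * cis t - z) * R * \<i> * cis t) = of_real (poisson R z t) * f (of_real R * cis t)" for t
  proof -
    define u where "u = of_real R * cis t"
    have u: "cmod u = R" using R0 by (simp add: u_def norm_mult)
    have u0: "u \<noteq> 0" using u R0 by auto
    have R2: "of_real (R\<^sup>2) = u * cnj u" by (metis complex_norm_square of_real_power u)
    have d: "of_real (R\<^sup>2) - cnj z * u = u * cnj (u - z)" unfolding R2 by (simp add: algebra_simps)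
    have uz: "u - z \<noteq> 0" using poisson_denom[OF z] by (simp add: u_def)
    have c: "of_real ((cmod (u - z))\<^sup>2) = (u - z) * cnj (u - z)" by (rule complex_norm_square)
    have "- \<i> * (X * R * \<i> * c) = X * (R * c)" for X c :: complex by (simp add: algebra_simps)
    then have "- \<i> * (k u / (u - z) * R * \<i> * cis t) = k u / (u - z) * u" by (simp only: u_def)
    also have "\<dots> = f u * of_real (R\<^sup>2 - (cmod z)\<^sup>2) * u / ((u * cnj (u - z)) * (u - z))"
      unfolding k_def d by simp
    also have "\<dots> = of_real (R\<^sup>2 - (cmod z)\<^sup>2) / of_real ((cmod (u - z))\<^sup>2) * f u"
    proof -
      have "x * y * u / ((u * v) * w) = y / (w * v) * x" for x y v w :: complex
        using u0 by (simp add: mult.commute)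
      then show ?thesis unfolding c by blast
    qed
    finally show ?thesis by (simp add: u_def poisson_def)
  qed
  with I kz show ?thesis by (simp add: algebra_simps)
qed

lemma poisson_integral:
  assumes z: "cmod z < R"
  shows "(poisson R z has_integral (2 * pi)) {0..2*pi}"
proof -
  have "((\<lambda>t. of_real (poisson R z t) * (1::complex)) has_integral (2 * pi * 1)) {0..2*pi}"
    using poisson_formula[where B = "R + 1" and f = "\<lambda>_. 1" and R = R and z = z] z by simp
  from has_integral_Re[OF this] show ?thesis by simp
qed

lemma poisson_continuous:
  assumes z: "cmod z < R"
  shows "continuous_on A (poisson R z)"
  unfolding poisson_def using poisson_denom[OF z] by (intro continuous_intros) auto

text \<open>
  For \<open>p \<ge> 1\<close> the function \<open>|f|\<^sup>p\<close> is subharmonic.  Instead of Jensen's inequality for the Poisson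
  measure, the tangent of \<open>t \<mapsto> t\<^sup>p\<close> at \<open>s = |f(z)|\<close> is integrated against the Poisson kernel.
\<close>
lemma subharmonic_powr:
  assumes f: "f holomorphic_on ball 0 B" and R: "R < B" and z: "cmod z < R" and p: "1 \<le> p"
  shows "2 * pi * cmod (f z) powr p
           \<le> integral {0..2*pi} (\<lambda>t. poisson R z t * cmod (f (of_real R * cis t)) powr p)"
proof -
  have R0: "R > 0" using z by (metis le_less_trans norm_ge_zero)
  define s where "s = cmod (f z)"
  define F where "F t = cmod (f (of_real R * cis t))" for t
  have cF: "continuous_on {0..2*pi} F" unfolding F_def
    using f R R0 by (intro continuous_on_norm continuous_on_circle[where B=B]) auto
  have cP: "continuous_on {0..2*pi} (\<lambda>t. poisson R z t * F t powr p)"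
    using continuous_on_circle_powr[OF f _ R, of p] R0 p
    by (intro continuous_on_mult poisson_continuous z) (auto simp: F_def)
  have cP1: "continuous_on {0..2*pi} (\<lambda>t. poisson R z t * F t)"
    by (intro continuous_on_mult poisson_continuous z cF)
  have A: "2 * pi * s \<le> integral {0..2*pi} (\<lambda>t. poisson R z t * F t)"
  proof -
    have "norm (2 * pi * f z) \<le> integral {0..2*pi} (\<lambda>t. poisson R z t * F t)"
      using integral_unique[OF poisson_formula[OF f R z]]
      by (subst integral_unique[OF poisson_formula[OF f R z], symmetric], intro integral_norm_bound_integral)
         (use poisson_formula[OF f R z] cP1 poisson_nonneg[OF z] in \<open>auto simp: norm_mult F_def has_integral_iff intro!: integrable_continuous_real\<close>)
    then show ?thesis by (simp add: norm_mult s_def)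
  qed
  have "2 * pi * s powr p = (2 * pi * s) * s powr (p - 1)"
    by (cases "s = 0") (auto simp: powr_diff s_def)
  also have "\<dots> \<le> integral {0..2*pi} (\<lambda>t. poisson R z t * F t) * s powr (p - 1)"
    using A by (intro mult_right_mono) auto
  also have "\<dots> = integral {0..2*pi} (\<lambda>t. poisson R z t * (F t * s powr (p - 1)))"
    by (simp add: mult.assoc[symmetric] flip: integral_mult_left)
  also have "\<dots> \<le> integral {0..2*pi} (\<lambda>t. poisson R z t * F t powr p / p + poisson R z t * ((1 - 1 / p) * s powr p))"
  proof (rule integral_le)
    show "(\<lambda>t. poisson R z t * (F t * s powr (p - 1))) integrable_on {0..2*pi}"
      by (intro integrable_continuous_real continuous_intros poisson_continuous z cF)
    show "(\<lambda>t. poisson R z t * F t powr p / p + poisson R z t * ((1 - 1 / p) * s powr p)) integrable_on {0..2*pi}"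
      using p by (intro integrable_continuous_real continuous_intros poisson_continuous z cP) auto
    fix t
    have "poisson R z t * (F t * s powr (p - 1)) \<le> poisson R z t * (F t powr p / p + (1 - 1 / p) * s powr p)"
      by (intro mult_left_mono powr_tangent poisson_nonneg z) (use p in \<open>auto simp: F_def s_def\<close>)
    then show "poisson R z t * (F t * s powr (p - 1)) \<le> poisson R z t * F t powr p / p + poisson R z t * ((1 - 1 / p) * s powr p)"
      by (simp add: distrib_left)
  qed
  also have "\<dots> = integral {0..2*pi} (\<lambda>t. poisson R z t * F t powr p / p)
                   + integral {0..2*pi} (\<lambda>t. poisson R z t * ((1 - 1 / p) * s powr p))"
    using p by (intro integral_add integrable_continuous_real continuous_intros poisson_continuous z cP) auto
  also have "integral {0..2*pi} (\<lambda>t. poisson R z t * ((1 - 1 / p) * s powr p)) = 2 * pi * ((1 - 1 / p) * s powr p)"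
    using integral_unique[OF poisson_integral[OF z]] by simp
  also have "integral {0..2*pi} (\<lambda>t. poisson R z t * F t powr p / p) = integral {0..2*pi} (\<lambda>t. poisson R z t * F t powr p) / p"
    by simp
  finally have "2 * pi * s powr p / p \<le> integral {0..2*pi} (\<lambda>t. poisson R z t * F t powr p) / p"
    by (simp add: algebra_simps)
  then show ?thesis using p by (simp add: divide_le_cancel s_def F_def)
qed

lemma norm_circle_diff_sym: "cmod (of_real R * cis t - of_real r * cis s) = cmod (of_real R * cis s - of_real r * cis t)"
proof -
  have "cmod (of_real R * cis t - of_real r * cis s) = cmod (cnj (of_real R * cis t - of_real r * cis s))"
    by (simp only: complex_mod_cnj)
  also have "\<dots> = cmod (cis (t + s) * cnj (of_real R * cis t - of_real r * cis s))"
    by (simp only: norm_mult norm_cis mult_1_left)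
  also have "cis (t + s) * cnj (of_real R * cis t - of_real r * cis s) = of_real R * cis s - of_real r * cis t"
    by (simp add: algebra_simps cis_cnj cis_mult)
  finally show ?thesis .
qed

text \<open>
  Averaging the preceding estimate over the circle of radius \<open>r\<close>: the Poisson kernel is symmetric in
  the two angles, so that it integrates to \<open>2\<pi>\<close> in either of them.
\<close>
lemma Hp_integral_mono:
  assumes f: "f holomorphic_on ball 0 B" and r: "0 \<le> r" "r \<le> R" "R < B" and p: "1 \<le> p"
  shows "Hp_integral p f r \<le> Hp_integral p f R"
proof (cases "r = R")
  case False
  with r have rR: "r < R" by simp
  then have R0: "R > 0" using r by simp
  have nr: "cmod (of_real r * cis s) < R" for s using rR r by (simp add: norm_mult)
  define G where "G s t = poisson R (of_real r * cis s) t * cmod (f (of_real R * cis t)) powr p" for s t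
  have sym: "poisson R (of_real r * cis s) t = poisson R (of_real r * cis t) s" for s t
    by (simp add: poisson_def norm_circle_diff_sym[of R t r s] norm_mult)
  have nz: "cmod (of_real R * cis t - of_real r * cis s) \<noteq> 0" for s t
    using poisson_denom[OF nr[of s], of t] by simp
  have fR: "continuous_on A (\<lambda>x. f (of_real R * cis (g x)))" if "continuous_on A g" for A :: "(real \<times> real) set" and g
  proof -
    have "continuous_on UNIV (\<lambda>t. f (of_real R * cis t))"
      using continuous_on_circle[OF f, of R] r R0 by auto
    then show ?thesis by (rule continuous_on_compose2) (use that in auto)
  qed
  have cG: "continuous_on (cbox (0,0) (2*pi,2*pi)) (\<lambda>(s,t). G s t)"
    unfolding G_def poisson_def case_prod_beta
    using nz p by (intro continuous_intros continuous_on_powr' fR) auto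
  have "2 * pi * Hp_integral p f r = integral {0..2*pi} (\<lambda>s. 2 * pi * cmod (f (of_real r * cis s)) powr p)"
    by (simp add: Hp_integral_eq)
  also have "\<dots> \<le> integral {0..2*pi} (\<lambda>s. integral {0..2*pi} (G s))"
  proof (rule integral_le)
    show "(\<lambda>s. 2 * pi * cmod (f (of_real r * cis s)) powr p) integrable_on {0..2*pi}"
      using r rR p by (intro integrable_on_mult_right circle_powr_integrable[OF f]) auto
    show "(\<lambda>s. integral {0..2*pi} (G s)) integrable_on {0..2*pi}"
      using integral_continuous_on_param[of "{0..2*pi}" 0 "2*pi" G] cG
      by (intro integrable_continuous_real) (auto simp: cbox_Pair_eq)
    fix s show "2 * pi * cmod (f (of_real r * cis s)) powr p \<le> integral {0..2*pi} (G s)"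
      using subharmonic_powr[OF f r(3) nr[of s] p] by (simp add: G_def[abs_def])
  qed
  also have "\<dots> = integral {0..2*pi} (\<lambda>t. integral {0..2*pi} (\<lambda>s. G s t))"
    using integral_swap_continuous[of 0 0 "2*pi" "2*pi" G] cG by simp
  also have "\<dots> = integral {0..2*pi} (\<lambda>t. 2 * pi * cmod (f (of_real R * cis t)) powr p)"
  proof (rule integral_cong)
    fix t
    have "integral {0..2*pi} (\<lambda>s. G s t) = integral {0..2*pi} (\<lambda>s. poisson R (of_real r * cis t) s) * cmod (f (of_real R * cis t)) powr p"
      unfolding G_def by (subst sym) simp
    also have "integral {0..2*pi} (\<lambda>s. poisson R (of_real r * cis t) s) = 2 * pi"
      using integral_unique[OF poisson_integral[OF nr[of t]]] by simp
    finally show "integral {0..2*pi} (\<lambda>s. G s t) = 2 * pi * cmod (f (of_real R * cis t)) powr p" .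
  qed
  also have "\<dots> = 2 * pi * Hp_integral p f R" by (simp add: Hp_integral_eq)
  finally show ?thesis by simp
qed simp

lemma Hp_integral_le:
  assumes f: "f holomorphic_on unit_disc" and g: "g holomorphic_on unit_disc" and h: "h holomorphic_on unit_disc"
    and r: "0 \<le> r" "r < 1" and pos: "0 < p" "0 < q" "0 < s"
    and le: "\<And>z. z \<in> unit_disc \<Longrightarrow> cmod (f z) powr p \<le> c * cmod (g z) powr q + d * cmod (h z) powr s"
  shows "Hp_integral p f r \<le> c * Hp_integral q g r + d * Hp_integral s h r"
proof -
  note int = circle_powr_integrable[where B=1, OF _ r]
  have "Hp_integral p f r \<le> integral {0..2*pi} (\<lambda>t. c * cmod (g (of_real r * cis t)) powr q + d * cmod (h (of_real r * cis t)) powr s)"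
    unfolding Hp_integral_eq using r
    by (intro integral_le integrable_add integrable_on_mult_right int f g h pos le) (simp add: norm_mult)
  also have "\<dots> = integral {0..2*pi} (\<lambda>t. c * cmod (g (of_real r * cis t)) powr q) + integral {0..2*pi} (\<lambda>t. d * cmod (h (of_real r * cis t)) powr s)"
    by (intro integral_add integrable_on_mult_right int g h pos)
  also have "\<dots> = c * Hp_integral q g r + d * Hp_integral s h r"
    by (simp add: Hp_integral_eq)
  finally show ?thesis .
qed

text \<open>
  Membership in the Hardy space for a function given by a formula; in contrast to \<open>Hp\<close>, nothing is
  required outside the disc.
\<close>
definition hardy :: "real \<Rightarrow> (complex \<Rightarrow> complex) \<Rightarrow> bool" where
  "hardy p f \<longleftrightarrow> f holomorphic_on unit_disc \<and> (\<exists>B. \<forall>r\<in>{0<..<1}. Hp_integral p f r \<le> B)"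

lemma hardy_holomorphic: "hardy p f \<Longrightarrow> f holomorphic_on unit_disc"
  by (simp add: hardy_def)

lemma hardy_boundE:
  assumes "hardy p f"
  obtains B where "B > 0" "\<And>r. 0 < r \<Longrightarrow> r < 1 \<Longrightarrow> Hp_integral p f r \<le> B"
proof -
  from assms obtain B where B: "\<And>r. 0 < r \<Longrightarrow> r < 1 \<Longrightarrow> Hp_integral p f r \<le> B"
    unfolding hardy_def by (meson greaterThanLessThan_iff)
  show ?thesis by (rule that[of "max B 1"]) (use B in \<open>auto simp: max_def not_le intro: order.trans less_imp_le\<close>)
qed

lemma add_powr_le:
  fixes a b p :: real
  assumes "0 \<le> a" "0 \<le> b" "0 < p"
  shows "(a + b) powr p \<le> 2 powr p * a powr p + 2 powr p * b powr p"
proof -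
  have "(a + b) powr p \<le> (2 * max a b) powr p"
    using assms by (intro powr_mono2) auto
  also have "\<dots> = 2 powr p * (max a b) powr p" using assms by (simp add: powr_mult)
  also have "\<dots> \<le> 2 powr p * (a powr p + b powr p)"
    by (intro mult_left_mono) (auto simp: max_def)
  finally show ?thesis by (simp add: distrib_left)
qed

lemma Hp_integral_dominated:
  assumes f: "f holomorphic_on unit_disc" and g: "g holomorphic_on unit_disc" and h: "h holomorphic_on unit_disc"
    and r: "0 \<le> r" "r < 1" and p: "0 < p" and c: "0 \<le> c"
    and le: "\<And>z. z \<in> unit_disc \<Longrightarrow> cmod (f z) \<le> c * (cmod (g z) + cmod (h z))"
  shows "Hp_integral p f r \<le> (2 * c) powr p * (Hp_integral p g r + Hp_integral p h r)"
proof -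
  have "Hp_integral p f r \<le> (2 * c) powr p * Hp_integral p g r + (2 * c) powr p * Hp_integral p h r"
  proof (rule Hp_integral_le[OF f g h r p p p])
    fix z assume "z \<in> unit_disc"
    then have "cmod (f z) powr p \<le> (c * (cmod (g z) + cmod (h z))) powr p"
      using le p by (intro powr_mono2) auto
    also have "\<dots> = c powr p * (cmod (g z) + cmod (h z)) powr p" using c by (simp add: powr_mult)
    also have "\<dots> \<le> c powr p * (2 powr p * cmod (g z) powr p + 2 powr p * cmod (h z) powr p)"
      by (intro mult_left_mono add_powr_le p) auto
    also have "\<dots> = (2 * c) powr p * cmod (g z) powr p + (2 * c) powr p * cmod (h z) powr p"
      using c by (simp add: powr_mult algebra_simps)
    finally show "cmod (f z) powr p \<le> (2 * c) powr p * cmod (g z) powr p + (2 * c) powr p * cmod (h z) powr p" .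
  qed
  then show ?thesis by (simp add: distrib_left)
qed

lemma hardy_dominated:
  assumes f: "f holomorphic_on unit_disc" and g: "hardy p g" and h: "hardy p h" and p: "0 < p"
    and le: "\<And>z. z \<in> unit_disc \<Longrightarrow> cmod (f z) \<le> c * (cmod (g z) + cmod (h z))"
  shows "hardy p f"
proof -
  obtain A where A: "\<And>r. 0 < r \<Longrightarrow> r < 1 \<Longrightarrow> Hp_integral p g r \<le> A" using hardy_boundE[OF g] by metis
  obtain B where B: "\<And>r. 0 < r \<Longrightarrow> r < 1 \<Longrightarrow> Hp_integral p h r \<le> B" using hardy_boundE[OF h] by metis
  have le': "cmod (f z) \<le> \<bar>c\<bar> * (cmod (g z) + cmod (h z))" if "z \<in> unit_disc" for z
    by (rule order.trans[OF le[OF that]]) (intro mult_right_mono, auto)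
  have "Hp_integral p f r \<le> (2 * \<bar>c\<bar>) powr p * (A + B)" if r: "0 < r" "r < 1" for r
  proof -
    have "Hp_integral p f r \<le> (2 * \<bar>c\<bar>) powr p * (Hp_integral p g r + Hp_integral p h r)"
      by (rule Hp_integral_dominated) (use f g h r p le' in \<open>auto simp: hardy_def\<close>)
    also have "\<dots> \<le> (2 * \<bar>c\<bar>) powr p * (A + B)"
      by (intro mult_left_mono add_mono A B r) auto
    finally show ?thesis .
  qed
  with f show ?thesis unfolding hardy_def by (meson greaterThanLessThan_iff)
qed

lemma hardy_const: "hardy p (\<lambda>_. c)"
  by (auto simp: hardy_def Hp_integral_eq)

lemma hardy_bounded:
  assumes "f holomorphic_on unit_disc" "\<And>z. z \<in> unit_disc \<Longrightarrow> cmod (f z) \<le> M" "0 < p"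
  shows "hardy p f"
  by (rule hardy_dominated[where g = "\<lambda>_. 1" and h = "\<lambda>_. 0" and c = M]) (use assms hardy_const in auto)

lemma hardy_add: "hardy p f \<Longrightarrow> hardy p g \<Longrightarrow> 0 < p \<Longrightarrow> hardy p (\<lambda>z. f z + g z)"
  by (rule hardy_dominated[where g = f and h = g and c = 1])
     (auto simp: hardy_def norm_triangle_ineq intro!: holomorphic_intros)

lemma hardy_mult_bounded:
  assumes "hardy p g" "f holomorphic_on unit_disc" "\<And>z. z \<in> unit_disc \<Longrightarrow> cmod (f z) \<le> M" "0 < p"
  shows "hardy p (\<lambda>z. f z * g z)"
  by (rule hardy_dominated[where g = g and h = "\<lambda>_. 0" and c = M])
     (use assms hardy_const in \<open>auto simp: hardy_def norm_mult intro!: holomorphic_intros mult_right_mono\<close>)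

lemma hardy_scale: "hardy p f \<Longrightarrow> 0 < p \<Longrightarrow> hardy p (\<lambda>z. c * f z)"
  by (rule hardy_mult_bounded[where M = "cmod c"]) auto

lemma hardy_diff: "hardy p f \<Longrightarrow> hardy p g \<Longrightarrow> 0 < p \<Longrightarrow> hardy p (\<lambda>z. f z - g z)"
  using hardy_add[of p f "\<lambda>z. -1 * g z"] hardy_scale[of p g "-1"] by simp

lemma hardy_sum:
  "(\<And>i. i \<in> I \<Longrightarrow> hardy p (f i)) \<Longrightarrow> 0 < p \<Longrightarrow> hardy p (\<lambda>z. \<Sum>i\<in>I. f i z)"
  by (induction I rule: infinite_finite_induct) (auto intro: hardy_const hardy_add)

text \<open>
  The exponent \<open>1/p\<close> in this estimate is sharp, and the sharp exponent is what later matches the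
  growth of an eigenfunction with the integrability of \<open>e\<^bsup>\<zeta>h\<^esup>\<close>.
\<close>
lemma hardy_point_bound:
  assumes f: "f holomorphic_on unit_disc" and B: "\<And>r. 0 < r \<Longrightarrow> r < 1 \<Longrightarrow> Hp_integral p f r \<le> B"
    and z: "z \<in> unit_disc" and p: "1 \<le> p"
  shows "cmod (f z) powr p \<le> B / (1 - cmod z)"
proof -
  define R where "R = (1 + cmod z) / 2"
  have z1: "cmod z < 1" using z by simp
  have R: "cmod z < R" "R < 1" using z1 by (auto simp: R_def)
  have R0: "R > 0" using R(1) by (metis le_less_trans norm_ge_zero)
  have B0: "0 \<le> B" using B[of "1/2"] Hp_integral_nonneg[of p f "1/2"] by linarith
  have P: "poisson R z t \<le> 4 / (1 - cmod z)" for t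
  proof -
    have d: "R - cmod z \<le> cmod (of_real R * cis t - z)"
      using norm_triangle_ineq2[of "of_real R * cis t" z] R0 by (simp add: norm_mult)
    have "poisson R z t \<le> (R\<^sup>2 - (cmod z)\<^sup>2) / (R - cmod z)\<^sup>2"
      unfolding poisson_def using d R by (intro divide_left_mono power_mono mult_pos_pos) (auto intro!: power_mono simp: poisson_denom)
    also have "\<dots> = (R + cmod z) / (R - cmod z)"
      using R by (simp add: power2_eq_square square_diff_square_factored)
    also have "\<dots> \<le> 2 / (R - cmod z)" using R z1 by (intro divide_right_mono) auto
    also have "\<dots> = 4 / (1 - cmod z)" using z1 by (simp add: R_def field_simps)
    finally show ?thesis .
  qed
  have cc: "continuous_on {0..2*pi} (\<lambda>t. cmod (f (of_real R * cis t)) powr p)"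
    using continuous_on_circle_powr[OF f _ R(2), of p] R0 p by auto
  have "2 * pi * cmod (f z) powr p \<le> integral {0..2*pi} (\<lambda>t. poisson R z t * cmod (f (of_real R * cis t)) powr p)"
    by (rule subharmonic_powr[OF f R(2) R(1) p])
  also have "\<dots> \<le> integral {0..2*pi} (\<lambda>t. 4 / (1 - cmod z) * cmod (f (of_real R * cis t)) powr p)"
    by (intro integral_le integrable_continuous_real continuous_intros poisson_continuous R cc mult_right_mono P) auto
  also have "\<dots> = 4 / (1 - cmod z) * Hp_integral p f R" by (simp add: Hp_integral_eq)
  also have "\<dots> \<le> 4 / (1 - cmod z) * B" using z1 by (intro mult_left_mono B R R0) auto
  finally have "2 * pi * cmod (f z) powr p / (2 * pi) \<le> 4 / (1 - cmod z) * B / (2 * pi)"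
    by (rule divide_right_mono) simp
  then have "cmod (f z) powr p \<le> (4 / (2 * pi)) * (B / (1 - cmod z))" by (simp add: mult.commute)
  also have "\<dots> \<le> 1 * (B / (1 - cmod z))"
    using pi_ge_two B0 z1 by (intro mult_right_mono) auto
  finally show ?thesis by simp
qed

text \<open>
  The mean of a harmonic function over a circle is its value at the centre.
\<close>
lemma harmonic_majorant:
  assumes f: "f holomorphic_on unit_disc" and G: "G holomorphic_on unit_disc" and r: "0 \<le> r" "r < 1" and p: "0 < p"
    and le: "\<And>z. z \<in> unit_disc \<Longrightarrow> cmod (f z) powr p \<le> Re (G z)"
  shows "Hp_integral p f r \<le> 2 * pi * Re (G 0)"
proof (cases "r = 0")
  case True
  then show ?thesis using le[of 0] by (simp add: Hp_integral_eq)
next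
  case False
  then have r0: "r > 0" using r by simp
  have "((\<lambda>t. of_real (poisson r 0 t) * G (of_real r * cis t)) has_integral (2 * pi * G 0)) {0..2*pi}"
    by (rule poisson_formula[OF G]) (use r r0 in auto)
  moreover have "poisson r 0 t = 1" for t using r0 by (simp add: poisson_def norm_mult)
  ultimately have "((\<lambda>t. G (of_real r * cis t)) has_integral (2 * pi * G 0)) {0..2*pi}" by simp
  from has_integral_Re[OF this] have I: "((\<lambda>t. Re (G (of_real r * cis t))) has_integral (2 * pi * Re (G 0))) {0..2*pi}"
    by simp
  have "Hp_integral p f r \<le> integral {0..2*pi} (\<lambda>t. Re (G (of_real r * cis t)))"
    unfolding Hp_integral_eq using circle_powr_integrable[OF f r p] I r le
    by (intro integral_le) (auto simp: has_integral_iff norm_mult)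
  with I show ?thesis by (simp add: has_integral_iff)
qed

lemma hardy_majorant:
  assumes f: "f holomorphic_on unit_disc" and G: "G holomorphic_on unit_disc" and p: "0 < p"
    and le: "\<And>z. z \<in> unit_disc \<Longrightarrow> cmod (f z) powr p \<le> Re (G z)"
  shows "hardy p f"
  unfolding hardy_def using f harmonic_majorant[OF f G _ _ p le] by (meson greaterThanLessThan_iff less_imp_le)

text \<open>
  On a set of uniformly bounded functions all integral means are equivalent, because
  \<open>|f|\<^sup>p \<le> s\<^sup>p + (M\<^sup>p / s\<^sup>q) |f|\<^sup>q\<close> for every \<open>s > 0\<close>.
\<close>
lemma bounded_small_Hp_integral:
  fixes M p q \<epsilon> :: real
  assumes M: "0 < M" and p: "0 < p" and q: "0 < q" and e: "0 < \<epsilon>"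
  obtains \<delta> where "\<delta> > 0"
    "\<And>f r. f holomorphic_on unit_disc \<Longrightarrow> (\<And>z. z \<in> unit_disc \<Longrightarrow> cmod (f z) \<le> M) \<Longrightarrow> 0 \<le> r \<Longrightarrow> r < 1
       \<Longrightarrow> Hp_integral q f r \<le> \<delta> \<Longrightarrow> Hp_integral p f r \<le> \<epsilon>"
proof -
  define s where "s = (\<epsilon> / (4 * pi)) powr (1 / p)"
  have s0: "s > 0" using e by (simp add: s_def)
  have sp: "s powr p = \<epsilon> / (4 * pi)" using p e by (simp add: s_def powr_powr)
  define c where "c = M powr p / s powr q"
  have c0: "c > 0" using M s0 by (simp add: c_def)
  show ?thesis
  proof (rule that[of "\<epsilon> / (2 * c)"])
    show "\<epsilon> / (2 * c) > 0" using e c0 by simp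
    fix f r assume f: "f holomorphic_on unit_disc" and fM: "\<And>z. z \<in> unit_disc \<Longrightarrow> cmod (f z) \<le> M"
      and r: "0 \<le> r" "r < 1" and I: "Hp_integral q f r \<le> \<epsilon> / (2 * c)"
    have "Hp_integral p f r \<le> s powr p * Hp_integral 1 (\<lambda>_. 1) r + c * Hp_integral q f r"
    proof (rule Hp_integral_le[OF f _ f r p _ q])
      fix z assume z: "z \<in> unit_disc"
      show "cmod (f z) powr p \<le> s powr p * cmod 1 powr 1 + c * cmod (f z) powr q"
      proof (cases "cmod (f z) \<le> s")
        case True
        then have "cmod (f z) powr p \<le> s powr p" using p by (intro powr_mono2) auto
        moreover have "0 \<le> c * cmod (f z) powr q" using c0 by simp
        ultimately show ?thesis by simp
      next
        case False
        have "s powr q \<le> cmod (f z) powr q" using False s0 q by (intro powr_mono2) auto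
        then have "1 \<le> cmod (f z) powr q / s powr q" using s0 by simp
        then have "M powr p * 1 \<le> M powr p * (cmod (f z) powr q / s powr q)" by (intro mult_left_mono) auto
        then have "M powr p \<le> c * cmod (f z) powr q" by (simp add: c_def)
        moreover have "cmod (f z) powr p \<le> M powr p" using fM[OF z] p by (intro powr_mono2) auto
        moreover have "0 \<le> s powr p * cmod 1 powr 1" by simp
        ultimately show ?thesis by linarith
      qed
    qed auto
    also have "\<dots> \<le> s powr p * (2 * pi) + c * (\<epsilon> / (2 * c))"
      using c0 I by (intro add_mono mult_left_mono) (auto simp: Hp_integral_eq)
    also have "\<dots> = \<epsilon>" using c0 by (simp add: sp)
    finally show "Hp_integral p f r \<le> \<epsilon>" .
  qed
qed

lemma powr_superadditive:
  fixes x y s :: real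
  assumes "0 \<le> x" "0 \<le> y" "1 \<le> s"
  shows "x powr s + y powr s \<le> (x + y) powr s"
proof -
  have *: "a powr s \<le> a * (x + y) powr (s - 1)" if "0 \<le> a" "a \<le> x + y" for a
  proof -
    have "a powr s = a * a powr (s - 1)" using that by (cases "a = 0") (auto simp: powr_diff)
    also have "\<dots> \<le> a * (x + y) powr (s - 1)"
      using that assms by (intro mult_left_mono powr_mono2) auto
    finally show ?thesis .
  qed
  have "x powr s + y powr s \<le> (x + y) * (x + y) powr (s - 1)"
    using *[of x] *[of y] assms by (simp add: distrib_right)
  also have "\<dots> = (x + y) powr s" using assms by (cases "x + y = 0") (auto simp: powr_diff)
  finally show ?thesis .
qed

lemma powr_midpoint:
  fixes x y s :: real
  assumes "0 \<le> x" "0 \<le> y" "1 \<le> s"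
  shows "2 * ((x + y) / 2) powr s \<le> x powr s + y powr s"
proof -
  define m where "m = (x + y) / 2"
  have m: "0 \<le> m" using assms by (simp add: m_def)
  have "x * m powr (s - 1) + y * m powr (s - 1) \<le> (x powr s + y powr s) / s + 2 * (1 - 1 / s) * m powr s"
    using powr_tangent[OF assms(3) m assms(1)] powr_tangent[OF assms(3) m assms(2)]
    by (simp add: add_divide_distrib left_diff_distrib)
  also have "x * m powr (s - 1) + y * m powr (s - 1) = 2 * (m * m powr (s - 1))"
    by (simp add: m_def field_simps)
  also have "m * m powr (s - 1) = m powr s" using m by (cases "m = 0") (auto simp: powr_diff)
  finally have "2 * m powr s / s \<le> (x powr s + y powr s) / s" by (simp add: algebra_simps)
  then show ?thesis using assms by (simp add: divide_le_cancel m_def)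
qed

text \<open>
  The parallelogram identity, with superadditivity and convexity of \<open>t \<mapsto> t\<^bsup>q/2\<^esup>\<close>.
\<close>
lemma Clarkson_inequality:
  fixes a b :: complex
  assumes q: "2 \<le> q"
  shows "cmod (a + b) powr q + cmod (a - b) powr q \<le> 2 powr (q - 1) * (cmod a powr q + cmod b powr q)"
proof -
  define s where "s = q / 2"
  have s: "1 \<le> s" using q by (simp add: s_def)
  have sq: "t powr q = (t\<^sup>2) powr s" if "0 \<le> t" for t
    using that by (cases "t = 0") (auto simp: s_def powr_powr simp flip: powr_numeral)
  have "cmod (a + b) powr q + cmod (a - b) powr q \<le> ((cmod (a + b))\<^sup>2 + (cmod (a - b))\<^sup>2) powr s"
    using s by (simp add: sq powr_superadditive)
  also have "(cmod (a + b))\<^sup>2 + (cmod (a - b))\<^sup>2 = 4 * (((cmod a)\<^sup>2 + (cmod b)\<^sup>2) / 2)"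
    unfolding cmod_power2 by (simp add: power2_eq_square algebra_simps)
  also have "\<dots> powr s = 4 powr s / 2 * (2 * (((cmod a)\<^sup>2 + (cmod b)\<^sup>2) / 2) powr s)"
    by (subst powr_mult) auto
  also have "\<dots> \<le> 4 powr s / 2 * (((cmod a)\<^sup>2) powr s + ((cmod b)\<^sup>2) powr s)"
    using s by (intro mult_left_mono powr_midpoint) auto
  also have "\<dots> = 4 powr s / 2 * (cmod a powr q + cmod b powr q)" by (simp add: sq)
  also have "(4::real) powr s = (2 powr 2) powr s" by simp
  also have "\<dots> / 2 = 2 powr (q - 1)" unfolding powr_powr by (simp add: powr_diff s_def)
  finally show ?thesis .
qed

text \<open>
  Uniform convexity turns \<open>f(s\<cdot>) \<rightarrow> f\<close> locally uniformly, together with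
  \<open>\<parallel>f(s\<cdot>)\<parallel> \<le> \<parallel>f\<parallel>\<close>, into convergence in norm: the midpoint of \<open>f\<close> and \<open>f(s\<cdot>)\<close> has norm close
  to \<open>\<parallel>f\<parallel>\<close>.
\<close>
lemma dilation_approximates:
  assumes f: "hardy q f" and q: "2 \<le> q" and e: "0 < \<epsilon>"
  obtains s where "0 < s" "s < 1" "\<And>r. 0 < r \<Longrightarrow> r < 1 \<Longrightarrow> Hp_integral q (\<lambda>z. f z - f (of_real s * z)) r \<le> \<epsilon>"
proof -
  have hf: "f holomorphic_on unit_disc" using f by (rule hardy_holomorphic)
  have q0: "0 < q" "1 \<le> q" using q by auto
  define M where "M = (SUP r\<in>{0<..<1}. Hp_integral q f r)"
  have bdd: "bdd_above (Hp_integral q f ` {0<..<1})" using f by (auto simp: hardy_def bdd_above_def)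
  have M: "Hp_integral q f r \<le> M" if "0 < r" "r < 1" for r
    unfolding M_def using that bdd by (intro cSUP_upper) auto
  define \<eta> where "\<eta> = \<epsilon> / 2 powr (q + 1)"
  have \<eta>: "\<eta> > 0" using e by (simp add: \<eta>_def)
  obtain \<rho> where \<rho>: "0 < \<rho>" "\<rho> < 1" "M - \<eta> < Hp_integral q f \<rho>"
    using less_cSUP_iff[OF _ bdd, of "M - \<eta>"] \<eta> unfolding M_def[symmetric] by auto
  define F where "F s z = f z + f (of_real s * z)" for s :: real and z
  define D where "D s z = f z - f (of_real s * z)" for s :: real and z
  have mem: "of_real s * z \<in> unit_disc" if "0 \<le> s" "s \<le> 1" "z \<in> unit_disc" for s :: real and z
    using that by (simp add: norm_mult) (metis abs_of_nonneg le_less_trans mult_left_le_one_le norm_ge_zero)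
  have dil: "(\<lambda>z. f (of_real s * z)) holomorphic_on unit_disc" if "0 \<le> s" "s \<le> 1" for s :: real
  proof -
    have "(\<lambda>z. of_real s * z) ` unit_disc \<subseteq> unit_disc" using mem[OF that] by blast
    from holomorphic_on_compose_gen[OF _ hf this] show ?thesis
      by (auto simp: o_def intro!: holomorphic_intros)
  qed
  have hF: "F s holomorphic_on unit_disc" and hD: "D s holomorphic_on unit_disc" if "0 \<le> s" "s \<le> 1" for s
    unfolding F_def D_def using dil[OF that] hf by (auto intro!: holomorphic_intros)
  have "continuous_on {1/2..1} (\<lambda>s. integral (cbox 0 (2*pi)) (\<lambda>t. cmod (F s (of_real \<rho> * cis t)) powr q))"
  proof (rule integral_continuous_on_param)
    have cf: "continuous_on unit_disc f" using hf by (rule holomorphic_on_imp_continuous_on)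
    show "continuous_on ({1/2..1} \<times> cbox 0 (2*pi)) (\<lambda>(s, t). cmod (F s (of_real \<rho> * cis t)) powr q)"
      unfolding F_def case_prod_beta using \<rho> q0
      by (intro continuous_on_powr' continuous_intros continuous_on_compose2[OF cf] continuous_on_cis)
         (auto simp: norm_mult intro!: mult_le_one le_less_trans[OF mult_left_le_one_le])
  qed
  then have cont: "continuous_on {1/2..1} (\<lambda>s. Hp_integral q (F s) \<rho>)" by (simp add: Hp_integral_eq)
  have F1: "Hp_integral q (F 1) \<rho> = 2 powr q * Hp_integral q f \<rho>"
  proof -
    have "cmod (F 1 z) powr q = 2 powr q * cmod (f z) powr q" for z
    proof -
      have "F 1 z = 2 * f z" by (simp add: F_def)
      then show ?thesis by (simp add: norm_mult powr_mult)
    qed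
    then show ?thesis by (simp add: Hp_integral_eq)
  qed
  have "\<forall>\<^sub>F s in at 1 within {1/2..1}. 2 powr q * (M - \<eta>) < Hp_integral q (F s) \<rho>"
  proof -
    have "((\<lambda>s. Hp_integral q (F s) \<rho>) \<longlongrightarrow> Hp_integral q (F 1) \<rho>) (at 1 within {1/2..1})"
      using cont by (auto simp: continuous_on_def)
    moreover have "2 powr q * (M - \<eta>) < Hp_integral q (F 1) \<rho>" using \<rho>(3) by (simp add: F1)
    ultimately show ?thesis by (rule order_tendstoD(1))
  qed
  then obtain d where d: "d > 0" "\<And>s. s \<in> {1/2..1} \<Longrightarrow> s \<noteq> 1 \<Longrightarrow> dist s 1 < d \<Longrightarrow> 2 powr q * (M - \<eta>) < Hp_integral q (F s) \<rho>"
    unfolding eventually_at by blast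
  define s where "s = max (1/2) (1 - d / 2)"
  have s: "0 < s" "s < 1" "s \<in> {1/2..1}" "dist s 1 < d" using d(1) by (auto simp: s_def dist_real_def max_def)
  have Fs: "2 powr q * (M - \<eta>) < Hp_integral q (F s) \<rho>" using d(2)[of s] s by auto
  have main: "Hp_integral q (D s) r \<le> \<epsilon>" if r: "\<rho> \<le> r" "r < 1" for r
  proof -
    have r0: "0 < r" using r \<rho> by simp
    have fs: "Hp_integral q (\<lambda>z. f (of_real s * z)) r \<le> M"
    proof -
      have "Hp_integral q (\<lambda>z. f (of_real s * z)) r = Hp_integral q f (s * r)"
        by (simp add: Hp_integral_eq mult.assoc)
      also have "\<dots> \<le> M" using s r r0 by (intro M mult_pos_pos) (auto intro: le_less_trans[OF mult_left_le_one_le])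
      finally show ?thesis .
    qed
    have "Hp_integral q (F s) r + Hp_integral q (D s) r = integral {0..2*pi} (\<lambda>t. cmod (F s (of_real r * cis t)) powr q + cmod (D s (of_real r * cis t)) powr q)"
      unfolding Hp_integral_eq using s r r0 q0
      by (intro integral_add[symmetric] circle_powr_integrable[OF hF] circle_powr_integrable[OF hD]) auto
    also have "\<dots> \<le> integral {0..2*pi} (\<lambda>t. 2 powr (q - 1) * (cmod (f (of_real r * cis t)) powr q + cmod (f (of_real s * (of_real r * cis t))) powr q))"
      using s r r0 q0
      by (intro integral_le integrable_add integrable_on_mult_right circle_powr_integrable[OF hF] circle_powr_integrable[OF hD]
          circle_powr_integrable[OF hf] circle_powr_integrable[OF dil])
         (auto simp: F_def D_def intro!: Clarkson_inequality q)
    also have "\<dots> = 2 powr (q - 1) * integral {0..2*pi} (\<lambda>t. cmod (f (of_real r * cis t)) powr q + cmod (f (of_real s * (of_real r * cis t))) powr q)"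
      by simp
    also have "integral {0..2*pi} (\<lambda>t. cmod (f (of_real r * cis t)) powr q + cmod (f (of_real s * (of_real r * cis t))) powr q)
       = Hp_integral q f r + Hp_integral q (\<lambda>z. f (of_real s * z)) r"
      unfolding Hp_integral_eq using s r r0 q0
      by (intro integral_add circle_powr_integrable[OF hf] circle_powr_integrable[OF dil]) auto
    also have "2 powr (q - 1) * (Hp_integral q f r + Hp_integral q (\<lambda>z. f (of_real s * z)) r) \<le> 2 powr (q - 1) * (M + M)"
      by (intro mult_left_mono add_mono M fs r r0) auto
    also have "\<dots> = 2 powr q * M" by (simp add: powr_diff)
    finally have "Hp_integral q (F s) r + Hp_integral q (D s) r \<le> 2 powr q * M" .
    moreover have "Hp_integral q (F s) \<rho> \<le> Hp_integral q (F s) r"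
      by (rule Hp_integral_mono[where B = 1]) (use hF s r \<rho> q0 in auto)
    ultimately have "Hp_integral q (D s) r \<le> 2 powr q * \<eta>" using Fs by (simp add: algebra_simps)
    also have "\<dots> \<le> \<epsilon>" using e by (simp add: \<eta>_def powr_add)
    finally show ?thesis .
  qed
  have "Hp_integral q (D s) r \<le> \<epsilon>" if r: "0 < r" "r < 1" for r
  proof (cases "\<rho> \<le> r")
    case False
    have "Hp_integral q (D s) r \<le> Hp_integral q (D s) \<rho>"
      by (rule Hp_integral_mono[where B = 1]) (use hD s r \<rho> q0 False in auto)
    with main[of \<rho>] \<rho> show ?thesis by simp
  qed (use main r in auto)
  then show ?thesis using s by (intro that[of s]) (auto simp: D_def[abs_def])
qed

section \<open>Factorization and density of polynomials\<close>

lemma Taylor_polynomial_uniform: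
  assumes f: "f holomorphic_on ball 0 R" and R: "1 < R" and e: "0 < \<epsilon>"
  obtains a n where "\<And>z::complex. z \<in> cball 0 1 \<Longrightarrow> cmod (f z - (\<Sum>i<n. a i * z ^ i)) \<le> \<epsilon>"
proof -
  define a where "a n = (deriv ^^ n) f 0 / fact n" for n
  have sums: "(\<lambda>n. a n * z ^ n) sums f z" if "z \<in> ball 0 R" for z
    using holomorphic_power_series[OF f that] by (simp add: a_def)
  define r where "r = (1 + R) / 2"
  have r: "1 < r" "r < R" using R by (auto simp: r_def)
  have "norm (of_real r :: complex) \<le> conv_radius a"
    by (rule conv_radius_geI) (use sums[of "of_real r"] r in \<open>auto simp: sums_iff\<close>)
  then have "ereal 1 < conv_radius a" using r by (simp add: less_le_trans[of _ "ereal r"])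
  then have "uniform_limit (cball 0 1) (\<lambda>n x. \<Sum>i<n. a i * (x - 0) ^ i) (\<lambda>x. suminf (\<lambda>i. a i * (x - 0) ^ i)) sequentially"
    by (rule powser_uniform_limit)
  then have "\<forall>\<^sub>F n in sequentially. \<forall>x\<in>cball 0 1. dist (\<Sum>i<n. a i * (x - 0) ^ i) (suminf (\<lambda>i. a i * (x - 0) ^ i)) < \<epsilon>"
    using e by (rule uniform_limitD)
  then obtain n where n: "\<forall>x\<in>cball 0 1. dist (\<Sum>i<n. a i * (x - 0) ^ i) (suminf (\<lambda>i. a i * (x - 0) ^ i)) < \<epsilon>"
    using eventually_happens'[OF sequentially_bot] by blast
  show ?thesis
  proof (rule that[of a n])
    fix z :: complex assume z: "z \<in> cball 0 1"
    have "suminf (\<lambda>i. a i * (z - 0) ^ i) = f z" using sums[of z] z R by (simp add: sums_iff)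
    with bspec[OF n z] show "cmod (f z - (\<Sum>i<n. a i * z ^ i)) \<le> \<epsilon>"
      by (simp add: dist_norm norm_minus_commute)
  qed
qed

lemma dilation_holomorphic:
  assumes f: "f holomorphic_on unit_disc" and s: "0 < s"
  shows "(\<lambda>z. f (of_real s * z)) holomorphic_on ball 0 (1 / s)"
proof -
  have sub: "(\<lambda>z. of_real s * z) ` ball 0 (1 / s) \<subseteq> unit_disc"
    using s by (auto simp: norm_mult field_simps)
  from holomorphic_on_compose_gen[OF _ f sub] show ?thesis
    by (auto simp: o_def intro!: holomorphic_intros)
qed

text \<open>
  The zeros of a polynomial in the disc are reflected in the circle, which does not change the
  modulus on the circle.  For polynomials this replaces division by a Blaschke product.
\<close>
lemma reflect_zeros_of_polynomial:
  fixes P :: "complex poly"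
  assumes "P \<noteq> 0"
  shows "\<exists>g. (\<forall>z\<in>unit_disc. poly g z \<noteq> 0 \<and> cmod (poly P z) \<le> cmod (poly g z)) \<and>
             (\<forall>z\<in>sphere 0 1. cmod (poly P z) = cmod (poly g z))"
  using assms
proof (induction "degree P" arbitrary: P)
  case 0
  then obtain c where "P = [:c:]" "c \<noteq> 0" by (metis degree_eq_zeroE pCons_0_0)
  then show ?case by (intro exI[of _ P]) auto
next
  case (Suc n)
  have "\<not> (\<exists>a l. a \<noteq> 0 \<and> l = 0 \<and> P = pCons a l)" using Suc.hyps(2) by auto
  then obtain a where "poly P a = 0" using fundamental_theorem_of_algebra_alt by blast
  then obtain Q where Q: "P = [:- a, 1:] * Q" by (metis poly_eq_0_iff_dvd dvd_def)
  with Suc.prems have "Q \<noteq> 0" by auto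
  moreover have "n = degree Q" using Suc.hyps(2) \<open>Q \<noteq> 0\<close> unfolding Q by (subst (asm) degree_mult_eq) auto
  ultimately obtain g where g: "\<And>z. z \<in> unit_disc \<Longrightarrow> poly g z \<noteq> 0" "\<And>z. z \<in> unit_disc \<Longrightarrow> cmod (poly Q z) \<le> cmod (poly g z)"
      "\<And>z. z \<in> sphere 0 1 \<Longrightarrow> cmod (poly Q z) = cmod (poly g z)"
    using Suc.hyps(1)[of Q] by blast
  have id: "(cmod (1 - cnj a * z))\<^sup>2 - (cmod (z - a))\<^sup>2 = (1 - (cmod a)\<^sup>2) * (1 - (cmod z)\<^sup>2)" for z
    unfolding cmod_power2 by (simp add: power2_eq_square algebra_simps)
  show ?case
  proof (cases "cmod a < 1")
    case True
    have a1: "0 \<le> 1 - (cmod a)\<^sup>2" using True by (simp add: abs_square_le_1)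
    have le: "cmod (z - a) \<le> cmod (1 - cnj a * z)" if "cmod z \<le> 1" for z
    proof -
      have "0 \<le> (1 - (cmod a)\<^sup>2) * (1 - (cmod z)\<^sup>2)"
        using a1 that by (intro mult_nonneg_nonneg) (auto simp: abs_square_le_1)
      then have "(cmod (z - a))\<^sup>2 \<le> (cmod (1 - cnj a * z))\<^sup>2" using id[of z] by linarith
      then show ?thesis by (rule power2_le_imp_le) simp
    qed
    have eq: "cmod (z - a) = cmod (1 - cnj a * z)" if "cmod z = 1" for z
      using id[of z] that by (simp add: power2_eq_iff_nonneg)
    have nz: "1 - cnj a * z \<noteq> 0" if "cmod z < 1" for z
    proof
      assume "1 - cnj a * z = 0"
      then have "cmod (cnj a * z) = 1" by (metis eq_iff_diff_eq_0 norm_one)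
      moreover have "cmod (cnj a * z) < 1"
        using that True by (simp add: norm_mult) (metis mult_strict_mono' norm_ge_zero mult_1)
      ultimately show False by simp
    qed
    show ?thesis
    proof (intro exI[of _ "[:1, - cnj a:] * g"] conjI ballI)
      fix z :: complex assume z: "z \<in> unit_disc"
      show "poly ([:1, - cnj a:] * g) z \<noteq> 0" using g(1)[OF z] nz[of z] z by (simp add: mult.commute)
      show "cmod (poly P z) \<le> cmod (poly ([:1, - cnj a:] * g) z)"
        using mult_mono[OF le[of z] g(2)[OF z]] z
        by (simp only: Q poly_mult norm_mult) (simp add: mult.commute)
    next
      fix z :: complex assume z: "z \<in> sphere 0 1"
      show "cmod (poly P z) = cmod (poly ([:1, - cnj a:] * g) z)"
        using eq[of z] g(3)[OF z] z
        by (simp only: Q poly_mult norm_mult) (simp add: mult.commute)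
    qed
  next
    case False
    show ?thesis
    proof (intro exI[of _ "[:- a, 1:] * g"] conjI ballI)
      fix z :: complex assume z: "z \<in> unit_disc"
      then have "z \<noteq> a" using False by auto
      then show "poly ([:- a, 1:] * g) z \<noteq> 0" using g(1)[OF z] by simp
      show "cmod (poly P z) \<le> cmod (poly ([:- a, 1:] * g) z)"
        using g(2)[OF z] by (simp only: Q poly_mult norm_mult mult_left_mono norm_ge_zero)
    next
      fix z :: complex assume z: "z \<in> sphere 0 1"
      show "cmod (poly P z) = cmod (poly ([:- a, 1:] * g) z)"
        using g(3)[OF z] by (simp only: Q poly_mult norm_mult)
    qed
  qed
qed

lemma Hp_integral_le_plus_one:
  assumes f: "f holomorphic_on ball 0 A" and g: "g holomorphic_on ball 0 B" and r: "0 \<le> r" "r < A" "r < B" and p: "0 < p"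
    and le: "\<And>t. cmod (f (of_real r * cis t)) \<le> cmod (g (of_real r * cis t)) + 1"
  shows "Hp_integral p f r \<le> 2 powr p * (Hp_integral p g r + 2 * pi)"
proof -
  have "Hp_integral p f r \<le> integral {0..2*pi} (\<lambda>t. 2 powr p * (cmod (g (of_real r * cis t)) powr p + 1))"
    unfolding Hp_integral_eq
  proof (intro integral_le integrable_on_mult_right integrable_add circle_powr_integrable[OF f] circle_powr_integrable[OF g] r p)
    fix t
    have "cmod (f (of_real r * cis t)) powr p \<le> (cmod (g (of_real r * cis t)) + 1) powr p"
      using le p by (intro powr_mono2) auto
    also have "\<dots> \<le> 2 powr p * cmod (g (of_real r * cis t)) powr p + 2 powr p * 1 powr p"
      by (intro add_powr_le p) auto
    finally show "cmod (f (of_real r * cis t)) powr p \<le> 2 powr p * (cmod (g (of_real r * cis t)) powr p + 1)"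
      by (simp add: distrib_left)
  qed auto
  also have "\<dots> = 2 powr p * integral {0..2*pi} (\<lambda>t. cmod (g (of_real r * cis t)) powr p + 1)" by simp
  also have "integral {0..2*pi} (\<lambda>t. cmod (g (of_real r * cis t)) powr p + 1) = Hp_integral p g r + 2 * pi"
    unfolding Hp_integral_eq by (subst integral_add) (auto intro!: circle_powr_integrable[OF g] r p)
  finally show ?thesis .
qed

text \<open>
  After the reflection of its zeros the polynomial has a square root in the disc, and the integral over
  the unit circle is unchanged.
\<close>
lemma polynomial_outer_square_root:
  fixes P :: "complex poly"
  assumes "P \<noteq> 0" and p: "1 \<le> p"
  obtains W where "W holomorphic_on unit_disc" "\<And>z. z \<in> unit_disc \<Longrightarrow> W z \<noteq> 0"
    "\<And>z. z \<in> unit_disc \<Longrightarrow> cmod (poly P z) \<le> (cmod (W z))\<^sup>2"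
    "\<And>r. 0 \<le> r \<Longrightarrow> r < 1 \<Longrightarrow> Hp_integral (2 * p) W r \<le> Hp_integral p (poly P) 1"
proof -
  obtain g where g: "\<And>z. z \<in> unit_disc \<Longrightarrow> poly g z \<noteq> 0" "\<And>z. z \<in> unit_disc \<Longrightarrow> cmod (poly P z) \<le> cmod (poly g z)"
      "\<And>z. z \<in> sphere 0 1 \<Longrightarrow> cmod (poly P z) = cmod (poly g z)"
    using reflect_zeros_of_polynomial[OF assms(1)] by blast
  have "simply_connected unit_disc" by (simp add: convex_imp_simply_connected)
  then have sqrt: "\<forall>f. f holomorphic_on unit_disc \<and> (\<forall>z\<in>unit_disc. f z \<noteq> 0)
       \<longrightarrow> (\<exists>W. W holomorphic_on unit_disc \<and> (\<forall>z\<in>unit_disc. f z = (W z)\<^sup>2))"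
    by (rule conjunct2[OF iffD1[OF simply_connected_eq_holomorphic_sqrt[OF open_ball]]])
  have hg: "poly g holomorphic_on S" for S by (intro holomorphic_intros)
  obtain W where W: "W holomorphic_on unit_disc" "\<And>z. z \<in> unit_disc \<Longrightarrow> poly g z = (W z)\<^sup>2"
    using sqrt[rule_format, of "poly g"] hg[of unit_disc] g(1) by auto
  have n: "cmod (poly g z) = (cmod (W z))\<^sup>2" if "z \<in> unit_disc" for z
    using W(2)[OF that] by (simp add: norm_power)
  show ?thesis
  proof (rule that[OF W(1)])
    fix z assume z: "z \<in> unit_disc"
    show "W z \<noteq> 0" using g(1)[OF z] W(2)[OF z] by auto
    show "cmod (poly P z) \<le> (cmod (W z))\<^sup>2" using g(2)[OF z] n[OF z] by simp
  next
    fix r :: real assume r: "0 \<le> r" "r < 1"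
    have "cmod (W z) powr (2 * p) = cmod (poly g z) powr p" if "z \<in> unit_disc" for z
      unfolding n[OF that] by (cases "W z = 0") (auto simp: powr_powr simp flip: powr_numeral)
    then have "Hp_integral (2 * p) W r = Hp_integral p (poly g) r"
      unfolding Hp_integral_eq using r by (intro integral_cong) (auto simp: norm_mult)
    also have "\<dots> \<le> Hp_integral p (poly g) 1"
      by (rule Hp_integral_mono[where B = 2]) (use hg r p in auto)
    also have "\<dots> = Hp_integral p (poly P) 1"
      unfolding Hp_integral_eq using g(3) by (intro integral_cong) auto
    finally show "Hp_integral (2 * p) W r \<le> Hp_integral p (poly P) 1" .
  qed
qed

lemma nonzero_polynomial_approximation:
  assumes "f holomorphic_on ball 0 R" "1 < R" "0 < \<epsilon>"
  obtains P :: "complex poly" where "P \<noteq> 0" "\<And>z. z \<in> cball 0 1 \<Longrightarrow> cmod (f z - poly P z) \<le> \<epsilon>"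
proof -
  obtain a n where an: "\<And>z::complex. z \<in> cball 0 1 \<Longrightarrow> cmod (f z - (\<Sum>i<n. a i * z ^ i)) \<le> \<epsilon> / 2"
    using Taylor_polynomial_uniform[OF assms(1,2), of "\<epsilon> / 2"] assms(3) by auto
  define P where "P = (\<Sum>i<n. monom (a i) i)"
  have P: "cmod (f z - poly P z) \<le> \<epsilon> / 2" if "z \<in> cball 0 1" for z
    using an[OF that] by (simp add: P_def poly_sum poly_monom)
  show ?thesis
  proof (cases "P = 0")
    case True
    have "cmod (f z - poly [:of_real (\<epsilon> / 2):] z) \<le> \<epsilon>" if "z \<in> cball 0 1" for z
      using norm_triangle_ineq4[of "f z" "of_real (\<epsilon> / 2)"] P[OF that] True assms(3) by simp
    then show ?thesis using assms(3) by (intro that[of "[:of_real (\<epsilon> / 2):]"]) auto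
  next
    case False
    have "cmod (f z - poly P z) \<le> \<epsilon>" if "z \<in> cball 0 1" for z using P[OF that] assms(3) by linarith
    with False show ?thesis by (rule that)
  qed
qed

text \<open>
  The factor \<open>W\<close> is a normal-families limit of the square roots belonging to polynomials that
  approximate the dilations of \<open>f\<close>; Hurwitz's theorem keeps it free of zeros.
\<close>
lemma hardy_factorization:
  assumes f: "hardy p f" and p: "1 \<le> p" and nz: "z0 \<in> unit_disc" "f z0 \<noteq> 0"
  obtains k W where "k holomorphic_on unit_disc" "\<And>z. z \<in> unit_disc \<Longrightarrow> cmod (k z) \<le> 1" "hardy (2 * p) W"
    "\<And>z. z \<in> unit_disc \<Longrightarrow> f z = k z * (W z)\<^sup>2"
proof -
  have hf: "f holomorphic_on unit_disc" using f by (rule hardy_holomorphic)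
  obtain B where B: "B > 0" "\<And>r. 0 < r \<Longrightarrow> r < 1 \<Longrightarrow> Hp_integral p f r \<le> B" using hardy_boundE[OF f] by metis
  define s where "s n = 1 - inverse (real (Suc (Suc n)))" for n
  have s: "0 < s n" "s n < 1" for n by (auto simp: s_def field_simps)
  have s_lim: "s \<longlonglongrightarrow> 1"
    using tendsto_diff[OF tendsto_const LIMSEQ_Suc[OF LIMSEQ_inverse_real_of_nat], of 1] by (simp add: s_def[abs_def])
  define F where "F n z = f (of_real (s n) * z)" for n z
  have hF: "F n holomorphic_on ball 0 (1 / s n)" for n unfolding F_def[abs_def] by (rule dilation_holomorphic[OF hf s(1)])
  have s1: "1 < 1 / s n" for n using s[of n] by simp
  have "\<exists>P::complex poly. P \<noteq> 0 \<and> (\<forall>z\<in>cball 0 1. cmod (F n z - poly P z) \<le> 1 / (of_nat n + 1))" for n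
  proof -
    have e: "0 < 1 / (of_nat n + 1 :: real)" by simp
    obtain P :: "complex poly" where "P \<noteq> 0" "\<And>z. z \<in> cball 0 1 \<Longrightarrow> cmod (F n z - poly P z) \<le> 1 / (of_nat n + 1)"
      using nonzero_polynomial_approximation[OF hF[of n] s1[of n] e] by metis
    then show ?thesis by blast
  qed
  then obtain P :: "nat \<Rightarrow> complex poly" where
    P': "\<And>n. P n \<noteq> 0 \<and> (\<forall>z\<in>cball 0 1. cmod (F n z - poly (P n) z) \<le> 1 / (of_nat n + 1))" by metis
  have P: "P n \<noteq> 0" "z \<in> cball 0 1 \<Longrightarrow> cmod (F n z - poly (P n) z) \<le> 1 / (of_nat n + 1)" for n z
    using P'[of n] by blast+
  define B' where "B' = 2 powr p * (B + 2 * pi)"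
  have PB: "Hp_integral p (poly (P n)) 1 \<le> B'" for n
  proof -
    have "Hp_integral p (poly (P n)) 1 \<le> 2 powr p * (Hp_integral p (F n) 1 + 2 * pi)"
    proof (rule Hp_integral_le_plus_one[where A = 2 and B = "1 / s n"])
      show "poly (P n) holomorphic_on ball 0 2" by (intro holomorphic_intros)
      fix t
      have "cmod (F n (cis t) - poly (P n) (cis t)) \<le> 1"
        by (rule order.trans[OF P(2)]) auto
      then show "cmod (poly (P n) (of_real 1 * cis t)) \<le> cmod (F n (of_real 1 * cis t)) + 1"
        using norm_triangle_ineq2[of "poly (P n) (cis t)" "F n (cis t)"] by (simp add: norm_minus_commute)
    qed (use hF s1 p in auto)
    also have "Hp_integral p (F n) 1 = Hp_integral p f (s n)" by (simp add: Hp_integral_eq F_def)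
    also have "2 powr p * (Hp_integral p f (s n) + 2 * pi) \<le> B'"
      unfolding B'_def by (intro mult_left_mono add_right_mono B s) auto
    finally show ?thesis .
  qed
  define Q where "Q n W \<longleftrightarrow> W holomorphic_on unit_disc \<and>
     (\<forall>z\<in>unit_disc. W z \<noteq> 0 \<and> cmod (poly (P n) z) \<le> (cmod (W z))\<^sup>2) \<and>
     (\<forall>r. 0 \<le> r \<longrightarrow> r < 1 \<longrightarrow> Hp_integral (2 * p) W r \<le> B')" for n W
  have "\<exists>W. Q n W" for n
  proof -
    obtain W where "W holomorphic_on unit_disc" "\<And>z. z \<in> unit_disc \<Longrightarrow> W z \<noteq> 0"
        "\<And>z. z \<in> unit_disc \<Longrightarrow> cmod (poly (P n) z) \<le> (cmod (W z))\<^sup>2"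
      and I: "\<And>r. 0 \<le> r \<Longrightarrow> r < 1 \<Longrightarrow> Hp_integral (2 * p) W r \<le> Hp_integral p (poly (P n)) 1"
      using polynomial_outer_square_root[OF P(1)[of n] p] by metis
    moreover have "Hp_integral (2 * p) W r \<le> B'" if "0 \<le> r" "r < 1" for r
      by (rule order.trans[OF I[OF that] PB])
    ultimately show ?thesis unfolding Q_def by blast
  qed
  then obtain W where WQ: "\<And>n. Q n (W n)" by metis
  have W: "W n holomorphic_on unit_disc" "z \<in> unit_disc \<Longrightarrow> W n z \<noteq> 0"
    "z \<in> unit_disc \<Longrightarrow> cmod (poly (P n) z) \<le> (cmod (W n z))\<^sup>2"
    "0 \<le> r \<Longrightarrow> r < 1 \<Longrightarrow> Hp_integral (2 * p) (W n) r \<le> B'" for n z r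
    using WQ[of n] unfolding Q_def by blast+
  have B'0: "0 \<le> B'" using B(1) by (simp add: B'_def)
  have loc: "\<exists>C. \<forall>h\<in>range W. \<forall>z\<in>K. cmod (h z) \<le> C" if K: "compact K" "K \<subseteq> unit_disc" for K
  proof (cases "K = {}")
    case False
    have "continuous_on K cmod" by (intro continuous_intros)
    from continuous_attains_sup[OF K(1) False this] obtain a where a: "a \<in> K" "\<And>z. z \<in> K \<Longrightarrow> cmod z \<le> cmod a" by auto
    have a1: "cmod a < 1" using a(1) K(2) by auto
    have "cmod (W n z) \<le> (B' / (1 - cmod a)) powr (1 / (2 * p))" if z: "z \<in> K" for n z
    proof -
      have zd: "z \<in> unit_disc" using z K(2) by auto
      have "cmod (W n z) powr (2 * p) \<le> B' / (1 - cmod z)"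
        by (rule hardy_point_bound[OF W(1) W(4) zd]) (use p in auto)
      also have "\<dots> \<le> B' / (1 - cmod a)"
        using a(2)[OF z] a1 B'0 by (intro divide_left_mono) (auto intro!: mult_pos_pos)
      finally have "(cmod (W n z) powr (2 * p)) powr (1 / (2 * p)) \<le> (B' / (1 - cmod a)) powr (1 / (2 * p))"
        using p by (intro powr_mono2) auto
      then show ?thesis using p by (simp add: powr_powr)
    qed
    then show ?thesis by blast
  qed auto
  obtain V \<sigma> where V: "V holomorphic_on unit_disc" "strict_mono (\<sigma> :: nat \<Rightarrow> nat)"
      "\<And>z. z \<in> unit_disc \<Longrightarrow> (\<lambda>n. W (\<sigma> n) z) \<longlonglongrightarrow> V z"
      "\<And>K. \<lbrakk>compact K; K \<subseteq> unit_disc\<rbrakk> \<Longrightarrow> uniform_limit K (W \<circ> \<sigma>) V sequentially"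
  proof (rule Montel[of unit_disc "range W" W])
    show "\<And>h. h \<in> range W \<Longrightarrow> h holomorphic_on unit_disc" using W(1) by auto
  qed (use loc in auto)
  have fV: "cmod (f z) \<le> (cmod (V z))\<^sup>2" if z: "z \<in> unit_disc" for z
  proof -
    have "isCont f z" using z by (intro continuous_on_interior[OF holomorphic_on_imp_continuous_on[OF hf]]) (simp add: interior_open)
    moreover have "(\<lambda>n. of_real (s (\<sigma> n)) * z) \<longlonglongrightarrow> of_real 1 * z"
      using LIMSEQ_subseq_LIMSEQ[OF s_lim V(2)] by (intro tendsto_intros) (simp add: o_def)
    ultimately have "(\<lambda>n. F (\<sigma> n) z) \<longlonglongrightarrow> f z"
      unfolding F_def using isCont_tendsto_compose[of z f "\<lambda>n. of_real (s (\<sigma> n)) * z" sequentially] by simp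
    then have 1: "(\<lambda>n. cmod (F (\<sigma> n) z)) \<longlonglongrightarrow> cmod (f z)" by (rule tendsto_norm)
    have "(\<lambda>n. 1 / (of_nat n + 1 :: real)) \<longlonglongrightarrow> 0"
      using LIMSEQ_inverse_real_of_nat by (simp add: inverse_eq_divide add.commute)
    from LIMSEQ_subseq_LIMSEQ[OF this V(2)] have "(\<lambda>n. 1 / (of_nat (\<sigma> n) + 1 :: real)) \<longlonglongrightarrow> 0" by (simp add: o_def)
    with V(3)[OF z] have 2: "(\<lambda>n. (cmod (W (\<sigma> n) z))\<^sup>2 + 1 / (of_nat (\<sigma> n) + 1)) \<longlonglongrightarrow> (cmod (V z))\<^sup>2 + 0"
      by (intro tendsto_intros)
    have "cmod (F (\<sigma> n) z) \<le> (cmod (W (\<sigma> n) z))\<^sup>2 + 1 / (of_nat (\<sigma> n) + 1)" for n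
      using P(2)[of z "\<sigma> n"] W(3)[OF z, of "\<sigma> n"] norm_triangle_ineq2[of "F (\<sigma> n) z" "poly (P (\<sigma> n)) z"] z by auto
    then show ?thesis using LIMSEQ_le[OF 1 2] by auto
  qed
  have V0: "V z0 \<noteq> 0" using fV[OF nz(1)] nz(2) by auto
  have Vnz: "V z \<noteq> 0" if z: "z \<in> unit_disc" for z
  proof (cases "V constant_on unit_disc")
    case True
    then show ?thesis using V0 nz(1) z by (metis constant_on_def)
  next
    case False
    have "connected unit_disc" by simp
    from Hurwitz_no_zeros[OF open_ball this _ V(1) V(4) False _ z] show ?thesis
      using W(1,2) by (auto simp: o_def)
  qed
  have hV: "hardy (2 * p) V"
    unfolding hardy_def
  proof (intro conjI exI ballI V(1))
    fix r :: real assume r: "r \<in> {0<..<1}"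
    have "uniform_limit (cball 0 r) (W \<circ> \<sigma>) V sequentially" by (rule V(4)) (use r in auto)
    then have "\<forall>\<^sub>F n in sequentially. \<forall>z\<in>cball 0 r. dist ((W \<circ> \<sigma>) n z) (V z) < 1" by (rule uniform_limitD) simp
    from eventually_happens'[OF sequentially_bot this]
    obtain n where "\<forall>z\<in>cball 0 r. dist ((W \<circ> \<sigma>) n z) (V z) < 1" by blast
    then have n: "dist (W (\<sigma> n) z) (V z) < 1" if "z \<in> cball 0 r" for z using that by (simp add: o_def)
    have "Hp_integral (2 * p) V r \<le> 2 powr (2 * p) * (Hp_integral (2 * p) (W (\<sigma> n)) r + 2 * pi)"
    proof (rule Hp_integral_le_plus_one[OF V(1) W(1)])
      fix t
      have "of_real r * cis t \<in> cball 0 r" using r by (simp add: norm_mult)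
      from n[OF this] show "cmod (V (of_real r * cis t)) \<le> cmod (W (\<sigma> n) (of_real r * cis t)) + 1"
        using norm_triangle_ineq2[of "V (of_real r * cis t)" "W (\<sigma> n) (of_real r * cis t)"]
        by (simp add: dist_norm norm_minus_commute)
    qed (use r p in auto)
    also have "\<dots> \<le> 2 powr (2 * p) * (B' + 2 * pi)"
      using r by (intro mult_left_mono add_right_mono W(4)) auto
    finally show "Hp_integral (2 * p) V r \<le> 2 powr (2 * p) * (B' + 2 * pi)" .
  qed
  show ?thesis
  proof (rule that[of "\<lambda>z. f z / (V z)\<^sup>2" V])
    show "(\<lambda>z. f z / (V z)\<^sup>2) holomorphic_on unit_disc"
      using Vnz by (intro holomorphic_intros hf V(1)) auto
    fix z assume z: "z \<in> unit_disc"
    show "cmod (f z / (V z)\<^sup>2) \<le> 1" using fV[OF z] Vnz[OF z] by (simp add: norm_divide norm_power)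
    show "f z = f z / (V z)\<^sup>2 * (V z)\<^sup>2" using Vnz[OF z] by simp
  qed (rule hV)
qed

section \<open>Continuous functionals on the Hardy space\<close>

text \<open>
  Continuity is expressed by \<open>p\<close>-th powers and an arbitrary bound of the integral means; the value
  depends only on the restriction to the disc.
\<close>
locale hardy_functional =
  fixes p :: real and \<Lambda> :: "(complex \<Rightarrow> complex) \<Rightarrow> complex" and C :: real
  assumes p: "1 \<le> p"
    and cong: "(\<And>z. z \<in> unit_disc \<Longrightarrow> f z = g z) \<Longrightarrow> \<Lambda> f = \<Lambda> g"
    and add: "hardy p f \<Longrightarrow> hardy p g \<Longrightarrow> \<Lambda> (\<lambda>z. f z + g z) = \<Lambda> f + \<Lambda> g"
    and scale: "hardy p f \<Longrightarrow> \<Lambda> (\<lambda>z. c * f z) = c * \<Lambda> f"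
    and bound: "hardy p f \<Longrightarrow> (\<And>r. 0 < r \<Longrightarrow> r < 1 \<Longrightarrow> Hp_integral p f r \<le> B) \<Longrightarrow> cmod (\<Lambda> f) powr p \<le> C * B"
begin

lemma p0: "0 < p" using p by simp

lemma zero: "\<Lambda> (\<lambda>_. 0) = 0"
  using scale[OF hardy_const[of p 0], of 0] by simp

lemma diff: "hardy p f \<Longrightarrow> hardy p g \<Longrightarrow> \<Lambda> (\<lambda>z. f z - g z) = \<Lambda> f - \<Lambda> g"
  using add[of f "\<lambda>z. -1 * g z"] scale[of g "-1"] hardy_scale[of p g "-1"] p0 by simp

lemma sum:
  "(\<And>i. i \<in> I \<Longrightarrow> hardy p (f i)) \<Longrightarrow> \<Lambda> (\<lambda>z. \<Sum>i\<in>I. c i * f i z) = (\<Sum>i\<in>I. c i * \<Lambda> (f i))"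
proof (induction I rule: infinite_finite_induct)
  case (insert i I)
  have "\<Lambda> (\<lambda>z. \<Sum>i\<in>insert i I. c i * f i z) = \<Lambda> (\<lambda>z. c i * f i z + (\<Sum>i\<in>I. c i * f i z))"
    using insert.hyps by simp
  also have "\<dots> = \<Lambda> (\<lambda>z. c i * f i z) + \<Lambda> (\<lambda>z. \<Sum>i\<in>I. c i * f i z)"
    by (intro add hardy_sum hardy_scale insert.prems p0) auto
  also have "\<dots> = c i * \<Lambda> (f i) + (\<Sum>i\<in>I. c i * \<Lambda> (f i))"
    using insert by (simp add: scale)
  finally show ?case using insert.hyps by simp
qed (auto simp: zero)

lemma bound_root:
  assumes "hardy p f" "\<And>r. 0 < r \<Longrightarrow> r < 1 \<Longrightarrow> Hp_integral p f r \<le> B"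
  shows "cmod (\<Lambda> f) \<le> (\<bar>C\<bar> * B) powr (1 / p)"
proof -
  have "0 \<le> B" using assms(2)[of "1/2"] Hp_integral_nonneg[of p f "1/2"] by linarith
  then have "cmod (\<Lambda> f) powr p \<le> \<bar>C\<bar> * B"
    using bound[OF assms] by (meson abs_ge_self mult_right_mono order_trans)
  then have "(cmod (\<Lambda> f) powr p) powr (1 / p) \<le> (\<bar>C\<bar> * B) powr (1 / p)"
    using p by (intro powr_mono2) auto
  then show ?thesis using p by (simp add: powr_powr)
qed

lemma approximation:
  assumes f: "hardy p f"
    and ap: "\<And>\<epsilon>. \<epsilon> > 0 \<Longrightarrow> \<exists>g. hardy p g \<and> \<Lambda> g = 0 \<and> (\<forall>r. 0 < r \<and> r < 1 \<longrightarrow> Hp_integral p (\<lambda>z. f z - g z) r \<le> \<epsilon>)"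
  shows "\<Lambda> f = 0"
proof (rule ccontr)
  assume nz: "\<Lambda> f \<noteq> 0"
  define e where "e = cmod (\<Lambda> f) powr p / (2 * (\<bar>C\<bar> + 1))"
  have e: "e > 0" using nz by (simp add: e_def)
  obtain g where g: "hardy p g" "\<Lambda> g = 0" "\<And>r. 0 < r \<Longrightarrow> r < 1 \<Longrightarrow> Hp_integral p (\<lambda>z. f z - g z) r \<le> e"
    using ap[OF e] by blast
  have "cmod (\<Lambda> (\<lambda>z. f z - g z)) powr p \<le> C * e"
    by (intro bound hardy_diff f g p0)
  then have "cmod (\<Lambda> f) powr p \<le> C * e" by (simp add: diff[OF f g(1)] g(2))
  also have "\<dots> \<le> \<bar>C\<bar> * e" using e by (intro mult_right_mono) auto
  also have "\<dots> < (\<bar>C\<bar> + 1) * (2 * e)" using e by (simp add: algebra_simps add_nonneg_pos)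
  also have "\<dots> = cmod (\<Lambda> f) powr p"
  proof -
    have "k * (2 * (x / (2 * k))) = x" if "k \<noteq> 0" for k x :: real using that by simp
    then show ?thesis unfolding e_def by (metis abs_ge_zero add_nonneg_pos less_irrefl zero_less_one)
  qed
  finally show False by simp
qed

lemma approximation_dominated:
  assumes f: "hardy p f" and M: "hardy p M" "hardy p N"
    and ap: "\<And>\<epsilon>. \<epsilon> > 0 \<Longrightarrow> \<exists>g. hardy p g \<and> \<Lambda> g = 0 \<and> (\<forall>z\<in>unit_disc. cmod (f z - g z) \<le> \<epsilon> * (cmod (M z) + cmod (N z)))"
  shows "\<Lambda> f = 0"
proof (rule approximation[OF f])
  fix \<epsilon> :: real assume e: "\<epsilon> > 0"
  obtain A where A: "A > 0" "\<And>r. 0 < r \<Longrightarrow> r < 1 \<Longrightarrow> Hp_integral p M r \<le> A" using hardy_boundE[OF M(1)] by metis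
  obtain B where B: "B > 0" "\<And>r. 0 < r \<Longrightarrow> r < 1 \<Longrightarrow> Hp_integral p N r \<le> B" using hardy_boundE[OF M(2)] by metis
  define d where "d = (\<epsilon> / (A + B)) powr (1 / p) / 2"
  have d: "d > 0" "(2 * d) powr p * (A + B) = \<epsilon>" using A(1) B(1) e p0 by (auto simp: d_def powr_powr)
  obtain g where g: "hardy p g" "\<Lambda> g = 0" "\<And>z. z \<in> unit_disc \<Longrightarrow> cmod (f z - g z) \<le> d * (cmod (M z) + cmod (N z))"
    using ap[OF d(1)] by blast
  have "Hp_integral p (\<lambda>z. f z - g z) r \<le> \<epsilon>" if r: "0 < r" "r < 1" for r
  proof -
    have "Hp_integral p (\<lambda>z. f z - g z) r \<le> (2 * d) powr p * (Hp_integral p M r + Hp_integral p N r)"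
      by (rule Hp_integral_dominated)
         (use f g M r d p0 in \<open>auto intro!: holomorphic_intros dest: hardy_holomorphic\<close>)
    also have "\<dots> \<le> (2 * d) powr p * (A + B)"
      by (intro mult_left_mono add_mono A B r) auto
    finally show ?thesis using d(2) by simp
  qed
  with g show "\<exists>g. hardy p g \<and> \<Lambda> g = 0 \<and> (\<forall>r. 0 < r \<and> r < 1 \<longrightarrow> Hp_integral p (\<lambda>z. f z - g z) r \<le> \<epsilon>)"
    by blast
qed

lemma approximation_uniform:
  assumes f: "hardy p f"
    and ap: "\<And>\<epsilon>. \<epsilon> > 0 \<Longrightarrow> \<exists>g. hardy p g \<and> \<Lambda> g = 0 \<and> (\<forall>z\<in>unit_disc. cmod (f z - g z) \<le> \<epsilon>)"
  shows "\<Lambda> f = 0"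
  using approximation_dominated[OF f hardy_const[of p 1] hardy_const[of p 0]] ap by simp

text \<open>
  Differentiation under \<open>\<Lambda>\<close>: a pointwise quadratic Taylor estimate with majorants in the Hardy
  space makes \<open>\<zeta> \<mapsto> \<Lambda>(F\<^sub>\<zeta>)\<close> complex differentiable.
\<close>
lemma has_derivative_dominated:
  assumes \<delta>: "\<delta> > 0" and F: "\<And>\<eta>. cmod \<eta> < \<delta> \<Longrightarrow> hardy p (F (\<zeta> + \<eta>))" and F': "hardy p F'"
    and M: "hardy p M" "hardy p N"
    and le: "\<And>\<eta> z. cmod \<eta> < \<delta> \<Longrightarrow> z \<in> unit_disc \<Longrightarrow>
        cmod (F (\<zeta> + \<eta>) z - F \<zeta> z - \<eta> * F' z) \<le> (cmod \<eta>)\<^sup>2 * (cmod (M z) + cmod (N z))"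
  shows "((\<lambda>\<zeta>. \<Lambda> (F \<zeta>)) has_field_derivative \<Lambda> F') (at \<zeta>)"
proof -
  obtain A where A: "A > 0" "\<And>r. 0 < r \<Longrightarrow> r < 1 \<Longrightarrow> Hp_integral p M r \<le> A" using hardy_boundE[OF M(1)] by metis
  obtain B where B: "B > 0" "\<And>r. 0 < r \<Longrightarrow> r < 1 \<Longrightarrow> Hp_integral p N r \<le> B" using hardy_boundE[OF M(2)] by metis
  define K where "K = 2 * (\<bar>C\<bar> * (A + B)) powr (1 / p)"
  have F0: "hardy p (F \<zeta>)" using F[of 0] \<delta> by simp
  have est: "cmod (\<Lambda> (F (\<zeta> + \<eta>)) - \<Lambda> (F \<zeta>) - \<eta> * \<Lambda> F') \<le> K * (cmod \<eta>)\<^sup>2" if \<eta>: "cmod \<eta> < \<delta>" for \<eta>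
  proof -
    define D where "D z = F (\<zeta> + \<eta>) z - F \<zeta> z - \<eta> * F' z" for z
    have hD: "hardy p D" unfolding D_def by (intro hardy_diff hardy_scale F F' F0 \<eta> p0)
    have "\<Lambda> D = \<Lambda> (\<lambda>z. F (\<zeta> + \<eta>) z - F \<zeta> z) - \<Lambda> (\<lambda>z. \<eta> * F' z)"
      unfolding D_def by (intro diff hardy_diff hardy_scale F F' F0 \<eta> p0)
    then have LD: "\<Lambda> D = \<Lambda> (F (\<zeta> + \<eta>)) - \<Lambda> (F \<zeta>) - \<eta> * \<Lambda> F'"
      by (simp add: diff[OF F[OF \<eta>] F0] scale[OF F'])
    have "Hp_integral p D r \<le> (2 * (cmod \<eta>)\<^sup>2) powr p * (A + B)" if r: "0 < r" "r < 1" for r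
    proof -
      have "Hp_integral p D r \<le> (2 * (cmod \<eta>)\<^sup>2) powr p * (Hp_integral p M r + Hp_integral p N r)"
        by (rule Hp_integral_dominated)
           (use hD M r p0 le[OF \<eta>] in \<open>auto simp: D_def dest: hardy_holomorphic\<close>)
      also have "\<dots> \<le> (2 * (cmod \<eta>)\<^sup>2) powr p * (A + B)"
        by (intro mult_left_mono add_mono A B r) auto
      finally show ?thesis .
    qed
    from bound_root[OF hD this] have "cmod (\<Lambda> D) \<le> (\<bar>C\<bar> * ((2 * (cmod \<eta>)\<^sup>2) powr p * (A + B))) powr (1 / p)" .
    also have "\<bar>C\<bar> * ((2 * (cmod \<eta>)\<^sup>2) powr p * (A + B)) = (2 * (cmod \<eta>)\<^sup>2) powr p * (\<bar>C\<bar> * (A + B))" by simp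
    also have "\<dots> powr (1 / p) = ((2 * (cmod \<eta>)\<^sup>2) powr p) powr (1 / p) * (\<bar>C\<bar> * (A + B)) powr (1 / p)"
      by (rule powr_mult)
    also have "((2 * (cmod \<eta>)\<^sup>2) powr p) powr (1 / p) = 2 * (cmod \<eta>)\<^sup>2" using p0 by (simp add: powr_powr)
    finally show ?thesis by (simp add: LD K_def mult.commute mult.left_commute)
  qed
  have "((\<lambda>\<eta>. (\<Lambda> (F (\<zeta> + \<eta>)) - \<Lambda> (F \<zeta>)) / \<eta> - \<Lambda> F') \<longlongrightarrow> 0) (at 0)"
  proof (rule Lim_null_comparison)
    show "\<forall>\<^sub>F \<eta> in at 0. norm ((\<Lambda> (F (\<zeta> + \<eta>)) - \<Lambda> (F \<zeta>)) / \<eta> - \<Lambda> F') \<le> K * cmod \<eta>"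
      unfolding eventually_at
    proof (intro exI[of _ \<delta>] conjI ballI impI \<delta>)
      fix \<eta> :: complex assume "\<eta> \<noteq> 0 \<and> dist \<eta> 0 < \<delta>"
      then have \<eta>: "\<eta> \<noteq> 0" "cmod \<eta> < \<delta>" by auto
      have "(\<Lambda> (F (\<zeta> + \<eta>)) - \<Lambda> (F \<zeta>)) / \<eta> - \<Lambda> F' = (\<Lambda> (F (\<zeta> + \<eta>)) - \<Lambda> (F \<zeta>) - \<eta> * \<Lambda> F') / \<eta>"
        using \<eta>(1) by (simp add: field_simps)
      then have "norm ((\<Lambda> (F (\<zeta> + \<eta>)) - \<Lambda> (F \<zeta>)) / \<eta> - \<Lambda> F') = cmod (\<Lambda> (F (\<zeta> + \<eta>)) - \<Lambda> (F \<zeta>) - \<eta> * \<Lambda> F') / cmod \<eta>"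
        by (simp add: norm_divide)
      also have "\<dots> \<le> K * (cmod \<eta>)\<^sup>2 / cmod \<eta>" by (intro divide_right_mono est \<eta>) auto
      also have "\<dots> = K * cmod \<eta>" using \<eta>(1) by (simp add: power2_eq_square)
      finally show "norm ((\<Lambda> (F (\<zeta> + \<eta>)) - \<Lambda> (F \<zeta>)) / \<eta> - \<Lambda> F') \<le> K * cmod \<eta>" .
    qed
    show "((\<lambda>\<eta>. K * cmod \<eta>) \<longlongrightarrow> 0) (at (0::complex))"
      by (auto intro!: tendsto_eq_intros)
  qed
  then have "((\<lambda>\<eta>. (\<Lambda> (F (\<zeta> + \<eta>)) - \<Lambda> (F \<zeta>)) / \<eta>) \<longlongrightarrow> \<Lambda> F') (at 0)" by (rule Lim_null[THEN iffD2])
  then show ?thesis by (simp add: has_field_derivative_def field_has_derivative_at)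
qed

text \<open>
  Dilations converge in norm for exponents at least \<open>2\<close>.  For a bounded function the exponent \<open>2\<close>
  suffices, since its dilations have a common bound.  In general \<open>f = k W\<^sup>2\<close> is approximated by the
  bounded functions \<open>k V\<^sup>2\<close>, where \<open>V\<close> is a dilation of \<open>W\<close>; here the exponent is \<open>2p \<ge> 2\<close>.
\<close>
lemma vanishes_on_polynomials_imp_vanishes:
  assumes poly: "\<And>k. \<Lambda> (\<lambda>z. z ^ k) = 0" and f: "hardy p f"
  shows "\<Lambda> f = 0"
proof -
  have hpow: "hardy p (\<lambda>z. z ^ k)" for k
    by (rule hardy_bounded[where M = 1]) (auto simp: norm_power power_le_one less_imp_le p0 intro!: holomorphic_intros)
  have entire: "\<Lambda> g = 0" if g: "g holomorphic_on ball 0 R" and R: "1 < R" for g R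
  proof -
    have sub: "cball 0 1 \<subseteq> ball 0 R" "unit_disc \<subseteq> ball 0 R" using R by auto
    have "compact (g ` cball 0 1)"
      using g sub by (intro compact_continuous_image) (auto intro: holomorphic_on_imp_continuous_on holomorphic_on_subset)
    then obtain M where M: "\<And>z. z \<in> cball 0 1 \<Longrightarrow> cmod (g z) \<le> M"
      by (meson bounded_iff compact_imp_bounded imageI)
    have hg: "hardy p g"
      by (rule hardy_bounded[where M = M]) (use M p0 g sub in \<open>auto intro: holomorphic_on_subset\<close>)
    show ?thesis
    proof (rule approximation_uniform[OF hg])
      fix \<epsilon> :: real assume "\<epsilon> > 0"
      then obtain a n where an: "\<And>z::complex. z \<in> cball 0 1 \<Longrightarrow> cmod (g z - (\<Sum>i<n. a i * z ^ i)) \<le> \<epsilon>"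
        using Taylor_polynomial_uniform[OF g R] by metis
      have "\<Lambda> (\<lambda>z. \<Sum>i<n. a i * z ^ i) = (\<Sum>i<n. a i * \<Lambda> (\<lambda>z. z ^ i))" by (rule sum) (rule hpow)
      then have "\<Lambda> (\<lambda>z. \<Sum>i<n. a i * z ^ i) = 0" by (simp add: poly)
      moreover have "hardy p (\<lambda>z. \<Sum>i<n. a i * z ^ i)" by (intro hardy_sum hardy_scale hpow p0)
      ultimately show "\<exists>h. hardy p h \<and> \<Lambda> h = 0 \<and> (\<forall>z\<in>unit_disc. cmod (g z - h z) \<le> \<epsilon>)"
        using an by (intro exI[of _ "\<lambda>z. \<Sum>i<n. a i * z ^ i"]) auto
    qed
  qed
  have dil_entire: "\<Lambda> (\<lambda>z. g (of_real s * z)) = 0" if "g holomorphic_on unit_disc" "0 < s" "s < 1" for g s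
    by (rule entire[OF dilation_holomorphic[OF that(1,2)]]) (use that in simp)
  have bdd: "\<Lambda> g = 0" if g: "g holomorphic_on unit_disc" and M: "\<And>z. z \<in> unit_disc \<Longrightarrow> cmod (g z) \<le> M" for g M
  proof -
    define M' where "M' = max 1 M"
    have M': "0 < M'" "\<And>z. z \<in> unit_disc \<Longrightarrow> cmod (g z) \<le> M'" using M by (auto simp: M'_def le_max_iff_disj)
    have g2: "hardy 2 g" by (rule hardy_bounded[OF g M]) auto
    have gp: "hardy p g" by (rule hardy_bounded[OF g M p0])
    show ?thesis
    proof (rule approximation[OF gp])
      fix \<epsilon> :: real assume e: "\<epsilon> > 0"
      obtain \<delta> where \<delta>: "\<delta> > 0"
        "\<And>f r. f holomorphic_on unit_disc \<Longrightarrow> (\<And>z. z \<in> unit_disc \<Longrightarrow> cmod (f z) \<le> 2 * M') \<Longrightarrow> 0 \<le> r \<Longrightarrow> r < 1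
           \<Longrightarrow> Hp_integral 2 f r \<le> \<delta> \<Longrightarrow> Hp_integral p f r \<le> \<epsilon>"
        using bounded_small_Hp_integral[of "2 * M'" p 2 \<epsilon>] M'(1) p0 e by auto
      obtain s where s: "0 < s" "s < 1" "\<And>r. 0 < r \<Longrightarrow> r < 1 \<Longrightarrow> Hp_integral 2 (\<lambda>z. g z - g (of_real s * z)) r \<le> \<delta>"
        using dilation_approximates[OF g2 _ \<delta>(1)] by auto
      have mem: "of_real s * z \<in> unit_disc" if "z \<in> unit_disc" for z :: complex
        using that s by (simp add: norm_mult) (metis less_imp_le mult_left_le_one_le norm_ge_zero order_le_less_trans)
      have hs: "(\<lambda>z. g (of_real s * z)) holomorphic_on unit_disc"
        by (rule holomorphic_on_subset[OF dilation_holomorphic[OF g s(1)] subset_ball]) (use s in simp)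
      have "Hp_integral p (\<lambda>z. g z - g (of_real s * z)) r \<le> \<epsilon>" if r: "0 < r" "r < 1" for r
      proof (rule \<delta>(2))
        show "(\<lambda>z. g z - g (of_real s * z)) holomorphic_on unit_disc" by (intro holomorphic_intros g hs)
        fix z :: complex assume z: "z \<in> unit_disc"
        show "cmod (g z - g (of_real s * z)) \<le> 2 * M'"
          using norm_triangle_ineq4[of "g z" "g (of_real s * z)"] M'(2)[OF z] M'(2)[OF mem[OF z]] by simp
      qed (use r s in auto)
      moreover have "hardy p (\<lambda>z. g (of_real s * z))"
        by (rule hardy_bounded[OF hs _ p0]) (use M mem in blast)
      ultimately show "\<exists>h. hardy p h \<and> \<Lambda> h = 0 \<and> (\<forall>r. 0 < r \<and> r < 1 \<longrightarrow> Hp_integral p (\<lambda>z. g z - h z) r \<le> \<epsilon>)"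
        using dil_entire[OF g s(1,2)] by (intro exI[of _ "\<lambda>z. g (of_real s * z)"]) auto
    qed
  qed
  show ?thesis
  proof (cases "\<exists>z0\<in>unit_disc. f z0 \<noteq> 0")
    case False
    then have "\<Lambda> f = \<Lambda> (\<lambda>_. 0)" by (intro cong) auto
    then show ?thesis by (simp add: zero)
  next
    case True
    then obtain z0 where "z0 \<in> unit_disc" "f z0 \<noteq> 0" by blast
    from hardy_factorization[OF f p this] obtain k W where k: "k holomorphic_on unit_disc"
        "\<And>z. z \<in> unit_disc \<Longrightarrow> cmod (k z) \<le> 1" and W: "hardy (2 * p) W"
        and fkW: "\<And>z. z \<in> unit_disc \<Longrightarrow> f z = k z * (W z)\<^sup>2" by metis
    have hW: "W holomorphic_on unit_disc" using W by (rule hardy_holomorphic)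
    obtain B where B: "B > 0" "\<And>r. 0 < r \<Longrightarrow> r < 1 \<Longrightarrow> Hp_integral (2 * p) W r \<le> B" using hardy_boundE[OF W] by metis
    define B' where "B' = 2 powr (2 * p) * (B + B)"
    have B': "B' > 0" using B by (simp add: B'_def)
    show ?thesis
    proof (rule approximation[OF f])
      fix \<epsilon> :: real assume e: "\<epsilon> > 0"
      define \<eta> where "\<eta> = \<epsilon> / B'"
      have \<eta>: "\<eta> > 0" using e B' by (simp add: \<eta>_def)
      obtain s where s: "0 < s" "s < 1"
        and sW: "\<And>r. 0 < r \<Longrightarrow> r < 1 \<Longrightarrow> Hp_integral (2 * p) (\<lambda>z. W z - W (of_real s * z)) r \<le> \<eta> * \<epsilon>"
        using dilation_approximates[OF W, of "\<eta> * \<epsilon>"] p \<eta> e by auto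
      define V where "V z = W (of_real s * z)" for z
      have hV1: "V holomorphic_on ball 0 (1 / s)" unfolding V_def[abs_def] by (rule dilation_holomorphic[OF hW s(1)])
      have s1: "1 < 1 / s" using s by simp
      have sub: "cball 0 1 \<subseteq> ball 0 (1 / s)" "unit_disc \<subseteq> ball 0 (1 / s)" using s1 by auto
      have hV: "V holomorphic_on unit_disc" by (rule holomorphic_on_subset[OF hV1 sub(2)])
      have "compact (V ` cball 0 1)"
        using hV1 sub by (intro compact_continuous_image) (auto intro: holomorphic_on_imp_continuous_on holomorphic_on_subset)
      then obtain M where M: "\<And>z. z \<in> cball 0 1 \<Longrightarrow> cmod (V z) \<le> M"
        by (meson bounded_iff compact_imp_bounded imageI)
      have M0: "0 \<le> M" by (rule order.trans[OF norm_ge_zero M[of 0]]) simp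
      define g where "g z = k z * (V z)\<^sup>2" for z
      have hg: "g holomorphic_on unit_disc" unfolding g_def by (intro holomorphic_intros k hV)
      have gM: "cmod (g z) \<le> 1 * M\<^sup>2" if "z \<in> unit_disc" for z
        unfolding g_def norm_mult norm_power
        by (intro mult_mono power_mono k M) (use that M0 in auto)
      have "Hp_integral p (\<lambda>z. f z - g z) r \<le> \<epsilon>" if r: "0 < r" "r < 1" for r
      proof -
        have "Hp_integral p (\<lambda>z. f z - g z) r \<le> 1 / (2 * \<eta>) * Hp_integral (2 * p) (\<lambda>z. W z - V z) r + \<eta> / 2 * Hp_integral (2 * p) (\<lambda>z. W z + V z) r"
        proof (rule Hp_integral_le)
          fix z assume z: "z \<in> unit_disc"
          define x where "x = cmod (W z - V z) powr p"
          define y where "y = cmod (W z + V z) powr p"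
          have x2: "cmod (W z - V z) powr (2 * p) = x\<^sup>2" and y2: "cmod (W z + V z) powr (2 * p) = y\<^sup>2"
            unfolding x_def y_def by (auto simp: powr_powr mult.commute simp flip: powr_numeral)
          have "f z - g z = k z * ((W z - V z) * (W z + V z))"
            unfolding fkW[OF z] g_def by (simp add: power2_eq_square algebra_simps)
          then have "cmod (f z - g z) \<le> 1 * (cmod (W z - V z) * cmod (W z + V z))"
            by (simp only: norm_mult) (intro mult_right_mono k(2)[OF z], simp)
          then have "cmod (f z - g z) powr p \<le> (cmod (W z - V z) * cmod (W z + V z)) powr p"
            using p0 by (intro powr_mono2) auto
          also have "\<dots> = x * y" by (simp add: powr_mult x_def y_def)
          \<comment> \<open>the weight \<open>\<eta>\<close> lets the small mean of \<open>W - V\<close> compensate the merely bounded mean of \<open>W + V\<close>\<close>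
          also have "\<dots> \<le> 1 / (2 * \<eta>) * x\<^sup>2 + \<eta> / 2 * y\<^sup>2"
          proof -
            have "0 \<le> (x - \<eta> * y)\<^sup>2 / (2 * \<eta>)" using \<eta> by simp
            also have "\<dots> = 1 / (2 * \<eta>) * x\<^sup>2 + \<eta> / 2 * y\<^sup>2 - x * y"
              using \<eta> by (simp add: field_simps power2_eq_square)
            finally show ?thesis by simp
          qed
          finally show "cmod (f z - g z) powr p \<le> 1 / (2 * \<eta>) * cmod (W z - V z) powr (2 * p) + \<eta> / 2 * cmod (W z + V z) powr (2 * p)"
            by (simp add: x2 y2)
        qed (use hW hV hg f r p0 in \<open>auto intro!: holomorphic_intros dest: hardy_holomorphic\<close>)
        also have "\<dots> \<le> 1 / (2 * \<eta>) * (\<eta> * \<epsilon>) + \<eta> / 2 * B'"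
        proof (intro add_mono mult_left_mono)
          show "Hp_integral (2 * p) (\<lambda>z. W z - V z) r \<le> \<eta> * \<epsilon>" using sW[OF r] by (simp add: V_def)
          have "Hp_integral (2 * p) (\<lambda>z. W z + V z) r \<le> (2 * 1) powr (2 * p) * (Hp_integral (2 * p) W r + Hp_integral (2 * p) V r)"
            by (rule Hp_integral_dominated)
               (use hW hV r p0 in \<open>auto intro!: holomorphic_intros simp: norm_triangle_ineq\<close>)
          also have "Hp_integral (2 * p) V r = Hp_integral (2 * p) W (s * r)" by (simp add: Hp_integral_eq V_def mult.assoc)
          also have "(2 * 1) powr (2 * p) * (Hp_integral (2 * p) W r + Hp_integral (2 * p) W (s * r)) \<le> (2 * 1) powr (2 * p) * (B + B)"
            using r s by (intro mult_left_mono add_mono B mult_pos_pos) (auto intro: le_less_trans[OF mult_left_le_one_le])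
          finally show "Hp_integral (2 * p) (\<lambda>z. W z + V z) r \<le> B'" by (simp add: B'_def)
        qed (use \<eta> in auto)
        also have "\<dots> = \<epsilon>" using \<eta> B' by (simp add: \<eta>_def)
        finally show ?thesis .
      qed
      moreover have "hardy p g" by (rule hardy_bounded[OF hg gM p0])
      moreover have "\<Lambda> g = 0" by (rule bdd[OF hg gM])
      ultimately show "\<exists>g. hardy p g \<and> \<Lambda> g = 0 \<and> (\<forall>r. 0 < r \<and> r < 1 \<longrightarrow> Hp_integral p (\<lambda>z. f z - g z) r \<le> \<epsilon>)"
        by blast
    qed
  qed
qed

end

section \<open>Approximation on a compact set with connected complement\<close>

lemma bounded_neighbourhood:
  fixes K :: "complex set"
  assumes "compact K"
  obtains R where "R > 0" "\<And>x. x \<in> K \<Longrightarrow> cmod x < R" "\<And>e. (\<Union>x\<in>K. ball x e) \<subseteq> ball 0 (R + e)"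
proof -
  obtain R where R: "R > 0" "\<And>x. x \<in> K \<Longrightarrow> cmod x < R" using compact_imp_bounded[OF assms] by (auto simp: bounded_pos_less)
  have "(\<Union>x\<in>K. ball x e) \<subseteq> ball 0 (R + e)" for e
  proof
    fix y assume "y \<in> (\<Union>x\<in>K. ball x e)"
    then obtain x where x: "x \<in> K" "dist x y < e" by auto
    then show "y \<in> ball 0 (R + e)" using R(2)[of x] norm_triangle_ineq2[of y x] by (simp add: dist_norm norm_minus_commute)
  qed
  with R show ?thesis by (rule that)
qed

text \<open>
  The complement of a component of the filled \<open>e\<close>-neighbourhood of \<open>K\<close> is connected and unbounded, so
  the component is simply connected.
\<close>
lemma simply_connected_neighbourhood:
  fixes K :: "complex set"
  assumes K: "compact K" "connected K" "K \<noteq> {}" and e: "0 < e"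
  obtains G where "open G" "simply_connected G" "bounded G" "K \<subseteq> G" "G \<inter> outside (\<Union>x\<in>K. ball x e) = {}"
proof -
  define U where "U = (\<Union>x\<in>K. ball x e)"
  have oU: "open U" by (auto simp: U_def)
  have KU: "K \<subseteq> U" using e by (auto simp: U_def)
  have bU: "bounded U" using bounded_neighbourhood[OF K(1)] unfolding U_def by (metis bounded_ball bounded_subset)
  have con: "connected (outside U)" using bU by (intro connected_outside) auto
  have ne: "outside U \<noteq> {}" using bU by (rule outside_bounded_nonempty)
  have ocomp: "outside U \<in> components (- U)" using con ne by (simp add: outside_in_components)
  have "closed (outside U)" using closed_components[OF _ ocomp] oU by (simp add: closed_Compl)
  then have oG: "open (- outside U)" by (simp add: open_Compl)
  have KG: "K \<subseteq> - outside U" using KU outside_no_overlap[of U] by blast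
  obtain C where C: "C \<in> components (- outside U)" "K \<subseteq> C"
    using exists_component_superset[OF KG _ K(2)] K(3) KG by auto
  have oC: "open C" by (rule open_components[OF oG C(1)])
  have cC: "connected (- C)" by (rule component_complement_connected[OF con C(1)])
  have CG: "C \<subseteq> - outside U" by (rule in_components_subset[OF C(1)])
  have nb: "\<not> bounded (- C)"
  proof
    assume "bounded (- C)"
    moreover have "outside U \<subseteq> - C" using CG by auto
    ultimately show False using unbounded_outside[OF bU] bounded_subset by blast
  qed
  have comps: "components (- C) = {- C}"
    using cC nb by (auto simp: components_eq_sing_iff)
  have "simply_connected C"
    using simply_connected_eq_unbounded_complement_components[OF oC] comps nb in_components_connected[OF C(1)] by simp
  moreover have "bounded C"
  proof -
    have "- outside U = U \<union> inside U" by (simp add: union_with_inside)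
    then have "bounded (- outside U)" using bU bounded_inside[OF bU] by simp
    then show ?thesis using CG bounded_subset by blast
  qed
  ultimately show ?thesis using oC C(2) CG that[of C] by (auto simp: U_def)
qed

text \<open>
  A point outside \<open>K\<close> is joined to infinity by a path that keeps a positive distance from \<open>K\<close>, so it
  is not swallowed when small neighbourhoods of \<open>K\<close> are filled.
\<close>
lemma outside_small_neighbourhoods:
  fixes K :: "complex set"
  assumes K: "compact K" and con: "connected (- K)" and x: "x \<notin> K"
  obtains d where "d > 0" "\<And>e. 0 < e \<Longrightarrow> e \<le> d \<Longrightarrow> ball x d \<subseteq> outside (\<Union>x\<in>K. ball x e)"
proof -
  obtain R where R: "R > 0" "\<And>x. x \<in> K \<Longrightarrow> cmod x < R" "\<And>e. (\<Union>x\<in>K. ball x e) \<subseteq> ball 0 (R + e)"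
    using bounded_neighbourhood[OF K] by blast
  define y where "y = (of_real (R + 2) :: complex)"
  have yK: "y \<notin> K" using R(2)[of y] R(1) by (auto simp: y_def)
  have oK: "open (- K)" using K by (simp add: compact_imp_closed open_Compl)
  have "path_connected (- K)" using con oK by (simp add: connected_open_path_connected)
  then obtain g where g: "path g" "path_image g \<subseteq> - K" "pathstart g = x" "pathfinish g = y"
    using x yK unfolding path_connected_def by (metis ComplI)
  have cg: "compact (path_image g)" using g(1) by (rule compact_path_image)
  have "\<exists>d0>0. \<forall>a\<in>path_image g. \<forall>b\<in>K. d0 \<le> dist a b"
    using separate_compact_closed[OF cg compact_imp_closed[OF K]] g(2) by blast
  then obtain d0 where d0: "d0 > 0" "\<And>a b. a \<in> path_image g \<Longrightarrow> b \<in> K \<Longrightarrow> d0 \<le> dist a b" by blast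
  define d where "d = min (d0 / 2) 1"
  have d: "d > 0" "d \<le> 1" "2 * d \<le> d0" using d0(1) by (auto simp: d_def)
  have "ball x d \<subseteq> outside (\<Union>x\<in>K. ball x e)" if e: "0 < e" "e \<le> d" for e
  proof
    fix z assume z: "z \<in> ball x d"
    define U where "U = (\<Union>x\<in>K. ball x e)"
    define S where "S = (ball x d \<union> path_image g) \<union> {w. cmod w \<ge> R + e}"
    have far: "connected {w::complex. cmod w \<ge> R + e}"
    proof -
      have "{w::complex. cmod w \<ge> R + e} = - ball 0 (R + e)" by auto
      then show ?thesis using connected_complement_bounded_convex[of "ball (0::complex) (R + e)"] by simp
    qed
    have xg: "x \<in> path_image g" using g(3) by (metis pathstart_in_path_image)
    have yg: "y \<in> path_image g" using g(4) by (metis pathfinish_in_path_image)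
    have cg: "connected (ball x d \<union> path_image g)"
    proof (rule connected_Un)
      show "ball x d \<inter> path_image g \<noteq> {}" using xg d(1) by (metis IntI centre_in_ball empty_iff)
    qed (use g(1) in \<open>auto intro: connected_path_image\<close>)
    have yf: "y \<in> {w. cmod w \<ge> R + e}" using R(1) e d unfolding y_def mem_Collect_eq norm_of_real by simp
    have cS: "connected S" unfolding S_def by (rule connected_Un[OF cg far]) (use yf yg in blast)
    have "S \<subseteq> - U"
    proof -
      have "dist w k \<ge> e" if "w \<in> ball x d" "k \<in> K" for w k
        using d0(2)[OF xg that(2)] dist_triangle[of x k w] that(1) d e by (simp add: dist_commute)
      moreover have "dist w k \<ge> e" if "w \<in> path_image g" "k \<in> K" for w k
        using d0(2)[OF that] d e by simp
      moreover have "w \<notin> U" if "cmod w \<ge> R + e" for w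
      proof
        assume "w \<in> U"
        then have "w \<in> ball 0 (R + e)" using R(3)[of e] unfolding U_def by blast
        then show False using that by simp
      qed
      ultimately show ?thesis by (fastforce simp: S_def U_def dist_commute)
    qed
    then have sub: "S \<subseteq> connected_component_set (- U) z"
      using cS z by (intro connected_component_maximal) (auto simp: S_def)
    have "\<not> bounded {w::complex. cmod w \<ge> R + e}"
    proof
      assume "bounded {w::complex. cmod w \<ge> R + e}"
      then obtain b where b: "\<And>w::complex. cmod w \<ge> R + e \<Longrightarrow> cmod w \<le> b" by (auto simp: bounded_iff)
      define t where "t = max (R + e) (\<bar>b\<bar> + 1)"
      have t: "R + e \<le> t" "\<bar>b\<bar> + 1 \<le> t" by (auto simp: t_def)
      have "cmod (of_real t) \<le> b" by (rule b) (use t in simp)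
      then show False using t by simp
    qed
    then have "\<not> bounded (connected_component_set (- U) z)"
      using sub bounded_subset by (metis S_def sup.bounded_iff)
    then show "z \<in> outside (\<Union>x\<in>K. ball x e)" by (simp add: outside U_def)
  qed
  with d(1) show ?thesis by (rule that)
qed

lemma Riemann_sum_uniform:
  fixes F :: "real \<Rightarrow> complex \<Rightarrow> complex"
  assumes F: "continuous_on ({a..b} \<times> K) (\<lambda>(t, x). F t x)" and K: "compact K" and ab: "a < b" and e: "0 < \<epsilon>"
  shows "\<exists>(N::nat) h. \<forall>x\<in>K. cmod (integral {a..b} (\<lambda>t. F t x) - (\<Sum>j<N. of_real h * F (a + of_nat j * h) x)) \<le> \<epsilon>"
proof -
  have "uniformly_continuous_on ({a..b} \<times> K) (\<lambda>(t, x). F t x)"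
    by (intro compact_uniformly_continuous F compact_Times K compact_Icc)
  moreover have e': "0 < \<epsilon> / (b - a)" using e ab by simp
  ultimately obtain \<delta> where \<delta>: "\<delta> > 0" "\<And>u v. u \<in> {a..b} \<times> K \<Longrightarrow> v \<in> {a..b} \<times> K \<Longrightarrow> dist v u < \<delta> \<Longrightarrow>
      dist ((\<lambda>(t, x). F t x) v) ((\<lambda>(t, x). F t x) u) < \<epsilon> / (b - a)"
    unfolding uniformly_continuous_on_def by meson
  obtain N :: nat where N: "(b - a) / \<delta> < of_nat N" using reals_Archimedean2 by blast
  have "0 < (b - a) / \<delta>" using ab \<delta>(1) by simp
  then have N0: "N > 0" using N by (metis less_trans of_nat_0_less_iff)
  define h where "h = (b - a) / of_nat N"
  have h: "h > 0" "of_nat N * h = b - a" using ab N0 by (auto simp: h_def)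
  have hd: "h < \<delta>" using N \<delta>(1) N0 by (simp add: h_def field_simps)
  have le_b: "a + of_nat n * h \<le> b" if "n \<le> N" for n
  proof -
    have "of_nat n * h \<le> of_nat N * h" using that h(1) by (intro mult_right_mono) auto
    then show ?thesis using h(2) by linarith
  qed
  have "cmod (integral {a..b} (\<lambda>t. F t x) - (\<Sum>j<N. of_real h * F (a + of_nat j * h) x)) \<le> \<epsilon>" if x: "x \<in> K" for x
  proof -
    have cF: "continuous_on {a..b} (\<lambda>t. F t x)"
    proof -
      have "continuous_on {a..b} ((\<lambda>(t, x). F t x) \<circ> (\<lambda>t. (t, x)))"
        using x by (intro continuous_on_compose continuous_intros continuous_on_subset[OF F]) auto
      then show ?thesis by (simp add: o_def)
    qed
    have int: "(\<lambda>t. F t x) integrable_on {c..d}" if "a \<le> c" "d \<le> b" for c d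
      by (rule integrable_continuous_real) (rule continuous_on_subset[OF cF], use that in auto)
    have "cmod (integral {a..a + of_nat n * h} (\<lambda>t. F t x) - (\<Sum>j<n. of_real h * F (a + of_nat j * h) x)) \<le> of_nat n * (h * (\<epsilon> / (b - a)))"
      if "n \<le> N" for n
      using that
    proof (induction n)
      case (Suc n)
      define c where "c = a + of_nat n * h"
      have c: "a \<le> c" "c + h \<le> b" "a + of_nat (Suc n) * h = c + h"
        using h(1) le_b[OF Suc.prems] by (auto simp: c_def algebra_simps)
      have split: "integral {a..c + h} (\<lambda>t. F t x) = integral {a..c} (\<lambda>t. F t x) + integral {c..c+h} (\<lambda>t. F t x)"
        using c h(1) by (intro Henstock_Kurzweil_Integration.integral_combine[symmetric] int) auto
      have "((\<lambda>t. F t x - F c x) has_integral (integral {c..c+h} (\<lambda>t. F t x) - of_real h * F c x)) {c..c+h}"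
        using has_integral_diff[OF integrable_integral[OF int[OF c(1,2)]] has_integral_const_real[of "F c x" c "c + h"]] h(1)
        by (simp add: scaleR_conv_of_real)
      moreover have "norm (F t x - F c x) \<le> \<epsilon> / (b - a)" if "t \<in> {c..c+h}" for t
        using \<delta>(2)[of "(c, x)" "(t, x)"] that c x hd by (auto simp: dist_Pair_Pair dist_norm less_imp_le)
      ultimately have "norm (integral {c..c+h} (\<lambda>t. F t x) - of_real h * F c x) \<le> \<epsilon> / (b - a) * measure lborel {c..c+h}"
        using e' h(1) by (intro has_integral_bound_real[where f = "\<lambda>t. F t x - F c x"]) auto
      then have "cmod (integral {c..c+h} (\<lambda>t. F t x) - of_real h * F c x) \<le> h * (\<epsilon> / (b - a))"
        using h(1) by (simp add: mult.commute)
      moreover have "cmod (integral {a..c} (\<lambda>t. F t x) - (\<Sum>j<n. of_real h * F (a + of_nat j * h) x)) \<le> of_nat n * (h * (\<epsilon> / (b - a)))"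
        using Suc by (simp add: c_def)
      ultimately have "cmod ((integral {a..c} (\<lambda>t. F t x) - (\<Sum>j<n. of_real h * F (a + of_nat j * h) x)) + (integral {c..c+h} (\<lambda>t. F t x) - of_real h * F c x))
          \<le> of_nat n * (h * (\<epsilon> / (b - a))) + h * (\<epsilon> / (b - a))"
        by (intro norm_triangle_mono)
      then show ?case unfolding c(3) split by (simp add: algebra_simps add_divide_distrib c_def)
    qed simp
    from this[of N] have "cmod (integral {a..a + of_nat N * h} (\<lambda>t. F t x) - (\<Sum>j<N. of_real h * F (a + of_nat j * h) x)) \<le> (of_nat N * h) * (\<epsilon> / (b - a))"
      by (simp add: mult.assoc)
    then show ?thesis unfolding h(2) using ab by simp
  qed
  then show ?thesis by blast
qed

text \<open>
  Cauchy's integral formula on a curve of \<open>G\<close> around \<open>K\<close>; the curve is the image of a circle under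
  the inverse Riemann map, which reduces the formula to the one for a circle.
\<close>
lemma Cauchy_formula_Riemann_map:
  assumes G: "open G" and fg: "f holomorphic_on G" "g holomorphic_on unit_disc"
      "\<And>x. x \<in> G \<Longrightarrow> f x \<in> unit_disc \<and> g (f x) = x" "\<And>u. u \<in> unit_disc \<Longrightarrow> g u \<in> G \<and> f (g u) = u"
    and \<phi>: "\<phi> holomorphic_on unit_disc" and r: "r < 1" and x: "x \<in> G" "cmod (f x) < r"
  shows "((\<lambda>t. \<phi> (r * cis t) * deriv g (r * cis t) * (r * cis t) / (2 * pi) / (g (r * cis t) - x)) has_integral \<phi> (f x)) {0..2*pi}"
proof -
  have r0: "r > 0" using x(2) by (metis le_less_trans norm_ge_zero)
  define u0 where "u0 = f x"
  have u0: "u0 \<in> unit_disc" "g u0 = x" using fg(3)[OF x(1)] by (auto simp: u0_def)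
  define D where "D u = (if u = u0 then deriv g u0 else (g u - g u0) / (u - u0))" for u
  have inj: "inj_on g unit_disc" by (rule inj_on_inverseI[where g = f]) (use fg(4) in auto)
  have hD: "D holomorphic_on unit_disc" unfolding D_def by (rule pole_lemma_open[OF fg(2) open_ball])
  have Dnz: "D u \<noteq> 0" if "u \<in> unit_disc" for u
    using holomorphic_injective_imp_regular[OF fg(2) open_ball inj u0(1)] inj that u0(1)
    by (auto simp: D_def inj_on_def)
  define k where "k u = \<phi> u * deriv g u / D u" for u
  have "k holomorphic_on unit_disc"
    unfolding k_def using Dnz by (intro holomorphic_intros \<phi> hD holomorphic_deriv fg(2)) auto
  then have "k holomorphic_on cball 0 r" by (rule holomorphic_on_subset) (use r in auto)
  from Cauchy_integral_circlepath_simple[OF this, of u0] x(2)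
  have "((\<lambda>u. k u / (u - u0)) has_contour_integral (2 * of_real pi * \<i> * k u0)) (part_circlepath 0 r 0 (2*pi))"
    by (simp add: circlepath_def u0_def)
  then have "((\<lambda>t. k (0 + r * cis t) / (0 + r * cis t - u0) * r * \<i> * cis t) has_integral (2 * of_real pi * \<i> * k u0)) {0..2*pi}"
    by (subst (asm) has_contour_integral_part_circlepath_iff) auto
  from has_integral_mult_right[OF this, of "1 / (2 * of_real pi * \<i>)"]
  have I: "((\<lambda>t. 1 / (2 * of_real pi * \<i>) * (k (r * cis t) / (r * cis t - u0) * r * \<i> * cis t)) has_integral k u0) {0..2*pi}"
    by simp
  have "k u0 = \<phi> (f x)"
    using Dnz[OF u0(1)] by (simp add: k_def D_def u0_def)
  moreover have "1 / (2 * of_real pi * \<i>) * (k (r * cis t) / (r * cis t - u0) * r * \<i> * cis t) =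
      \<phi> (r * cis t) * deriv g (r * cis t) * (r * cis t) / (2 * pi) / (g (r * cis t) - x)" for t
  proof -
    define u where "u = of_real r * cis t"
    have nu: "cmod u = r" using r0 by (simp add: u_def norm_mult)
    then have ne: "u - u0 \<noteq> 0" using x(2) by (auto simp: u0_def)
    have "k u / (u - u0) = \<phi> u * deriv g u / (g u - x)"
      using ne u0(2) by (simp add: k_def D_def)
    then have "1 / (2 * of_real pi * \<i>) * (k u / (u - u0) * r * \<i> * cis t) = \<phi> u * deriv g u / (g u - x) * u / (2 * pi)"
      by (simp add: u_def ac_simps)
    then show ?thesis by (simp add: u_def ac_simps)
  qed
  ultimately show ?thesis using I by simp
qed

lemma inverse_distance_bounded:
  fixes K :: "complex set"
  assumes K: "closed K" and x: "x \<notin> K"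
  obtains M where "\<And>w. w \<in> K \<Longrightarrow> cmod (1 / (x - w)) \<le> M"
proof (cases "K = {}")
  case True then show ?thesis using that by auto
next
  case False
  define d where "d = infdist x K"
  have d: "d > 0" using infdist_pos_not_in_closed[OF K False x] by (simp add: d_def)
  show ?thesis
  proof (rule that[of "1 / d"])
    fix w assume w: "w \<in> K"
    have "d \<le> cmod (x - w)" using infdist_le[OF w, of x] by (simp add: d_def dist_norm)
    then show "cmod (1 / (x - w)) \<le> 1 / d" using d by (simp add: norm_divide frac_le)
  qed
qed

context hardy_functional
begin

text \<open>
  Riemann sums of Cauchy's formula approximate \<open>\<phi> \<circ> f\<close> on \<open>K\<close> uniformly by linear combinations of the
  functions \<open>1/(x - \<cdot>)\<close> with poles off \<open>K\<close>.
\<close>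
lemma vanishes_on_Riemann_map:
  assumes H: "H holomorphic_on unit_disc" "H ` unit_disc \<subseteq> K" and K: "compact K"
    and rat: "\<And>x. x \<notin> K \<Longrightarrow> \<Lambda> (\<lambda>z. 1 / (x - H z)) = 0"
    and G: "open G" "K \<subseteq> G" and fg: "f holomorphic_on G" "g holomorphic_on unit_disc"
      "\<And>x. x \<in> G \<Longrightarrow> f x \<in> unit_disc \<and> g (f x) = x" "\<And>u. u \<in> unit_disc \<Longrightarrow> g u \<in> G \<and> f (g u) = u"
    and \<phi>: "\<phi> holomorphic_on unit_disc"
  shows "\<Lambda> (\<lambda>z. \<phi> (f (H z))) = 0"
proof -
  have Kf: "compact (f ` K)" using G(2) fg(1) K
    by (intro compact_continuous_image) (auto intro: holomorphic_on_imp_continuous_on holomorphic_on_subset)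
  have fK: "f ` K \<subseteq> unit_disc" using fg(3) G(2) by blast
  obtain r where r: "r < 1" "\<And>x. x \<in> K \<Longrightarrow> cmod (f x) < r"
  proof (cases "K = {}")
    case False
    obtain a where a: "a \<in> f ` K" "\<And>y. y \<in> f ` K \<Longrightarrow> cmod y \<le> cmod a"
      using continuous_attains_sup[OF Kf, of cmod] False by (auto intro!: continuous_intros)
    have "cmod a < 1" using a(1) fK by auto
    then show ?thesis using that[of "(1 + cmod a) / 2"] a(2) by force
  qed (use that[of 0] in auto)
  define c where "c t = \<phi> (of_real r * cis t) * deriv g (of_real r * cis t) * (of_real r * cis t) / (2 * pi)" for t
  define \<gamma> where "\<gamma> t = g (of_real r * cis t)" for t
  have int: "((\<lambda>t. c t / (\<gamma> t - x)) has_integral \<phi> (f x)) {0..2*pi}" if "x \<in> K" for x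
    unfolding c_def \<gamma>_def by (rule Cauchy_formula_Riemann_map[OF G(1) fg \<phi> r(1)]) (use that G(2) r(2) in auto)
  have hfH: "(\<lambda>z. \<phi> (f (H z))) holomorphic_on unit_disc"
  proof -
    have "(\<phi> \<circ> (f \<circ> H)) holomorphic_on unit_disc"
      by (intro holomorphic_on_compose_gen[OF _ \<phi>] holomorphic_on_compose_gen[OF H(1) fg(1)])
         (use H(2) G(2) fK in auto)
    then show ?thesis by (simp add: o_def)
  qed
  have "compact (\<phi> ` f ` K)"
    by (intro compact_continuous_image Kf continuous_on_subset[OF holomorphic_on_imp_continuous_on[OF \<phi>] fK])
  then obtain M where M: "\<And>x. x \<in> K \<Longrightarrow> cmod (\<phi> (f x)) \<le> M"
    by (meson bounded_iff compact_imp_bounded imageI)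
  have hard: "hardy p (\<lambda>z. \<phi> (f (H z)))"
    by (rule hardy_bounded[OF hfH _ p0]) (use M H(2) in blast)
  show ?thesis
  proof (cases "K = {}")
    case True
    then have "\<Lambda> (\<lambda>z. \<phi> (f (H z))) = \<Lambda> (\<lambda>_. 0)" using H(2) by (intro cong) auto
    then show ?thesis by (simp add: zero)
  next
    case False
    then have r0: "r > 0" using r(2) by (metis ex_in_conv le_less_trans norm_ge_zero)
    have ud: "of_real r * cis t \<in> unit_disc" for t using r0 r(1) by (simp add: norm_mult)
    have \<gamma>K: "\<gamma> t \<notin> K" for t
    proof
      assume "\<gamma> t \<in> K"
      then have "cmod (f (\<gamma> t)) < r" by (rule r(2))
      then show False using fg(4)[OF ud[of t]] r0 by (simp add: \<gamma>_def norm_mult)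
    qed
    have circ: "continuous_on A (\<lambda>t. k (of_real r * cis t))" if "k holomorphic_on unit_disc" for k :: "complex \<Rightarrow> complex" and A
      using continuous_on_circle[OF that] r0 r(1) by simp
    have cc: "continuous_on A c" for A
      unfolding c_def by (intro continuous_intros circ \<phi> holomorphic_deriv fg(2) open_ball) auto
    have c\<gamma>: "continuous_on A \<gamma>" for A unfolding \<gamma>_def by (rule circ[OF fg(2)])
    have cF: "continuous_on ({0..2*pi} \<times> K) (\<lambda>(t, x). c t / (\<gamma> t - x))"
      unfolding case_prod_beta
      using \<gamma>K by (intro continuous_intros continuous_on_compose2[OF cc[of UNIV]] continuous_on_compose2[OF c\<gamma>[of UNIV]]) auto
    have hrat: "hardy p (\<lambda>z. 1 / (\<gamma> t - H z))" for t
    proof -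
      obtain B where B: "\<And>w. w \<in> K \<Longrightarrow> cmod (1 / (\<gamma> t - w)) \<le> B"
        using inverse_distance_bounded[OF compact_imp_closed[OF K] \<gamma>K] by metis
      show ?thesis
      proof (rule hardy_bounded[OF _ _ p0])
        show "(\<lambda>z. 1 / (\<gamma> t - H z)) holomorphic_on unit_disc"
        proof (intro holomorphic_intros H(1))
          fix z assume "z \<in> unit_disc"
          then have "H z \<in> K" using H(2) by blast
          then show "\<gamma> t - H z \<noteq> 0" using \<gamma>K[of t] by auto
        qed
        show "cmod (1 / (\<gamma> t - H z)) \<le> B" if "z \<in> unit_disc" for z by (rule B) (use H(2) that in blast)
      qed
    qed
    show ?thesis
    proof (rule approximation_uniform[OF hard])
      fix \<epsilon> :: real assume e: "\<epsilon> > 0"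
      have two_pi: "0 < 2 * pi" by simp
      obtain N :: nat and h where
        N: "\<And>x. x \<in> K \<Longrightarrow> cmod (integral {0..2*pi} (\<lambda>t. c t / (\<gamma> t - x)) - (\<Sum>j<N. of_real h * (c (0 + of_nat j * h) / (\<gamma> (0 + of_nat j * h) - x)))) \<le> \<epsilon>"
        using Riemann_sum_uniform[OF cF K two_pi e] by blast
      define S where "S z = (\<Sum>j<N. (of_real h * c (of_nat j * h)) * (1 / (\<gamma> (of_nat j * h) - H z)))" for z
      have "\<Lambda> S = (\<Sum>j<N. (of_real h * c (of_nat j * h)) * \<Lambda> (\<lambda>z. 1 / (\<gamma> (of_nat j * h) - H z)))"
        unfolding S_def by (rule sum) (rule hrat)
      then have "\<Lambda> S = 0" using rat[OF \<gamma>K] by simp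
      moreover have "hardy p S" unfolding S_def by (intro hardy_sum hardy_scale hrat p0)
      moreover have "cmod (\<phi> (f (H z)) - S z) \<le> \<epsilon>" if z: "z \<in> unit_disc" for z
        using N[of "H z"] integral_unique[OF int[of "H z"]] H(2) z by (auto simp: S_def image_subset_iff)
      ultimately show "\<exists>g. hardy p g \<and> \<Lambda> g = 0 \<and> (\<forall>z\<in>unit_disc. cmod (\<phi> (f (H z)) - g z) \<le> \<epsilon>)" by blast
    qed
  qed
qed

text \<open>
  Let \<open>g\<^sub>n\<close> be the inverse Riemann maps of shrinking neighbourhoods of \<open>K\<close>.  Every limit \<open>\<gamma>\<close> of them maps into
  \<open>K\<close>, hence into \<open>int K = H(\<D>)\<close>; the inverses composed with \<open>H\<close> are self-maps \<open>z \<tau>\<^sub>n(z)\<close> of the disc that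
  fix \<open>0\<close>.  Schwarz's lemma for \<open>H\<^sup>-\<^sup>1 \<circ> \<gamma>\<close> and for these self-maps forces \<open>\<tau>\<^sub>n(0) \<rightarrow> \<alpha>\<close> with \<open>|\<alpha>| = 1\<close> along a
  subsequence.  Then \<open>cnj \<alpha> z \<tau>\<^sub>n(z) \<rightarrow> z\<close> in \<open>H\<^sup>2\<close>, since \<open>|cnj \<alpha> \<tau>\<^sub>n - 1|\<^sup>2 \<le> 2 Re (1 - cnj \<alpha> \<tau>\<^sub>n)\<close>, and the right-hand
  side is harmonic.
\<close>
lemma vanishes_on_rational_imp_vanishes_on_powers:
  assumes H: "H holomorphic_on unit_disc" "inj_on H unit_disc"
    and K: "K = closure (H ` unit_disc)" "compact K" "connected (- K)" "interior K = H ` unit_disc"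
    and rat: "\<And>x. x \<notin> K \<Longrightarrow> \<Lambda> (\<lambda>z. 1 / (x - H z)) = 0"
  shows "\<Lambda> (\<lambda>z. z ^ m) = 0"
proof -
  have HK: "H ` unit_disc \<subseteq> K" unfolding K(1) by (rule closure_subset)
  have cK: "connected K" unfolding K(1)
    by (intro connected_imp_connected_closure connected_continuous_image holomorphic_on_imp_continuous_on[OF H(1)]) simp
  have neK: "K \<noteq> {}" using HK by auto
  define x0 where "x0 = H 0"
  have x0K: "x0 \<in> K" using HK by (auto simp: x0_def)
  define e where "e n = inverse (real (Suc n))" for n
  have e0: "e n > 0" for n by (simp add: e_def)
  define Q where "Q n f g G \<longleftrightarrow> open G \<and> bounded G \<and> K \<subseteq> G \<and> G \<inter> outside (\<Union>x\<in>K. ball x (e n)) = {} \<and>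
     f holomorphic_on G \<and> g holomorphic_on unit_disc \<and> (\<forall>x\<in>G. f x \<in> unit_disc \<and> g (f x) = x) \<and>
     (\<forall>u\<in>unit_disc. g u \<in> G \<and> f (g u) = u) \<and> f x0 = 0" for n and f g :: "complex \<Rightarrow> complex" and G
  have "\<exists>f g G. Q n f g G" for n
  proof -
    obtain G where G: "open G" "simply_connected G" "bounded G" "K \<subseteq> G" "G \<inter> outside (\<Union>x\<in>K. ball x (e n)) = {}"
      using simply_connected_neighbourhood[OF K(2) cK neK e0] by blast
    have nU: "G \<noteq> UNIV" and ne: "G \<noteq> {}" using G(3,4) neK by auto
    have "\<exists>f g. f holomorphic_on G \<and> g holomorphic_on unit_disc \<and> (\<forall>z\<in>G. f z \<in> unit_disc \<and> g (f z) = z) \<and>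
        (\<forall>z\<in>unit_disc. g z \<in> G \<and> f (g z) = z)"
      using iffD1[OF simply_connected_eq_biholomorphic_to_disc[OF G(1)] G(2)] by (simp only: nU ne simp_thms)
    then obtain f1 g1 where "f1 holomorphic_on G \<and> g1 holomorphic_on unit_disc \<and> (\<forall>z\<in>G. f1 z \<in> unit_disc \<and> g1 (f1 z) = z) \<and>
        (\<forall>z\<in>unit_disc. g1 z \<in> G \<and> f1 (g1 z) = z)" by (elim exE)
    then have 1: "f1 holomorphic_on G" "g1 holomorphic_on unit_disc"
        "z \<in> G \<Longrightarrow> f1 z \<in> unit_disc \<and> g1 (f1 z) = z" "z \<in> unit_disc \<Longrightarrow> g1 z \<in> G \<and> f1 (g1 z) = z" for z
      by blast+
    have a: "f1 x0 \<in> unit_disc" using 1(3) x0K G(4) by auto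
    obtain f2 g2 where 2: "f2 (f1 x0) = 0" "f2 holomorphic_on unit_disc" "f2 ` unit_disc \<subseteq> unit_disc"
        "g2 holomorphic_on unit_disc" "g2 ` unit_disc \<subseteq> unit_disc"
        "\<And>z. z \<in> unit_disc \<Longrightarrow> f2 (g2 z) = z" "\<And>z. z \<in> unit_disc \<Longrightarrow> g2 (f2 z) = z"
      using ball_biholomorphism_exists[OF a] by metis
    have "(f2 \<circ> f1) holomorphic_on G" by (rule holomorphic_on_compose_gen[OF 1(1) 2(2)]) (use 1(3) in auto)
    moreover have "(g1 \<circ> g2) holomorphic_on unit_disc" by (rule holomorphic_on_compose_gen[OF 2(4) 1(2) 2(5)])
    ultimately have "Q n (f2 \<circ> f1) (g1 \<circ> g2) G"
      unfolding Q_def using G 1(3,4) 2(1,3,5,6,7) by (auto simp: image_subset_iff)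
    then show ?thesis by blast
  qed
  then obtain f g G where Q: "\<And>n. Q n (f n) (g n) (G n)" by metis
  have G: "open (G n)" "bounded (G n)" "K \<subseteq> G n" "G n \<inter> outside (\<Union>x\<in>K. ball x (e n)) = {}"
    and hfg: "f n holomorphic_on G n" "g n holomorphic_on unit_disc"
    and fg: "x \<in> G n \<Longrightarrow> f n x \<in> unit_disc \<and> g n (f n x) = x" "u \<in> unit_disc \<Longrightarrow> g n u \<in> G n \<and> f n (g n u) = u"
    and f0: "f n x0 = 0" for n x u
    using Q[of n] unfolding Q_def by blast+
  obtain R where R: "R > 0" "\<And>x. x \<in> K \<Longrightarrow> cmod x < R" "\<And>e. (\<Union>x\<in>K. ball x e) \<subseteq> ball 0 (R + e)"
    using bounded_neighbourhood[OF K(2)] by metis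
  have GR: "cmod x < R + 1" if "x \<in> G n" for n x
  proof -
    have "(\<Union>x\<in>K. ball x (e n)) \<subseteq> ball 0 (R + e n)" by (rule R(3))
    also have "\<dots> \<subseteq> ball 0 (R + 1)" by (intro subset_ball) (simp add: e_def field_simps)
    finally have "outside (ball 0 (R + 1)) \<subseteq> outside (\<Union>x\<in>K. ball x (e n))" by (rule outside_mono)
    moreover have "outside (ball (0::complex) (R + 1)) = - ball 0 (R + 1)" by (rule outside_convex) simp
    ultimately show ?thesis using G(4)[of n] that by auto
  qed
  define \<sigma> where "\<sigma> n z = f n (H z)" for n z
  have h\<sigma>: "\<sigma> n holomorphic_on unit_disc" for n
  proof -
    have "(f n \<circ> H) holomorphic_on unit_disc"
      by (rule holomorphic_on_compose_gen[OF H(1) hfg(1)]) (use HK G(3) in blast)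
    then show ?thesis by (simp add: \<sigma>_def[abs_def] o_def)
  qed
  have \<sigma>1: "cmod (\<sigma> n z) < 1" and g\<sigma>: "g n (\<sigma> n z) = H z" if "z \<in> unit_disc" for n z
  proof -
    have "H z \<in> G n" using HK G(3)[of n] that by blast
    from fg(1)[OF this] show "cmod (\<sigma> n z) < 1" "g n (\<sigma> n z) = H z" by (auto simp: \<sigma>_def)
  qed
  have \<sigma>0: "\<sigma> n 0 = 0" for n using f0 by (simp add: \<sigma>_def x0_def)
  have "\<exists>\<tau>. \<tau> holomorphic_on unit_disc \<and> (\<forall>z. cmod z < 1 \<longrightarrow> \<sigma> n z = z * \<tau> z)" for n
    using Schwarz3[OF h\<sigma> \<sigma>0] by metis
  then obtain \<tau> where \<tau>: "\<And>n. \<tau> n holomorphic_on unit_disc" "\<And>n z. cmod z < 1 \<Longrightarrow> \<sigma> n z = z * \<tau> n z" by metis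
  have \<tau>1: "cmod (\<tau> n z) \<le> 1" if z: "z \<in> unit_disc" for n z
  proof -
    have off0: "cmod (\<tau> n w) \<le> 1" if "cmod w < 1" "w \<noteq> 0" for w
    proof -
      have "cmod (\<sigma> n w) \<le> cmod w" by (rule Schwarz_Lemma(1)[OF h\<sigma> \<sigma>0 _ that(1)]) (use \<sigma>1 in auto)
      then show ?thesis using \<tau>(2)[OF that(1), of n] that(2) by (simp add: norm_mult)
    qed
    show ?thesis
    proof (cases "z = 0")
      case True
      have "isCont (\<tau> n) 0"
        by (rule continuous_on_interior[OF holomorphic_on_imp_continuous_on[OF \<tau>(1)]]) (simp add: interior_open)
      then have "((\<lambda>w. cmod (\<tau> n w)) \<longlongrightarrow> cmod (\<tau> n 0)) (at 0)" by (simp add: isCont_def tendsto_norm)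
      moreover have "\<forall>\<^sub>F w in at 0. cmod (\<tau> n w) \<le> 1"
        unfolding eventually_at using off0 by (intro exI[of _ 1]) auto
      ultimately have "cmod (\<tau> n 0) \<le> 1" by (rule tendsto_upperbound) simp
      then show ?thesis by (simp add: True)
    qed (use z off0 in auto)
  qed
  obtain \<gamma> r1 where \<gamma>: "\<gamma> holomorphic_on unit_disc" "strict_mono (r1 :: nat \<Rightarrow> nat)"
      "\<And>z. z \<in> unit_disc \<Longrightarrow> (\<lambda>n. g (r1 n) z) \<longlonglongrightarrow> \<gamma> z"
      "\<And>L. \<lbrakk>compact L; L \<subseteq> unit_disc\<rbrakk> \<Longrightarrow> uniform_limit L (g \<circ> r1) \<gamma> sequentially"
  proof (rule Montel[of unit_disc "range g" g])
    show "\<exists>B. \<forall>h\<in>range g. \<forall>z\<in>L. cmod (h z) \<le> B" if "compact L" "L \<subseteq> unit_disc" for L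
      using fg(2) GR that(2) by (intro exI[of _ "R + 1"]) (fastforce intro: less_imp_le)
  qed (use hfg in auto)
  obtain \<theta> r2 where \<theta>: "\<theta> holomorphic_on unit_disc" "strict_mono (r2 :: nat \<Rightarrow> nat)"
      "\<And>z. z \<in> unit_disc \<Longrightarrow> (\<lambda>n. (\<tau> \<circ> r1) (r2 n) z) \<longlonglongrightarrow> \<theta> z"
  proof (rule Montel[of unit_disc "range (\<tau> \<circ> r1)" "\<tau> \<circ> r1"])
    show "\<exists>B. \<forall>h\<in>range (\<tau> \<circ> r1). \<forall>z\<in>L. cmod (h z) \<le> B" if "compact L" "L \<subseteq> unit_disc" for L
      using \<tau>1 that(2) by (intro exI[of _ 1]) fastforce
  qed (use \<tau>(1) in auto)
  define r where "r = r1 \<circ> r2"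
  have r: "strict_mono r" unfolding r_def by (rule strict_mono_o[OF \<gamma>(2) \<theta>(2)])
  have \<tau>lim: "(\<lambda>n. \<tau> (r n) z) \<longlonglongrightarrow> \<theta> z" if "z \<in> unit_disc" for z
    using \<theta>(3)[OF that] by (simp add: r_def o_def)
  have \<theta>1: "cmod (\<theta> z) \<le> 1" if "z \<in> unit_disc" for z
    by (rule Lim_norm_ubound[OF _ \<tau>lim[OF that]]) (use \<tau>1[OF that] in auto)
  have \<gamma>H: "\<gamma> (z * \<theta> z) = H z" if z: "z \<in> unit_disc" for z
  proof -
    have z\<theta>: "cmod (z * \<theta> z) \<le> cmod z" using \<theta>1[OF z] by (simp add: norm_mult mult_left_le)
    have "uniform_limit (cball 0 (cmod z)) (g \<circ> r1) \<gamma> sequentially" by (rule \<gamma>(4)) (use z in auto)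
    then have "uniform_limit (cball 0 (cmod z)) (\<lambda>n. (g \<circ> r1) (r2 n)) \<gamma> sequentially"
      by (rule filterlim_compose) (rule filterlim_subseq[OF \<theta>(2)])
    then have ul: "uniform_limit (cball 0 (cmod z)) (\<lambda>n. g (r n)) \<gamma> sequentially" by (simp add: r_def o_def)
    have "continuous_on (cball 0 (cmod z)) \<gamma>"
      by (rule continuous_on_subset[OF holomorphic_on_imp_continuous_on[OF \<gamma>(1)]]) (use z in auto)
    have lim: "(\<lambda>n. \<sigma> (r n) z) \<longlonglongrightarrow> z * \<theta> z"
      using tendsto_mult[OF tendsto_const \<tau>lim[OF z], of z] \<tau>(2)[of z] z by simp
    have "(\<lambda>n. g (r n) (\<sigma> (r n) z)) \<longlonglongrightarrow> \<gamma> (z * \<theta> z)"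
    proof -
      have in_ball: "\<sigma> (r n) z \<in> cball 0 (cmod z)" for n
        using \<tau>(2)[of z "r n"] \<tau>1[OF z, of "r n"] z by (simp add: norm_mult mult_left_le)
      have "(\<lambda>n. \<gamma> (\<sigma> (r n) z)) \<longlonglongrightarrow> \<gamma> (z * \<theta> z)"
        by (rule continuous_on_tendsto_compose[OF _ lim]) (use z\<theta> in_ball in \<open>auto intro: \<open>continuous_on (cball 0 (cmod z)) \<gamma>\<close>\<close>)
      moreover have "(\<lambda>n. g (r n) (\<sigma> (r n) z) - \<gamma> (\<sigma> (r n) z)) \<longlonglongrightarrow> 0"
      proof (rule tendstoI)
        fix \<epsilon> :: real assume "0 < \<epsilon>"
        from uniform_limitD[OF ul this] show "\<forall>\<^sub>F n in sequentially. dist (g (r n) (\<sigma> (r n) z) - \<gamma> (\<sigma> (r n) z)) 0 < \<epsilon>"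
          by eventually_elim (use in_ball in \<open>auto simp: dist_norm\<close>)
      qed
      ultimately show ?thesis using tendsto_add by fastforce
    qed
    then have "(\<lambda>n::nat. H z) \<longlonglongrightarrow> \<gamma> (z * \<theta> z)" using g\<sigma>[OF z] by simp
    then show ?thesis by (simp add: LIMSEQ_const_iff)
  qed
  have \<gamma>K: "\<gamma> u \<in> K" if u: "u \<in> unit_disc" for u
  proof (rule ccontr)
    assume "\<gamma> u \<notin> K"
    then obtain d where d: "d > 0" "\<And>e. 0 < e \<Longrightarrow> e \<le> d \<Longrightarrow> ball (\<gamma> u) d \<subseteq> outside (\<Union>x\<in>K. ball x e)"
      using outside_small_neighbourhoods[OF K(2,3)] by metis
    have "e \<longlonglongrightarrow> 0" unfolding e_def[abs_def] by (rule LIMSEQ_inverse_real_of_nat)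
    from LIMSEQ_subseq_LIMSEQ[OF this \<gamma>(2)] have "(\<lambda>n. e (r1 n)) \<longlonglongrightarrow> 0" by (simp add: o_def)
    then have "\<forall>\<^sub>F n in sequentially. e (r1 n) < d" using d(1) by (rule order_tendstoD)
    moreover have "\<forall>\<^sub>F n in sequentially. dist (g (r1 n) u) (\<gamma> u) < d" using \<gamma>(3)[OF u] d(1) by (rule tendstoD)
    ultimately have "\<forall>\<^sub>F n in sequentially. e (r1 n) < d \<and> dist (g (r1 n) u) (\<gamma> u) < d" by eventually_elim simp
    from eventually_happens'[OF sequentially_bot this]
    obtain n where n: "e (r1 n) < d" "dist (g (r1 n) u) (\<gamma> u) < d" by blast
    have "g (r1 n) u \<in> outside (\<Union>x\<in>K. ball x (e (r1 n)))"
      using d(2)[OF e0 less_imp_le[OF n(1)]] n(2) by (auto simp: dist_commute)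
    moreover have "g (r1 n) u \<in> G (r1 n)" using fg(2)[OF u] by blast
    ultimately show False using G(4)[of "r1 n"] by blast
  qed
  have nonconst: "\<not> \<gamma> constant_on unit_disc"
  proof
    assume "\<gamma> constant_on unit_disc"
    then obtain c where c: "\<And>u. u \<in> unit_disc \<Longrightarrow> \<gamma> u = c" by (auto simp: constant_on_def)
    have mem: "z * \<theta> z \<in> unit_disc" if "z \<in> unit_disc" for z
      using \<theta>1[OF that] that by (simp add: norm_mult) (metis mult_left_le norm_ge_zero order_le_less_trans)
    have "H (1/2) = H 0" using \<gamma>H[of "1/2"] \<gamma>H[of 0] c[OF mem[of "1/2"]] c[OF mem[of 0]] by simp
    then have "(1/2::complex) = 0" by (rule inj_onD[OF H(2)]) auto
    then show False by simp
  qed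
  have "open (\<gamma> ` unit_disc)" by (rule open_mapping_thm[OF \<gamma>(1) _ _ _ _ nonconst]) auto
  then have \<gamma>H_im: "\<gamma> ` unit_disc \<subseteq> H ` unit_disc" using \<gamma>K K(4) by (metis image_subsetI interior_maximal)
  obtain hi where hi: "hi holomorphic_on H ` unit_disc" "\<And>z. z \<in> unit_disc \<Longrightarrow> hi (H z) = z"
    using holomorphic_has_inverse[OF H(1) open_ball H(2)] by metis
  define \<psi> where "\<psi> = hi \<circ> \<gamma>"
  have h\<psi>: "\<psi> holomorphic_on unit_disc" unfolding \<psi>_def by (rule holomorphic_on_compose_gen[OF \<gamma>(1) hi(1) \<gamma>H_im])
  have \<psi>1: "cmod (\<psi> u) < 1" if u: "cmod u < 1" for u
  proof -
    have "\<gamma> u \<in> H ` unit_disc" by (rule subsetD[OF \<gamma>H_im]) (use u in simp)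
    then obtain z where "z \<in> unit_disc" "\<gamma> u = H z" by blast
    then show ?thesis using hi(2)[of z] by (simp add: \<psi>_def)
  qed
  have \<psi>\<theta>: "\<psi> (z * \<theta> z) = z" if "z \<in> unit_disc" for z using \<gamma>H[OF that] hi(2)[OF that] by (simp add: \<psi>_def)
  have \<psi>0: "\<psi> 0 = 0" using \<psi>\<theta>[of 0] by simp
  have \<theta>2: "1 \<le> cmod (\<theta> z)" if z: "z \<in> unit_disc" "z \<noteq> 0" for z
  proof -
    have "cmod (z * \<theta> z) < 1" using \<theta>1[OF z(1)] z(1)
      by (simp add: norm_mult) (metis mult_left_le norm_ge_zero order_le_less_trans)
    from Schwarz_Lemma(1)[OF h\<psi> \<psi>0 \<psi>1 this] have "cmod z \<le> cmod z * cmod (\<theta> z)"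
      using \<psi>\<theta>[OF z(1)] by (simp add: norm_mult)
    then show ?thesis using z(2) by simp
  qed
  define \<alpha> where "\<alpha> = \<theta> 0"
  have "1 \<le> cmod \<alpha>"
  proof -
    have "isCont \<theta> 0"
      by (rule continuous_on_interior[OF holomorphic_on_imp_continuous_on[OF \<theta>(1)]]) (simp add: interior_open)
    then have "((\<lambda>w. cmod (\<theta> w)) \<longlongrightarrow> cmod (\<theta> 0)) (at 0)" by (simp add: isCont_def tendsto_norm)
    moreover have "\<forall>\<^sub>F w in at 0. 1 \<le> cmod (\<theta> w)"
      unfolding eventually_at using \<theta>2 by (intro exI[of _ 1]) auto
    ultimately show ?thesis unfolding \<alpha>_def by (rule tendsto_lowerbound) simp
  qed
  then have \<alpha>1: "cmod \<alpha> = 1" using \<theta>1[of 0] by (simp add: \<alpha>_def)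
  then have \<alpha>\<alpha>: "cnj \<alpha> * \<alpha> = 1" using complex_norm_square[of \<alpha>] by (simp add: mult.commute)
  define w where "w n z = cnj \<alpha> * \<sigma> n z" for n z
  have hw: "w n holomorphic_on unit_disc" for n unfolding w_def[abs_def] by (intro holomorphic_intros h\<sigma>)
  have w1: "cmod (w n z) \<le> 1" if "z \<in> unit_disc" for n z
    using \<sigma>1[OF that, of n] \<alpha>1 by (simp add: w_def norm_mult)
  define \<beta> where "\<beta> n = 2 * pi * Re (2 * (1 - cnj \<alpha> * \<tau> n 0))" for n
  have Iw: "Hp_integral 2 (\<lambda>z. w n z - z) \<rho> \<le> \<beta> n" if \<rho>: "0 < \<rho>" "\<rho> < 1" for n \<rho>
    unfolding \<beta>_def
  proof (rule harmonic_majorant)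
    fix z assume z: "z \<in> unit_disc"
    have "w n z - z = z * (cnj \<alpha> * \<tau> n z - 1)" using \<tau>(2)[of z n] z by (simp add: w_def algebra_simps)
    then have "(cmod (w n z - z))\<^sup>2 = (cmod z)\<^sup>2 * (cmod (cnj \<alpha> * \<tau> n z - 1))\<^sup>2" by (simp add: norm_mult power_mult_distrib)
    also have "\<dots> \<le> 1 * (cmod (cnj \<alpha> * \<tau> n z - 1))\<^sup>2"
      using z by (intro mult_right_mono) (auto simp: abs_square_le_1)
    also have "(cmod (cnj \<alpha> * \<tau> n z - 1))\<^sup>2 = (cmod (cnj \<alpha> * \<tau> n z))\<^sup>2 + 1 - 2 * Re (cnj \<alpha> * \<tau> n z)"
      unfolding cmod_power2 by (simp add: power2_eq_square algebra_simps)
    also have "(cmod (cnj \<alpha> * \<tau> n z))\<^sup>2 \<le> 1" using \<tau>1[OF z] \<alpha>1 by (simp add: norm_mult abs_square_le_1)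
    finally show "cmod (w n z - z) powr 2 \<le> Re (2 * (1 - cnj \<alpha> * \<tau> n z))" by simp
  qed (use hw \<tau>(1) \<rho> in \<open>auto intro!: holomorphic_intros\<close>)
  have "(\<lambda>n. \<beta> (r n)) \<longlonglongrightarrow> 2 * pi * Re (2 * (1 - cnj \<alpha> * \<alpha>))"
    unfolding \<beta>_def \<alpha>_def by (intro tendsto_intros \<tau>lim) simp
  then have \<beta>0: "(\<lambda>n. \<beta> (r n)) \<longlonglongrightarrow> 0" by (simp add: \<alpha>\<alpha>)
  have hm: "hardy p (\<lambda>z. z ^ m)"
    by (rule hardy_bounded[where M = 1]) (auto simp: norm_power power_le_one less_imp_le p0 intro!: holomorphic_intros)
  show ?thesis
  proof (rule approximation[OF hm])
    fix \<epsilon> :: real assume e: "\<epsilon> > 0"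
    obtain \<delta> where \<delta>: "\<delta> > 0"
        "\<And>f r. f holomorphic_on unit_disc \<Longrightarrow> (\<And>z. z \<in> unit_disc \<Longrightarrow> cmod (f z) \<le> 2) \<Longrightarrow> 0 \<le> r \<Longrightarrow> r < 1
           \<Longrightarrow> Hp_integral 2 f r \<le> \<delta> \<Longrightarrow> Hp_integral p f r \<le> \<epsilon>"
      using bounded_small_Hp_integral[of 2 p 2 \<epsilon>] p0 e by auto
    have "(\<lambda>n. (2 * real m) powr 2 * \<beta> (r n)) \<longlonglongrightarrow> (2 * real m) powr 2 * 0" by (intro tendsto_intros \<beta>0)
    then have "\<forall>\<^sub>F n in sequentially. (2 * real m) powr 2 * \<beta> (r n) < \<delta>"
      using \<delta>(1) by (intro order_tendstoD) auto
    then obtain n where n: "(2 * real m) powr 2 * \<beta> (r n) < \<delta>"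
      using eventually_happens'[OF sequentially_bot] by blast
    define g0 where "g0 z = w (r n) z ^ m" for z
    have hg0: "g0 holomorphic_on unit_disc" unfolding g0_def[abs_def] by (intro holomorphic_intros hw)
    have g01: "cmod (g0 z) \<le> 1" if "z \<in> unit_disc" for z
      using w1[OF that] by (simp add: g0_def norm_power power_le_one)
    have small: "Hp_integral p (\<lambda>z. z ^ m - g0 z) \<rho> \<le> \<epsilon>" if \<rho>: "0 < \<rho>" "\<rho> < 1" for \<rho>
    proof (rule \<delta>(2))
      show "(\<lambda>z. z ^ m - g0 z) holomorphic_on unit_disc" by (intro holomorphic_intros hg0)
      show "cmod (z ^ m - g0 z) \<le> 2" if z: "z \<in> unit_disc" for z
        using norm_triangle_ineq4[of "z ^ m" "g0 z"] g01[OF z] z power_le_one[of "cmod z" m] by (simp add: norm_power)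
      have "Hp_integral 2 (\<lambda>z. z ^ m - g0 z) \<rho> \<le> (2 * real m) powr 2 * (Hp_integral 2 (\<lambda>z. w (r n) z - z) \<rho> + Hp_integral 2 (\<lambda>z. 0) \<rho>)"
      proof (rule Hp_integral_dominated)
        fix z assume z: "z \<in> unit_disc"
        show "cmod (z ^ m - g0 z) \<le> real m * (cmod (w (r n) z - z) + cmod 0)"
          using norm_power_diff[of z "w (r n) z" m] w1[OF z] z by (simp add: g0_def norm_minus_commute)
      qed (use hw hg0 \<rho> in \<open>auto intro!: holomorphic_intros\<close>)
      also have "Hp_integral 2 (\<lambda>z. 0) \<rho> = 0" by (simp add: Hp_integral_eq)
      also have "(2 * real m) powr 2 * (Hp_integral 2 (\<lambda>z. w (r n) z - z) \<rho> + 0) \<le> (2 * real m) powr 2 * \<beta> (r n)"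
        using Iw[OF \<rho>] by (intro mult_left_mono) auto
      finally show "Hp_integral 2 (\<lambda>z. z ^ m - g0 z) \<rho> \<le> \<delta>" using n by simp
    qed (use \<rho> in auto)
    have pw: "(\<lambda>u. u ^ m) holomorphic_on unit_disc" by (intro holomorphic_intros)
    have "\<Lambda> (\<lambda>z. f (r n) (H z) ^ m) = 0"
      by (rule vanishes_on_Riemann_map[OF H(1) HK K(2) rat G(1) G(3) hfg fg pw])
    moreover have "hardy p (\<lambda>z. f (r n) (H z) ^ m)"
    proof (rule hardy_bounded[OF _ _ p0])
      show "(\<lambda>z. f (r n) (H z) ^ m) holomorphic_on unit_disc"
        using h\<sigma>[of "r n"] by (auto simp: \<sigma>_def[abs_def] intro!: holomorphic_intros)
      show "cmod (f (r n) (H z) ^ m) \<le> 1" if "z \<in> unit_disc" for z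
        using \<sigma>1[OF that, of "r n"] by (simp add: \<sigma>_def norm_power power_le_one)
    qed
    moreover have "g0 = (\<lambda>z. cnj \<alpha> ^ m * f (r n) (H z) ^ m)"
      by (simp add: g0_def w_def \<sigma>_def power_mult_distrib fun_eq_iff)
    ultimately have "\<Lambda> g0 = 0" using scale[of "\<lambda>z. f (r n) (H z) ^ m" "cnj \<alpha> ^ m"] by simp
    moreover have "hardy p g0" by (rule hardy_bounded[OF hg0 g01 p0])
    ultimately show "\<exists>g. hardy p g \<and> \<Lambda> g = 0 \<and> (\<forall>r. 0 < r \<and> r < 1 \<longrightarrow> Hp_integral p (\<lambda>z. z ^ m - g z) r \<le> \<epsilon>)"
      using small by blast
  qed
qed

end

section \<open>Exponential families and resolvents\<close>

lemma square_exp_bound: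
  fixes t \<delta> :: real
  assumes "0 \<le> t" "0 < \<delta>"
  shows "t\<^sup>2 \<le> 2 / \<delta>\<^sup>2 * exp (\<delta> * t)"
proof -
  have "(\<delta> * t)\<^sup>2 / 2 \<le> 1 + \<delta> * t + (\<delta> * t)\<^sup>2 / 2" using assms by simp
  also have "\<dots> \<le> exp (\<delta> * t)" using assms by (intro exp_lower_Taylor_quadratic) auto
  finally have "\<delta>\<^sup>2 * t\<^sup>2 \<le> 2 * exp (\<delta> * t)" by (simp add: power_mult_distrib)
  then show ?thesis using assms by (simp add: field_simps)
qed

lemma exp_second_order: "cmod (exp u - 1 - u) \<le> (cmod u)\<^sup>2 * exp (cmod u)"
proof -
  have "cmod (exp u - (\<Sum>k\<le>1. u ^ k / fact k)) \<le> exp \<bar>Re u\<bar> * cmod u ^ Suc 1 / fact 1" by (rule Taylor_exp)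
  also have "(\<Sum>k\<le>1. u ^ k / fact k) = 1 + u" by simp
  also have "exp \<bar>Re u\<bar> * cmod u ^ Suc 1 / fact 1 \<le> exp (cmod u) * (cmod u)\<^sup>2"
    using abs_Re_le_cmod[of u] by (simp add: power2_eq_square mult_right_mono)
  finally show ?thesis by (simp add: algebra_simps)
qed

lemma exp_abs_le_sum: "exp (\<bar>x\<bar> :: real) \<le> exp x + exp (- x)"
  by (cases "x \<ge> 0") auto

lemma cmod_exp_le:
  assumes "\<bar>Im w\<bar> \<le> \<beta>"
  shows "cmod (exp (\<zeta> * w)) \<le> exp (\<bar>Im \<zeta>\<bar> * \<beta>) * cmod (exp (of_real (Re \<zeta>) * w))"
proof -
  have "- (Im \<zeta> * Im w) \<le> \<bar>Im \<zeta>\<bar> * \<bar>Im w\<bar>" by (metis abs_ge_minus_self abs_mult)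
  also have "\<dots> \<le> \<bar>Im \<zeta>\<bar> * \<beta>" using assms by (intro mult_left_mono) auto
  finally show ?thesis by (simp add: mult_exp_exp)
qed

text \<open>
  The factor \<open>e\<^bsup>\<delta>|w|\<^esup>\<close> absorbs powers of \<open>w\<close>; the price is a shift of \<open>Re \<zeta>\<close> by \<open>\<delta>\<close> in either direction,
  as \<open>|w|\<close> differs from \<open>|Re w|\<close> by a bounded amount on the strip.
\<close>
lemma exp_growth:
  assumes w: "\<bar>Im w\<bar> \<le> \<beta>" and d: "0 < \<delta>"
  shows "exp (\<delta> * cmod w) * cmod (exp (\<zeta> * w)) \<le> exp (\<bar>Im \<zeta>\<bar> * \<beta> + \<delta> * \<beta>) *
     (cmod (exp (of_real (Re \<zeta> + \<delta>) * w)) + cmod (exp (of_real (Re \<zeta> - \<delta>) * w)))"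
proof -
  have "cmod w \<le> \<bar>Re w\<bar> + \<beta>" using cmod_le[of w] w by linarith
  then have "\<delta> * cmod w \<le> \<bar>\<delta> * Re w\<bar> + \<delta> * \<beta>" using d by (simp add: abs_mult) (metis distrib_left less_imp_le mult_left_mono)
  then have "exp (\<delta> * cmod w) \<le> exp \<bar>\<delta> * Re w\<bar> * exp (\<delta> * \<beta>)" by (simp add: mult_exp_exp)
  also have "\<dots> \<le> (exp (\<delta> * Re w) + exp (- (\<delta> * Re w))) * exp (\<delta> * \<beta>)"
    by (intro mult_right_mono exp_abs_le_sum) auto
  finally have A: "exp (\<delta> * cmod w) \<le> (exp (\<delta> * Re w) + exp (- (\<delta> * Re w))) * exp (\<delta> * \<beta>)" .
  have "exp (\<delta> * cmod w) * cmod (exp (\<zeta> * w)) \<le>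
     ((exp (\<delta> * Re w) + exp (- (\<delta> * Re w))) * exp (\<delta> * \<beta>)) * (exp (\<bar>Im \<zeta>\<bar> * \<beta>) * cmod (exp (of_real (Re \<zeta>) * w)))"
    by (intro mult_mono A cmod_exp_le w) (auto intro!: add_nonneg_nonneg mult_nonneg_nonneg)
  also have "\<dots> = exp (\<bar>Im \<zeta>\<bar> * \<beta> + \<delta> * \<beta>) *
     (cmod (exp (of_real (Re \<zeta> + \<delta>) * w)) + cmod (exp (of_real (Re \<zeta> - \<delta>) * w)))"
  proof -
    have n: "cmod (exp (of_real a * w)) = exp (a * Re w)" for a by simp
    have "exp ((Re \<zeta> + \<delta>) * Re w) = exp (\<delta> * Re w) * exp (Re \<zeta> * Re w)"
      by (simp add: distrib_right add.commute flip: exp_add)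
    moreover have "exp ((Re \<zeta> - \<delta>) * Re w) = exp (- (\<delta> * Re w)) * exp (Re \<zeta> * Re w)"
      by (simp add: left_diff_distrib flip: exp_add)
    ultimately show ?thesis unfolding n exp_add[of "\<bar>Im \<zeta>\<bar> * \<beta>"] by (simp only: distrib_left distrib_right mult_ac)
  qed
  finally show ?thesis .
qed

locale strip_map =
  fixes p \<beta> :: real and h :: "complex \<Rightarrow> complex"
  assumes p: "1 \<le> p" and h: "h holomorphic_on unit_disc"
    and strip: "z \<in> unit_disc \<Longrightarrow> \<bar>Im (h z)\<bar> \<le> \<beta>"
begin

lemma p0: "0 < p" using p by simp

lemma hardy_exp:
  assumes s: "hardy p (\<lambda>z. exp (of_real (Re \<zeta>) * h z))"
    and q: "q holomorphic_on unit_disc" "\<And>z. z \<in> unit_disc \<Longrightarrow> cmod (q z) \<le> Q"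
  shows "hardy p (\<lambda>z. q z * exp (\<zeta> * h z))"
proof (rule hardy_dominated[OF _ s hardy_const[of p 0] p0])
  fix z assume z: "z \<in> unit_disc"
  have Q: "0 \<le> Q" using q(2)[OF z] by (meson norm_ge_zero order_trans)
  have "cmod (q z * exp (\<zeta> * h z)) \<le> Q * (exp (\<bar>Im \<zeta>\<bar> * \<beta>) * cmod (exp (of_real (Re \<zeta>) * h z)))"
    unfolding norm_mult by (intro mult_mono q z cmod_exp_le strip Q) auto
  then show "cmod (q z * exp (\<zeta> * h z)) \<le> (Q * exp (\<bar>Im \<zeta>\<bar> * \<beta>)) * (cmod (exp (of_real (Re \<zeta>) * h z)) + cmod 0)"
    by (simp add: mult.assoc)
qed (intro holomorphic_intros q h)

lemma hardy_exp_times_h: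
  assumes d: "0 < \<delta>" and s: "hardy p (\<lambda>z. exp (of_real (Re \<zeta> + \<delta>) * h z))" "hardy p (\<lambda>z. exp (of_real (Re \<zeta> - \<delta>) * h z))"
    and q: "q holomorphic_on unit_disc" "\<And>z. z \<in> unit_disc \<Longrightarrow> cmod (q z) \<le> Q"
  shows "hardy p (\<lambda>z. q z * h z * exp (\<zeta> * h z))"
proof (rule hardy_dominated[OF _ s p0])
  fix z assume z: "z \<in> unit_disc"
  have Q: "0 \<le> Q" using q(2)[OF z] by (meson norm_ge_zero order_trans)
  define t where "t = cmod (h z)"
  have t0: "0 \<le> t" by (simp add: t_def)
  have "0 \<le> (1 - t)\<^sup>2" by simp
  then have "2 * t \<le> 1 + t\<^sup>2" by (simp add: power2_diff)
  then have "t \<le> 1 + t\<^sup>2" using t0 by linarith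
  also have "\<dots> \<le> exp (\<delta> * t) + 2 / \<delta>\<^sup>2 * exp (\<delta> * t)"
    using d by (intro add_mono square_exp_bound) (auto simp: t_def)
  finally have "t \<le> (1 + 2 / \<delta>\<^sup>2) * exp (\<delta> * t)" by (simp add: distrib_right)
  then have "cmod (q z * h z * exp (\<zeta> * h z)) \<le> Q * ((1 + 2 / \<delta>\<^sup>2) * exp (\<delta> * t)) * cmod (exp (\<zeta> * h z))"
    unfolding norm_mult using Q q(2)[OF z] by (intro mult_mono) (auto simp: t_def)
  also have "\<dots> = Q * (1 + 2 / \<delta>\<^sup>2) * (exp (\<delta> * cmod (h z)) * cmod (exp (\<zeta> * h z)))" by (simp add: t_def)
  also have "\<dots> \<le> Q * (1 + 2 / \<delta>\<^sup>2) * (exp (\<bar>Im \<zeta>\<bar> * \<beta> + \<delta> * \<beta>) *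
     (cmod (exp (of_real (Re \<zeta> + \<delta>) * h z)) + cmod (exp (of_real (Re \<zeta> - \<delta>) * h z))))"
    by (intro mult_left_mono exp_growth strip z d) (use Q in auto)
  finally show "cmod (q z * h z * exp (\<zeta> * h z)) \<le> (Q * (1 + 2 / \<delta>\<^sup>2) * exp (\<bar>Im \<zeta>\<bar> * \<beta> + \<delta> * \<beta>)) *
     (cmod (exp (of_real (Re \<zeta> + \<delta>) * h z)) + cmod (exp (of_real (Re \<zeta> - \<delta>) * h z)))"
    by (simp only: mult.assoc)
qed (intro holomorphic_intros q h)

end

locale strip_functional = strip_map p \<beta> h + hardy_functional p \<Lambda> C
  for p \<beta> h \<Lambda> C
begin

text \<open>
  The second-order remainder contains \<open>h\<^sup>2\<close>, which exponentials with slightly larger and smaller \<open>Re \<zeta>\<close>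
  dominate.
\<close>
lemma exp_family_has_derivative:
  assumes d: "0 < \<delta>" and s: "\<And>s. \<bar>s - Re \<zeta>\<bar> < \<delta> \<Longrightarrow> hardy p (\<lambda>z. exp (of_real s * h z))"
    and q: "q holomorphic_on unit_disc" "\<And>z. z \<in> unit_disc \<Longrightarrow> cmod (q z) \<le> Q"
  shows "((\<lambda>\<zeta>. \<Lambda> (\<lambda>z. q z * exp (\<zeta> * h z))) has_field_derivative \<Lambda> (\<lambda>z. q z * h z * exp (\<zeta> * h z))) (at \<zeta>)"
proof -
  define e where "e = \<delta> / 4"
  have e: "0 < e" "2 * e < \<delta>" using d by (auto simp: e_def)
  have Q: "0 \<le> Q" using q(2)[of 0] by (meson norm_ge_zero order_trans centre_in_ball zero_less_one)
  define c where "c = Q * (2 / e\<^sup>2) * exp (\<bar>Im \<zeta>\<bar> * \<beta> + 2 * e * \<beta>)"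
  have c0: "0 \<le> c" using Q by (simp add: c_def)
  have hM: "hardy p (\<lambda>z. exp (of_real (Re \<zeta> + 2 * e) * h z))" and hN: "hardy p (\<lambda>z. exp (of_real (Re \<zeta> - 2 * e) * h z))"
    by (rule s; use e in simp)+
  show ?thesis
  proof (rule has_derivative_dominated[where \<delta> = e])
    show "hardy p (\<lambda>z. q z * exp ((\<zeta> + \<eta>) * h z))" if "cmod \<eta> < e" for \<eta>
      by (rule hardy_exp[OF s q]) (use that e abs_Re_le_cmod[of \<eta>] in auto)
    show "hardy p (\<lambda>z. q z * h z * exp (\<zeta> * h z))"
      by (rule hardy_exp_times_h[OF e(1) s s q]) (use e in auto)
    show "hardy p (\<lambda>z. of_real c * exp (of_real (Re \<zeta> + 2 * e) * h z))" by (intro hardy_scale hM p0)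
    show "hardy p (\<lambda>z. of_real c * exp (of_real (Re \<zeta> - 2 * e) * h z))" by (intro hardy_scale hN p0)
    fix \<eta> z :: complex assume \<eta>: "cmod \<eta> < e" and z: "z \<in> unit_disc"
    define w where "w = h z"
    have "q z * exp ((\<zeta> + \<eta>) * w) - q z * exp (\<zeta> * w) - \<eta> * (q z * w * exp (\<zeta> * w)) = q z * ((exp (\<eta> * w) - 1 - \<eta> * w) * exp (\<zeta> * w))"
      by (simp add: algebra_simps exp_add)
    then have "cmod (q z * exp ((\<zeta> + \<eta>) * w) - q z * exp (\<zeta> * w) - \<eta> * (q z * w * exp (\<zeta> * w)))
        = cmod (q z) * (cmod (exp (\<eta> * w) - 1 - \<eta> * w) * cmod (exp (\<zeta> * w)))" by (simp only: norm_mult)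
    also have "\<dots> \<le> Q * ((cmod \<eta>)\<^sup>2 * ((2 / e\<^sup>2) * exp (2 * e * cmod w)) * cmod (exp (\<zeta> * w)))"
    proof (intro mult_mono q z mult_right_mono)
      have "cmod (exp (\<eta> * w) - 1 - \<eta> * w) \<le> (cmod (\<eta> * w))\<^sup>2 * exp (cmod (\<eta> * w))" by (rule exp_second_order)
      also have "\<dots> = (cmod \<eta>)\<^sup>2 * ((cmod w)\<^sup>2 * exp (cmod \<eta> * cmod w))" by (simp add: norm_mult power_mult_distrib)
      also have "\<dots> \<le> (cmod \<eta>)\<^sup>2 * ((2 / e\<^sup>2 * exp (e * cmod w)) * exp (e * cmod w))"
        using \<eta> e by (intro mult_left_mono mult_mono square_exp_bound) (auto intro: mult_right_mono)
      also have "\<dots> = (cmod \<eta>)\<^sup>2 * ((2 / e\<^sup>2) * exp (2 * e * cmod w))" by (simp add: mult_exp_exp)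
      finally show "cmod (exp (\<eta> * w) - 1 - \<eta> * w) \<le> (cmod \<eta>)\<^sup>2 * ((2 / e\<^sup>2) * exp (2 * e * cmod w))" .
    qed (use Q in auto)
    also have "\<dots> = Q * (cmod \<eta>)\<^sup>2 * (2 / e\<^sup>2) * (exp ((2 * e) * cmod w) * cmod (exp (\<zeta> * w)))" by simp
    also have "\<dots> \<le> Q * (cmod \<eta>)\<^sup>2 * (2 / e\<^sup>2) * (exp (\<bar>Im \<zeta>\<bar> * \<beta> + 2 * e * \<beta>) *
       (cmod (exp (of_real (Re \<zeta> + 2 * e) * w)) + cmod (exp (of_real (Re \<zeta> - 2 * e) * w))))"
      by (intro mult_left_mono exp_growth) (use strip[OF z] e Q in \<open>auto simp: w_def\<close>)
    also have "\<dots> = (cmod \<eta>)\<^sup>2 * (cmod (of_real c * exp (of_real (Re \<zeta> + 2 * e) * w)) + cmod (of_real c * exp (of_real (Re \<zeta> - 2 * e) * w)))"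
      using c0 by (simp only: norm_mult norm_of_real abs_of_nonneg) (simp add: c_def algebra_simps)
    finally show "cmod (q z * exp ((\<zeta> + \<eta>) * h z) - q z * exp (\<zeta> * h z) - \<eta> * (q z * h z * exp (\<zeta> * h z)))
       \<le> (cmod \<eta>)\<^sup>2 * (cmod (of_real c * exp (of_real (Re \<zeta> + 2 * e) * h z)) + cmod (of_real c * exp (of_real (Re \<zeta> - 2 * e) * h z)))"
      unfolding w_def .
  qed (rule e(1))
qed

text \<open>
  The function \<open>K(\<zeta>) = \<Lambda>(e\<^bsup>\<zeta>h\<^esup> / (\<xi> - h))\<close> solves \<open>K' = \<xi>K\<close> because \<open>h / (\<xi> - h) = \<xi> / (\<xi> - h) - 1\<close> and
  \<open>\<Lambda>\<close> annihilates exponentials.  On the imaginary axis \<open>K\<close> grows at most like \<open>e\<^bsup>\<beta>|\<zeta>|\<^esup>\<close>, too slowly for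
  a nonzero multiple of \<open>e\<^bsup>\<xi>\<zeta>\<^esup>\<close> when \<open>\<xi>\<close> lies off the strip.
\<close>
lemma resolvent_off_strip:
  assumes d: "0 < \<delta>" and s: "\<And>s. \<bar>s\<bar> < \<delta> \<Longrightarrow> hardy p (\<lambda>z. exp (of_real s * h z))"
    and \<Lambda>0: "\<And>\<zeta>. \<bar>Re \<zeta>\<bar> < \<delta> \<Longrightarrow> \<Lambda> (\<lambda>z. exp (\<zeta> * h z)) = 0" and \<xi>: "\<beta> < \<bar>Im \<xi>\<bar>"
  shows "\<Lambda> (\<lambda>z. 1 / (\<xi> - h z)) = 0" "hardy p (\<lambda>z. 1 / (\<xi> - h z))"
proof -
  define q where "q z = 1 / (\<xi> - h z)" for z
  define D where "D = \<bar>Im \<xi>\<bar> - \<beta>"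
  have D: "D > 0" using \<xi> by (simp add: D_def)
  have dist: "D \<le> cmod (\<xi> - h z)" if "z \<in> unit_disc" for z
    using abs_Im_le_cmod[of "\<xi> - h z"] strip[OF that] by (simp add: D_def)
  have nz: "\<xi> - h z \<noteq> 0" if "z \<in> unit_disc" for z using dist[OF that] D by auto
  have q: "q holomorphic_on unit_disc" unfolding q_def using nz by (intro holomorphic_intros h) auto
  have qD: "cmod (q z) \<le> 1 / D" if "z \<in> unit_disc" for z
    using dist[OF that] D by (simp add: q_def norm_divide frac_le)
  show hq: "hardy p (\<lambda>z. 1 / (\<xi> - h z))" using hardy_bounded[OF q qD p0] by (simp add: q_def[abs_def])
  define S where "S = {\<zeta>. \<bar>Re \<zeta>\<bar> < \<delta>}"
  have S: "convex S" "open S"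
  proof -
    have "S = {\<zeta>. Re \<zeta> < \<delta>} \<inter> {\<zeta>. Re \<zeta> > - \<delta>}" by (auto simp: S_def)
    then show "convex S" "open S" by (auto simp: convex_Int convex_halfspace_Re_lt convex_halfspace_Re_gt open_Int open_halfspace_Re_lt open_halfspace_Re_gt)
  qed
  have hq_exp: "hardy p (\<lambda>z. q z * exp (\<zeta> * h z))" if "\<zeta> \<in> S" for \<zeta>
    by (rule hardy_exp[OF s q qD]) (use that in \<open>auto simp: S_def\<close>)
  have h_exp: "hardy p (\<lambda>z. exp (\<zeta> * h z))" if "\<zeta> \<in> S" for \<zeta>
  proof -
    have "hardy p (\<lambda>z. 1 * exp (\<zeta> * h z))"
      by (rule hardy_exp[where Q = 1]) (use that s[of "Re \<zeta>"] in \<open>auto simp: S_def\<close>)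
    then show ?thesis by simp
  qed
  define K where "K \<zeta> = \<Lambda> (\<lambda>z. q z * exp (\<zeta> * h z))" for \<zeta>
  have K': "(K has_field_derivative \<xi> * K \<zeta>) (at \<zeta>)" if \<zeta>: "\<zeta> \<in> S" for \<zeta>
  proof -
    have "(K has_field_derivative \<Lambda> (\<lambda>z. q z * h z * exp (\<zeta> * h z))) (at \<zeta>)"
      unfolding K_def by (rule exp_family_has_derivative[OF _ s q qD, of "\<delta> - \<bar>Re \<zeta>\<bar>"]) (use \<zeta> in \<open>auto simp: S_def\<close>)
    also have "\<Lambda> (\<lambda>z. q z * h z * exp (\<zeta> * h z)) = \<Lambda> (\<lambda>z. \<xi> * (q z * exp (\<zeta> * h z)) - exp (\<zeta> * h z))"
    proof (rule cong)
      fix z assume "z \<in> unit_disc"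
      then have "q z * h z = \<xi> * q z - 1" using nz by (simp add: q_def field_simps)
      then have "q z * h z * exp (\<zeta> * h z) = (\<xi> * q z - 1) * exp (\<zeta> * h z)" by (simp only:)
      then show "q z * h z * exp (\<zeta> * h z) = \<xi> * (q z * exp (\<zeta> * h z)) - exp (\<zeta> * h z)" by (simp add: left_diff_distrib)
    qed
    also have "\<dots> = \<xi> * K \<zeta> - \<Lambda> (\<lambda>z. exp (\<zeta> * h z))"
      using hq_exp[OF \<zeta>] h_exp[OF \<zeta>] by (simp add: diff hardy_scale p0 scale K_def)
    finally show ?thesis using \<Lambda>0 \<zeta> by (simp add: S_def)
  qed
  have "\<exists>c. \<forall>\<zeta>\<in>S. K \<zeta> * exp (- \<xi> * \<zeta>) = c"
  proof (rule has_field_derivative_zero_constant[OF S(1)])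
    fix \<zeta> assume "\<zeta> \<in> S"
    then have "((\<lambda>\<zeta>. K \<zeta> * exp (- \<xi> * \<zeta>)) has_field_derivative 0) (at \<zeta>)"
      by (auto intro!: derivative_eq_intros K' simp: algebra_simps)
    then show "((\<lambda>\<zeta>. K \<zeta> * exp (- \<xi> * \<zeta>)) has_field_derivative 0) (at \<zeta> within S)" by (rule has_field_derivative_at_within)
  qed
  then obtain c where c: "\<And>\<zeta>. \<zeta> \<in> S \<Longrightarrow> K \<zeta> * exp (- \<xi> * \<zeta>) = c" by blast
  have Kc: "K \<zeta> = c * exp (\<xi> * \<zeta>)" if "\<zeta> \<in> S" for \<zeta>
  proof -
    have "c * exp (\<xi> * \<zeta>) = K \<zeta> * (exp (- \<xi> * \<zeta>) * exp (\<xi> * \<zeta>))"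
      using c[OF that] by (simp only: mult.assoc[symmetric])
    then show ?thesis by (simp add: mult_exp_exp)
  qed
  define B where "B = (\<bar>C\<bar> * ((2 * (1 / D)) powr p * (2 * pi))) powr (1 / p)"
  define \<sigma> where "\<sigma> = (if Im \<xi> > 0 then 1 else - 1 :: real)"
  have K_bound: "cmod (K (- \<i> * of_real (\<sigma> * t))) \<le> B * exp (t * \<beta>)" if t: "t \<ge> 0" for t
  proof -
    define g where "g z = of_real (exp (- (t * \<beta>))) * (q z * exp (- \<i> * of_real (\<sigma> * t) * h z))" for z
    have mem: "- \<i> * of_real (\<sigma> * t) \<in> S" using d by (simp add: S_def)
    have hg: "hardy p g" unfolding g_def by (intro hardy_scale hq_exp mem p0)
    have "Hp_integral p g r \<le> (2 * (1 / D)) powr p * (2 * pi)" if r: "0 < r" "r < 1" for r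
    proof -
      have "Hp_integral p g r \<le> (2 * (1 / D)) powr p * (Hp_integral p (\<lambda>_. 1) r + Hp_integral p (\<lambda>_. 0) r)"
      proof (rule Hp_integral_dominated)
        fix z assume z: "z \<in> unit_disc"
        have "cmod (exp (- \<i> * of_real (\<sigma> * t) * h z)) \<le> exp (t * \<beta>) * cmod (exp (of_real 0 * h z))"
          using cmod_exp_le[OF strip[OF z], of "- \<i> * of_real (\<sigma> * t)"] t by (cases "0 < Im \<xi>") (simp_all add: \<sigma>_def)
        then have "cmod (g z) \<le> exp (- (t * \<beta>)) * (1 / D * exp (t * \<beta>))"
          unfolding g_def norm_mult norm_of_real using qD[OF z] D by (intro mult_mono) auto
        also have "\<dots> = 1 / D" by (simp add: exp_minus)
        finally show "cmod (g z) \<le> 1 / D * (cmod 1 + cmod 0)" by simp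
      qed (use hg r p0 D in \<open>auto dest: hardy_holomorphic\<close>)
      then show ?thesis by (simp add: Hp_integral_eq)
    qed
    from bound_root[OF hg this] have "cmod (\<Lambda> g) \<le> B" by (simp add: B_def)
    moreover have "\<Lambda> g = of_real (exp (- (t * \<beta>))) * K (- \<i> * of_real (\<sigma> * t))"
      unfolding g_def K_def by (rule scale) (rule hq_exp[OF mem])
    ultimately have "exp (- (t * \<beta>)) * cmod (K (- \<i> * of_real (\<sigma> * t))) \<le> B" by (simp add: norm_mult)
    then show ?thesis by (simp add: exp_minus field_simps)
  qed
  have "c = 0"
  proof (rule ccontr)
    assume c0: "c \<noteq> 0"
    have "cmod c * exp (t * D) \<le> B" if t: "t \<ge> 0" for t
    proof -
      have "Re (\<xi> * (- \<i> * of_real (\<sigma> * t))) = t * \<bar>Im \<xi>\<bar>" by (simp add: \<sigma>_def)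
      then have "cmod (K (- \<i> * of_real (\<sigma> * t))) = cmod c * exp (t * \<bar>Im \<xi>\<bar>)"
        using Kc[of "- \<i> * of_real (\<sigma> * t)"] d by (simp add: S_def norm_mult)
      with K_bound[OF t] have "cmod c * exp (t * \<bar>Im \<xi>\<bar>) \<le> B * exp (t * \<beta>)" by simp
      moreover have "exp (t * \<bar>Im \<xi>\<bar>) = exp (t * D) * exp (t * \<beta>)" by (simp add: D_def algebra_simps flip: exp_add)
      ultimately show ?thesis by (simp add: mult.assoc[symmetric])
    qed
    moreover have "1 + t * D \<le> exp (t * D)" for t by simp
    ultimately have lin: "cmod c * (1 + t * D) \<le> B" if "t \<ge> 0" for t
      using that c0 by (meson mult_left_mono norm_ge_zero order_trans)
    define t where "t = \<bar>B\<bar> / (cmod c * D)"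
    have "cmod c * (1 + t * D) = cmod c + \<bar>B\<bar>" using c0 D by (simp add: t_def field_simps)
    moreover have "cmod c * (1 + t * D) \<le> B" by (rule lin) (use D in \<open>simp add: t_def\<close>)
    moreover have "0 < cmod c" "B \<le> \<bar>B\<bar>" using c0 by simp_all
    ultimately show False by linarith
  qed
  then have "K 0 = 0" using Kc[of 0] d by (simp add: S_def)
  then show "\<Lambda> (\<lambda>z. 1 / (\<xi> - h z)) = 0" by (simp add: K_def q_def)
qed

end

section \<open>Partial fractions and the hyperbolic tangent\<close>

text \<open>The logarithmic derivative of the reflection formula of the Gamma function.\<close>
lemma Digamma_reflection:
  fixes z :: complex
  assumes z: "z \<notin> \<int>"
  shows "Digamma (1 - z) - Digamma z = of_real pi * cos (of_real pi * z) / sin (of_real pi * z)"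
proof -
  have z1: "1 - z \<notin> \<int>" using z by (metis Ints_1 Ints_diff diff_diff_eq2 add_diff_cancel_left')
  have nz: "z \<notin> \<int>\<^sub>\<le>\<^sub>0" "1 - z \<notin> \<int>\<^sub>\<le>\<^sub>0" using z z1 nonpos_Ints_Int by blast+
  have "((\<lambda>w. rGamma w * rGamma (1 - w)) has_field_derivative
      (rGamma z * rGamma (1 - z) * (Digamma (1 - z) - Digamma z))) (at z)"
    by (rule derivative_eq_intros refl | use nz in \<open>simp add: algebra_simps\<close>)+
  moreover have "(\<lambda>w::complex. rGamma w * rGamma (1 - w)) = (\<lambda>w. sin (of_real pi * w) / of_real pi)"
    by (simp add: rGamma_reflection_complex fun_eq_iff)
  moreover have "((\<lambda>w. sin (of_real pi * w) / of_real pi) has_field_derivative cos (of_real pi * z)) (at z)"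
    by (auto intro!: derivative_eq_intros)
  ultimately have eq: "rGamma z * rGamma (1 - z) * (Digamma (1 - z) - Digamma z) = cos (of_real pi * z)"
    using DERIV_unique by fastforce
  have "rGamma z * rGamma (1 - z) \<noteq> 0" using nz by (simp add: rGamma_eq_zero_iff)
  then have "sin (of_real pi * z) \<noteq> 0" by (simp add: rGamma_reflection_complex)
  with eq show ?thesis by (simp add: rGamma_reflection_complex field_simps)
qed

lemma cot_partial_fractions:
  fixes z :: complex
  assumes z: "z \<notin> \<int>"
  shows "(\<lambda>m. \<Sum>n<m. 1 / (z + of_nat n) + 1 / (z - of_nat n - 1)) \<longlonglongrightarrow> of_real pi * cos (of_real pi * z) / sin (of_real pi * z)"
proof -
  have nz: "z \<noteq> 0" "1 - z \<noteq> 0" using z by auto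
  have "(\<lambda>m. (of_real (ln (real m)) - (\<Sum>n<m. inverse (1 - z + of_nat n))) - (of_real (ln (real m)) - (\<Sum>n<m. inverse (z + of_nat n))))
      \<longlonglongrightarrow> Digamma (1 - z) - Digamma z"
    by (intro tendsto_diff Digamma_LIMSEQ nz)
  also have "(\<lambda>m. (of_real (ln (real m)) - (\<Sum>n<m. inverse (1 - z + of_nat n))) - (of_real (ln (real m)) - (\<Sum>n<m. inverse (z + of_nat n))))
      = (\<lambda>m. \<Sum>n<m. 1 / (z + of_nat n) + 1 / (z - of_nat n - 1))"
  proof
    fix m
    have "- inverse (1 - z + of_nat n) = 1 / (z - of_nat n - 1)" for n
    proof -
      have "z - of_nat n - 1 = - (1 - z + of_nat n)" by simp
      then show ?thesis by (metis inverse_eq_divide inverse_minus_eq)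
    qed
    then have "- (\<Sum>n<m. inverse (1 - z + of_nat n)) = (\<Sum>n<m. 1 / (z - of_nat n - 1))"
      by (simp only: sum_negf[symmetric])
    then show "(of_real (ln (real m)) - (\<Sum>n<m. inverse (1 - z + of_nat n))) - (of_real (ln (real m)) - (\<Sum>n<m. inverse (z + of_nat n)))
      = (\<Sum>n<m. 1 / (z + of_nat n) + 1 / (z - of_nat n - 1))"
      by (simp add: sum.distrib inverse_eq_divide)
  qed
  finally show ?thesis by (simp add: Digamma_reflection[OF z])
qed

text \<open>
  The terms are \<open>O(|2z - 1| / n\<^sup>2)\<close> with a constant that is uniform on the strip \<open>0 < Re z < 1\<close>.
\<close>
lemma cot_partial_fractions_tail:
  fixes z :: complex
  assumes z: "0 < Re z" "Re z < 1" and m: "2 \<le> m"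
  shows "cmod (of_real pi * cos (of_real pi * z) / sin (of_real pi * z) - (\<Sum>n<m. 1 / (z + of_nat n) + 1 / (z - of_nat n - 1)))
     \<le> cmod (2 * z - 1) / (of_nat m - 1)"
proof -
  have zI: "z \<notin> \<int>" using z by (auto elim!: Ints_cases)
  define T where "T n = 1 / (z + of_nat n) + 1 / (z - of_nat n - 1)" for n
  have T: "cmod (T n) \<le> cmod (2 * z - 1) * (1 / (real n - 1) - 1 / real n)" if n: "2 \<le> n" for n
  proof -
    have a: "real n \<le> cmod (z + of_nat n)" using abs_Re_le_cmod[of "z + of_nat n"] z by simp
    have b: "real n \<le> cmod (z - of_nat n - 1)" using abs_Re_le_cmod[of "z - of_nat n - 1"] z by simp
    have n0: "real n \<ge> 2" using n by simp
    have nz: "z + of_nat n \<noteq> 0" "z - of_nat n - 1 \<noteq> 0" using a b n0 by auto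
    have "T n = (2 * z - 1) / ((z + of_nat n) * (z - of_nat n - 1))"
      unfolding T_def using nz by (simp add: add_frac_eq)
    then have "cmod (T n) = cmod (2 * z - 1) * (1 / (cmod (z + of_nat n) * cmod (z - of_nat n - 1)))"
      by (simp add: norm_divide norm_mult)
    also have "\<dots> \<le> cmod (2 * z - 1) * (1 / (real n * real n))"
      using a b n0 by (intro mult_left_mono divide_left_mono mult_mono mult_pos_pos) auto
    also have "1 / (real n * real n) \<le> 1 / (real n - 1) - 1 / real n"
      using n0 by (simp add: divide_simps)
    finally show ?thesis by (simp add: mult_left_mono)
  qed
  have tail: "cmod ((\<Sum>n<m + k. T n) - (\<Sum>n<m. T n)) \<le> cmod (2 * z - 1) * (1 / (real m - 1) - 1 / (real (m + k) - 1))" for k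
  proof (induction k)
    case (Suc k)
    have "cmod ((\<Sum>n<m + Suc k. T n) - (\<Sum>n<m. T n)) \<le> cmod ((\<Sum>n<m + k. T n) - (\<Sum>n<m. T n)) + cmod (T (m + k))"
      using norm_triangle_ineq[of "(\<Sum>n<m + k. T n) - (\<Sum>n<m. T n)" "T (m + k)"] by (simp add: algebra_simps)
    also have "\<dots> \<le> cmod (2 * z - 1) * (1 / (real m - 1) - 1 / (real (m + k) - 1)) + cmod (2 * z - 1) * (1 / (real (m + k) - 1) - 1 / real (m + k))"
      by (intro add_mono Suc T) (use m in auto)
    also have "\<dots> = cmod (2 * z - 1) * (1 / (real m - 1) - 1 / (real (m + Suc k) - 1))" by (simp add: algebra_simps)
    finally show ?case .
  qed simp
  have "(\<lambda>k. \<Sum>n<m + k. T n) \<longlonglongrightarrow> of_real pi * cos (of_real pi * z) / sin (of_real pi * z)"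
    using LIMSEQ_ignore_initial_segment[OF cot_partial_fractions[OF zI], of m] by (simp add: T_def add.commute)
  then have lim: "(\<lambda>k. cmod ((\<Sum>n<m + k. T n) - (\<Sum>n<m. T n))) \<longlonglongrightarrow> cmod (of_real pi * cos (of_real pi * z) / sin (of_real pi * z) - (\<Sum>n<m. T n))"
    by (intro tendsto_intros)
  have "cmod ((\<Sum>n<m + k. T n) - (\<Sum>n<m. T n)) \<le> cmod (2 * z - 1) / (real m - 1)" for k
  proof -
    have "0 \<le> 1 / (real (m + k) - 1)" using m by simp
    then have "cmod (2 * z - 1) * (1 / (real m - 1) - 1 / (real (m + k) - 1)) \<le> cmod (2 * z - 1) * (1 / (real m - 1))"
      by (intro mult_left_mono) auto
    with tail[of k] show ?thesis by simp
  qed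
  with lim show ?thesis unfolding T_def[symmetric] by (intro tendsto_upperbound[OF lim]) auto
qed

lemma geometric_as_cot:
  fixes z :: complex
  assumes "exp (- (2 * of_real pi * \<i> * z)) \<noteq> 1"
  shows "1 / (1 - exp (- (2 * of_real pi * \<i> * z))) = 1 / 2 - \<i> / (2 * of_real pi) * (of_real pi * cos (of_real pi * z) / sin (of_real pi * z))"
proof -
  define a where "a = exp (\<i> * (of_real pi * z))"
  have a0: "a \<noteq> 0" by (simp add: a_def)
  have E: "exp (- (2 * of_real pi * \<i> * z)) = 1 / a\<^sup>2"
    by (simp add: a_def exp_minus field_simps flip: exp_double)
  have c: "cos (of_real pi * z) = (a + 1 / a) / 2" unfolding cos_exp_eq a_def exp_minus by (simp add: inverse_eq_divide)
  have s: "sin (of_real pi * z) = (a - 1 / a) / (2 * \<i>)" unfolding sin_exp_eq a_def exp_minus by (simp add: inverse_eq_divide)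
  have a2: "a\<^sup>2 \<noteq> 1" using assms E by auto
  have "cos (of_real pi * z) / sin (of_real pi * z) = \<i> * (a\<^sup>2 + 1) / (a\<^sup>2 - 1)"
  proof -
    have "a + 1 / a = (a\<^sup>2 + 1) / a" "a - 1 / a = (a\<^sup>2 - 1) / a" using a0 by (auto simp: field_simps power2_eq_square)
    moreover have "(P / a / 2) / ((Q / a) / (2 * \<i>)) = \<i> * P / Q" if "Q \<noteq> 0" for P Q :: complex
      using a0 that by (simp add: field_simps)
    ultimately show ?thesis unfolding c s using a2 by simp
  qed
  then have ct: "of_real pi * cos (of_real pi * z) / sin (of_real pi * z) = of_real pi * (\<i> * ((a\<^sup>2 + 1) / (a\<^sup>2 - 1)))"
    by (metis times_divide_eq_right)
  have "1 / 2 - \<i> / (2 * of_real pi) * (of_real pi * (\<i> * Q)) = (1 + Q) / 2" for Q :: complex by (simp add: field_simps)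
  then have "1 / 2 - \<i> / (2 * of_real pi) * (of_real pi * cos (of_real pi * z) / sin (of_real pi * z)) = (1 + (a\<^sup>2 + 1) / (a\<^sup>2 - 1)) / 2"
    by (simp only: ct)
  also have "1 + (a\<^sup>2 + 1) / (a\<^sup>2 - 1) = 2 * a\<^sup>2 / (a\<^sup>2 - 1)" using a2 by (simp add: field_simps)
  also have "2 * a\<^sup>2 / (a\<^sup>2 - 1) / 2 = 1 / (1 - 1 / a\<^sup>2)"
  proof -
    have "1 - 1 / a\<^sup>2 = (a\<^sup>2 - 1) / a\<^sup>2" using a0 by (simp add: diff_divide_distrib)
    moreover have "2 * u / v / 2 = 1 / (v / u)" for u v :: complex by simp
    ultimately show ?thesis by (simp only:)
  qed
  finally show ?thesis by (simp add: E)
qed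

text \<open>
  This is \<open>tanh(w/2)\<close>, which maps the strip \<open>|Im w| < \<pi>/2\<close> conformally onto the unit disc.
\<close>
definition strip_to_disc :: "complex \<Rightarrow> complex" where
  "strip_to_disc w = (exp w - 1) / (exp w + 1)"

lemma exp_strip_pos: "\<bar>Im w\<bar> < pi / 2 \<Longrightarrow> 0 < Re (exp w)"
  by (auto simp: Re_exp intro!: mult_pos_pos cos_gt_zero_pi)

lemma exp_strip_plus_one: "\<bar>Im w\<bar> < pi / 2 \<Longrightarrow> exp w + 1 \<noteq> 0"
  using exp_strip_pos[of w] by (metis add.commute add_pos_pos less_irrefl plus_complex.simps(1) one_complex.simps(1) zero_complex.simps(1) zero_less_one)

lemma Cayley_in_disc:
  assumes "0 < Re X"
  shows "cmod ((X - 1) / (X + 1)) < 1"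
proof -
  have "(cmod (X - 1))\<^sup>2 < (cmod (X + 1))\<^sup>2"
    unfolding cmod_power2 using assms by (simp add: power2_eq_square algebra_simps)
  then have "cmod (X - 1) < cmod (X + 1)" by (rule power2_less_imp_less) simp
  then show ?thesis by (simp add: norm_divide divide_less_eq)
qed

lemma strip_to_disc_in_disc: "\<bar>Im w\<bar> < pi / 2 \<Longrightarrow> cmod (strip_to_disc w) < 1"
  unfolding strip_to_disc_def by (intro Cayley_in_disc exp_strip_pos)

lemma strip_to_disc_holomorphic: "(\<And>w. w \<in> S \<Longrightarrow> \<bar>Im w\<bar> < pi / 2) \<Longrightarrow> strip_to_disc holomorphic_on S"
  unfolding strip_to_disc_def using exp_strip_plus_one by (intro holomorphic_intros) auto

definition disc_to_strip :: "complex \<Rightarrow> complex" where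
  "disc_to_strip x = Ln ((1 + x) / (1 - x))"

lemma Cayley_inverse_pos:
  assumes "cmod x < 1"
  shows "0 < Re ((1 + x) / (1 - x))"
proof -
  have "(cmod x)\<^sup>2 < 1" using assms by (simp add: abs_square_less_1)
  then have "0 < Re ((1 + x) * cnj (1 - x))" unfolding cmod_power2 by (simp add: power2_eq_square algebra_simps)
  moreover have "1 - x \<noteq> 0" using assms by auto
  ultimately show ?thesis by (simp add: complex_div_cnj[of "1 + x" "1 - x"] Re_divide_of_real del: complex_cnj_diff)
qed

lemma disc_to_strip_in_strip: "cmod x < 1 \<Longrightarrow> \<bar>Im (disc_to_strip x)\<bar> < pi / 2"
  unfolding disc_to_strip_def by (intro Re_Ln_pos_lt_imp Cayley_inverse_pos)

lemma strip_to_disc_to_strip: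
  assumes "cmod x < 1"
  shows "strip_to_disc (disc_to_strip x) = x"
proof -
  have 1: "1 - x \<noteq> 0" using assms by auto
  have "(1 + x) / (1 - x) \<noteq> 0" using Cayley_inverse_pos[OF assms] by auto
  then have "exp (disc_to_strip x) = (1 + x) / (1 - x)" by (simp add: disc_to_strip_def)
  then have "exp (disc_to_strip x) - 1 = 2 * x / (1 - x)" "exp (disc_to_strip x) + 1 = 2 / (1 - x)"
    using 1 by (simp_all add: field_simps)
  then show ?thesis unfolding strip_to_disc_def using 1 by simp
qed

lemma disc_to_strip_to_disc:
  assumes "\<bar>Im w\<bar> < pi / 2"
  shows "disc_to_strip (strip_to_disc w) = w"
proof -
  have nz: "exp w + 1 \<noteq> 0" by (rule exp_strip_plus_one[OF assms])
  then have "1 + strip_to_disc w = 2 * exp w / (exp w + 1)" "1 - strip_to_disc w = 2 / (exp w + 1)"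
    unfolding strip_to_disc_def by (simp_all add: field_simps)
  then have "(1 + strip_to_disc w) / (1 - strip_to_disc w) = exp w" using nz by simp
  moreover have "Ln (exp w) = w" by (rule Ln_exp) (use assms pi_gt_zero in auto)
  ultimately show ?thesis by (simp add: disc_to_strip_def)
qed

lemma disc_to_strip_holomorphic: "disc_to_strip holomorphic_on unit_disc"
  unfolding disc_to_strip_def
proof (intro holomorphic_intros)
  fix x :: complex assume x: "x \<in> unit_disc"
  then show "1 - x \<noteq> 0" by auto
  show "(1 + x) / (1 - x) \<notin> \<real>\<^sub>\<le>\<^sub>0" using Cayley_inverse_pos[of x] x by (auto simp: complex_nonpos_Reals_iff)
qed

context strip_functional
begin

text \<open>
  The poles of \<open>1 / (1 - e\<^bsup>w - \<xi>\<^esup>)\<close> are the points \<open>\<xi> + 2\<pi>\<i>n\<close>, all of them off the strip.  The expansion of the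
  cotangent writes the function as a series of resolvents of \<open>h\<close>, and the remainders are dominated by
  an affine function of \<open>h\<close>, which belongs to the Hardy space.
\<close>
lemma periodic_resolvent:
  assumes res: "\<And>\<xi>. \<beta> < \<bar>Im \<xi>\<bar> \<Longrightarrow> \<Lambda> (\<lambda>z. 1 / (\<xi> - h z)) = 0"
    and res_h: "\<And>\<xi>. \<beta> < \<bar>Im \<xi>\<bar> \<Longrightarrow> hardy p (\<lambda>z. 1 / (\<xi> - h z))"
    and one: "\<Lambda> (\<lambda>_. 1) = 0" and hh: "hardy p h" and \<beta>: "\<beta> < pi / 2"
    and \<xi>: "pi / 2 \<le> Im \<xi>" "Im \<xi> \<le> 3 * pi / 2"
  shows "\<Lambda> (\<lambda>z. 1 / (1 - exp (h z - \<xi>))) = 0" "hardy p (\<lambda>z. 1 / (1 - exp (h z - \<xi>)))"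
proof -
  define y where "y z = (\<xi> - h z) / (2 * of_real pi * \<i>)" for z
  have tpi: "2 * of_real pi * \<i> \<noteq> (0 :: complex)" by simp
  have Re_y: "Re (y z) = (Im \<xi> - Im (h z)) / (2 * pi)" for z
  proof -
    have "y z = - \<i> * (\<xi> - h z) / of_real (2 * pi)" by (simp add: y_def field_simps)
    then show ?thesis by (simp only: Re_divide_of_real) simp
  qed
  have y: "0 < Re (y z)" "Re (y z) < 1" if "z \<in> unit_disc" for z
    using strip[OF that] \<beta> \<xi> pi_gt_zero by (auto simp: Re_y field_simps)
  have hy: "y holomorphic_on unit_disc" unfolding y_def[abs_def] by (intro holomorphic_intros h) auto
  have yexp: "exp (h z - \<xi>) = exp (- (2 * of_real pi * \<i> * y z))" for z using tpi by (simp add: y_def)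
  have ne1: "exp (h z - \<xi>) \<noteq> 1" if "z \<in> unit_disc" for z
  proof
    assume "exp (h z - \<xi>) = 1"
    then obtain n :: int where n: "Im (h z - \<xi>) = of_int (2 * n) * pi" unfolding exp_eq_1 by auto
    have "\<bar>Im (h z)\<bar> < pi / 2" using strip[OF that] \<beta> by simp
    then have "- (2 * pi) < Im (h z - \<xi>)" "Im (h z - \<xi>) < 0" using \<xi> unfolding minus_complex.simps by linarith+
    then have "- (2 * pi) < of_int (2 * n) * pi" "of_int (2 * n) * pi < 0" unfolding n by blast+
    then have "- 2 < (of_int (2 * n) :: real)" "of_int (2 * n) < (0::real)"
      using mult_less_cancel_right_pos[OF pi_gt_zero, of "-2" "of_int (2 * n)"] by (auto simp: mult_less_0_iff)
    then show False by auto
  qed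
  define f where "f z = 1 / (1 - exp (h z - \<xi>))" for z
  define T where "T n z = 1 / (y z + of_nat n) + 1 / (y z - of_nat n - 1)" for n :: nat and z
  define g where "g m z = 1 / 2 - \<i> / (2 * of_real pi) * (\<Sum>n<m. T n z)" for m :: nat and z
  have fg: "cmod (f z - g m z) \<le> 1 / (real m - 1) * (cmod (2 * y z - 1) + cmod 0)" if z: "z \<in> unit_disc" and m: "2 \<le> m" for z m
  proof -
    have "f z = 1 / 2 - \<i> / (2 * of_real pi) * (of_real pi * cos (of_real pi * y z) / sin (of_real pi * y z))"
      unfolding f_def yexp by (rule geometric_as_cot) (use ne1[OF z] yexp in simp)
    then have "f z - g m z = - (\<i> / (2 * of_real pi)) * (of_real pi * cos (of_real pi * y z) / sin (of_real pi * y z) - (\<Sum>n<m. T n z))"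
      by (simp add: g_def algebra_simps)
    then have "cmod (f z - g m z) = 1 / (2 * pi) * cmod (of_real pi * cos (of_real pi * y z) / sin (of_real pi * y z) - (\<Sum>n<m. T n z))"
      by (simp only: norm_mult norm_minus_cancel norm_divide) simp
    also have "\<dots> \<le> 1 * (cmod (2 * y z - 1) / (real m - 1))"
      using pi_ge_two cot_partial_fractions_tail[OF y[OF z] m] unfolding T_def by (intro mult_mono) auto
    finally show ?thesis by simp
  qed
  have T_eq: "T n z = (2 * of_real pi * \<i>) * (1 / ((\<xi> + 2 * of_real pi * \<i> * of_nat n) - h z))
      + (2 * of_real pi * \<i>) * (1 / ((\<xi> - 2 * of_real pi * \<i> * (of_nat n + 1)) - h z))" for n z
  proof -
    have "y z + of_nat n = ((\<xi> + 2 * of_real pi * \<i> * of_nat n) - h z) / (2 * of_real pi * \<i>)"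
      by (simp add: y_def field_simps)
    moreover have "y z - of_nat n - 1 = ((\<xi> - 2 * of_real pi * \<i> * (of_nat n + 1)) - h z) / (2 * of_real pi * \<i>)"
      by (simp add: y_def field_simps)
    ultimately show ?thesis unfolding T_def by simp
  qed
  have pos1: "\<beta> < \<bar>Im (\<xi> + 2 * of_real pi * \<i> * of_nat n)\<bar>" for n :: nat
  proof -
    have "Im \<xi> \<le> Im (\<xi> + 2 * of_real pi * \<i> * of_nat n)" by simp
    then show ?thesis using \<beta> \<xi> by linarith
  qed
  have pos2: "\<beta> < \<bar>Im (\<xi> - 2 * of_real pi * \<i> * (of_nat n + 1))\<bar>" for n :: nat
  proof -
    have "0 \<le> 2 * pi * real n" by simp
    then have "Im (\<xi> - 2 * of_real pi * \<i> * (of_nat n + 1)) \<le> Im \<xi> - 2 * pi" by (simp add: algebra_simps)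
    then show ?thesis using \<beta> \<xi> by linarith
  qed
  have T_h: "hardy p (T n)" for n unfolding T_eq[abs_def] by (intro hardy_add hardy_scale res_h pos1 pos2 p0)
  have T_0: "\<Lambda> (T n) = 0" for n
  proof -
    have "\<Lambda> (T n) = \<Lambda> (\<lambda>z. (2 * of_real pi * \<i>) * (1 / ((\<xi> + 2 * of_real pi * \<i> * of_nat n) - h z)))
      + \<Lambda> (\<lambda>z. (2 * of_real pi * \<i>) * (1 / ((\<xi> - 2 * of_real pi * \<i> * (of_nat n + 1)) - h z)))"
      unfolding T_eq[abs_def] by (intro add hardy_scale res_h pos1 pos2 p0)
    also have "\<dots> = 0"
      by (simp only: scale[OF res_h[OF pos1]] scale[OF res_h[OF pos2]] res[OF pos1] res[OF pos2] mult_zero_right add_0)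
    finally show ?thesis .
  qed
  have sT_h: "hardy p (\<lambda>z. \<Sum>n<m. T n z)" for m by (intro hardy_sum T_h p0)
  have sT_0: "\<Lambda> (\<lambda>z. \<Sum>n<m. T n z) = 0" for m
    using sum[of "{..<m}" T "\<lambda>_. 1"] T_h T_0 by simp
  have g_h: "hardy p (g m)" for m unfolding g_def[abs_def] by (intro hardy_diff hardy_const hardy_scale sT_h p0)
  have g_0: "\<Lambda> (g m) = 0" for m
  proof -
    have "\<Lambda> (g m) = \<Lambda> (\<lambda>z. 1 / 2) - \<Lambda> (\<lambda>z. \<i> / (2 * of_real pi) * (\<Sum>n<m. T n z))"
      unfolding g_def[abs_def] by (intro diff hardy_const hardy_scale sT_h p0)
    also have "\<Lambda> (\<lambda>z. \<i> / (2 * of_real pi) * (\<Sum>n<m. T n z)) = 0" by (simp only: scale[OF sT_h] sT_0 mult_zero_right)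
    also have "\<Lambda> (\<lambda>z. 1 / 2) = 0" using scale[OF hardy_const[of p 1], of "1/2"] one by simp
    finally show ?thesis by simp
  qed
  have M_h: "hardy p (\<lambda>z. 2 * y z - 1)"
    using hardy_diff[OF hardy_diff[OF hardy_const hardy_scale[OF hh p0, of "1 / (of_real pi * \<i>)"] p0] hardy_const[of p 1] p0, of "\<xi> / (of_real pi * \<i>)"]
    by (simp add: y_def diff_divide_distrib)
  have hf: "f holomorphic_on unit_disc" unfolding f_def[abs_def] using ne1 by (intro holomorphic_intros h) auto
  have f_h: "hardy p f"
  proof -
    have "hardy p (\<lambda>z. f z - g 2 z)"
      by (rule hardy_dominated[OF _ M_h hardy_const[of p 0] p0, where c = 1])
         (use fg[of _ 2] hf hardy_holomorphic[OF g_h] in \<open>auto intro!: holomorphic_intros\<close>)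
    from hardy_add[OF this g_h[of 2] p0] show ?thesis by simp
  qed
  then show "hardy p (\<lambda>z. 1 / (1 - exp (h z - \<xi>)))" by (simp add: f_def[abs_def])
  have "\<Lambda> f = 0"
  proof (rule approximation_dominated[OF f_h M_h hardy_const[of p 0]])
    fix \<epsilon> :: real assume e: "\<epsilon> > 0"
    obtain m :: nat where m: "1 / \<epsilon> + 2 < real m" using reals_Archimedean2 by blast
    have "0 < 1 / \<epsilon>" using e by simp
    then have m2: "2 \<le> m" "1 / \<epsilon> \<le> real m - 1" using m by linarith+
    have "1 / (real m - 1) \<le> \<epsilon>" using m2 e by (simp add: field_simps)
    then have "cmod (f z - g m z) \<le> \<epsilon> * (cmod (2 * y z - 1) + cmod 0)" if "z \<in> unit_disc" for z
      using fg[OF that m2(1)] by (meson order_trans mult_right_mono add_nonneg_nonneg norm_ge_zero)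
    then show "\<exists>k. hardy p k \<and> \<Lambda> k = 0 \<and> (\<forall>z\<in>unit_disc. cmod (f z - k z) \<le> \<epsilon> * (cmod (2 * y z - 1) + cmod 0))"
      using g_h g_0 by blast
  qed
  then show "\<Lambda> (\<lambda>z. 1 / (1 - exp (h z - \<xi>))) = 0" by (simp add: f_def[abs_def])
qed

text \<open>
  For \<open>|x| > 1\<close> the function \<open>1 / (x - tanh(h/2))\<close> is an affine function of \<open>1 / (1 - e\<^bsup>h - \<xi>\<^esup>)\<close>,
  where \<open>tanh(\<xi>/2) = x\<close> and \<open>\<pi>/2 < Im \<xi> < 3\<pi>/2\<close>.
\<close>
lemma tanh_resolvent_outside_disc:
  assumes per: "\<And>\<xi>. pi / 2 \<le> Im \<xi> \<Longrightarrow> Im \<xi> \<le> 3 * pi / 2 \<Longrightarrow> \<Lambda> (\<lambda>z. 1 / (1 - exp (h z - \<xi>))) = 0 \<and> hardy p (\<lambda>z. 1 / (1 - exp (h z - \<xi>)))"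
    and one: "\<Lambda> (\<lambda>_. 1) = 0" and \<beta>: "\<beta> < pi / 2" and x: "1 < cmod x"
  shows "\<Lambda> (\<lambda>z. 1 / (x - strip_to_disc (h z))) = 0"
proof -
  have x1: "1 - x \<noteq> 0" "1 + x \<noteq> 0" using x by (auto simp: add_eq_0_iff)
  define Y where "Y = (1 + x) / (1 - x)"
  have Y0: "Y \<noteq> 0" "Y + 1 \<noteq> 0" using x1 by (auto simp: Y_def field_simps)
  have xY: "x = (Y - 1) / (Y + 1)"
  proof -
    have "Y - 1 = 2 * x / (1 - x)" "Y + 1 = 2 / (1 - x)" using x1 by (auto simp: Y_def field_simps)
    then show ?thesis using x1 by simp
  qed
  have "0 < Re (- Y)"
  proof -
    have "1 < (cmod x)\<^sup>2" using x by (simp add: power_strict_mono[of 1 "cmod x" 2, simplified])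
    then have "0 < Re (- ((1 + x) * cnj (1 - x)))" unfolding cmod_power2 by (simp add: power2_eq_square algebra_simps)
    moreover have "- Y = - ((1 + x) * cnj (1 - x)) / of_real ((cmod (1 - x))\<^sup>2)"
      unfolding Y_def by (subst complex_div_cnj) simp
    ultimately show ?thesis using x1 by (simp only: Re_divide_of_real) simp
  qed
  then have L: "\<bar>Im (Ln (- Y))\<bar> < pi / 2" by (rule Re_Ln_pos_lt_imp)
  define \<xi> where "\<xi> = Ln (- Y) + \<i> * of_real pi"
  have \<xi>: "pi / 2 \<le> Im \<xi>" "Im \<xi> \<le> 3 * pi / 2" using L by (auto simp: \<xi>_def)
  have e\<xi>: "exp \<xi> = Y" using Y0 by (simp add: \<xi>_def exp_add)
  have P: "\<Lambda> (\<lambda>z. 1 / (1 - exp (h z - \<xi>))) = 0" "hardy p (\<lambda>z. 1 / (1 - exp (h z - \<xi>)))" using per[OF \<xi>] by auto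
  define c0 where "c0 = (Y + 1) / 2"
  define c where "c = c0 * ((Y + 1) / Y)"
  have "\<Lambda> (\<lambda>z. 1 / (x - strip_to_disc (h z))) = \<Lambda> (\<lambda>z. c * (1 / (1 - exp (h z - \<xi>))) + - c0 * 1)"
  proof (rule cong)
    fix z assume z: "z \<in> unit_disc"
    define X where "X = exp (h z)"
    have im: "\<bar>Im (h z)\<bar> < pi / 2" using strip[OF z] \<beta> by simp
    have X1: "X + 1 \<noteq> 0" unfolding X_def by (rule exp_strip_plus_one[OF im])
    have "strip_to_disc (h z) \<noteq> x" using strip_to_disc_in_disc[OF im] x by auto
    then have XY: "Y - X \<noteq> 0" unfolding strip_to_disc_def X_def[symmetric] using xY by auto
    have eX: "1 - exp (h z - \<xi>) = (Y - X) / Y" using Y0 by (simp add: exp_diff e\<xi> X_def field_simps)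
    have "x - strip_to_disc (h z) = 2 * (Y - X) / ((Y + 1) * (X + 1))"
      unfolding strip_to_disc_def X_def[symmetric] by (subst xY) (use Y0 X1 in \<open>simp add: field_simps\<close>)
    then have "1 / (x - strip_to_disc (h z)) = c0 * ((X + 1) / (Y - X))" using Y0 X1 XY by (simp add: c0_def)
    also have "(X + 1) / (Y - X) = (Y + 1) / (Y - X) - 1" using XY by (simp add: field_simps)
    also have "c0 * ((Y + 1) / (Y - X) - 1) = c * (1 / (1 - exp (h z - \<xi>))) + - c0 * 1"
      unfolding eX c_def using Y0 XY by (simp add: right_diff_distrib)
    finally show "1 / (x - strip_to_disc (h z)) = c * (1 / (1 - exp (h z - \<xi>))) + - c0 * 1" .
  qed
  also have "\<dots> = \<Lambda> (\<lambda>z. c * (1 / (1 - exp (h z - \<xi>)))) + \<Lambda> (\<lambda>z. - c0 * 1)"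
    by (intro add hardy_scale P hardy_const p0)
  also have "\<dots> = 0" by (simp only: scale[OF P(2)] scale[OF hardy_const[of p 1]] P(1) one mult_zero_right add_0)
  finally show ?thesis .
qed

text \<open>
  The function \<open>x \<mapsto> \<Lambda>(1/(x - H))\<close> is holomorphic on the connected complement of \<open>K\<close>.
\<close>
lemma resolvent_continuation:
  assumes H: "H holomorphic_on unit_disc" "H ` unit_disc \<subseteq> K" and K: "closed K" "connected (- K)" "K \<subseteq> cball 0 1"
    and out: "\<And>x. 1 < cmod x \<Longrightarrow> \<Lambda> (\<lambda>z. 1 / (x - H z)) = 0" and x: "x \<notin> K"
  shows "\<Lambda> (\<lambda>z. 1 / (x - H z)) = 0"
proof -
  have neK: "K \<noteq> {}" using H(2) by auto
  have HK: "H z \<in> K" if "z \<in> unit_disc" for z using H(2) that by blast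
  have "(\<lambda>x. \<Lambda> (\<lambda>z. 1 / (x - H z))) field_differentiable at x" if x: "x \<notin> K" for x
  proof -
    define d where "d = infdist x K"
    have d: "d > 0" using infdist_pos_not_in_closed[OF K(1) neK x] by (simp add: d_def)
    have dx: "d \<le> cmod (x - H z)" if "z \<in> unit_disc" for z
      using infdist_le[OF HK[OF that], of x] by (simp add: d_def dist_norm)
    have dx': "d / 2 \<le> cmod (x + \<eta> - H z)" if "z \<in> unit_disc" "cmod \<eta> < d / 2" for z \<eta>
      using dx[OF that(1)] that(2) norm_triangle_ineq2[of "x - H z" "- \<eta>"] by (simp add: algebra_simps)
    have res: "hardy p (\<lambda>z. 1 / (x + \<eta> - H z))" if "cmod \<eta> < d / 2" for \<eta>
    proof (rule hardy_bounded[OF _ _ p0])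
      show "(\<lambda>z. 1 / (x + \<eta> - H z)) holomorphic_on unit_disc"
        by (intro holomorphic_intros H(1)) (use dx'[OF _ that] d in force)
      show "cmod (1 / (x + \<eta> - H z)) \<le> 2 / d" if "z \<in> unit_disc" for z
      proof -
        have "1 / cmod (x + \<eta> - H z) \<le> 1 / (d / 2)"
          using dx'[OF that \<open>cmod \<eta> < d / 2\<close>] d by (intro frac_le) auto
        then show ?thesis by (simp add: norm_divide)
      qed
    qed
    have nz: "x - H z \<noteq> 0" if "z \<in> unit_disc" for z using dx[OF that] d by auto
    have "((\<lambda>x. \<Lambda> (\<lambda>z. 1 / (x - H z))) has_field_derivative \<Lambda> (\<lambda>z. - 1 / (x - H z)\<^sup>2)) (at x)"
    proof (rule has_derivative_dominated[where \<delta> = "d / 2" and M = "\<lambda>_. of_real (2 / d ^ 3)" and N = "\<lambda>_. 0"])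
      show "hardy p (\<lambda>z. - 1 / (x - H z)\<^sup>2)"
      proof (rule hardy_bounded[OF _ _ p0])
        show "(\<lambda>z. - 1 / (x - H z)\<^sup>2) holomorphic_on unit_disc" using nz by (intro holomorphic_intros H(1)) auto
        show "cmod (- 1 / (x - H z)\<^sup>2) \<le> 1 / d\<^sup>2" if "z \<in> unit_disc" for z
          using dx[OF that] d by (simp add: norm_divide norm_power frac_le power_mono)
      qed
      fix \<eta> z :: complex assume \<eta>: "cmod \<eta> < d / 2" and z: "z \<in> unit_disc"
      define a where "a = x - H z"
      have a: "a \<noteq> 0" "d \<le> cmod a" using nz[OF z] dx[OF z] by (auto simp: a_def)
      have b: "d / 2 \<le> cmod (a + \<eta>)" using dx'[OF z \<eta>] by (simp add: a_def algebra_simps)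
      then have b0: "a + \<eta> \<noteq> 0" using d by auto
      have "1 / (a + \<eta>) - 1 / a - \<eta> * (- 1 / a\<^sup>2) = \<eta>\<^sup>2 / ((a + \<eta>) * a\<^sup>2)"
      proof -
        have "1 / y - 1 / x - (y - x) * (- 1 / x\<^sup>2) = (y - x)\<^sup>2 / (y * x\<^sup>2)" if "x \<noteq> 0" "y \<noteq> 0" for x y :: complex
          using that by (simp add: field_simps power2_eq_square)
        from this[OF a(1) b0] show ?thesis by simp
      qed
      then have "cmod (1 / (a + \<eta>) - 1 / a - \<eta> * (- 1 / a\<^sup>2)) = (cmod \<eta>)\<^sup>2 * (1 / (cmod (a + \<eta>) * (cmod a)\<^sup>2))"
        by (simp add: norm_divide norm_mult norm_power)
      also have "\<dots> \<le> (cmod \<eta>)\<^sup>2 * (1 / (d / 2 * d\<^sup>2))"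
        using a b d by (intro mult_left_mono divide_left_mono mult_mono power_mono mult_pos_pos) auto
      also have "1 / (d / 2 * d\<^sup>2) = 2 / d ^ 3" by (simp add: power2_eq_square power3_eq_cube)
      finally show "cmod (1 / (x + \<eta> - H z) - 1 / (x - H z) - \<eta> * (- 1 / (x - H z)\<^sup>2)) \<le> (cmod \<eta>)\<^sup>2 * (cmod (of_real (2 / d ^ 3)) + cmod 0)"
        using d unfolding a_def norm_of_real by (simp add: algebra_simps)
    qed (use res d hardy_const in auto)
    then show ?thesis unfolding field_differentiable_def by blast
  qed
  then have hol: "(\<lambda>x. \<Lambda> (\<lambda>z. 1 / (x - H z))) holomorphic_on - K"
    by (auto simp: holomorphic_on_def intro: field_differentiable_at_within)
  show ?thesis
  proof (rule analytic_continuation_open[where f = "\<lambda>x. \<Lambda> (\<lambda>z. 1 / (x - H z))" and g = "\<lambda>_. 0" and s = "- cball 0 1" and s' = "- K"])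
    have "(2::complex) \<in> - cball 0 1" by simp
    then show "- cball (0::complex) 1 \<noteq> {}" by blast
    show "- cball 0 1 \<subseteq> - K" using K(3) by blast
  qed (use K out hol x in \<open>auto simp: open_Compl\<close>)
qed

end

section \<open>The image of a strip domain in the disc\<close>

lemma exp_cone: "\<bar>Im w\<bar> \<le> \<beta> \<Longrightarrow> \<beta> < pi / 2 \<Longrightarrow> cos \<beta> * cmod (exp w) \<le> Re (exp w)"
proof -
  assume w: "\<bar>Im w\<bar> \<le> \<beta>" "\<beta> < pi / 2"
  have "cos \<beta> \<le> cos \<bar>Im w\<bar>" using w pi_gt_zero by (intro cos_monotone_0_pi_le) auto
  then show ?thesis by (simp add: Re_exp mult.commute mult_left_mono)
qed

text \<open>
  On a strip with \<open>\<beta> < \<pi>/2\<close> the exponential stays in the cone \<open>cos \<beta> |v| \<le> Re v\<close>, while \<open>\<plusminus>\<i>\<close> correspond to the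
  points \<open>\<plusminus>\<i>\<close> off that cone.
\<close>
lemma unit_points_not_limits:
  assumes S': "\<forall>w\<in>S. \<bar>Im w\<bar> \<le> \<beta>" and \<beta>: "\<beta> < pi / 2" and x: "x = \<i> \<or> x = - \<i>"
  shows "x \<notin> closure (strip_to_disc ` S)"
proof
  note S = bspec[OF S']
  assume "x \<in> closure (strip_to_disc ` S)"
  then obtain u where u: "\<And>n::nat. u n \<in> strip_to_disc ` S" "u \<longlonglongrightarrow> x" by (auto simp: closure_sequential)
  have "\<forall>n. \<exists>v. v \<in> S \<and> u n = strip_to_disc v" using u(1) by blast
  from choice[OF this] obtain w where w: "\<And>n. w n \<in> S" "\<And>n. u n = strip_to_disc (w n)" by blast
  have im: "\<bar>Im (w n)\<bar> < pi / 2" for n using S[OF w(1)[of n]] \<beta> by simp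
  have eq: "(1 + u n) / (1 - u n) = exp (w n)" for n
  proof -
    have nz: "exp (w n) + 1 \<noteq> 0" by (rule exp_strip_plus_one[OF im])
    then have "1 + u n = 2 * exp (w n) / (exp (w n) + 1)" "1 - u n = 2 / (exp (w n) + 1)"
      unfolding w(2) strip_to_disc_def by (simp_all add: field_simps)
    then show ?thesis using nz by simp
  qed
  define y where "y = (1 + x) / (1 - x)"
  have nx: "1 - x \<noteq> 0" using x by (auto simp: complex_eq_iff)
  have "x * x = - 1" using x by auto
  then have "y = x" using nx by (simp add: y_def field_simps)
  then have y: "cmod y = 1" "Re y = 0" using x by auto
  have lim: "(\<lambda>n. exp (w n)) \<longlonglongrightarrow> y" unfolding eq[symmetric] y_def by (intro tendsto_intros u(2) nx)
  have "cos \<beta> * cmod y \<le> Re y"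
    by (rule LIMSEQ_le[where X = "\<lambda>n. cos \<beta> * cmod (exp (w n))" and Y = "\<lambda>n. Re (exp (w n))"])
       (use lim exp_cone[OF S[OF w(1)] \<beta>] in \<open>auto intro!: tendsto_intros simp del: norm_exp_eq_Re Re_exp\<close>)
  moreover have "0 \<le> \<beta>" using S[OF w(1)[of 0]] by linarith
  then have "cos \<beta> > 0" using \<beta> by (intro cos_gt_zero_pi) auto
  ultimately show False using y by simp
qed

lemma closed_image_in_disc:
  assumes S': "\<forall>w\<in>S. \<bar>Im w\<bar> \<le> \<beta>" and \<beta>: "\<beta> < pi / 2"
  shows "closure (strip_to_disc ` S) \<inter> unit_disc = strip_to_disc ` closure S"
    "\<And>w. w \<in> closure S \<Longrightarrow> \<bar>Im w\<bar> \<le> \<beta>" "closure (strip_to_disc ` S) \<subseteq> cball 0 1"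
proof -
  note S = bspec[OF S']
  have "closed {w. \<bar>Im w\<bar> \<le> \<beta>}" by (intro closed_Collect_le continuous_intros)
  then have "closure S \<subseteq> {w. \<bar>Im w\<bar> \<le> \<beta>}" using S by (intro closure_minimal) auto
  then show cl: "\<bar>Im w\<bar> \<le> \<beta>" if "w \<in> closure S" for w using that by blast
  have "strip_to_disc ` S \<subseteq> cball 0 1"
    using S \<beta> strip_to_disc_in_disc by (force intro: less_imp_le)
  then show "closure (strip_to_disc ` S) \<subseteq> cball 0 1" by (intro closure_minimal) auto
  show "closure (strip_to_disc ` S) \<inter> unit_disc = strip_to_disc ` closure S"
  proof (intro equalityI subsetI)
    fix x assume x: "x \<in> closure (strip_to_disc ` S) \<inter> unit_disc"
    then obtain u where u: "\<And>n::nat. u n \<in> strip_to_disc ` S" "u \<longlonglongrightarrow> x" by (auto simp: closure_sequential)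
    have "\<forall>n. \<exists>v. v \<in> S \<and> u n = strip_to_disc v" using u(1) by blast
  from choice[OF this] obtain w where w: "\<And>n. w n \<in> S" "\<And>n. u n = strip_to_disc (w n)" by blast
    have ud: "u n \<in> unit_disc" for n using strip_to_disc_in_disc[of "w n"] S[OF w(1)[of n]] \<beta> by (simp add: w(2))
    have "(\<lambda>n. disc_to_strip (u n)) \<longlonglongrightarrow> disc_to_strip x"
      by (rule continuous_on_tendsto_compose[OF holomorphic_on_imp_continuous_on[OF disc_to_strip_holomorphic] u(2)])
         (use x ud in auto)
    moreover have "disc_to_strip (u n) = w n" for n
      unfolding w(2) by (rule disc_to_strip_to_disc) (use S[OF w(1)[of n]] \<beta> in simp)
    ultimately have "disc_to_strip x \<in> closure S" using w(1) by (auto simp: closure_sequential)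
    moreover have "x = strip_to_disc (disc_to_strip x)" using x by (simp add: strip_to_disc_to_strip)
    ultimately show "x \<in> strip_to_disc ` closure S" by blast
  next
    fix x assume "x \<in> strip_to_disc ` closure S"
    then obtain w where w: "w \<in> closure S" "x = strip_to_disc w" by blast
    have "strip_to_disc holomorphic_on closure S" by (rule strip_to_disc_holomorphic) (use cl \<beta> in fastforce)
    then have "strip_to_disc ` closure S \<subseteq> closure (strip_to_disc ` S)"
      by (intro image_closure_subset holomorphic_on_imp_continuous_on closure_subset) auto
    moreover have "x \<in> unit_disc" using strip_to_disc_in_disc[of w] cl[OF w(1)] \<beta> w(2) by simp
    ultimately show "x \<in> closure (strip_to_disc ` S) \<inter> unit_disc" using w by blast
  qed
qed

lemma interior_image_in_disc:
  assumes S': "\<forall>w\<in>S. \<bar>Im w\<bar> \<le> \<beta>" and \<beta>: "\<beta> < pi / 2" and reg: "interior (closure S) = S"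
  shows "interior (closure (strip_to_disc ` S)) = strip_to_disc ` S"
proof -
  note S = bspec[OF S']
  define K where "K = closure (strip_to_disc ` S)"
  note KD = closed_image_in_disc[OF S' \<beta>, folded K_def]
  have oS: "open S" using reg by (metis open_interior)
  have inj: "inj_on disc_to_strip unit_disc"
    by (rule inj_on_inverseI[where g = strip_to_disc]) (simp add: strip_to_disc_to_strip)
  have inj': "inj_on strip_to_disc S"
    by (rule inj_on_inverseI[where g = disc_to_strip]) (use S \<beta> in \<open>force intro!: disc_to_strip_to_disc\<close>)
  have intD: "interior K \<subseteq> unit_disc" using interior_mono[OF KD(3)] by simp
  show ?thesis unfolding K_def[symmetric]
  proof (intro equalityI subsetI)
    fix x assume x: "x \<in> interior K"
    have "open (disc_to_strip ` interior K)"
      by (rule open_mapping_thm3[OF holomorphic_on_subset[OF disc_to_strip_holomorphic intD] open_interior inj_on_subset[OF inj intD]])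
    moreover have "disc_to_strip ` interior K \<subseteq> closure S"
    proof
      fix w assume "w \<in> disc_to_strip ` interior K"
      then obtain y where y: "y \<in> interior K" "w = disc_to_strip y" by blast
      then have "y \<in> strip_to_disc ` closure S" using KD(1) intD interior_subset[of K] by blast
      then obtain v where v: "v \<in> closure S" "y = strip_to_disc v" by blast
      then have "w = v" using KD(2)[OF v(1)] \<beta> by (simp add: y(2) disc_to_strip_to_disc)
      with v show "w \<in> closure S" by simp
    qed
    ultimately have "disc_to_strip ` interior K \<subseteq> S" using interior_maximal reg by blast
    then have "disc_to_strip x \<in> S" using x by blast
    moreover have "x = strip_to_disc (disc_to_strip x)" using x intD by (auto simp: strip_to_disc_to_strip)
    ultimately show "x \<in> strip_to_disc ` S" by blast
  next
    fix x assume x: "x \<in> strip_to_disc ` S"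
    have "open (strip_to_disc ` S)"
      by (rule open_mapping_thm3[OF strip_to_disc_holomorphic oS inj']) (use S \<beta> in fastforce)
    then have "strip_to_disc ` S \<subseteq> interior K" unfolding K_def by (intro interior_maximal closure_subset)
    with x show "x \<in> interior K" by blast
  qed
qed

text \<open>
  The exterior of the closed disc is connected, and every other point of the complement is connected to
  it: a point of the circle by a small disc; a point of the disc through the images of the margins
  \<open>\<beta> < \<plusminus>Im w < \<pi>/2\<close>, which have the points \<open>\<plusminus>\<i>\<close> of the circle as limits.  A connected set that joins \<open>w\<close> to a
  point off the closed strip is pushed into a margin by truncating imaginary parts; the truncation
  cannot hit the closure of \<open>S\<close>.
\<close>
lemma connected_complement_image_in_disc:
  assumes S': "\<forall>w\<in>S. \<bar>Im w\<bar> \<le> \<beta>" and \<beta>: "0 \<le> \<beta>" "\<beta> < pi / 2"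
    and off: "\<And>w. w \<notin> closure S \<Longrightarrow> \<exists>T. connected T \<and> w \<in> T \<and> T \<inter> closure S = {} \<and> (\<exists>v\<in>T. \<beta> < \<bar>Im v\<bar>)"
  shows "connected (- closure (strip_to_disc ` S))"
proof -
  note S = bspec[OF S']
  define K where "K = closure (strip_to_disc ` S)"
  note KD = closed_image_in_disc[OF S' \<beta>(2), folded K_def]
  have oK: "open (- K)" by (simp add: K_def open_Compl)
  have notK: "strip_to_disc w \<notin> K" if "\<bar>Im w\<bar> < pi / 2" "w \<notin> closure S" for w
  proof
    assume "strip_to_disc w \<in> K"
    then have "strip_to_disc w \<in> strip_to_disc ` closure S" using KD(1) strip_to_disc_in_disc[OF that(1)] by auto
    then obtain v where v: "v \<in> closure S" "strip_to_disc w = strip_to_disc v" by blast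
    then have "disc_to_strip (strip_to_disc w) = disc_to_strip (strip_to_disc v)" by simp
    then have "w = v" using that(1) KD(2)[OF v(1)] \<beta> by (simp add: disc_to_strip_to_disc)
    with v that show False by simp
  qed
  have cont: "continuous_on {w. \<bar>Im w\<bar> < pi / 2} strip_to_disc"
    by (intro holomorphic_on_imp_continuous_on strip_to_disc_holomorphic) auto
  define E where "E = - cball (0::complex) 1"
  have cE: "connected E" unfolding E_def by (rule connected_complement_bounded_convex) auto
  have EK: "E \<subseteq> - K" using KD(3) by (auto simp: E_def)
  have near: "\<exists>N. connected N \<and> N \<subseteq> - K \<and> N \<inter> E \<noteq> {} \<and> ball x d \<subseteq> N" if "d > 0" "ball x d \<subseteq> - K" "cmod x = 1" for x d
  proof (intro exI conjI)
    show "ball x d \<inter> E \<noteq> {}"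
    proof -
      define y where "y = of_real (1 + d / 2) * x"
      have "cmod (y - x) = d / 2"
      proof -
        have "y - x = of_real (d / 2) * x" by (simp add: y_def algebra_simps)
        then have "cmod (y - x) = cmod (of_real (d / 2) * x)" by (simp only:)
        then show ?thesis unfolding norm_mult norm_of_real using that by simp
      qed
      moreover have "1 < cmod y" unfolding y_def norm_mult norm_of_real using that by simp
      ultimately have "y \<in> ball x d \<inter> E" using that(1) by (simp add: E_def dist_norm norm_minus_commute)
      then show ?thesis by blast
    qed
  qed (use that in auto)
  have margin: "\<exists>A. connected A \<and> A \<subseteq> - K \<and> A \<inter> E \<noteq> {} \<and> strip_to_disc ` {w. \<beta> < s * Im w \<and> s * Im w < pi / 2} \<subseteq> A"
    if s: "s = 1 \<or> s = -1" for s :: real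
  proof -
    define M where "M = {w. \<beta> < s * Im w \<and> s * Im w < pi / 2}"
    define x where "x = (of_real s * \<i> :: complex)"
    have x: "x = \<i> \<or> x = - \<i>" using s by (auto simp: x_def)
    have "x \<notin> K" unfolding K_def by (rule unit_points_not_limits[OF S' \<beta>(2) x])
    then obtain d where d: "d > 0" "ball x d \<subseteq> - K" using oK by (meson ComplI open_contains_ball)
    have Ms: "w \<in> M \<Longrightarrow> \<bar>Im w\<bar> < pi / 2 \<and> w \<notin> closure S" for w
      using s KD(2)[of w] \<beta> by (auto simp: M_def)
    have "convex M"
    proof -
      have "M = {w. inner (of_real s * \<i>) w > \<beta>} \<inter> {w. inner (of_real s * \<i>) w < pi / 2}"
        by (auto simp: M_def inner_complex_def)
      then show ?thesis by (simp only:) (intro convex_Int convex_halfspace_gt convex_halfspace_lt)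
    qed
    then have cM: "connected (strip_to_disc ` M)"
      by (intro connected_continuous_image continuous_on_subset[OF cont] convex_connected) (use Ms in auto)
    have lim: "((\<lambda>t. strip_to_disc (of_real (s * t) * \<i>)) \<longlongrightarrow> x) (at_left (pi / 2))"
    proof -
      have "isCont (\<lambda>t. (exp (of_real (s * t) * \<i>) - 1) / (exp (of_real (s * t) * \<i>) + 1)) (pi / 2)"
      proof (intro continuous_intros)
        show "exp (of_real (s * (pi / 2)) * \<i>) + 1 \<noteq> 0" using s by (auto simp: exp_Euler complex_eq_iff Re_exp Im_exp)
      qed
      then have "((\<lambda>t. strip_to_disc (of_real (s * t) * \<i>)) \<longlongrightarrow> strip_to_disc (of_real (s * (pi / 2)) * \<i>)) (at (pi / 2))"
        by (simp add: isCont_def strip_to_disc_def)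
      moreover have "strip_to_disc (of_real (s * (pi / 2)) * \<i>) = x"
      proof -
        have "exp (of_real (s * (pi / 2)) * \<i>) = x" using s by (auto simp: x_def complex_eq_iff Re_exp Im_exp)
        moreover have "(x - 1) / (x + 1) = x" using x by (auto simp: complex_eq_iff Re_divide Im_divide power2_eq_square)
        ultimately show ?thesis by (simp add: strip_to_disc_def)
      qed
      ultimately show ?thesis by (metis tendsto_within_subset at_left_eq UNIV_I subsetI)
    qed
    have e1: "\<forall>\<^sub>F t in at_left (pi / 2). dist (strip_to_disc (of_real (s * t) * \<i>)) x < d" by (rule tendstoD[OF lim d(1)])
    have e2: "\<forall>\<^sub>F t in at_left (pi / 2). t \<in> {\<beta><..<pi / 2}" by (rule eventually_at_left_real[OF \<beta>(2)])
    from e1 e2 have "\<forall>\<^sub>F t in at_left (pi / 2). dist (strip_to_disc (of_real (s * t) * \<i>)) x < d \<and> \<beta> < t \<and> t < pi / 2"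
      by eventually_elim auto
    then obtain t where t: "dist (strip_to_disc (of_real (s * t) * \<i>)) x < d" "\<beta> < t" "t < pi / 2"
      using eventually_happens'[OF trivial_limit_at_left_real] by blast
    have "of_real (s * t) * \<i> \<in> M" using s t by (auto simp: M_def)
    then have meet: "ball x d \<inter> strip_to_disc ` M \<noteq> {}" using t(1) by (auto simp: dist_commute)
    have "cmod x = 1" using x by auto
    then obtain N where N: "connected N" "N \<subseteq> - K" "N \<inter> E \<noteq> {}" "ball x d \<subseteq> N" using near[OF d] by blast
    have "connected (N \<union> strip_to_disc ` M)" using N meet cM by (intro connected_Un) auto
    moreover have "strip_to_disc ` M \<subseteq> - K" using Ms notK by blast
    ultimately show ?thesis using N unfolding M_def[symmetric] by (intro exI[of _ "N \<union> strip_to_disc ` M"]) auto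
  qed
  have main: "\<exists>A. connected A \<and> x \<in> A \<and> A \<subseteq> - K \<and> A \<inter> E \<noteq> {}" if x: "x \<notin> K" for x
  proof -
    consider "cmod x > 1" | "cmod x = 1" | "cmod x < 1" by linarith
    then show ?thesis
    proof cases
      case 1
      then have "x \<in> E" by (simp add: E_def)
      then show ?thesis using cE EK by (intro exI[of _ E]) auto
    next
      case 2
      obtain d where d: "d > 0" "ball x d \<subseteq> - K" using oK x by (meson ComplI open_contains_ball)
      from near[OF this 2] obtain N where "connected N" "N \<subseteq> - K" "N \<inter> E \<noteq> {}" "ball x d \<subseteq> N" by blast
      moreover have "x \<in> ball x d" using d by simp
      ultimately show ?thesis by blast
    next
      case 3
      define w where "w = disc_to_strip x"
      have wx: "strip_to_disc w = x" unfolding w_def by (rule strip_to_disc_to_strip[OF 3])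
      have wi: "\<bar>Im w\<bar> < pi / 2" unfolding w_def by (rule disc_to_strip_in_strip[OF 3])
      have "w \<notin> closure S"
      proof
        assume "w \<in> closure S"
        then have "x \<in> strip_to_disc ` closure S" using wx by blast
        then show False using KD(1) x by blast
      qed
      then obtain T where T: "connected T" "w \<in> T" "T \<inter> closure S = {}" "\<exists>v\<in>T. \<beta> < \<bar>Im v\<bar>" using off by blast
      obtain v where v: "v \<in> T" "\<beta> < \<bar>Im v\<bar>" using T(4) by blast
      define mid where "mid = (\<beta> + pi / 2) / 2"
      have mid: "\<beta> < mid" "mid < pi / 2" using \<beta>(2) by (simp_all add: mid_def)
      define b where "b = max \<bar>Im w\<bar> mid"
      have b: "\<bar>Im w\<bar> \<le> b" "\<beta> < b" "b < pi / 2" using wi mid unfolding b_def by linarith+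
      define c where "c u = Complex (Re u) (max (- b) (min b (Im u)))" for u
      have c_im: "\<bar>Im (c u)\<bar> \<le> b" for u using b \<beta> by (auto simp: c_def)
      have c_lt: "\<bar>Im (c u)\<bar> < pi / 2" for u using c_im[of u] b by linarith
      have c_off: "c u \<notin> closure S" if "u \<in> T" for u
      proof (cases "\<bar>Im u\<bar> \<le> b")
        case True
        then have "c u = u" by (auto simp: c_def complex_eq_iff)
        with that T(3) show ?thesis by auto
      next
        case False
        then have "\<bar>Im (c u)\<bar> = b" using b \<beta> by (auto simp: c_def)
        then show ?thesis using KD(2)[of "c u"] b by auto
      qed
      have "continuous_on T c" unfolding c_def Complex_eq by (intro continuous_intros)
      then have cT: "connected (c ` T)" using T(1) by (rule connected_continuous_image)
      have cA: "connected (strip_to_disc ` c ` T)"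
        by (rule connected_continuous_image[OF continuous_on_subset[OF cont] cT]) (use c_lt in auto)
      have AK: "strip_to_disc ` c ` T \<subseteq> - K" using notK[OF c_lt c_off] by blast
      have "c w = w" using b by (auto simp: c_def complex_eq_iff)
      then have xA: "x \<in> strip_to_disc ` c ` T" using T(2) wx by (metis imageI)
      obtain s :: real where s: "s = 1 \<or> s = -1" "\<beta> < s * Im (c v)"
      proof (cases "Im v \<ge> 0")
        case True then show ?thesis using v(2) b \<beta> that[of 1] by (auto simp: c_def)
      next
        case False then show ?thesis using v(2) b \<beta> that[of "-1"] by (auto simp: c_def)
      qed
      have "c v \<in> {w. \<beta> < s * Im w \<and> s * Im w < pi / 2}" using s c_im[of v] b by auto
      moreover obtain A where A: "connected A" "A \<subseteq> - K" "A \<inter> E \<noteq> {}" "strip_to_disc ` {w. \<beta> < s * Im w \<and> s * Im w < pi / 2} \<subseteq> A"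
        using margin[OF s(1)] by blast
      ultimately have "strip_to_disc (c v) \<in> strip_to_disc ` c ` T \<inter> A" using v(1) by blast
      then have "connected (strip_to_disc ` c ` T \<union> A)" using cA A(1) by (intro connected_Un) auto
      then show ?thesis using xA AK A by (intro exI[of _ "strip_to_disc ` c ` T \<union> A"]) auto
    qed
  qed
  obtain A where A: "\<And>x. x \<notin> K \<Longrightarrow> connected (A x) \<and> x \<in> A x \<and> A x \<subseteq> - K \<and> A x \<inter> E \<noteq> {}" using main by metis
  have "- K = (\<Union>x\<in>- K. A x \<union> E)"
  proof (intro equalityI subsetI)
    fix x assume "x \<in> - K"
    then show "x \<in> (\<Union>x\<in>- K. A x \<union> E)" using A[of x] by blast
  next
    fix x assume "x \<in> (\<Union>x\<in>- K. A x \<union> E)"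
    then obtain y where "y \<in> - K" "x \<in> A y \<union> E" by blast
    then show "x \<in> - K" using A[of y] EK by blast
  qed
  moreover have "connected (\<Union>x\<in>- K. A x \<union> E)"
  proof (rule connected_Union)
    have "(2::complex) \<in> E" by (simp add: E_def)
    then show "\<Inter> ((\<lambda>x. A x \<union> E) ` (- K)) \<noteq> {}" by blast
    fix s assume "s \<in> (\<lambda>x. A x \<union> E) ` (- K)"
    then obtain y where "y \<notin> K" "s = A y \<union> E" by blast
    then show "connected s" using A[of y] cE connected_Un by blast
  qed
  ultimately have "connected (- K)" by simp
  then show ?thesis by (simp add: K_def)
qed

section \<open>Completeness of the exponentials\<close>
context strip_functional
begin

text \<open>
  The bounded univalent function \<open>H = tanh(h/2)\<close> generates, through its resolvents, all polynomials;
  these resolvents come from the exponentials.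
\<close>
theorem vanishes_on_exponentials_imp_vanishes:
  assumes inj: "inj_on h unit_disc" and \<beta>: "\<beta> < pi / 2"
    and d: "0 < \<delta>" and s: "\<And>s. \<bar>s\<bar> < \<delta> \<Longrightarrow> hardy p (\<lambda>z. exp (of_real s * h z))"
    and \<Lambda>0: "\<And>\<zeta>. \<bar>Re \<zeta>\<bar> < \<delta> \<Longrightarrow> \<Lambda> (\<lambda>z. exp (\<zeta> * h z)) = 0"
    and reg: "interior (closure (h ` unit_disc)) = h ` unit_disc"
    and off: "\<And>w. w \<notin> closure (h ` unit_disc) \<Longrightarrow>
       \<exists>T. connected T \<and> w \<in> T \<and> T \<inter> closure (h ` unit_disc) = {} \<and> (\<exists>v\<in>T. \<beta> < \<bar>Im v\<bar>)"
    and f: "hardy p f"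
  shows "\<Lambda> f = 0"
proof -
  define S where "S = h ` unit_disc"
  have S: "\<forall>w\<in>S. \<bar>Im w\<bar> \<le> \<beta>" using strip by (auto simp: S_def)
  have \<beta>0: "0 \<le> \<beta>" using strip[of 0] by simp
  note res = resolvent_off_strip[OF d s \<Lambda>0]
  have one: "\<Lambda> (\<lambda>_. 1) = 0" using \<Lambda>0[of 0] d by simp
  have hh: "hardy p h"
  proof -
    have "hardy p (\<lambda>z. 1 * h z * exp (0 * h z))"
    proof (rule hardy_exp_times_h[where Q = 1])
      show "0 < \<delta> / 2" using d by simp
      show "hardy p (\<lambda>z. exp (of_real (Re 0 + \<delta> / 2) * h z))" by (rule s) (use d in simp)
      show "hardy p (\<lambda>z. exp (of_real (Re 0 - \<delta> / 2) * h z))" by (rule s) (use d in simp)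
    qed auto
    then show ?thesis by simp
  qed
  have out: "\<Lambda> (\<lambda>z. 1 / (x - strip_to_disc (h z))) = 0" if x: "1 < cmod x" for x
  proof (rule tanh_resolvent_outside_disc[OF _ one \<beta> x])
    fix \<xi> :: complex assume \<xi>: "pi / 2 \<le> Im \<xi>" "Im \<xi> \<le> 3 * pi / 2"
    from periodic_resolvent[OF res(1) res(2) one hh \<beta> \<xi>]
    show "\<Lambda> (\<lambda>z. 1 / (1 - exp (h z - \<xi>))) = 0 \<and> hardy p (\<lambda>z. 1 / (1 - exp (h z - \<xi>)))" by simp
  qed
  define H where "H = (\<lambda>z. strip_to_disc (h z))"
  have Him: "H ` unit_disc = strip_to_disc ` S" by (auto simp: H_def S_def)
  have hH: "H holomorphic_on unit_disc"
  proof -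
    have "strip_to_disc holomorphic_on S" by (rule strip_to_disc_holomorphic) (use S \<beta> in fastforce)
    from holomorphic_on_compose[OF h this[unfolded S_def]] show ?thesis by (simp add: H_def o_def)
  qed
  have iH: "inj_on H unit_disc"
  proof (rule inj_onI)
    fix z w assume zw: "z \<in> unit_disc" "w \<in> unit_disc" "H z = H w"
    then have "disc_to_strip (strip_to_disc (h z)) = disc_to_strip (strip_to_disc (h w))" by (simp add: H_def)
    then have "h z = h w" using strip[OF zw(1)] strip[OF zw(2)] \<beta> by (simp add: disc_to_strip_to_disc)
    then show "z = w" using inj zw by (auto dest: inj_onD)
  qed
  define K where "K = closure (H ` unit_disc)"
  have K1: "K \<subseteq> cball 0 1" using closed_image_in_disc(3)[OF S \<beta>] by (simp add: K_def Him)
  have K2: "connected (- K)" using connected_complement_image_in_disc[OF S \<beta>0 \<beta> off[folded S_def]] by (simp add: K_def Him S_def)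
  have K3: "interior K = H ` unit_disc" using interior_image_in_disc[OF S \<beta> reg[folded S_def]] by (simp add: K_def Him)
  have K4: "closed K" by (simp add: K_def)
  have K5: "compact K" using K1 K4 by (metis bounded_cball bounded_subset compact_eq_bounded_closed)
  have K6: "H ` unit_disc \<subseteq> K" unfolding K_def by (rule closure_subset)
  have rat: "\<Lambda> (\<lambda>z. 1 / (x - H z)) = 0" if "x \<notin> K" for x
    by (rule resolvent_continuation[OF hH K6 K4 K2 K1 _ that]) (use out in \<open>simp add: H_def\<close>)
  have "\<Lambda> (\<lambda>z. z ^ k) = 0" for k
    by (rule vanishes_on_rational_imp_vanishes_on_powers[OF hH iH K_def K5 K2 K3 rat])
  then show ?thesis by (rule vanishes_on_polynomials_imp_vanishes[OF _ f])
qed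

end

section \<open>Schwarz, Julia and Harnack\<close>

lemma Moebius_identity:
  fixes a z :: complex
  shows "(cmod (1 - cnj a * z))\<^sup>2 - (cmod (z - a))\<^sup>2 = (1 - (cmod a)\<^sup>2) * (1 - (cmod z)\<^sup>2)"
  unfolding cmod_power2 by (simp add: power2_eq_square algebra_simps)

lemma one_minus_cnj_mult_nonzero:
  fixes a z :: complex
  assumes "cmod a < 1" "cmod z < 1"
  shows "1 - cnj a * z \<noteq> 0"
proof
  assume "1 - cnj a * z = 0"
  then have "cmod (cnj a * z) = 1" by (metis eq_iff_diff_eq_0 norm_one)
  moreover have "cmod (cnj a * z) < 1"
    using assms by (simp add: norm_mult) (metis mult_strict_mono' norm_ge_zero mult_1)
  ultimately show False by simp
qed

text \<open>
  The invariant form of Schwarz's lemma, multiplied out so that limits at the circle can be taken.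
\<close>
lemma Schwarz_Pick:
  assumes f: "f holomorphic_on unit_disc" "\<And>z. z \<in> unit_disc \<Longrightarrow> f z \<in> unit_disc"
    and a: "a \<in> unit_disc" and z: "z \<in> unit_disc"
  shows "(cmod (1 - cnj (f a) * f z))\<^sup>2 * ((1 - (cmod a)\<^sup>2) * (1 - (cmod z)\<^sup>2))
     \<le> (cmod (1 - cnj a * z))\<^sup>2 * ((1 - (cmod (f a))\<^sup>2) * (1 - (cmod (f z))\<^sup>2))"
proof -
  define b where "b = f a"
  have a1: "cmod a < 1" and z1: "cmod z < 1" and b1: "cmod b < 1" and fz1: "cmod (f z) < 1"
    using a z f(2)[OF a] f(2)[OF z] by (auto simp: b_def)
  define g where "g u = (f ((u + a) / (1 + cnj a * u)) - b) / (1 - cnj b * f ((u + a) / (1 + cnj a * u)))" for u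
  define m where "m u = (u + a) / (1 + cnj a * u)" for u
  have nz: "1 + cnj a * u \<noteq> 0" if "cmod u < 1" for u
    using one_minus_cnj_mult_nonzero[of a "- u"] a1 that by simp
  have m1: "cmod (m u) < 1" if u: "cmod u < 1" for u
  proof -
    have "0 < (1 - (cmod a)\<^sup>2) * (1 - (cmod u)\<^sup>2)" using a1 u by (intro mult_pos_pos) (auto simp: abs_square_less_1)
    then have "(cmod (u + a))\<^sup>2 < (cmod (1 + cnj a * u))\<^sup>2"
      using Moebius_identity[of a "- u"] by (simp add: norm_minus_commute add.commute)
    then have "cmod (u + a) < cmod (1 + cnj a * u)" by (rule power2_less_imp_less) simp
    then show ?thesis by (simp add: m_def norm_divide divide_less_eq)
  qed
  have hm: "m holomorphic_on unit_disc" unfolding m_def[abs_def] using nz by (intro holomorphic_intros) auto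
  have hfm: "(\<lambda>u. f (m u)) holomorphic_on unit_disc"
  proof -
    have "m ` unit_disc \<subseteq> unit_disc" using m1 by auto
    from holomorphic_on_compose_gen[OF hm f(1) this] show ?thesis by (simp add: o_def)
  qed
  have fm1: "cmod (f (m u)) < 1" if "cmod u < 1" for u using f(2)[of "m u"] m1[OF that] by simp
  have g: "g u = (f (m u) - b) / (1 - cnj b * f (m u))" for u by (simp add: g_def m_def)
  have hg: "g holomorphic_on unit_disc"
    unfolding g[abs_def] using one_minus_cnj_mult_nonzero[OF b1 fm1] by (intro holomorphic_intros hfm) auto
  have g1: "cmod (g u) < 1" if u: "cmod u < 1" for u
  proof -
    have "0 < (1 - (cmod b)\<^sup>2) * (1 - (cmod (f (m u)))\<^sup>2)" using b1 fm1[OF u] by (intro mult_pos_pos) (auto simp: abs_square_less_1)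
    then have "(cmod (f (m u) - b))\<^sup>2 < (cmod (1 - cnj b * f (m u)))\<^sup>2" using Moebius_identity[of b "f (m u)"] by simp
    then have "cmod (f (m u) - b) < cmod (1 - cnj b * f (m u))" by (rule power2_less_imp_less) simp
    then show ?thesis by (simp add: g norm_divide divide_less_eq)
  qed
  have g0: "g 0 = 0" by (simp add: g m_def b_def)
  define u where "u = (z - a) / (1 - cnj a * z)"
  have nza: "1 - cnj a * z \<noteq> 0" by (rule one_minus_cnj_mult_nonzero[OF a1 z1])
  have u1: "cmod u < 1"
  proof -
    have "0 < (1 - (cmod a)\<^sup>2) * (1 - (cmod z)\<^sup>2)" using a1 z1 by (intro mult_pos_pos) (auto simp: abs_square_less_1)
    then have "(cmod (z - a))\<^sup>2 < (cmod (1 - cnj a * z))\<^sup>2" using Moebius_identity[of a z] by simp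
    then have "cmod (z - a) < cmod (1 - cnj a * z)" by (rule power2_less_imp_less) simp
    then show ?thesis by (simp add: u_def norm_divide divide_less_eq)
  qed
  have mu: "m u = z"
  proof -
    have "m u * (1 + cnj a * u) = u + a" using nz[OF u1] by (simp add: m_def)
    have A: "1 + cnj a * u = (1 - cnj a * a) / (1 - cnj a * z)" using nza by (simp add: u_def field_simps)
    have B: "u + a = z * (1 - cnj a * a) / (1 - cnj a * z)" using nza by (simp add: u_def field_simps)
    have "1 - cnj a * a \<noteq> 0" by (rule one_minus_cnj_mult_nonzero[OF a1 a1])
    then show ?thesis unfolding m_def A B using nza by simp
  qed
  have "cmod (g u) \<le> cmod u" by (rule Schwarz_Lemma(1)[OF hg g0 g1 u1])
  then have "cmod (f z - b) / cmod (1 - cnj b * f z) \<le> cmod (z - a) / cmod (1 - cnj a * z)"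
  proof -
    have "cmod u = cmod (z - a) / cmod (1 - cnj a * z)" by (simp add: u_def norm_divide)
    moreover have "cmod (g u) = cmod (f z - b) / cmod (1 - cnj b * f z)" by (simp add: g mu norm_divide)
    ultimately show ?thesis using \<open>cmod (g u) \<le> cmod u\<close> by simp
  qed
  moreover have p: "0 < cmod (1 - cnj b * f z)" "0 < cmod (1 - cnj a * z)"
    using one_minus_cnj_mult_nonzero[OF b1 fz1] nza by auto
  ultimately have "cmod (f z - b) * cmod (1 - cnj a * z) \<le> cmod (z - a) * cmod (1 - cnj b * f z)"
    by (simp add: divide_simps)
  then have "(cmod (f z - b) * cmod (1 - cnj a * z))\<^sup>2 \<le> (cmod (z - a) * cmod (1 - cnj b * f z))\<^sup>2"
    by (intro power_mono) auto
  then have "(cmod (f z - b))\<^sup>2 * (cmod (1 - cnj a * z))\<^sup>2 \<le> (cmod (z - a))\<^sup>2 * (cmod (1 - cnj b * f z))\<^sup>2"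
    by (simp add: power_mult_distrib)
  moreover have "(cmod (f z - b))\<^sup>2 = (cmod (1 - cnj b * f z))\<^sup>2 - (1 - (cmod b)\<^sup>2) * (1 - (cmod (f z))\<^sup>2)"
    "(cmod (z - a))\<^sup>2 = (cmod (1 - cnj a * z))\<^sup>2 - (1 - (cmod a)\<^sup>2) * (1 - (cmod z)\<^sup>2)"
    using Moebius_identity[of b "f z"] Moebius_identity[of a z] by linarith+
  ultimately have "((cmod (1 - cnj b * f z))\<^sup>2 - (1 - (cmod b)\<^sup>2) * (1 - (cmod (f z))\<^sup>2)) * (cmod (1 - cnj a * z))\<^sup>2
     \<le> ((cmod (1 - cnj a * z))\<^sup>2 - (1 - (cmod a)\<^sup>2) * (1 - (cmod z)\<^sup>2)) * (cmod (1 - cnj b * f z))\<^sup>2" by (simp only:)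
  moreover have "P * V \<le> Q * U" if "(P - U) * Q \<le> (Q - V) * P" for P Q U V :: real
    using that by (simp add: algebra_simps)
  ultimately show ?thesis unfolding b_def[symmetric] by blast
qed

text \<open>
  The inequality of Schwarz and Pick for the pair consisting of \<open>0\<close> and \<open>z\<close>.
\<close>
lemma disc_self_map_boundary_distance:
  assumes f: "f holomorphic_on unit_disc" "\<And>z. z \<in> unit_disc \<Longrightarrow> f z \<in> unit_disc"
  obtains c where "c > 0" "\<And>z. z \<in> unit_disc \<Longrightarrow> c * (1 - cmod z) \<le> 1 - cmod (f z)"
proof -
  define b where "b = cmod (f 0)"
  have b: "0 \<le> b" "b < 1" using f(2)[of 0] by (auto simp: b_def)
  have b2: "0 < 1 - b\<^sup>2" using b by (simp add: abs_square_less_1)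
  show ?thesis
  proof (rule that[of "(1 - b)\<^sup>2 / 2"])
    show "(1 - b)\<^sup>2 / 2 > 0" using b by simp
    fix z assume z: "z \<in> unit_disc"
    have z1: "cmod z < 1" using z by simp
    have fz1: "cmod (f z) < 1" using f(2)[OF z] by simp
    have "1 - b \<le> cmod (1 - cnj (f 0) * f z)"
    proof -
      have "cmod (cnj (f 0) * f z) \<le> b * 1" unfolding norm_mult using fz1 by (intro mult_mono) (auto simp: b_def)
      then show ?thesis using norm_triangle_ineq2[of 1 "cnj (f 0) * f z"] by simp
    qed
    then have "(1 - b)\<^sup>2 * (1 - (cmod z)\<^sup>2) \<le> (cmod (1 - cnj (f 0) * f z))\<^sup>2 * (1 - (cmod z)\<^sup>2)"
      using b z1 by (intro mult_right_mono power_mono) (auto simp: abs_square_le_1)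
    also have "\<dots> \<le> (1 - b\<^sup>2) * (1 - (cmod (f z))\<^sup>2)"
      using Schwarz_Pick[OF f _ z, of 0] by (simp add: b_def)
    also have "\<dots> \<le> 1 * (1 - (cmod (f z))\<^sup>2)" using fz1 by (intro mult_right_mono) (auto simp: abs_square_le_1)
    also have "1 - (cmod (f z))\<^sup>2 = (1 - cmod (f z)) * (1 + cmod (f z))" by (simp add: power2_eq_square algebra_simps)
    also have "1 * ((1 - cmod (f z)) * (1 + cmod (f z))) \<le> (1 - cmod (f z)) * 2"
      using fz1 by (simp only: mult_1_left) (intro mult_left_mono, auto)
    finally have "(1 - b)\<^sup>2 * (1 - (cmod z)\<^sup>2) \<le> 2 * (1 - cmod (f z))" by simp
    moreover have "(1 - b)\<^sup>2 * (1 - cmod z) \<le> (1 - b)\<^sup>2 * (1 - (cmod z)\<^sup>2)"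
      using z1 by (intro mult_left_mono) (auto simp: power2_eq_square mult_left_le)
    ultimately show "(1 - b)\<^sup>2 / 2 * (1 - cmod z) \<le> 1 - cmod (f z)" by simp
  qed
qed

text \<open>
  Schwarz's lemma for the Cayley transform of \<open>H\<close> that vanishes at the centre.
\<close>
lemma Harnack_half_plane:
  assumes H: "H holomorphic_on unit_disc" and pos: "\<And>z. z \<in> unit_disc \<Longrightarrow> 0 < Re (H z)" and v: "v \<in> unit_disc"
  shows "Re (H v) * (1 - cmod v) \<le> Re (H 0) * (1 + cmod v)"
proof -
  define c where "c z = (H z - H 0) / (H z + cnj (H 0))" for z
  have p0: "0 < Re (H 0)" by (rule pos) simp
  have nz: "H z + cnj (H 0) \<noteq> 0" if "z \<in> unit_disc" for z
    using pos[OF that] p0 by (auto simp: complex_eq_iff)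
  have hc: "c holomorphic_on unit_disc" unfolding c_def[abs_def] using nz by (intro holomorphic_intros H) auto
  have c1: "cmod (c z) < 1" if z: "cmod z < 1" for z
  proof -
    have "z \<in> unit_disc" using z by simp
    note pz = pos[OF this] nz[OF this]
    have "0 < Re (H z) * Re (H 0)" using pz p0 by simp
    then have "(cmod (H z - H 0))\<^sup>2 < (cmod (H z + cnj (H 0)))\<^sup>2"
      unfolding cmod_power2 by (simp add: power2_eq_square algebra_simps)
    then have "cmod (H z - H 0) < cmod (H z + cnj (H 0))" by (rule power2_less_imp_less) simp
    then show ?thesis by (simp add: c_def norm_divide divide_less_eq)
  qed
  have v1: "cmod v < 1" using v by simp
  define r where "r = cmod v"
  have r: "0 \<le> r" "r < 1" using v1 by (auto simp: r_def)
  have "cmod (c v) \<le> r" unfolding r_def by (rule Schwarz_Lemma(1)[OF hc _ c1 v1]) (simp add: c_def)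
  then have "cmod (H v - H 0) \<le> r * cmod (H v + cnj (H 0))"
    using nz[OF v] by (simp add: c_def norm_divide divide_le_eq)
  then have "(cmod (H v - H 0))\<^sup>2 \<le> (r * cmod (H v + cnj (H 0)))\<^sup>2" by (intro power_mono) auto
  then have "(cmod (H v - H 0))\<^sup>2 \<le> r\<^sup>2 * (cmod (H v + cnj (H 0)))\<^sup>2" by (simp add: power_mult_distrib)
  then have "(Re (H v) - Re (H 0))\<^sup>2 + (Im (H v) - Im (H 0))\<^sup>2 \<le> r\<^sup>2 * (Re (H v) + Re (H 0))\<^sup>2 + r\<^sup>2 * (Im (H v) - Im (H 0))\<^sup>2"
    unfolding cmod_power2 by (simp add: distrib_left)
  moreover have "r\<^sup>2 * (Im (H v) - Im (H 0))\<^sup>2 \<le> 1 * (Im (H v) - Im (H 0))\<^sup>2"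
    using r by (intro mult_right_mono) (auto simp: abs_square_le_1)
  ultimately have "(Re (H v) - Re (H 0))\<^sup>2 \<le> (r * (Re (H v) + Re (H 0)))\<^sup>2" by (simp add: power_mult_distrib)
  then have "Re (H v) - Re (H 0) \<le> r * (Re (H v) + Re (H 0))"
    by (rule power2_le_imp_le) (intro mult_nonneg_nonneg r add_nonneg_nonneg less_imp_le[OF pos[OF v]] less_imp_le[OF p0])
  then show ?thesis by (simp add: r_def algebra_simps)
qed

text \<open>
  Julia's inequality at the Denjoy-Wolff point.  The orbit of \<open>0\<close> first gives invariance of the
  horocycles, hence \<open>\<psi>(r\<tau>) \<rightarrow> \<tau>\<close>; then the bound on the derivative along the radius gives the factor
  \<open>q < 1\<close>.
\<close>
lemma Julia_inequality:
  assumes \<psi>: "\<psi> holomorphic_on unit_disc" "\<And>z. z \<in> unit_disc \<Longrightarrow> \<psi> z \<in> unit_disc" and \<tau>: "cmod \<tau> = 1"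
    and orb: "\<And>n::nat. u n \<in> unit_disc" "\<And>n. u (Suc n) = \<psi> (u n)" "u \<longlonglongrightarrow> \<tau>"
    and q: "0 < q" and r0: "r0 < 1"
    and der: "\<And>r. r0 < r \<Longrightarrow> r < 1 \<Longrightarrow> cmod (deriv \<psi> (of_real r * \<tau>)) \<le> q"
    and z: "z \<in> unit_disc"
  shows "(cmod (1 - cnj \<tau> * \<psi> z))\<^sup>2 * (1 - (cmod z)\<^sup>2) \<le> q * ((cmod (1 - cnj \<tau> * z))\<^sup>2 * (1 - (cmod (\<psi> z))\<^sup>2))"
proof -
  define J where "J w = (cmod (1 - cnj \<tau> * w))\<^sup>2" for w
  have sq1: "0 < 1 - (cmod w)\<^sup>2" if "w \<in> unit_disc" for w using that by (simp add: abs_square_less_1)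
  have horo: "J (\<psi> w) * (1 - (cmod w)\<^sup>2) \<le> J w * (1 - (cmod (\<psi> w))\<^sup>2)" if w: "w \<in> unit_disc" for w
  proof -
    define e where "e n = 1 - (cmod (u n))\<^sup>2" for n
    have e_pos: "0 < e n" for n using sq1[OF orb(1)] by (simp add: e_def)
    have "(\<lambda>n. 1 - (cmod (u n))\<^sup>2) \<longlonglongrightarrow> 1 - (cmod \<tau>)\<^sup>2" by (intro tendsto_intros orb(3))
    then have e0: "e \<longlonglongrightarrow> 0" by (simp add: e_def[abs_def] \<tau>)
    \<comment> \<open>as \<open>e\<close> tends to \<open>0\<close>, it decreases infinitely often; these are the times at which Schwarz-Pick gives a factor at most \<open>1\<close>\<close>
    have inf: "\<exists>n\<ge>N. e (Suc n) \<le> e n" for N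
    proof (rule ccontr)
      assume "\<not> (\<exists>n\<ge>N. e (Suc n) \<le> e n)"
      then have inc: "e n < e (Suc n)" if "n \<ge> N" for n using that by force
      have "e N \<le> e (N + k)" for k by (induction k) (use inc in \<open>auto intro: order.trans[OF _ less_imp_le]\<close>)
      moreover have "(\<lambda>k. e (N + k)) \<longlonglongrightarrow> 0" using LIMSEQ_ignore_initial_segment[OF e0, of N] by (simp add: add.commute)
      ultimately have "e N \<le> 0" by (intro LIMSEQ_le_const) auto
      then show False using e_pos[of N] by simp
    qed
    have "\<forall>N. \<exists>n. n \<ge> N \<and> e (Suc n) \<le> e n" using inf by blast
    from choice[OF this] obtain k where k: "\<And>N. k N \<ge> N" "\<And>N. e (Suc (k N)) \<le> e (k N)" by blast
    have kinf: "filterlim k at_top sequentially"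
      unfolding filterlim_at_top eventually_sequentially using k(1) by (meson order_trans)
    have l1: "(\<lambda>N. u (k N)) \<longlonglongrightarrow> \<tau>" by (rule filterlim_compose[OF orb(3) kinf])
    have l2: "(\<lambda>N. u (Suc (k N))) \<longlonglongrightarrow> \<tau>" by (rule filterlim_compose[OF LIMSEQ_Suc[OF orb(3)] kinf])
    have ineq: "(cmod (1 - cnj (u (Suc (k N))) * \<psi> w))\<^sup>2 * (1 - (cmod w)\<^sup>2) \<le> (cmod (1 - cnj (u (k N)) * w))\<^sup>2 * (1 - (cmod (\<psi> w))\<^sup>2)" for N
    proof -
      define A where "A = (cmod (1 - cnj (u (Suc (k N))) * \<psi> w))\<^sup>2 * (1 - (cmod w)\<^sup>2)"
      define B where "B = (cmod (1 - cnj (u (k N)) * w))\<^sup>2 * (1 - (cmod (\<psi> w))\<^sup>2)"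
      have B0: "0 \<le> B" unfolding B_def using sq1[OF \<psi>(2)[OF w]] by (intro mult_nonneg_nonneg) auto
      have "A * e (k N) \<le> B * e (Suc (k N))"
        using Schwarz_Pick[OF \<psi> orb(1)[of "k N"] w] by (simp add: orb(2)[symmetric] A_def B_def e_def mult_ac)
      also have "\<dots> \<le> B * e (k N)" by (intro mult_left_mono k B0)
      finally show ?thesis using e_pos[of "k N"] by (simp add: A_def B_def)
    qed
    have "(\<lambda>N. (cmod (1 - cnj (u (Suc (k N))) * \<psi> w))\<^sup>2 * (1 - (cmod w)\<^sup>2)) \<longlonglongrightarrow> (cmod (1 - cnj \<tau> * \<psi> w))\<^sup>2 * (1 - (cmod w)\<^sup>2)"
      by (intro tendsto_intros l2)
    moreover have "(\<lambda>N. (cmod (1 - cnj (u (k N)) * w))\<^sup>2 * (1 - (cmod (\<psi> w))\<^sup>2)) \<longlonglongrightarrow> (cmod (1 - cnj \<tau> * w))\<^sup>2 * (1 - (cmod (\<psi> w))\<^sup>2)"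
      by (intro tendsto_intros l1)
    ultimately show ?thesis unfolding J_def by (rule LIMSEQ_le) (use ineq in blast)
  qed
  have ud: "of_real r * \<tau> \<in> unit_disc" if "0 \<le> r" "r < 1" for r using that \<tau> by (simp add: norm_mult)
  have \<tau>\<tau>: "cnj \<tau> * \<tau> = 1" using complex_norm_square[of \<tau>] \<tau> by (simp add: mult.commute)
  have J_ge: "(1 - cmod w) * cmod (1 - cnj \<tau> * w) \<le> J w" if "w \<in> unit_disc" for w
  proof -
    have "1 - cmod w \<le> cmod (1 - cnj \<tau> * w)" using norm_triangle_ineq2[of 1 "cnj \<tau> * w"] \<tau> by (simp add: norm_mult)
    then show ?thesis unfolding J_def power2_eq_square by (intro mult_right_mono) auto
  qed
  have Jr: "J (of_real r * \<tau>) = (1 - r)\<^sup>2" for r :: real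
  proof -
    have "1 - cnj \<tau> * (of_real r * \<tau>) = of_real (1 - r)" using \<tau>\<tau> by (simp add: mult.left_commute)
    then show ?thesis unfolding J_def by (simp only: norm_of_real) simp
  qed
  have close: "cmod (1 - cnj \<tau> * \<psi> (of_real r * \<tau>)) \<le> 2 * (1 - r)" if r: "0 \<le> r" "r < 1" for r
  proof -
    define w where "w = \<psi> (of_real r * \<tau>)"
    have w: "w \<in> unit_disc" unfolding w_def by (rule \<psi>(2)[OF ud[OF r]])
    have "J w * (1 - r\<^sup>2) \<le> (1 - r)\<^sup>2 * (1 - (cmod w)\<^sup>2)"
      using horo[OF ud[OF r]] Jr[of r] r \<tau> by (simp add: w_def norm_mult)
    then have "((1 - r) * (1 + r)) * J w \<le> (1 - r) * ((1 - r) * (1 - (cmod w)\<^sup>2))"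
      by (simp add: power2_eq_square algebra_simps)
    then have "(1 + r) * J w \<le> (1 - r) * (1 - (cmod w)\<^sup>2)" using r by (simp add: mult.assoc)
    moreover have "J w \<le> (1 + r) * J w" using r by (simp add: J_def mult_le_cancel_right1)
    moreover have "1 - (cmod w)\<^sup>2 = (1 - cmod w) * (1 + cmod w)" by (simp add: power2_eq_square algebra_simps)
    ultimately have "(1 - cmod w) * cmod (1 - cnj \<tau> * w) \<le> (1 - r) * ((1 - cmod w) * (1 + cmod w))"
      using J_ge[OF w] by (metis order_trans)
    also have "\<dots> \<le> (1 - r) * ((1 - cmod w) * 2)" using w r by (intro mult_left_mono) auto
    finally have "(1 - cmod w) * cmod (1 - cnj \<tau> * w) \<le> (1 - cmod w) * (2 * (1 - r))" by (simp only: mult_ac)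
    then show ?thesis using w by (simp add: w_def)
  qed
  define r1 where "r1 = max 0 r0"
  have rad: "cmod (\<tau> - \<psi> (of_real r * \<tau>)) \<le> q * (1 - r)" if r: "r1 < r" "r < 1" for r
  proof -
    have r': "0 \<le> r" "r0 < r" using r by (auto simp: r1_def)
    have bd: "cmod (\<psi> (of_real s * \<tau>) - \<psi> (of_real r * \<tau>)) \<le> q * (s - r)" if s: "r \<le> s" "s < 1" for s
    proof -
      define T where "T = (\<lambda>t. of_real t * \<tau>) ` {r..s}"
      have conv: "convex T" unfolding T_def
        by (rule convex_linear_image) (auto intro!: linearI simp: algebra_simps scaleR_conv_of_real)
      have "cmod (\<psi> (of_real s * \<tau>) - \<psi> (of_real r * \<tau>)) \<le> q * cmod (of_real s * \<tau> - of_real r * \<tau>)"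
      proof (rule field_differentiable_bound[OF conv])
        fix w assume "w \<in> T"
        then obtain t where t: "r \<le> t" "t \<le> s" "w = of_real t * \<tau>" by (auto simp: T_def)
        have "w \<in> unit_disc" unfolding t(3) by (rule ud) (use t r' s in auto)
        then show "(\<psi> has_field_derivative deriv \<psi> w) (at w within T)"
          using holomorphic_derivI[OF \<psi>(1) open_ball] by (blast intro: has_field_derivative_at_within)
        show "cmod (deriv \<psi> w) \<le> q" unfolding t(3) by (rule der) (use t r' s in auto)
      qed (use s in \<open>auto simp: T_def\<close>)
      also have "of_real s * \<tau> - of_real r * \<tau> = of_real (s - r) * \<tau>" by (simp add: algebra_simps)
      finally show ?thesis using s \<tau> by (simp add: norm_mult del: of_real_diff)
    qed
    define s where "s n = 1 - (1 - r) / real (Suc n)" for n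
    have s: "r \<le> s n" "s n < 1" for n
    proof -
      have "(1 - r) / real (Suc n) \<le> (1 - r) / 1" using r by (intro divide_left_mono) auto
      then show "r \<le> s n" by (simp add: s_def)
      show "s n < 1" using r by (simp add: s_def)
    qed
    have s1: "s \<longlonglongrightarrow> 1"
      using tendsto_diff[OF tendsto_const tendsto_mult[OF tendsto_const LIMSEQ_inverse_real_of_nat, of "1 - r"], of 1]
      by (simp add: s_def[abs_def] divide_inverse)
    have "(\<lambda>n. cmod (1 - cnj \<tau> * \<psi> (of_real (s n) * \<tau>))) \<longlonglongrightarrow> 0"
    proof (rule Lim_null_comparison)
      show "\<forall>\<^sub>F n in sequentially. norm (cmod (1 - cnj \<tau> * \<psi> (of_real (s n) * \<tau>))) \<le> 2 * (1 - s n)"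
        using close s r' by (intro always_eventually allI) (auto intro: order.trans)
      show "(\<lambda>n. 2 * (1 - s n)) \<longlonglongrightarrow> 0" using tendsto_mult[OF tendsto_const tendsto_diff[OF tendsto_const s1, of 1], of 2] by simp
    qed
    moreover have "cmod (1 - cnj \<tau> * w) = cmod (w - \<tau>)" for w
    proof -
      have "cmod (1 - cnj \<tau> * w) = cmod (cnj \<tau> * (\<tau> - w))" by (simp add: right_diff_distrib \<tau>\<tau>)
      then show ?thesis using \<tau> by (simp only: norm_mult complex_mod_cnj norm_minus_commute)
    qed
    ultimately have "(\<lambda>n. \<psi> (of_real (s n) * \<tau>)) \<longlonglongrightarrow> \<tau>" by (simp add: LIM_zero_iff tendsto_norm_zero_iff)
    then have "(\<lambda>n. cmod (\<psi> (of_real (s n) * \<tau>) - \<psi> (of_real r * \<tau>))) \<longlonglongrightarrow> cmod (\<tau> - \<psi> (of_real r * \<tau>))"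
      by (intro tendsto_intros)
    moreover have "(\<lambda>n. q * (s n - r)) \<longlonglongrightarrow> q * (1 - r)" by (intro tendsto_intros s1)
    ultimately show ?thesis by (rule LIMSEQ_le) (use bd[OF s] in blast)
  qed
  have step: "(cmod (1 - cnj (\<psi> (of_real r * \<tau>)) * \<psi> z))\<^sup>2 * (1 - (cmod z)\<^sup>2) * (1 + r)
     \<le> 2 * q * ((cmod (1 - cnj (of_real r * \<tau>) * z))\<^sup>2 * (1 - (cmod (\<psi> z))\<^sup>2))" if r: "r1 < r" "r < 1" for r
  proof -
    have r': "0 \<le> r" using r by (auto simp: r1_def)
    define w where "w = \<psi> (of_real r * \<tau>)"
    define A where "A = (cmod (1 - cnj w * \<psi> z))\<^sup>2 * (1 - (cmod z)\<^sup>2)"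
    define B where "B = (cmod (1 - cnj (of_real r * \<tau>) * z))\<^sup>2 * (1 - (cmod (\<psi> z))\<^sup>2)"
    have B0: "0 \<le> B" unfolding B_def using sq1[OF \<psi>(2)[OF z]] by (intro mult_nonneg_nonneg) auto
    have wd: "w \<in> unit_disc" unfolding w_def by (rule \<psi>(2)[OF ud[OF r' r(2)]])
    have "A * (1 - r\<^sup>2) \<le> B * (1 - (cmod w)\<^sup>2)"
      using Schwarz_Pick[OF \<psi> ud[OF r' r(2)] z] r' \<tau> by (simp add: A_def B_def w_def norm_mult mult_ac)
    also have "1 - (cmod w)\<^sup>2 \<le> 2 * q * (1 - r)"
    proof -
      have "1 - cmod w \<le> q * (1 - r)" using rad[OF r] norm_triangle_ineq2[of \<tau> w] \<tau> by (simp add: w_def)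
      moreover have "1 - (cmod w)\<^sup>2 \<le> 2 * (1 - cmod w)"
      proof -
        have "0 \<le> (1 - cmod w)\<^sup>2" by simp
        then show ?thesis by (simp add: power2_eq_square algebra_simps)
      qed
      moreover have "2 * a \<le> 2 * b" if "a \<le> b" for a b :: real using that by simp
      ultimately have "1 - (cmod w)\<^sup>2 \<le> 2 * (q * (1 - r))" by (metis order.trans)
      then show ?thesis by (simp only: mult.assoc)
    qed
    finally have "A * (1 - r\<^sup>2) \<le> B * (2 * q * (1 - r))" using B0 by (simp add: mult_left_mono)
    moreover have "1 - r\<^sup>2 = (1 - r) * (1 + r)" by (simp add: power2_eq_square algebra_simps)
    ultimately have "(1 - r) * (A * (1 + r)) \<le> (1 - r) * (2 * q * B)" by (simp add: mult_ac)
    then show ?thesis using r by (simp add: A_def B_def w_def)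
  qed
  define s where "s n = 1 - (1 - r1) / real (Suc (Suc n))" for n
  have r11: "r1 < 1" using r0 by (simp add: r1_def)
  have s: "r1 < s n" "s n < 1" for n
  proof -
    have "(1 - r1) / real (Suc (Suc n)) < (1 - r1) / 1" using r11 by (intro divide_strict_left_mono) auto
    then show "r1 < s n" by (simp add: s_def)
    show "s n < 1" using r11 by (simp add: s_def)
  qed
  have s1: "s \<longlonglongrightarrow> 1"
    using tendsto_diff[OF tendsto_const tendsto_mult[OF tendsto_const LIMSEQ_Suc[OF LIMSEQ_inverse_real_of_nat], of "1 - r1"], of 1]
    by (simp add: s_def[abs_def] divide_inverse)
  have \<psi>1: "(\<lambda>n. \<psi> (of_real (s n) * \<tau>)) \<longlonglongrightarrow> \<tau>"
  proof (rule LIM_zero_cancel, rule Lim_null_comparison)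
    show "\<forall>\<^sub>F n in sequentially. norm (\<psi> (of_real (s n) * \<tau>) - \<tau>) \<le> q * (1 - s n)"
      using rad[OF s] by (simp add: norm_minus_commute)
    show "(\<lambda>n. q * (1 - s n)) \<longlonglongrightarrow> 0" using tendsto_mult[OF tendsto_const tendsto_diff[OF tendsto_const s1, of 1], of q] by simp
  qed
  have "(\<lambda>n. (cmod (1 - cnj (\<psi> (of_real (s n) * \<tau>)) * \<psi> z))\<^sup>2 * (1 - (cmod z)\<^sup>2) * (1 + s n))
     \<longlonglongrightarrow> (cmod (1 - cnj \<tau> * \<psi> z))\<^sup>2 * (1 - (cmod z)\<^sup>2) * (1 + 1)"
    by (intro tendsto_intros \<psi>1 s1)
  moreover have "(\<lambda>n. 2 * q * ((cmod (1 - cnj (of_real (s n) * \<tau>) * z))\<^sup>2 * (1 - (cmod (\<psi> z))\<^sup>2)))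
     \<longlonglongrightarrow> 2 * q * ((cmod (1 - cnj (of_real 1 * \<tau>) * z))\<^sup>2 * (1 - (cmod (\<psi> z))\<^sup>2))"
    by (intro tendsto_intros s1)
  ultimately have "(cmod (1 - cnj \<tau> * \<psi> z))\<^sup>2 * (1 - (cmod z)\<^sup>2) * (1 + 1) \<le> 2 * q * ((cmod (1 - cnj (of_real 1 * \<tau>) * z))\<^sup>2 * (1 - (cmod (\<psi> z))\<^sup>2))"
    by (rule LIMSEQ_le) (use step[OF s] in blast)
  then show ?thesis by simp
qed

section \<open>Koenigs domains of hyperbolic semiflows\<close>

lemma koenigs_shift:
  assumes "koenigs_function \<Phi> h" "0 \<le> t" "z \<in> unit_disc"
  shows "h (\<Phi> t z) = h z + of_real t" "h z + of_real t \<in> h ` unit_disc"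
  using assms by (auto simp: koenigs_function_def f_inv_into_f)

lemma koenigs_domain_shift:
  assumes "koenigs_function \<Phi> h" "0 \<le> t" "w \<in> h ` unit_disc"
  shows "w + of_real t \<in> h ` unit_disc"
  using assms koenigs_shift(2) by blast

text \<open>
  The preimages of \<open>\<Omega>\<close> under the translations by integers cover \<open>K\<close>, and they increase with the integer.
\<close>
lemma shifts_absorb_compact:
  assumes \<Omega>: "open \<Omega>" and inv: "\<And>w t. w \<in> \<Omega> \<Longrightarrow> 0 \<le> t \<Longrightarrow> w + of_real t \<in> \<Omega>"
    and K: "compact K" and Im: "\<And>w. w \<in> K \<Longrightarrow> \<exists>v\<in>\<Omega>. Im v = Im w"
  obtains t0 where "0 \<le> t0" "\<And>w t. w \<in> K \<Longrightarrow> t0 \<le> t \<Longrightarrow> w + of_real t \<in> \<Omega>"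
proof -
  define U where "U n = (\<lambda>w. w + of_nat n) -` \<Omega>" for n :: nat
  have oU: "open (U n)" for n unfolding U_def by (intro open_vimage \<Omega> continuous_intros)
  have cov: "K \<subseteq> (\<Union>n\<in>UNIV. U n)"
  proof
    fix w assume "w \<in> K"
    then obtain v where v: "v \<in> \<Omega>" "Im v = Im w" using Im by blast
    obtain n :: nat where n: "Re v - Re w \<le> of_nat n" using real_arch_simple by blast
    have "w + of_nat n = v + of_real (Re w + of_nat n - Re v)" using v(2) by (simp add: complex_eq_iff)
    moreover have "v + of_real (Re w + of_nat n - Re v) \<in> \<Omega>" by (rule inv[OF v(1)]) (use n in simp)
    ultimately have "w + of_nat n \<in> \<Omega>" by (simp only:)
    then have "w \<in> U n" by (simp add: U_def)
    then show "w \<in> (\<Union>n\<in>UNIV. U n)" by blast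
  qed
  obtain F where F: "finite F" "K \<subseteq> (\<Union>n\<in>F. U n)"
    using compactE_image[OF K, of UNIV U] oU cov by metis
  define t0 where "t0 = real (Max (insert 0 F))"
  show ?thesis
  proof (rule that[of t0])
    show "0 \<le> t0" by (simp add: t0_def)
    fix w t assume w: "w \<in> K" and t: "t0 \<le> t"
    then obtain n where n: "n \<in> F" "w + of_nat n \<in> \<Omega>" using F(2) by (auto simp: U_def)
    have "real n \<le> t0" using F(1) n(1) by (simp add: t0_def)
    then have "(w + of_nat n) + of_real (t - real n) \<in> \<Omega>" using n(2) t by (intro inv) auto
    then show "w + of_real t \<in> \<Omega>" by simp
  qed
qed

text \<open>
  Let \<open>H\<close> map the disc onto the right half-plane with the Denjoy-Wolff point at infinity.  By Julia's
  inequality \<open>Re H\<close> grows by a factor \<open>1/q > 1\<close> with every unit of time.  If the heights of the domain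
  were unbounded, the domain would contain discs of every radius \<open>R\<close>, far to the right; there the positive
  harmonic function \<open>Re H \<circ> h\<^sup>-\<^sup>1\<close> grows by a factor of at most \<open>(R + 1)/(R - 1)\<close> along a unit translation
  from the centre.
\<close>
lemma hyperbolic_koenigs_width_bounded:
  assumes hyp: "hyperbolic_semiflow \<Phi>" and koe: "koenigs_function \<Phi> h"
  shows "\<exists>L. \<forall>z\<in>unit_disc. \<forall>z'\<in>unit_disc. Im (h z) - Im (h z') \<le> L"
proof -
  have h: "h holomorphic_on unit_disc" "inj_on h unit_disc" using koe by (auto simp: koenigs_function_def)
  obtain \<tau> \<alpha> where sf: "holomorphic_semiflow \<Phi>" and dw: "denjoy_wolff_point \<Phi> \<tau>" and \<alpha>: "\<alpha> < 0"
    and nt: "\<And>t. t \<ge> 0 \<Longrightarrow> nontangential_limit (deriv (\<Phi> t)) \<tau> (of_real (exp (t * \<alpha>)))"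
    using hyp unfolding hyperbolic_semiflow_def by blast
  define \<psi> where "\<psi> = \<Phi> 1"
  have self: "\<Phi> t z \<in> unit_disc" if "0 \<le> t" "z \<in> unit_disc" for t z
    using sf that unfolding holomorphic_semiflow_def by blast
  have \<psi>: "\<psi> holomorphic_on unit_disc" "\<And>z. z \<in> unit_disc \<Longrightarrow> \<psi> z \<in> unit_disc"
    using sf self[of 1] unfolding holomorphic_semiflow_def \<psi>_def by auto
  have \<tau>: "cmod \<tau> = 1" using dw by (simp add: denjoy_wolff_point_def)
  define u where "u n = \<Phi> (real n) 0" for n
  have u1: "u n \<in> unit_disc" for n unfolding u_def by (rule self) auto
  have u2: "u (Suc n) = \<psi> (u n)" for n
  proof -
    have "\<Phi> (1 + real n) 0 = \<Phi> 1 (\<Phi> (real n) 0)" using sf unfolding holomorphic_semiflow_def by simp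
    then show ?thesis by (simp add: u_def \<psi>_def)
  qed
  have u3: "u \<longlonglongrightarrow> \<tau>"
  proof -
    have "uniform_limit {0} \<Phi> (\<lambda>z. \<tau>) at_top"
      using dw unfolding denjoy_wolff_point_def by (elim conjE allE[of _ "{0}"]) simp
    then have "((\<lambda>t. \<Phi> t 0) \<longlongrightarrow> \<tau>) at_top" by simp
    from filterlim_compose[OF this filterlim_real_sequentially] show ?thesis by (simp add: u_def[abs_def])
  qed
  define q where "q = (1 + exp \<alpha>) / 2"
  have q: "exp \<alpha> < q" "q < 1" "0 < q" using \<alpha> by (auto simp: q_def add_pos_pos)
  have "(deriv \<psi> \<longlongrightarrow> of_real (exp \<alpha>)) (at \<tau> within stolz_region \<tau> 2)"
    using nt[of 1] unfolding nontangential_limit_def \<psi>_def by simp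
  then have "\<forall>\<^sub>F z in at \<tau> within stolz_region \<tau> 2. dist (deriv \<psi> z) (of_real (exp \<alpha>)) < q - exp \<alpha>"
    by (rule tendstoD) (use q in simp)
  then obtain d where d: "d > 0" "\<And>z. z \<in> stolz_region \<tau> 2 \<Longrightarrow> z \<noteq> \<tau> \<Longrightarrow> dist z \<tau> < d \<Longrightarrow> dist (deriv \<psi> z) (of_real (exp \<alpha>)) < q - exp \<alpha>"
    unfolding eventually_at by blast
  define r0 where "r0 = max 0 (1 - d)"
  have r0: "r0 < 1" using d(1) by (simp add: r0_def)
  have der: "cmod (deriv \<psi> (of_real r * \<tau>)) \<le> q" if r: "r0 < r" "r < 1" for r
  proof -
    have r': "0 < r" "1 - r < d" using r by (auto simp: r0_def)
    have "of_real r * \<tau> - \<tau> = of_real (r - 1) * \<tau>" by (simp add: algebra_simps)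
    then have dd: "cmod (of_real r * \<tau> - \<tau>) = 1 - r" using \<tau> r by (simp add: norm_mult del: of_real_diff)
    have "dist (deriv \<psi> (of_real r * \<tau>)) (of_real (exp \<alpha>)) < q - exp \<alpha>"
      by (rule d(2)) (use dd r r' \<tau> in \<open>auto simp: stolz_region_def norm_mult dist_norm\<close>)
    then have "cmod (deriv \<psi> (of_real r * \<tau>)) - cmod (of_real (exp \<alpha>)) < q - exp \<alpha>"
      unfolding dist_norm using norm_triangle_ineq2 le_less_trans by blast
    then show ?thesis by simp
  qed
  define H where "H z = (1 + cnj \<tau> * z) / (1 - cnj \<tau> * z)" for z
  have \<tau>z: "cmod (cnj \<tau> * z) < 1" if "z \<in> unit_disc" for z using that \<tau> by (simp add: norm_mult)
  have nz: "1 - cnj \<tau> * z \<noteq> 0" if "z \<in> unit_disc" for z using \<tau>z[OF that] by auto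
  have ReH: "Re (H z) = (1 - (cmod z)\<^sup>2) / (cmod (1 - cnj \<tau> * z))\<^sup>2" for z
  proof -
    define v where "v = cnj \<tau> * z"
    have "cmod v = cmod z" using \<tau> by (simp add: v_def norm_mult)
    moreover have "Re ((1 + v) / (1 - v)) = (1 - (cmod v)\<^sup>2) / (cmod (1 - v))\<^sup>2"
    proof -
      have "Re ((1 + v) / (1 - v)) = Re ((1 + v) * cnj (1 - v)) / (cmod (1 - v))\<^sup>2"
        by (subst complex_div_cnj) (simp only: Re_divide_of_real of_real_power[symmetric])
      also have "Re ((1 + v) * cnj (1 - v)) = 1 - (cmod v)\<^sup>2"
        unfolding cmod_power2 by (simp add: power2_eq_square algebra_simps)
      finally show ?thesis .
    qed
    ultimately show ?thesis by (simp add: H_def v_def)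
  qed
  have hH: "H holomorphic_on unit_disc" unfolding H_def[abs_def] using nz by (intro holomorphic_intros) auto
  have sq: "0 < 1 - (cmod z)\<^sup>2" if "z \<in> unit_disc" for z using that by (simp add: abs_square_less_1)
  have posH: "0 < Re (H z)" if "z \<in> unit_disc" for z
    unfolding ReH using sq[OF that] nz[OF that] by simp
  have grow: "Re (H z) \<le> q * Re (H (\<psi> z))" if z: "z \<in> unit_disc" for z
  proof -
    have \<psi>z: "\<psi> z \<in> unit_disc" by (rule \<psi>(2)[OF z])
    have "(cmod (1 - cnj \<tau> * \<psi> z))\<^sup>2 * (1 - (cmod z)\<^sup>2) \<le> q * ((cmod (1 - cnj \<tau> * z))\<^sup>2 * (1 - (cmod (\<psi> z))\<^sup>2))"
      by (rule Julia_inequality[OF \<psi> \<tau> u1 u2 u3 q(3) r0 der z])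
    moreover have "0 < (cmod (1 - cnj \<tau> * \<psi> z))\<^sup>2" "0 < (cmod (1 - cnj \<tau> * z))\<^sup>2" using nz[OF \<psi>z] nz[OF z] by auto
    ultimately show ?thesis unfolding ReH by (simp add: divide_simps mult_ac)
  qed
  define \<Omega> where "\<Omega> = h ` unit_disc"
  have o\<Omega>: "open \<Omega>" unfolding \<Omega>_def by (rule open_mapping_thm3[OF h(1) open_ball h(2)])
  have inv: "w + of_real t \<in> \<Omega>" if "w \<in> \<Omega>" "0 \<le> t" for w t
    using koenigs_domain_shift[OF koe that(2)] that(1) by (simp add: \<Omega>_def)
  obtain hi where hi: "hi holomorphic_on \<Omega>" "\<And>z. z \<in> unit_disc \<Longrightarrow> hi (h z) = z"
    using holomorphic_has_inverse[OF h(1) open_ball h(2)] unfolding \<Omega>_def by metis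
  have hi_disc: "hi w \<in> unit_disc \<and> h (hi w) = w" if "w \<in> \<Omega>" for w using that hi(2) by (auto simp: \<Omega>_def)
  have hi_\<psi>: "hi (w + 1) = \<psi> (hi w)" if w: "w \<in> \<Omega>" for w
  proof -
    have "h (\<psi> (hi w)) = w + 1" using koenigs_shift(1)[OF koe, of 1 "hi w"] hi_disc[OF w] by (simp add: \<psi>_def)
    then show ?thesis using hi(2)[OF \<psi>(2)] hi_disc[OF w] by metis
  qed
  have c\<Omega>: "connected \<Omega>" unfolding \<Omega>_def
    by (intro connected_continuous_image holomorphic_on_imp_continuous_on h) simp
  have cI: "connected (Im ` \<Omega>)" by (intro connected_continuous_image c\<Omega> continuous_intros)
  \<comment> \<open>for this radius the factor \<open>(R + 1)/(R - 1)\<close> is less than \<open>1/q\<close>\<close>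
  define R where "R = 2 / (1 - q)"
  have R: "2 \<le> R" "R * (1 - q) = 2" using q by (auto simp: R_def field_simps)
  show ?thesis
  proof (intro exI[of _ "2 * R"] ballI, rule ccontr)
    fix z z' assume z: "z \<in> unit_disc" "z' \<in> unit_disc" "\<not> Im (h z) - Im (h z') \<le> 2 * R"
    define y where "y = (Im (h z) + Im (h z')) / 2"
    have "{Im (h z')..Im (h z)} \<subseteq> Im ` \<Omega>"
      by (rule connected_contains_Icc[OF cI]) (use z in \<open>auto simp: \<Omega>_def\<close>)
    moreover have "Im w \<in> {Im (h z')..Im (h z)}" if "w \<in> cball (\<i> * of_real y) R" for w
    proof -
      have "\<bar>Im w - y\<bar> \<le> R" using that abs_Im_le_cmod[of "\<i> * of_real y - w"] by (simp add: dist_norm)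
      then have "- R \<le> Im w - y" "Im w - y \<le> R" by linarith+
      moreover have "2 * y = Im (h z) + Im (h z')" by (simp add: y_def)
      moreover have "Im (h z) - Im (h z') > 2 * R" using z(3) by linarith
      ultimately show ?thesis unfolding atLeastAtMost_iff by (intro conjI; linarith)
    qed
    ultimately have "\<exists>v\<in>\<Omega>. Im v = Im w" if "w \<in> cball (\<i> * of_real y) R" for w using that by (metis (no_types) imageE subsetD)
    from shifts_absorb_compact[OF o\<Omega> inv compact_cball this]
    obtain t0 where t0: "0 \<le> t0" "\<And>w t. w \<in> cball (\<i> * of_real y) R \<Longrightarrow> t0 \<le> t \<Longrightarrow> w + of_real t \<in> \<Omega>" by metis
    define w0 where "w0 = \<i> * of_real y + of_real t0"
    have disc: "w0 + of_real R * v \<in> \<Omega>" if v: "cmod v \<le> 1" for v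
    proof -
      have "\<i> * of_real y + of_real R * v \<in> cball (\<i> * of_real y) R"
        using v R(1) by (simp add: dist_norm norm_mult)
      from t0(2)[OF this order.refl] show ?thesis by (simp add: w0_def algebra_simps)
    qed
    define k where "k v = hi (w0 + of_real R * v)" for v
    have "(hi \<circ> (\<lambda>v. w0 + of_real R * v)) holomorphic_on unit_disc"
      by (rule holomorphic_on_compose_gen[OF _ hi(1)]) (use disc in \<open>auto intro!: holomorphic_intros\<close>)
    then have hk: "k holomorphic_on unit_disc" by (simp add: k_def[abs_def] o_def)
    have kd: "k v \<in> unit_disc" if "v \<in> unit_disc" for v using hi_disc[OF disc[of v]] that by (simp add: k_def)
    have "(H \<circ> k) holomorphic_on unit_disc" by (rule holomorphic_on_compose_gen[OF hk hH]) (use kd in blast)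
    then have hHk: "(\<lambda>v. H (k v)) holomorphic_on unit_disc" by (simp add: o_def)
    have v: "of_real (1 / R) \<in> unit_disc" using R(1) unfolding mem_ball_0 norm_of_real by simp
    have "Re (H (k (of_real (1 / R)))) * (1 - cmod (of_real (1 / R))) \<le> Re (H (k 0)) * (1 + cmod (of_real (1 / R)))"
      by (rule Harnack_half_plane[OF hHk _ v]) (use posH kd in blast)
    moreover have "cmod (of_real (1 / R)) = 1 / R" using R(1) unfolding norm_of_real by simp
    moreover have "k (of_real (1 / R)) = \<psi> (k 0)" using hi_\<psi>[OF disc[of 0]] R(1) by (simp add: k_def)
    ultimately have "Re (H (\<psi> (k 0))) * (1 - 1 / R) \<le> Re (H (k 0)) * (1 + 1 / R)" by simp
    also have "\<dots> \<le> (q * Re (H (\<psi> (k 0)))) * (1 + 1 / R)"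
      using grow[OF kd[of 0]] R(1) by (intro mult_right_mono) auto
    finally have "Re (H (\<psi> (k 0))) * (1 - 1 / R) \<le> Re (H (\<psi> (k 0))) * (q * (1 + 1 / R))" by (simp add: mult_ac)
    moreover have "0 < Re (H (\<psi> (k 0)))" by (intro posH \<psi>(2) kd) simp
    ultimately have "1 - 1 / R \<le> q * (1 + 1 / R)" by simp
    then have "R * (1 - 1 / R) \<le> R * (q * (1 + 1 / R))" using R(1) by (intro mult_left_mono) auto
    moreover have "R * (1 - 1 / R) = R - 1" "R * (q * (1 + 1 / R)) = q * (R + 1)" using R(1) by (simp_all add: field_simps)
    ultimately have "R - 1 \<le> q * (R + 1)" by (simp only:)
    then show False using R q by (simp add: algebra_simps)
  qed
qed

section \<open>Growth of eigenfunctions\<close>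

text \<open>
  Along the axis of a half-strip of width \<open>2d\<close> the boundary distance in the disc decays at most like
  \<open>e\<^bsup>-\<pi>n/(2d)\<^esup>\<close>, by comparison with the conformal map \<open>u \<mapsto> (2d/\<pi>) Log(2/(1 - u))\<close> of the disc into the
  half-strip.  With the sharp pointwise estimate this bounds the eigenvalue.
\<close>
lemma eigenfunction_growth:
  assumes h: "h holomorphic_on unit_disc" "inj_on h unit_disc" and d: "0 < d" and \<sigma>: "\<sigma> = 1 \<or> \<sigma> = (-1::real)"
    and strip: "\<And>v. 0 < Re v \<Longrightarrow> \<bar>Im v\<bar> < d \<Longrightarrow> w0 + of_real \<sigma> * v \<in> h ` unit_disc"
    and g: "hardy p g" and p: "1 \<le> p"
    and zs: "\<And>n::nat. 1 \<le> n \<Longrightarrow> zs n \<in> unit_disc \<and> h (zs n) = w0 + of_real (\<sigma> * of_nat n)"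
    and e: "0 < \<epsilon>" and Q: "0 < Q" and gz: "\<And>n::nat. 1 \<le> n \<Longrightarrow> \<epsilon> * Q ^ n \<le> cmod (g (zs n))"
  shows "Q \<le> exp (pi / (2 * d * p))"
proof -
  define a where "a = pi / (2 * d)"
  have a: "0 < a" using d by (simp add: a_def)
  have p0: "0 < p" using p by simp
  obtain hi where hi: "hi holomorphic_on h ` unit_disc" "\<And>z. z \<in> unit_disc \<Longrightarrow> hi (h z) = z"
    using holomorphic_has_inverse[OF h(1) open_ball h(2)] by metis
  define m where "m u = w0 + of_real \<sigma> * (of_real (1 / a) * Ln (2 / (1 - u)))" for u
  have X: "1 < Re (2 / (1 - u))" if "u \<in> unit_disc" for u
  proof -
    have "1 - u \<noteq> 0" using that by auto
    then have "2 / (1 - u) = 1 + (1 + u) / (1 - u)" by (simp add: field_simps)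
    moreover have "0 < Re ((1 + u) / (1 - u))" by (rule Cayley_inverse_pos) (use that in simp)
    ultimately show ?thesis by simp
  qed
  have m: "m u \<in> h ` unit_disc" if u: "u \<in> unit_disc" for u
  proof -
    define L where "L = Ln (2 / (1 - u))"
    have "1 < cmod (2 / (1 - u))" using X[OF u] complex_Re_le_cmod[of "2 / (1 - u)"] by linarith
    moreover have "2 / (1 - u) \<noteq> 0" using X[OF u] by auto
    ultimately have "0 < Re L" by (simp add: L_def)
    moreover have "\<bar>Im L\<bar> < pi / 2" unfolding L_def by (rule Re_Ln_pos_lt_imp) (use X[OF u] in linarith)
    moreover have "pi / 2 = a * d" using d by (simp add: a_def)
    ultimately have "0 < Re (of_real (1 / a) * L)" "\<bar>Im (of_real (1 / a) * L)\<bar> < d"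
      using a by (auto simp: abs_mult field_simps)
    from strip[OF this] show ?thesis by (simp add: m_def L_def)
  qed
  have hm: "m holomorphic_on unit_disc" unfolding m_def[abs_def]
  proof (intro holomorphic_intros)
    fix u :: complex assume u: "u \<in> unit_disc"
    then show "1 - u \<noteq> 0" by auto
    show "2 / (1 - u) \<notin> \<real>\<^sub>\<le>\<^sub>0" using X[OF u] by (auto simp: complex_nonpos_Reals_iff)
  qed
  define k where "k u = hi (m u)" for u
  have "(hi \<circ> m) holomorphic_on unit_disc" by (rule holomorphic_on_compose_gen[OF hm hi(1)]) (use m in blast)
  then have hk: "k holomorphic_on unit_disc" by (simp add: k_def[abs_def] o_def)
  have kd: "k u \<in> unit_disc" if "u \<in> unit_disc" for u using m[OF that] hi(2) by (auto simp: k_def)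
  obtain c where c: "c > 0" "\<And>u. u \<in> unit_disc \<Longrightarrow> c * (1 - cmod u) \<le> 1 - cmod (k u)"
    using disc_self_map_boundary_distance[OF hk kd] by metis
  obtain B where B: "B > 0" "\<And>r. 0 < r \<Longrightarrow> r < 1 \<Longrightarrow> Hp_integral p g r \<le> B" using hardy_boundE[OF g] by metis
  define M where "M = (B / (2 * c)) powr (1 / p)"
  have est: "\<epsilon> * Q ^ n \<le> M * exp (a / p) ^ n" if n: "1 \<le> n" "exp (- (real n * a)) \<le> 1 / 2" for n :: nat
  proof -
    \<comment> \<open>the point with \<open>m u = w0 + \<sigma> n\<close>\<close>
    define u where "u = (of_real (1 - 2 * exp (- (real n * a))) :: complex)"
    have nu: "cmod u = 1 - 2 * exp (- (real n * a))" unfolding u_def norm_of_real using n by simp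
    have ud: "u \<in> unit_disc" using nu by simp
    have "1 - u = of_real (2 * exp (- (real n * a)))" by (simp add: u_def)
    then have "2 / (1 - u) = of_real (2 / (2 * exp (- (real n * a))))" by (simp only: of_real_divide of_real_numeral)
    moreover have "2 / (2 * inverse e) = e" if "e > 0" for e :: real using that by (simp add: field_simps)
    then have "2 / (2 * exp (- (real n * a))) = exp (real n * a)" by (metis exp_gt_zero exp_minus)
    ultimately have "2 / (1 - u) = of_real (exp (real n * a))" by (simp only:)
    then have "Ln (2 / (1 - u)) = of_real (real n * a)" by (simp only: Ln_of_real[OF exp_gt_zero] ln_exp)
    then have "m u = w0 + of_real (\<sigma> * of_nat n)" using a by (simp add: m_def)
    then have ku: "k u = zs n" using zs[OF n(1)] hi(2) by (metis k_def)
    have "c * (2 * exp (- (real n * a))) \<le> 1 - cmod (zs n)" using c(2)[OF ud] nu ku by simp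
    moreover have "0 < c * (2 * exp (- (real n * a)))" using c(1) by simp
    ultimately have "B / (1 - cmod (zs n)) \<le> B / (c * (2 * exp (- (real n * a))))"
      using B(1) by (intro divide_left_mono) auto
    also have "\<dots> = B / (2 * c) * exp (real n * a)" by (simp add: exp_minus field_simps)
    finally have "cmod (g (zs n)) powr p \<le> B / (2 * c) * exp (real n * a)"
      using hardy_point_bound[OF hardy_holomorphic[OF g] B(2) _ p, of "zs n"] zs[OF n(1)] by (meson order_trans)
    then have "(cmod (g (zs n)) powr p) powr (1 / p) \<le> (B / (2 * c) * exp (real n * a)) powr (1 / p)"
      using p0 by (intro powr_mono2) auto
    also have "\<dots> = M * exp (a / p) ^ n"
    proof -
      have "(B / (2 * c) * exp (real n * a)) powr (1 / p) = (B / (2 * c)) powr (1 / p) * exp (real n * a) powr (1 / p)"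
        by (rule powr_mult)
      moreover have "exp (real n * a) powr (1 / p) = exp (a / p) ^ n"
        by (simp add: exp_powr_real exp_of_nat_mult[symmetric])
      ultimately show ?thesis by (simp only: M_def)
    qed
    finally have "cmod (g (zs n)) \<le> M * exp (a / p) ^ n" using p0 by (simp add: powr_powr)
    with gz[OF n(1)] show ?thesis by simp
  qed
  have "Q \<le> exp (a / p)"
  proof (rule ccontr)
    assume "\<not> Q \<le> exp (a / p)"
    define \<rho> where "\<rho> = Q / exp (a / p)"
    have \<rho>: "1 < \<rho>" using \<open>\<not> Q \<le> exp (a / p)\<close> by (simp add: \<rho>_def)
    obtain n1 where n1: "M / \<epsilon> < \<rho> ^ n1" using real_arch_pow[OF \<rho>] by blast
    obtain n2 :: nat where n2: "1 / a \<le> of_nat n2" using real_arch_simple by blast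
    define n where "n = max n1 (max n2 1)"
    have n: "1 \<le> n" "n1 \<le> n" "1 / a \<le> real n" using n2 by (auto simp: n_def)
    have "1 \<le> real n * a" using n(3) a by (simp add: pos_divide_le_eq)
    then have "2 \<le> exp (real n * a)" using exp_ge_add_one_self[of "real n * a"] by linarith
    from le_imp_inverse_le[OF this] have "exp (- (real n * a)) \<le> 1 / 2" by (simp only: exp_minus inverse_eq_divide)
    from est[OF n(1) this] have "(\<epsilon> * Q ^ n) / exp (a / p) ^ n \<le> M" by (simp only: pos_divide_le_eq zero_less_power exp_gt_zero)
    moreover have "(\<epsilon> * Q ^ n) / exp (a / p) ^ n = \<epsilon> * \<rho> ^ n" by (simp only: \<rho>_def power_divide times_divide_eq_right)
    ultimately have "\<epsilon> * \<rho> ^ n \<le> M" by (simp only:)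
    moreover have "\<rho> ^ n1 \<le> \<rho> ^ n" using n(2) \<rho> by (intro power_increasing) auto
    ultimately have "\<epsilon> * \<rho> ^ n1 \<le> M" using e by (meson mult_left_mono less_imp_le order_trans)
    moreover have "M < \<rho> ^ n1 * \<epsilon>" using n1 e by (simp only: pos_divide_less_eq)
    ultimately show False by (simp add: mult.commute)
  qed
  moreover have "a / p = pi / (2 * d * p)" by (simp add: a_def)
  ultimately show ?thesis by (simp only:)
qed

text \<open>
  By the growth bound, \<open>g\<close> vanishes on the axis of the half-strip, hence everywhere.
\<close>
lemma eigenfunction_zero:
  assumes h: "h holomorphic_on unit_disc" "inj_on h unit_disc" and d: "0 < d" and \<sigma>: "\<sigma> = 1 \<or> \<sigma> = (-1::real)"
    and strip: "\<And>w. t0 < \<sigma> * Re w \<Longrightarrow> \<bar>Im w - y0\<bar> < d \<Longrightarrow> w \<in> h ` unit_disc"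
    and g: "hardy p g" and p: "1 \<le> p" and Q: "exp (pi / (2 * d * p)) < Q"
    and eig: "\<And>z z'. z \<in> unit_disc \<Longrightarrow> z' \<in> unit_disc \<Longrightarrow> h z' = h z + of_real \<sigma> \<Longrightarrow> cmod (g z') = Q * cmod (g z)"
    and z: "z \<in> unit_disc"
  shows "g z = 0"
proof -
  obtain hi where hi: "hi holomorphic_on h ` unit_disc" "\<And>z. z \<in> unit_disc \<Longrightarrow> hi (h z) = z"
    using holomorphic_has_inverse[OF h(1) open_ball h(2)] by metis
  have hid: "hi w \<in> unit_disc \<and> h (hi w) = w" if "w \<in> h ` unit_disc" for w using that hi(2) by auto
  have Q0: "0 < Q" using Q by (meson exp_gt_zero less_trans)
  define \<gamma> where "\<gamma> t = of_real (\<sigma> * t) + \<i> * of_real y0" for t :: real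
  have \<sigma>2: "\<sigma> * \<sigma> = 1" using \<sigma> by auto
  have \<gamma>\<Omega>: "\<gamma> t \<in> h ` unit_disc" if "t0 < t" for t
  proof (rule strip)
    have "\<sigma> * Re (\<gamma> t) = (\<sigma> * \<sigma>) * t" by (simp add: \<gamma>_def)
    then show "t0 < \<sigma> * Re (\<gamma> t)" using that by (simp add: \<sigma>2)
  qed (use d in \<open>simp add: \<gamma>_def\<close>)
  have zero: "g (hi (\<gamma> t)) = 0" if t: "t0 < t" for t
  proof (rule ccontr)
    assume nz: "g (hi (\<gamma> t)) \<noteq> 0"
    define w0 where "w0 = \<gamma> t"
    have pts: "w0 + of_real \<sigma> * v \<in> h ` unit_disc" if v: "0 \<le> Re v" "\<bar>Im v\<bar> < d" for v
    proof (rule strip)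
      have "\<sigma> * Re (w0 + of_real \<sigma> * v) = (\<sigma> * \<sigma>) * t + (\<sigma> * \<sigma>) * Re v" by (simp add: w0_def \<gamma>_def distrib_left mult.assoc)
      then show "t0 < \<sigma> * Re (w0 + of_real \<sigma> * v)" using v t by (simp add: \<sigma>2)
      show "\<bar>Im (w0 + of_real \<sigma> * v) - y0\<bar> < d" using v \<sigma> by (auto simp: w0_def \<gamma>_def)
    qed
    define zs where "zs n = hi (w0 + of_real (\<sigma> * of_nat n))" for n :: nat
    have zs: "zs n \<in> unit_disc \<and> h (zs n) = w0 + of_real (\<sigma> * of_nat n)" for n
      unfolding zs_def by (rule hid) (use pts[of "of_nat n"] d in simp)
    have gzs: "cmod (g (zs n)) = cmod (g (zs 0)) * Q ^ n" for n
    proof (induction n)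
      case (Suc n)
      have "cmod (g (zs (Suc n))) = Q * cmod (g (zs n))"
        by (rule eig) (use zs[of n] zs[of "Suc n"] in \<open>auto simp: algebra_simps\<close>)
      then show ?case using Suc by simp
    qed simp
    have "zs 0 = hi (\<gamma> t)" by (simp add: zs_def w0_def)
    then have e: "0 < cmod (g (zs 0))" using nz by simp
    have "Q \<le> exp (pi / (2 * d * p))"
    proof (rule eigenfunction_growth[OF h d \<sigma> _ g p _ e Q0])
      show "w0 + of_real \<sigma> * v \<in> h ` unit_disc" if "0 < Re v" "\<bar>Im v\<bar> < d" for v
        by (rule pts[OF less_imp_le[OF that(1)] that(2)])
      show "zs n \<in> unit_disc \<and> h (zs n) = w0 + of_real (\<sigma> * of_nat n)" for n by (rule zs)
      show "cmod (g (zs 0)) * Q ^ n \<le> cmod (g (zs n))" for n by (simp only: gzs[symmetric] order.refl)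
    qed
    with Q show False by simp
  qed
  have hg: "g holomorphic_on unit_disc" using g by (rule hardy_holomorphic)
  define t1 where "t1 = t0 + 1"
  define x where "x n = hi (\<gamma> (t1 + inverse (real (Suc n))))" for n
  have \<gamma>1: "\<gamma> t1 \<in> h ` unit_disc" by (rule \<gamma>\<Omega>) (simp add: t1_def)
  have xin: "t0 < t1 + inverse (real (Suc n))" for n by (simp add: t1_def add_pos_pos)
  have "(\<lambda>n. \<gamma> (t1 + inverse (real (Suc n)))) \<longlonglongrightarrow> \<gamma> (t1 + 0)"
    unfolding \<gamma>_def by (intro tendsto_intros LIMSEQ_inverse_real_of_nat)
  then have lim: "(\<lambda>n. \<gamma> (t1 + inverse (real (Suc n)))) \<longlonglongrightarrow> \<gamma> t1" by simp
  have xlim: "x \<longlonglongrightarrow> hi (\<gamma> t1)" unfolding x_def[abs_def]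
    by (rule continuous_on_tendsto_compose[OF holomorphic_on_imp_continuous_on[OF hi(1)] lim \<gamma>1]) (use \<gamma>\<Omega>[OF xin] in auto)
  have xne: "x n \<noteq> hi (\<gamma> t1)" for n
  proof
    assume "x n = hi (\<gamma> t1)"
    then have "h (x n) = h (hi (\<gamma> t1))" by simp
    then have "\<gamma> (t1 + inverse (real (Suc n))) = \<gamma> t1" using hid[OF \<gamma>\<Omega>[OF xin]] hid[OF \<gamma>1] by (simp add: x_def)
    moreover have "Re (\<gamma> t) = \<sigma> * t" for t by (simp add: \<gamma>_def)
    ultimately have "\<sigma> * (t1 + inverse (real (Suc n))) = \<sigma> * t1" by metis
    moreover have "inverse (real (Suc n)) \<noteq> 0" by simp
    ultimately show False using \<sigma> by (metis \<sigma>2 add_cancel_right_right distrib_left mult_eq_0_iff zero_neq_one)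
  qed
  have lp: "hi (\<gamma> t1) islimpt range x"
    unfolding islimpt_sequential using xlim xne by (intro exI[of _ x]) auto
  show ?thesis
  proof (rule analytic_continuation[OF hg open_ball _ _ _ lp])
    show "range x \<subseteq> unit_disc" using hid[OF \<gamma>\<Omega>[OF xin]] by (auto simp: x_def)
    show "hi (\<gamma> t1) \<in> unit_disc" using hid[OF \<gamma>1] by blast
    show "g u = 0" if "u \<in> range x" for u using that zero[OF xin] by (auto simp: x_def)
  qed (use z in auto)
qed

section \<open>The complement of a Koenigs domain\<close>

lemma closure_right_invariant:
  fixes \<Omega> :: "complex set"
  assumes inv: "\<And>w t. w \<in> \<Omega> \<Longrightarrow> 0 \<le> t \<Longrightarrow> w + of_real t \<in> \<Omega>" and w: "w \<in> closure \<Omega>" "0 \<le> t"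
  shows "w + of_real t \<in> closure \<Omega>"
proof -
  have "(\<lambda>w. of_real t + w) ` \<Omega> \<subseteq> \<Omega>" using inv[OF _ w(2)] by (auto simp: add.commute)
  then have "closure ((\<lambda>w. of_real t + w) ` \<Omega>) \<subseteq> closure \<Omega>" by (rule closure_mono)
  then have "(\<lambda>w. of_real t + w) ` closure \<Omega> \<subseteq> closure \<Omega>" unfolding closure_translation .
  then show ?thesis using w(1) by (auto simp: add.commute)
qed

lemma closure_Im_bounds:
  assumes width: "\<And>w. w \<in> \<Omega> \<Longrightarrow> a \<le> Im w \<and> Im w \<le> b" and w: "w \<in> closure \<Omega>"
  shows "a \<le> Im w \<and> Im w \<le> b"
proof -
  have "closure \<Omega> \<subseteq> {w. a \<le> Im w} \<inter> {w. Im w \<le> b}"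
    by (rule closure_minimal) (use width in \<open>blast intro: closed_Int closed_halfspace_Im_ge closed_halfspace_Im_le\<close>)+
  then show ?thesis using w by blast
qed
text \<open>
  A component of the complement of \<open>K\<close> that meets neither the half-plane above nor the one below the
  strip would be a third component, unless these two half-planes lie in one component.  In that case
  the component of the half-planes crosses every horizontal line in between; since the complement is
  invariant under translation to the left, any two points of it on the same horizontal line lie in
  the same component.
\<close>
lemma complement_connects_to_half_planes:
  assumes inv: "\<And>w t. w \<in> K \<Longrightarrow> 0 \<le> t \<Longrightarrow> w + of_real t \<in> K"
    and width: "\<And>w. w \<in> K \<Longrightarrow> a \<le> Im w \<and> Im w \<le> b"
    and fin: "finite (components (- K))" and two: "card (components (- K)) \<le> 2"
    and w: "w \<notin> K"
  shows "\<exists>T. connected T \<and> w \<in> T \<and> T \<inter> K = {} \<and> (\<exists>v\<in>T. Im v < a \<or> b < Im v)"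
proof (rule ccontr)
  assume no: "\<not> ?thesis"
  define CC where "CC = connected_component_set (- K)"
  have CC: "connected (CC u)" "CC u \<subseteq> - K" for u by (simp_all add: CC_def connected_component_subset)
  have self: "u \<in> CC u" if "u \<notin> K" for u using that by (simp add: CC_def)
  have same: "CC u = CC v" if "v \<in> CC u" for u v using that by (simp add: CC_def connected_component_eq)
  have comp: "CC u \<in> components (- K)" if "u \<notin> K" for u using that by (auto simp: CC_def components_def)
  have bdd: "a \<le> Im v \<and> Im v \<le> b" if "v \<in> CC w" for v
    using no CC self[OF w] that by (metis disjoint_eq_subset_Compl not_le)
  define up where "up = Complex 0 (b + 1)"
  define dn where "dn = Complex 0 (a - 1)"
  have ab: "a \<le> Im w" "Im w \<le> b" using bdd[OF self[OF w]] by auto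
  have up: "up \<notin> K" and dn: "dn \<notin> K" using width[of up] width[of dn] by (auto simp: up_def dn_def)
  have ne: "CC w \<noteq> CC up" "CC w \<noteq> CC dn"
    using bdd[of up] bdd[of dn] self[OF up] self[OF dn] by (auto simp: up_def dn_def)
  have "CC up = CC dn"
  proof (rule ccontr)
    assume "CC up \<noteq> CC dn"
    then have "card {CC w, CC up, CC dn} = 3" using ne by simp
    moreover have "card {CC w, CC up, CC dn} \<le> card (components (- K))"
      by (rule card_mono[OF fin]) (use comp w up dn in blast)
    ultimately show False using two by simp
  qed
  then have "dn \<in> CC up" using self[OF dn] by simp
  moreover have "connected (Im ` CC up)" by (intro connected_continuous_image CC continuous_intros)
  ultimately have "{Im dn..Im up} \<subseteq> Im ` CC up" using self[OF up] by (intro connected_contains_Icc imageI)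
  moreover have "Im w \<in> {Im dn..Im up}" using ab by (simp add: up_def dn_def)
  ultimately obtain u where u: "u \<in> CC up" "Im u = Im w" by (metis imageE subsetD)
  have uK: "u \<notin> K" using u(1) CC(2) by blast
  \<comment> \<open>the half-line from \<open>x\<close> to the left\<close>
  define L where "L x = (\<lambda>t. Complex t (Im x)) ` {..Re x}" for x
  have L: "L x \<subseteq> CC x" if x: "x \<notin> K" for x
  proof -
    have "connected (L x)" unfolding L_def Complex_eq by (intro connected_continuous_image continuous_intros) auto
    moreover have "x \<in> L x" by (auto simp: L_def intro!: image_eqI[of _ _ "Re x"])
    moreover have "L x \<subseteq> - K"
    proof
      fix v assume "v \<in> L x"
      then have v: "Re v \<le> Re x" "Im v = Im x" by (auto simp: L_def)
      have "x = v + of_real (Re x - Re v)" using v(2) by (simp add: complex_eq_iff)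
      then show "v \<in> - K" using inv[of v "Re x - Re v"] v(1) x by auto
    qed
    ultimately show ?thesis unfolding CC_def by (intro connected_component_maximal)
  qed
  define v where "v = Complex (min (Re u) (Re w)) (Im w)"
  have "v \<in> L u" "v \<in> L w" using u(2) by (auto simp: v_def L_def)
  then have "v \<in> CC u" "v \<in> CC w" using L[OF uK] L[OF w] by auto
  then have "CC u = CC w" using same by metis
  moreover have "CC u = CC up" using same[OF u(1)] by simp
  ultimately show False using ne by simp
qed

text \<open>
  The heights of the full horizontal lines in \<open>K\<close> form a compact set, and an interval because a
  missing line could not be connected to the outside of the strip.  A point of \<open>K\<close> far to the left
  has nearly such a height, by compactness and the invariance of \<open>K\<close> under translation to the right.
\<close>
lemma maximal_strip:
  assumes K: "closed K" and inv: "\<And>w t. w \<in> K \<Longrightarrow> 0 \<le> t \<Longrightarrow> w + of_real t \<in> K"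
    and width: "\<And>w. w \<in> K \<Longrightarrow> a \<le> Im w \<and> Im w \<le> b"
    and off: "\<And>w. w \<notin> K \<Longrightarrow> \<exists>T. connected T \<and> w \<in> T \<and> T \<inter> K = {} \<and> (\<exists>v\<in>T. Im v < a \<or> b < Im v)"
    and cd: "c < d" "\<And>w. c < Im w \<Longrightarrow> Im w < d \<Longrightarrow> w \<in> K"
  obtains a' b' where "a' < b'" "\<And>w. a' < Im w \<Longrightarrow> Im w < b' \<Longrightarrow> w \<in> K"
    "\<And>\<epsilon>. 0 < \<epsilon> \<Longrightarrow> \<exists>n. \<forall>w\<in>K. Re w < - n \<longrightarrow> a' - \<epsilon> < Im w \<and> Im w < b' + \<epsilon>"
proof -
  define Z where "Z = {y. \<forall>x. Complex x y \<in> K}"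
  have "Z = (\<Inter>x. (\<lambda>y. Complex x y) -` K)" by (auto simp: Z_def)
  moreover have "closed ((\<lambda>y. Complex x y) -` K)" for x
    unfolding Complex_eq by (intro closed_vimage K continuous_intros)
  ultimately have cZ: "closed Z" by auto
  have Zab: "Z \<subseteq> {a..b}"
  proof
    fix y assume "y \<in> Z"
    then have "Complex 0 y \<in> K" by (simp add: Z_def)
    from width[OF this] show "y \<in> {a..b}" by simp
  qed
  have kZ: "compact Z" using cZ Zab by (meson bounded_closed_interval bounded_subset compact_eq_bounded_closed)
  have cdZ: "y \<in> Z" if "c < y" "y < d" for y using cd(2) that by (simp add: Z_def)
  obtain y1 where y1: "c < y1" "y1 < d" using dense[OF cd(1)] by blast
  obtain y2 where y2: "y1 < y2" "y2 < d" using dense[OF y1(2)] by blast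
  have Z12: "y1 \<in> Z" "y2 \<in> Z" using cdZ y1 y2 by auto
  then have neZ: "Z \<noteq> {}" by blast
  obtain a' where a': "a' \<in> Z" "\<And>y. y \<in> Z \<Longrightarrow> a' \<le> y" using compact_attains_inf[OF kZ neZ] by blast
  obtain b' where b': "b' \<in> Z" "\<And>y. y \<in> Z \<Longrightarrow> y \<le> b'" using compact_attains_sup[OF kZ neZ] by blast
  show ?thesis
  proof (rule that[of a' b'])
    show "a' < b'" using a'(2)[OF Z12(1)] b'(2)[OF Z12(2)] y2 by linarith
    show "w \<in> K" if w: "a' < Im w" "Im w < b'" for w
    proof (rule ccontr)
      assume "w \<notin> K"
      then obtain T v where T: "connected T" "w \<in> T" "T \<inter> K = {}" and v: "v \<in> T" "Im v < a \<or> b < Im v"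
        using off by blast
      have line: "False" if "u \<in> T" "Im u \<in> Z" for u
      proof -
        have "Complex (Re u) (Im u) \<in> K" using that(2) unfolding Z_def by blast
        then show False using that(1) T(3) by auto
      qed
      have cI: "connected (Im ` T)" by (intro connected_continuous_image T continuous_intros)
      have "a \<le> a'" "b' \<le> b" using Zab a'(1) b'(1) by auto
      then consider "Im v < a'" | "b' < Im v" using v(2) by linarith
      then show False
      proof cases
        case 1
        have "{Im v..Im w} \<subseteq> Im ` T" using cI v(1) T(2) by (intro connected_contains_Icc imageI)
        then have "a' \<in> Im ` T" using 1 w by auto
        then show False using line a'(1) by blast
      next
        case 2
        have "{Im w..Im v} \<subseteq> Im ` T" using cI v(1) T(2) by (intro connected_contains_Icc imageI)
        then have "b' \<in> Im ` T" using 2 w by auto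
        then show False using line b'(1) by blast
      qed
    qed
    show "\<exists>n. \<forall>w\<in>K. Re w < - n \<longrightarrow> a' - \<epsilon> < Im w \<and> Im w < b' + \<epsilon>" if e: "0 < \<epsilon>" for \<epsilon>
    proof (rule ccontr)
      assume neg: "\<not> ?thesis"
      have "\<forall>n::nat. \<exists>w. w \<in> K \<and> Re w < - real n \<and> \<not> (a' - \<epsilon> < Im w \<and> Im w < b' + \<epsilon>)" using neg by blast
      from choice[OF this] obtain w where w: "\<And>n. w n \<in> K" "\<And>n. Re (w n) < - real n"
        "\<And>n. \<not> (a' - \<epsilon> < Im (w n) \<and> Im (w n) < b' + \<epsilon>)" by blast
      define S where "S = {a..b} \<inter> ({..a' - \<epsilon>} \<union> {b' + \<epsilon>..})"
      have "compact S" unfolding S_def by (intro compact_Int_closed closed_Un compact_Icc closed_atMost closed_atLeast)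
      moreover have "\<forall>n. Im (w n) \<in> S"
      proof
        fix n show "Im (w n) \<in> S" using w(3)[of n] width[OF w(1)[of n]] unfolding S_def by auto
      qed
      ultimately obtain y r where y: "y \<in> S" "strict_mono r" "((\<lambda>n. Im (w n)) \<circ> r) \<longlonglongrightarrow> y"
        unfolding compact_def by metis
      have "Complex x y \<in> K" for x
      proof -
        obtain N :: nat where N: "- x \<le> of_nat N" using real_arch_simple by blast
        have "Complex x (Im (w (r (n + N)))) \<in> K" for n
        proof -
          have "N \<le> r (n + N)" using seq_suble[OF y(2), of "n + N"] by simp
          then have "Re (w (r (n + N))) \<le> x" using w(2)[of "r (n + N)"] N by linarith
          moreover have "Complex x (Im (w (r (n + N)))) = w (r (n + N)) + of_real (x - Re (w (r (n + N))))"
            by (simp add: complex_eq_iff)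
          moreover have "w (r (n + N)) + of_real (x - Re (w (r (n + N)))) \<in> K" if "Re (w (r (n + N))) \<le> x"
            by (rule inv[OF w(1)]) (use that in simp)
          ultimately show ?thesis by (simp only:)
        qed
        moreover have "(\<lambda>n. Im (w (r (n + N)))) \<longlonglongrightarrow> y" using LIMSEQ_ignore_initial_segment[OF y(3), of N] by (simp add: o_def)
        then have "(\<lambda>n. Complex x (Im (w (r (n + N))))) \<longlonglongrightarrow> Complex x y"
          by (intro tendsto_Complex tendsto_const)
        ultimately show ?thesis by (rule closed_sequentially[OF K, where f = "\<lambda>n. Complex x (Im (w (r (n + N))))"])
      qed
      then have "y \<in> Z" by (simp add: Z_def)
      then show False using a'(2)[of y] b'(2)[of y] y(1) e by (auto simp: S_def)
    qed
  qed
qed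

section \<open>Exponentials of the Koenigs function\<close>

text \<open>
  Where \<open>ps Im h\<close> is within \<open>\<theta> < \<pi>/2\<close> of a constant, the real part of \<open>exp (ps (h - \<i>y))\<close> is at least
  \<open>cos \<theta> |e\<^bsup>sh\<^esup>|\<^sup>p\<close>; where \<open>|e\<^bsup>sh\<^esup>|\<^sup>p \<le> E\<close>, the added constant \<open>2E\<close> makes up for a possibly negative real part.
\<close>
lemma hardy_exp_of_angle_bound:
  fixes s p y \<theta> E :: real
  assumes h: "h holomorphic_on unit_disc" and p: "0 < p" and \<theta>: "\<theta> < pi / 2" and E: "0 \<le> E"
    and dich: "\<And>z. z \<in> unit_disc \<Longrightarrow> exp (p * s * Re (h z)) \<le> E \<or> \<bar>p * s * (Im (h z) - y)\<bar> \<le> \<theta>"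
    and \<theta>0: "0 \<le> \<theta>"
  shows "hardy p (\<lambda>z. exp (of_real s * h z))"
proof (rule hardy_majorant[OF _ _ p])
  define G where "G z = (exp (of_real (p * s) * (h z - \<i> * of_real y)) + of_real (2 * E)) / of_real (cos \<theta>)" for z
  show "(\<lambda>z. exp (of_real s * h z)) holomorphic_on unit_disc" by (intro holomorphic_intros h)
  have c: "0 < cos \<theta>" using \<theta> \<theta>0 by (intro cos_gt_zero_pi) linarith+
  show "G holomorphic_on unit_disc" unfolding G_def[abs_def] by (intro holomorphic_intros h) (use c in simp)
  fix z assume z: "z \<in> unit_disc"
  define X where "X = exp (p * s * Re (h z))"
  have X: "0 < X" by (simp add: X_def)
  have "cmod (exp (of_real s * h z)) powr p = X" by (simp add: X_def exp_powr_real mult_ac)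
  moreover have "Re (G z) = (X * cos (p * s * (Im (h z) - y)) + 2 * E) / cos \<theta>"
    unfolding G_def by (simp only: Re_divide_of_real) (simp add: X_def Re_exp mult_ac)
  moreover have "X * cos \<theta> \<le> X * cos (p * s * (Im (h z) - y)) + 2 * E"
    using dich[OF z]
  proof
    assume "exp (p * s * Re (h z)) \<le> E"
    then have "X \<le> E" by (simp add: X_def)
    moreover have "X * cos \<theta> \<le> X * 1" "X * (-1) \<le> X * cos (p * s * (Im (h z) - y))"
      using X by (intro mult_left_mono; simp)+
    ultimately show ?thesis by linarith
  next
    assume "\<bar>p * s * (Im (h z) - y)\<bar> \<le> \<theta>"
    then have "cos \<theta> \<le> cos \<bar>p * s * (Im (h z) - y)\<bar>" using \<theta> by (intro cos_monotone_0_pi_le) auto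
    then have "X * cos \<theta> \<le> X * cos (p * s * (Im (h z) - y))" using X by simp
    then show ?thesis using E by linarith
  qed
  ultimately show "cmod (exp (of_real s * h z)) powr p \<le> Re (G z)" using c by (simp add: pos_le_divide_eq)
qed

text \<open>
  An exponential \<open>exp (s h)\<close> with \<open>s < 0\<close> is large only far to the left, where the domain is barely
  wider than its maximal strip.
\<close>
lemma hardy_exp_left:
  assumes h: "h holomorphic_on unit_disc" and p: "0 < p" and s: "s \<le> 0"
    and width: "a < b" "- s * (p * (b - a)) < pi"
    and left: "\<And>\<epsilon>. 0 < \<epsilon> \<Longrightarrow> \<exists>n. \<forall>w\<in>h ` unit_disc. Re w < - n \<longrightarrow> a - \<epsilon> < Im w \<and> Im w < b + \<epsilon>"
  shows "hardy p (\<lambda>z. exp (of_real s * h z))"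
proof -
  \<comment> \<open>small enough for the strip widened by \<open>\<epsilon>\<close> on both sides; \<open>1 - s\<close> in place of \<open>- s\<close> avoids a zero denominator\<close>
  define \<epsilon> where "\<epsilon> = (pi - (- s * (p * (b - a)))) / (4 * (p * (1 - s)))"
  have ps: "0 < p * (1 - s)" using p s by simp
  have e: "0 < \<epsilon>" using width(2) ps by (simp add: \<epsilon>_def)
  obtain n where n: "\<And>w. w \<in> h ` unit_disc \<Longrightarrow> Re w < - n \<Longrightarrow> a - \<epsilon> < Im w \<and> Im w < b + \<epsilon>" using left[OF e] by blast
  define \<theta> where "\<theta> = p * (- s) * ((b - a) / 2 + \<epsilon>)"
  have \<theta>0: "0 \<le> \<theta>" unfolding \<theta>_def using p s width(1) e by (intro mult_nonneg_nonneg add_nonneg_nonneg) auto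
  have "p * (- s) * \<epsilon> \<le> p * (1 - s) * \<epsilon>" using p e by (intro mult_right_mono mult_left_mono) auto
  also have "p * (1 - s) * \<epsilon> = (pi - (- s * (p * (b - a)))) / 4"
  proof -
    have "x * (y / (4 * x)) = y / 4" if "x \<noteq> 0" for x y :: real using that by simp
    then show ?thesis using ps unfolding \<epsilon>_def by (metis less_irrefl)
  qed
  finally have "2 * (p * (- s) * \<epsilon>) \<le> (pi - (- s * (p * (b - a)))) / 2" by linarith
  moreover have "2 * \<theta> = - s * (p * (b - a)) + 2 * (p * (- s) * \<epsilon>)" 
  proof -
    have "2 * (k * (x / 2 + e)) = k * x + 2 * (k * e)" for k x e :: real by (simp add: algebra_simps)
    then have "2 * \<theta> = p * (- s) * (b - a) + 2 * (p * (- s) * \<epsilon>)" unfolding \<theta>_def by blast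
    moreover have "p * (- s) * (b - a) = - s * (p * (b - a))" by simp
    ultimately show ?thesis by (simp only:)
  qed
  moreover have "t < P / 2" if "2 * e \<le> (P - k) / 2" "2 * t = k + 2 * e" "k < P" for t e P k :: real
    using that by (simp add: field_simps)
  ultimately have "\<theta> < pi / 2" using width(2) by blast
  then show ?thesis
  proof (rule hardy_exp_of_angle_bound[OF h p _ _ _ \<theta>0, where y = "(a + b) / 2" and E = "exp (p * (- s) * n)"])
    fix z assume z: "z \<in> unit_disc"
    show "exp (p * s * Re (h z)) \<le> exp (p * (- s) * n) \<or> \<bar>p * s * (Im (h z) - (a + b) / 2)\<bar> \<le> \<theta>"
    proof (cases "Re (h z) < - n")
      case True
      then have "a - \<epsilon> < Im (h z)" "Im (h z) < b + \<epsilon>" using n[of "h z"] z by auto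
      then have "\<bar>Im (h z) - (a + b) / 2\<bar> \<le> (b - a) / 2 + \<epsilon>" by (simp add: abs_le_iff field_simps)
      then have "(p * (- s)) * \<bar>Im (h z) - (a + b) / 2\<bar> \<le> (p * (- s)) * ((b - a) / 2 + \<epsilon>)"
        using p s by (intro mult_left_mono mult_nonneg_nonneg) auto
      moreover have "\<bar>p * s * (Im (h z) - (a + b) / 2)\<bar> = (p * (- s)) * \<bar>Im (h z) - (a + b) / 2\<bar>"
        using p s by (simp add: abs_mult)
      ultimately show ?thesis by (simp only: \<theta>_def) simp
    next
      case False
      then have "(p * (- s)) * (- n) \<le> (p * (- s)) * Re (h z)" using p s by (intro mult_left_mono mult_nonneg_nonneg) auto
      then show ?thesis by simp
    qed
  qed simp
qed

context hardy_functional
begin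

text \<open>The strip may have any width: an affine change of the map reduces to half-width less than \<open>\<pi>/2\<close>.\<close>
lemma vanishes_of_exponentials:
  assumes hh: "h holomorphic_on unit_disc" and inj: "inj_on h unit_disc"
    and width: "\<And>w. w \<in> h ` unit_disc \<Longrightarrow> a \<le> Im w \<and> Im w \<le> b"
    and d: "0 < \<delta>" and s: "\<And>s. \<bar>s\<bar> < \<delta> \<Longrightarrow> hardy p (\<lambda>z. exp (of_real s * h z))"
    and \<Lambda>0: "\<And>\<zeta>. \<bar>Re \<zeta>\<bar> < \<delta> \<Longrightarrow> \<Lambda> (\<lambda>z. exp (\<zeta> * h z)) = 0"
    and reg: "interior (closure (h ` unit_disc)) = h ` unit_disc"
    and off: "\<And>w. w \<notin> closure (h ` unit_disc) \<Longrightarrow>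
       \<exists>T. connected T \<and> w \<in> T \<and> T \<inter> closure (h ` unit_disc) = {} \<and> (\<exists>v\<in>T. Im v < a \<or> b < Im v)"
    and f: "hardy p f"
  shows "\<Lambda> f = 0"
proof -
  define \<Omega> where "\<Omega> = h ` unit_disc"
  have ab: "a \<le> b" using width[of "h 0"] by force
  define \<kappa> where "\<kappa> = 1 / ((b - a) / 2 + 1)"
  have "0 < (b - a) / 2 + 1" using ab by (intro add_nonneg_pos) auto
  then have \<kappa>: "0 < \<kappa>" unfolding \<kappa>_def by simp
  define y where "y = (a + b) / 2"
  define \<beta> where "\<beta> = \<kappa> * ((b - a) / 2)"
  have \<beta>: "\<beta> < pi / 2"
  proof -
    have "1 / (x + 1) * x \<le> 1" if "0 \<le> x" for x :: real using that by (simp add: divide_le_eq)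
    moreover have "0 \<le> (b - a) / 2" using ab by (intro divide_nonneg_pos) auto
    ultimately have "\<beta> \<le> 1" unfolding \<beta>_def \<kappa>_def by blast
    then show ?thesis using pi_gt3 by linarith
  qed
  define m where "m w = \<kappa> *\<^sub>R (- (\<i> * of_real y) + w)" for w
  have m_im: "m ` S = (\<lambda>w. \<kappa> *\<^sub>R w) ` ((\<lambda>w. - (\<i> * of_real y) + w) ` S)" for S by (auto simp: m_def image_image)
  have lin: "linear (\<lambda>w::complex. \<kappa> *\<^sub>R w)" "inj (\<lambda>w::complex. \<kappa> *\<^sub>R w)"
    using \<kappa> by (auto intro!: injI bounded_linear.linear bounded_linear_scaleR_right)
  have cl: "closure (m ` S) = m ` closure S" for S
    unfolding m_im by (simp only: closure_translation closure_injective_linear_image[OF lin, symmetric])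
  have int: "interior (m ` S) = m ` interior S" for S
    unfolding m_im by (simp only: interior_translation interior_injective_linear_image[OF lin])
  have Im_m: "Im (m w) = \<kappa> * (Im w - y)" for w by (simp add: m_def)
  have hm: "(\<lambda>z. m (h z)) holomorphic_on unit_disc"
    unfolding m_def scaleR_conv_of_real by (intro holomorphic_intros hh)
  interpret strip_functional p \<beta> "\<lambda>z. m (h z)" \<Lambda> C
  proof unfold_locales
    fix z assume z: "z \<in> unit_disc"
    have "\<bar>Im (h z) - y\<bar> \<le> (b - a) / 2" using width[of "h z"] z unfolding y_def by (auto simp: abs_le_iff field_simps)
    then show "\<bar>Im (m (h z))\<bar> \<le> \<beta>" using \<kappa> by (simp add: Im_m \<beta>_def abs_mult)
  qed (fact p hm)+
  have expm: "exp (\<zeta> * m (h z)) = exp (- (\<zeta> * of_real \<kappa> * \<i> * of_real y)) * exp (\<zeta> * of_real \<kappa> * h z)" for \<zeta> z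
    unfolding exp_add[symmetric] m_def scaleR_conv_of_real by (simp add: algebra_simps)
  have im: "(\<lambda>z. m (h z)) ` unit_disc = m ` \<Omega>" by (auto simp: \<Omega>_def)
  show ?thesis
  proof (rule vanishes_on_exponentials_imp_vanishes[where \<delta> = "\<delta> / \<kappa>", OF _ \<beta> _ _ _ _ _ f])
    have "inj m" using \<kappa> by (auto intro!: injI simp: m_def)
    then show "inj_on (\<lambda>z. m (h z)) unit_disc" using inj by (auto simp: inj_on_def)
    show "0 < \<delta> / \<kappa>" using d \<kappa> by simp
    have sm: "\<bar>s * \<kappa>\<bar> < \<delta>" if "\<bar>s\<bar> < \<delta> / \<kappa>" for s using that \<kappa> by (simp add: abs_mult pos_less_divide_eq)
    have e1: "hardy p (\<lambda>z. exp (of_real (s' * \<kappa>) * h z))" if "\<bar>s'\<bar> < \<delta> / \<kappa>" for s' by (rule s[OF sm[OF that]])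
    show "hardy p (\<lambda>z. exp (of_real s' * m (h z)))" if "\<bar>s'\<bar> < \<delta> / \<kappa>" for s'
      unfolding expm of_real_mult[symmetric] by (rule hardy_scale[OF e1[OF that] p0])
    show "\<Lambda> (\<lambda>z. exp (\<zeta> * m (h z))) = 0" if z: "\<bar>Re \<zeta>\<bar> < \<delta> / \<kappa>" for \<zeta>
    proof -
      have "hardy p (\<lambda>z. exp (\<zeta> * of_real \<kappa> * h z))"
      proof (rule hardy_dominated[OF _ e1[OF z] e1[OF z] p0])
        show "(\<lambda>z. exp (\<zeta> * of_real \<kappa> * h z)) holomorphic_on unit_disc" by (intro holomorphic_intros hh)
        fix z assume "z \<in> unit_disc"
        then have "\<bar>Im (h z)\<bar> \<le> \<bar>a\<bar> + \<bar>b\<bar>" using width[of "h z"] by fastforce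
        then have "\<bar>Im \<zeta> * \<kappa>\<bar> * \<bar>Im (h z)\<bar> \<le> \<bar>Im \<zeta> * \<kappa>\<bar> * (\<bar>a\<bar> + \<bar>b\<bar>)" by (intro mult_left_mono) auto
        moreover have "- (Im \<zeta> * \<kappa> * Im (h z)) \<le> \<bar>Im \<zeta> * \<kappa>\<bar> * \<bar>Im (h z)\<bar>" by (metis abs_ge_minus_self abs_mult)
        ultimately have "exp (- (Im \<zeta> * \<kappa> * Im (h z))) \<le> exp (\<bar>Im \<zeta> * \<kappa>\<bar> * (\<bar>a\<bar> + \<bar>b\<bar>))" by simp
        then have "exp (Re \<zeta> * \<kappa> * Re (h z)) * exp (- (Im \<zeta> * \<kappa> * Im (h z))) \<le> exp (Re \<zeta> * \<kappa> * Re (h z)) * exp (\<bar>Im \<zeta> * \<kappa>\<bar> * (\<bar>a\<bar> + \<bar>b\<bar>))"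
          by (intro mult_left_mono) auto
        moreover have "cmod (exp (\<zeta> * of_real \<kappa> * h z)) = exp (Re \<zeta> * \<kappa> * Re (h z)) * exp (- (Im \<zeta> * \<kappa> * Im (h z)))"
          unfolding exp_add[symmetric] norm_exp_eq_Re by simp
        moreover have "cmod (exp (of_real (Re \<zeta> * \<kappa>) * h z)) = exp (Re \<zeta> * \<kappa> * Re (h z))" by simp
        moreover have "0 \<le> exp (Re \<zeta> * \<kappa> * Re (h z)) * exp (\<bar>Im \<zeta> * \<kappa>\<bar> * (\<bar>a\<bar> + \<bar>b\<bar>))" by simp
        moreover have "x \<le> e * (q + q)" if "x \<le> q * e" "0 \<le> q * e" for x q e :: real
          using that by (simp add: algebra_simps)
        ultimately show "cmod (exp (\<zeta> * of_real \<kappa> * h z)) \<le> exp (\<bar>Im \<zeta> * \<kappa>\<bar> * (\<bar>a\<bar> + \<bar>b\<bar>)) *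
           (cmod (exp (of_real (Re \<zeta> * \<kappa>) * h z)) + cmod (exp (of_real (Re \<zeta> * \<kappa>) * h z)))" by metis
      qed
      moreover have "\<Lambda> (\<lambda>z. exp (\<zeta> * of_real \<kappa> * h z)) = 0" by (rule \<Lambda>0) (use sm[OF z] in simp)
      ultimately show ?thesis unfolding expm by (simp only: scale mult_zero_right)
    qed
    show "interior (closure ((\<lambda>z. m (h z)) ` unit_disc)) = (\<lambda>z. m (h z)) ` unit_disc"
      unfolding im cl int using reg by (simp only: \<Omega>_def)
    fix w assume w: "w \<notin> closure ((\<lambda>z. m (h z)) ` unit_disc)"
    define u where "u = w /\<^sub>R \<kappa> + \<i> * of_real y"
    have mu: "m u = w" using \<kappa> by (simp add: m_def u_def)
    then have "u \<notin> closure \<Omega>" using w unfolding im cl by blast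
    then obtain T v where T: "connected T" "u \<in> T" "T \<inter> closure \<Omega> = {}" and v: "v \<in> T" "Im v < a \<or> b < Im v"
      using off unfolding \<Omega>_def by blast
    have "connected (m ` T)" unfolding m_def[abs_def] by (intro connected_continuous_image T continuous_intros)
    moreover have "w \<in> m ` T" using T(2) mu by blast
    moreover have "m ` T \<inter> m ` closure \<Omega> = {}"
    proof -
      have "inj m" using \<kappa> by (auto intro!: injI simp: m_def)
      then show ?thesis using T(3) by (auto dest: injD)
    qed
    moreover have "\<beta> < \<bar>Im (m v)\<bar>"
    proof -
      have "(b - a) / 2 < - (Im v - y) \<or> (b - a) / 2 < Im v - y" using v(2) unfolding y_def by (auto simp: field_simps)
      then have "(b - a) / 2 < \<bar>Im v - y\<bar>" by (meson abs_ge_self abs_ge_minus_self less_le_trans)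
      then show ?thesis using \<kappa> by (simp add: Im_m \<beta>_def abs_mult)
    qed
    ultimately show "\<exists>T. connected T \<and> w \<in> T \<and> T \<inter> closure ((\<lambda>z. m (h z)) ` unit_disc) = {} \<and> (\<exists>v\<in>T. \<beta> < \<bar>Im v\<bar>)"
      using v(1) unfolding im cl by blast
  qed
qed

text \<open>
  The transform \<open>\<zeta> \<mapsto> \<Lambda>(exp (\<zeta> h))\<close> is holomorphic on the vertical strip of the \<open>\<zeta>\<close> for which the
  exponentials belong to the space, so its zeros on any vertical substrip are enough.
\<close>
lemma vanishes_of_exponentials_substrip:
  assumes h: "h holomorphic_on unit_disc" and inj: "inj_on h unit_disc"
    and width: "\<And>w. w \<in> h ` unit_disc \<Longrightarrow> a \<le> Im w \<and> Im w \<le> b"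
    and s12: "s1 < 0" "0 < s2" and s: "\<And>s. s1 < s \<Longrightarrow> s < s2 \<Longrightarrow> hardy p (\<lambda>z. exp (of_real s * h z))"
    and t12: "s1 \<le> t1" "t1 < t2" "t2 \<le> s2"
    and \<Lambda>0: "\<And>\<zeta>. t1 < Re \<zeta> \<Longrightarrow> Re \<zeta> < t2 \<Longrightarrow> \<Lambda> (\<lambda>z. exp (\<zeta> * h z)) = 0"
    and reg: "interior (closure (h ` unit_disc)) = h ` unit_disc"
    and off: "\<And>w. w \<notin> closure (h ` unit_disc) \<Longrightarrow>
       \<exists>T. connected T \<and> w \<in> T \<and> T \<inter> closure (h ` unit_disc) = {} \<and> (\<exists>v\<in>T. Im v < a \<or> b < Im v)"
    and f: "hardy p f"
  shows "\<Lambda> f = 0"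
proof -
  interpret strip_functional p "\<bar>a\<bar> + \<bar>b\<bar>" h \<Lambda> C
  proof unfold_locales
    fix z assume "z \<in> unit_disc"
    then show "\<bar>Im (h z)\<bar> \<le> \<bar>a\<bar> + \<bar>b\<bar>" using width[of "h z"] by fastforce
  qed (fact p h)+
  define V where "V = {\<zeta>. s1 < Re \<zeta>} \<inter> {\<zeta>. Re \<zeta> < s2}"
  have oV: "open V" unfolding V_def by (intro open_Int open_halfspace_Re_gt open_halfspace_Re_lt)
  have cV: "connected V" unfolding V_def
    by (intro convex_connected convex_Int convex_halfspace_Re_gt convex_halfspace_Re_lt)
  define W where "W = {\<zeta>. t1 < Re \<zeta>} \<inter> {\<zeta>. Re \<zeta> < t2}"
  have oW: "open W" unfolding W_def by (intro open_Int open_halfspace_Re_gt open_halfspace_Re_lt)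
  have "complex_of_real ((t1 + t2) / 2) \<in> W" using t12 by (simp add: W_def)
  then have neW: "W \<noteq> {}" by blast
  have WV: "W \<subseteq> V" using t12 by (auto simp: W_def V_def)
  have hol: "(\<lambda>\<zeta>. \<Lambda> (\<lambda>z. exp (\<zeta> * h z))) holomorphic_on V"
  proof (rule holomorphic_onI)
    fix \<zeta> assume z: "\<zeta> \<in> V"
    define \<delta> where "\<delta> = min (Re \<zeta> - s1) (s2 - Re \<zeta>)"
    have "0 < \<delta>" using z by (simp add: V_def \<delta>_def)
    moreover have "hardy p (\<lambda>z. exp (of_real s * h z))" if "\<bar>s - Re \<zeta>\<bar> < \<delta>" for s
      by (rule s) (use that in \<open>auto simp: \<delta>_def\<close>)
    ultimately have "((\<lambda>\<zeta>. \<Lambda> (\<lambda>z. 1 * exp (\<zeta> * h z))) has_field_derivative \<Lambda> (\<lambda>z. 1 * h z * exp (\<zeta> * h z))) (at \<zeta>)"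
      by (rule exp_family_has_derivative[where Q = 1]) auto
    then show "(\<lambda>\<zeta>. \<Lambda> (\<lambda>z. exp (\<zeta> * h z))) field_differentiable at \<zeta> within V"
      by (auto simp: field_differentiable_def intro: has_field_derivative_at_within)
  qed
  have all: "\<Lambda> (\<lambda>z. exp (\<zeta> * h z)) = 0" if "\<zeta> \<in> V" for \<zeta>
    by (rule analytic_continuation_open[OF oW oV neW cV WV hol holomorphic_on_const _ that]) (use \<Lambda>0 in \<open>simp add: W_def\<close>)
  define \<delta> where "\<delta> = min (- s1) s2"
  show ?thesis
  proof (rule vanishes_of_exponentials[OF h inj width _ _ _ reg off f, where \<delta> = \<delta>])
    show "0 < \<delta>" using s12 by (simp add: \<delta>_def)
    show "hardy p (\<lambda>z. exp (of_real s * h z))" if "\<bar>s\<bar> < \<delta>" for s by (rule s) (use that in \<open>auto simp: \<delta>_def\<close>)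
    show "\<Lambda> (\<lambda>z. exp (\<zeta> * h z)) = 0" if "\<bar>Re \<zeta>\<bar> < \<delta>" for \<zeta> by (rule all) (use that in \<open>auto simp: V_def \<delta>_def\<close>)
  qed
qed

end

section \<open>Operators on the Hardy space\<close>

definition zero_extension :: "(complex \<Rightarrow> complex) \<Rightarrow> complex \<Rightarrow> complex" where
  "zero_extension f z = (if z \<in> unit_disc then f z else 0)"

lemma Hp_integral_zero_extension:
  assumes "0 < r" "r < 1"
  shows "Hp_integral p (zero_extension f) r = Hp_integral p f r"
  using assms by (simp add: Hp_integral_def zero_extension_def norm_mult)

lemma hardy_iff_Hp: "f \<in> Hp p \<longleftrightarrow> hardy p f \<and> (\<forall>z. z \<notin> unit_disc \<longrightarrow> f z = 0)"
  by (auto simp: Hp_def hardy_def bdd_above_def)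

lemma hardy_zero_extension:
  assumes "hardy p f" shows "zero_extension f \<in> Hp p"
proof -
  have "zero_extension f holomorphic_on unit_disc \<longleftrightarrow> f holomorphic_on unit_disc"
    by (rule holomorphic_cong) (auto simp: zero_extension_def)
  moreover have "(\<forall>r\<in>{0<..<1}. Hp_integral p (zero_extension f) r \<le> B) \<longleftrightarrow> (\<forall>r\<in>{0<..<1}. Hp_integral p f r \<le> B)" for B
    by (intro ball_cong refl) (simp add: Hp_integral_zero_extension)
  ultimately show ?thesis using assms by (auto simp: hardy_iff_Hp hardy_def zero_extension_def)
qed

lemma zero_extension_Hp: "f \<in> Hp p \<Longrightarrow> zero_extension f = f"
  by (auto simp: Hp_def zero_extension_def)

lemma Hp_norm_le:
  assumes "\<And>r. 0 < r \<Longrightarrow> r < 1 \<Longrightarrow> Hp_integral p f r \<le> B" "0 < p"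
  shows "Hp_norm p f \<le> B powr (1 / p)"
proof -
  have le: "(SUP r\<in>{0<..<1}. Hp_integral p f r) \<le> B" by (rule cSUP_least) (use assms(1) in auto)
  have "bdd_above (Hp_integral p f ` {0<..<1})" by (rule bdd_aboveI2[where M = B]) (use assms(1) in auto)
  then have "Hp_integral p f (1/2) \<le> (SUP r\<in>{0<..<1}. Hp_integral p f r)" by (intro cSUP_upper) auto
  then have "0 \<le> (SUP r\<in>{0<..<1}. Hp_integral p f r)" using Hp_integral_nonneg[of p f "1/2"] by linarith
  then show ?thesis unfolding Hp_norm_def using le assms(2) by (intro powr_mono2) auto
qed

lemma Hp_integral_le_norm:
  assumes f: "f \<in> Hp p" and r: "0 < r" "r < 1" and p: "0 < p"
  shows "Hp_integral p f r \<le> Hp_norm p f powr p"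
proof -
  have "Hp_integral p f r \<le> (SUP r\<in>{0<..<1}. Hp_integral p f r)" using f r by (intro cSUP_upper) (auto simp: Hp_def)
  moreover from this have "0 \<le> (SUP r\<in>{0<..<1}. Hp_integral p f r)" using Hp_integral_nonneg[of p f r] by linarith
  ultimately show ?thesis unfolding Hp_norm_def using p by (simp add: powr_powr)
qed

text \<open>
  Point evaluations are continuous on the Hardy space by the pointwise estimate, so that an operator can
  be studied through the scalar functionals \<open>f \<mapsto> (A f)(z)\<close>.
\<close>
lemma evaluation_hardy_functional:
  assumes A: "bounded_operator_on (Hp p) (Hp_norm p) A" and p: "1 \<le> p" and z: "z \<in> unit_disc"
  obtains C where "hardy_functional p (\<lambda>f. A (zero_extension f) z) C"
proof -
  have p0: "0 < p" using p by simp
  obtain K where K: "\<And>f. f \<in> Hp p \<Longrightarrow> Hp_norm p (A f) \<le> K * Hp_norm p f" using A unfolding bounded_operator_on_def by blast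
  have AX: "A f \<in> Hp p" if "f \<in> Hp p" for f using A that unfolding bounded_operator_on_def by blast
  have "hardy_functional p (\<lambda>f. A (zero_extension f) z) (\<bar>K\<bar> powr p / (1 - cmod z))"
  proof
    show "1 \<le> p" by (rule p)
    show "A (zero_extension f) z = A (zero_extension g) z" if "\<And>z. z \<in> unit_disc \<Longrightarrow> f z = g z" for f g
    proof -
      have "zero_extension f = zero_extension g" using that by (auto simp: zero_extension_def)
      then show ?thesis by simp
    qed
    show "A (zero_extension (\<lambda>z. f z + g z)) z = A (zero_extension f) z + A (zero_extension g) z"
      if "hardy p f" "hardy p g" for f g
    proof -
      have e: "zero_extension (\<lambda>z. f z + g z) = (\<lambda>z. zero_extension f z + zero_extension g z)" by (auto simp: zero_extension_def)
      have "A (\<lambda>z. zero_extension f z + zero_extension g z) = (\<lambda>z. A (zero_extension f) z + A (zero_extension g) z)"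
        using A hardy_zero_extension[OF that(1)] hardy_zero_extension[OF that(2)] unfolding bounded_operator_on_def by blast
      then show ?thesis unfolding e by simp
    qed
    show "A (zero_extension (\<lambda>z. c * f z)) z = c * A (zero_extension f) z" if "hardy p f" for f c
    proof -
      have e: "zero_extension (\<lambda>z. c * f z) = (\<lambda>z. c * zero_extension f z)" by (auto simp: zero_extension_def)
      have "A (\<lambda>z. c * zero_extension f z) = (\<lambda>z. c * A (zero_extension f) z)"
        using A hardy_zero_extension[OF that] unfolding bounded_operator_on_def by blast
      then show ?thesis unfolding e by simp
    qed
    fix f B assume f: "hardy p f" and B: "\<And>r. 0 < r \<Longrightarrow> r < 1 \<Longrightarrow> Hp_integral p f r \<le> B"
    have fX: "zero_extension f \<in> Hp p" by (rule hardy_zero_extension[OF f])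
    have B0: "0 \<le> B" using B[of "1/2"] Hp_integral_nonneg[of p f "1/2"] by linarith
    have n1: "Hp_norm p (zero_extension f) \<le> B powr (1 / p)"
      by (rule Hp_norm_le[OF _ p0]) (simp add: Hp_integral_zero_extension B)
    have "Hp_norm p (A (zero_extension f)) \<le> K * Hp_norm p (zero_extension f)" by (rule K[OF fX])
    also have "\<dots> \<le> \<bar>K\<bar> * Hp_norm p (zero_extension f)" by (intro mult_right_mono) (auto simp: Hp_norm_def)
    also have "\<dots> \<le> \<bar>K\<bar> * B powr (1 / p)" by (intro mult_left_mono n1) auto
    finally have n2: "Hp_norm p (A (zero_extension f)) \<le> \<bar>K\<bar> * B powr (1 / p)" .
    have n3: "Hp_integral p (A (zero_extension f)) r \<le> \<bar>K\<bar> powr p * B" if "0 < r" "r < 1" for r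
    proof -
      have "Hp_integral p (A (zero_extension f)) r \<le> Hp_norm p (A (zero_extension f)) powr p"
        by (rule Hp_integral_le_norm[OF AX[OF fX] that p0])
      also have "\<dots> \<le> (\<bar>K\<bar> * B powr (1 / p)) powr p" using n2 p0 by (intro powr_mono2) (auto simp: Hp_norm_def)
      also have "\<dots> = \<bar>K\<bar> powr p * B" using B0 p0 by (simp add: powr_mult powr_powr)
      finally show ?thesis .
    qed
    have "cmod (A (zero_extension f) z) powr p \<le> \<bar>K\<bar> powr p * B / (1 - cmod z)"
      by (rule hardy_point_bound[OF _ n3 z p]) (use AX[OF fX] in \<open>simp_all add: Hp_def\<close>)
    then show "cmod (A (zero_extension f) z) powr p \<le> \<bar>K\<bar> powr p / (1 - cmod z) * B" by simp
  qed
  then show ?thesis by (rule that)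
qed

lemma bounded_multiplication_operator:
  assumes b: "b holomorphic_on unit_disc" "\<And>z. z \<in> unit_disc \<Longrightarrow> cmod (b z) \<le> M" and p: "1 \<le> p"
  shows "bounded_operator_on (Hp p) (Hp_norm p) (\<lambda>f z. b z * f z)"
proof -
  have p0: "0 < p" using p by simp
  have M0: "0 \<le> M" using b(2)[of 0] norm_ge_zero[of "b 0"] by (meson centre_in_ball order_trans zero_less_one)
  have I0: "Hp_integral p (\<lambda>_. 0) r = 0" for r by (simp add: Hp_integral_def)
  have est: "Hp_integral p (\<lambda>z. b z * f z) r \<le> (2 * M) powr p * Hp_integral p f r" if "f \<in> Hp p" "0 < r" "r < 1" for f r
  proof -
    have "Hp_integral p (\<lambda>z. b z * f z) r \<le> (2 * M) powr p * (Hp_integral p f r + Hp_integral p (\<lambda>_. 0) r)"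
    proof (rule Hp_integral_dominated[OF _ _ _ _ that(3) p0 M0])
      show "(\<lambda>z. b z * f z) holomorphic_on unit_disc" using that by (intro holomorphic_intros b) (simp add: Hp_def)
      show "cmod (b z * f z) \<le> M * (cmod (f z) + cmod 0)" if "z \<in> unit_disc" for z
        using b(2)[OF that] by (simp add: norm_mult mult_right_mono)
    qed (use that in \<open>simp_all add: Hp_def\<close>)
    then show ?thesis by (simp add: I0)
  qed
  have mem: "(\<lambda>z. b z * f z) \<in> Hp p" if "f \<in> Hp p" for f
    using hardy_mult_bounded[OF _ b p0] that by (auto simp: hardy_iff_Hp)
  have bd: "Hp_norm p (\<lambda>z. b z * f z) \<le> (2 * M) * Hp_norm p f" if f: "f \<in> Hp p" for f
  proof -
    have "Hp_norm p (\<lambda>z. b z * f z) \<le> ((2 * M) powr p * Hp_norm p f powr p) powr (1 / p)"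
    proof (rule Hp_norm_le[OF _ p0])
      fix r :: real assume r: "0 < r" "r < 1"
      have "Hp_integral p (\<lambda>z. b z * f z) r \<le> (2 * M) powr p * Hp_integral p f r" by (rule est[OF f r])
      also have "\<dots> \<le> (2 * M) powr p * Hp_norm p f powr p" by (intro mult_left_mono Hp_integral_le_norm f r p0) simp
      finally show "Hp_integral p (\<lambda>z. b z * f z) r \<le> (2 * M) powr p * Hp_norm p f powr p" .
    qed
    also have "\<dots> = (2 * M) * Hp_norm p f"
    proof -
      have N0: "0 \<le> Hp_norm p f" by (simp add: Hp_norm_def)
      have "((2 * M) powr p * Hp_norm p f powr p) powr (1 / p) = ((2 * M * Hp_norm p f) powr p) powr (1 / p)"
        using M0 N0 by (simp add: powr_mult)
      also have "\<dots> = 2 * M * Hp_norm p f" using M0 N0 p0 by (simp add: powr_powr)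
      finally show ?thesis .
    qed
    finally show ?thesis .
  qed
  show ?thesis unfolding bounded_operator_on_def
    using mem bd by (auto simp: distrib_left mult.left_commute)
qed

text \<open>Multiplication by \<open>exp (\<zeta> h)\<close> intertwines \<open>C\<^sub>\<phi>\<close> with \<open>e\<^sup>\<zeta> C\<^sub>\<phi>\<close>.\<close>
lemma exponential_multiplier_extended_eigenvalue:
  assumes h: "h holomorphic_on unit_disc" and \<phi>: "\<And>z. z \<in> unit_disc \<Longrightarrow> \<phi> z \<in> unit_disc \<and> h (\<phi> z) = h z + 1"
    and bd: "\<And>z. z \<in> unit_disc \<Longrightarrow> Re (\<zeta> * h z) \<le> M" and p: "1 \<le> p"
  shows "exp \<zeta> \<in> extended_eigenvalues (Hp p) (Hp_norm p) (composition_operator \<phi>)"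
proof -
  define A where "A f = (\<lambda>z. exp (\<zeta> * h z) * f z)" for f :: "complex \<Rightarrow> complex"
  have "bounded_operator_on (Hp p) (Hp_norm p) A"
    unfolding A_def[abs_def] by (rule bounded_multiplication_operator[where M = "exp M"]) (use bd p in \<open>auto intro!: holomorphic_intros h\<close>)
  moreover have "zero_extension (\<lambda>_. 1) \<in> Hp p" by (rule hardy_zero_extension[OF hardy_const])
  moreover have "A (zero_extension (\<lambda>_. 1)) \<noteq> (\<lambda>z. 0)"
  proof
    assume "A (zero_extension (\<lambda>_. 1)) = (\<lambda>z. 0)"
    from fun_cong[OF this, of 0] show False by (simp add: A_def zero_extension_def)
  qed
  moreover have "composition_operator \<phi> (A f) = (\<lambda>z. exp \<zeta> * A (composition_operator \<phi> f) z)" for f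
    by (rule ext) (use \<phi> in \<open>auto simp: composition_operator_def A_def distrib_left exp_add\<close>)
  ultimately show ?thesis unfolding extended_eigenvalues_def by blast
qed

text \<open>
  If \<open>C\<^sub>\<phi> A f = 0\<close>, then \<open>A f\<close> vanishes on the open set \<open>\<phi>(\<D>)\<close>.
\<close>
lemma zero_not_extended_eigenvalue:
  assumes \<phi>: "\<phi> holomorphic_on unit_disc" "\<phi> ` unit_disc \<subseteq> unit_disc" "inj_on \<phi> unit_disc"
  shows "0 \<notin> extended_eigenvalues (Hp p) (Hp_norm p) (composition_operator \<phi>)"
proof
  assume "0 \<in> extended_eigenvalues (Hp p) (Hp_norm p) (composition_operator \<phi>)"
  then obtain A f where A: "bounded_operator_on (Hp p) (Hp_norm p) A" and f: "f \<in> Hp p" "A f \<noteq> (\<lambda>z. 0)"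
    and z: "\<forall>f\<in>Hp p. composition_operator \<phi> (A f) = (\<lambda>z. 0 * A (composition_operator \<phi> f) z)"
    unfolding extended_eigenvalues_def by blast
  have Af: "A f \<in> Hp p" using A f(1) unfolding bounded_operator_on_def by blast
  have zero: "A f (\<phi> u) = 0" if "u \<in> unit_disc" for u
    using fun_cong[OF bspec[OF z f(1)], of u] that by (simp add: composition_operator_def)
  have "A f u = 0" if "u \<in> unit_disc" for u
  proof (rule analytic_continuation_open[of "\<phi> ` unit_disc" unit_disc "A f" "\<lambda>_. 0"])
    show "open (\<phi> ` unit_disc)" by (rule open_mapping_thm3[OF \<phi>(1) open_ball \<phi>(3)])
    show "\<phi> ` unit_disc \<noteq> {}" by simp
    show "A f holomorphic_on unit_disc" using Af by (simp add: Hp_def)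
  qed (use \<phi>(2) that zero in auto)
  then have "A f = (\<lambda>z. 0)" using Af by (fastforce simp: Hp_def)
  with f(2) show False by simp
qed

text \<open>
  An intertwining operator maps the exponentials in the space, which are eigenfunctions of the
  composition operator, to eigenfunctions whose eigenvalue is multiplied by \<open>\<mu>\<close>.  When that eigenvalue
  exceeds the growth that a half-strip in the Koenigs domain allows, all these images vanish, and
  the exponentials determine the operator.
\<close>
lemma intertwining_operator_zero:
  assumes h: "h holomorphic_on unit_disc" and inj: "inj_on h unit_disc"
    and \<phi>: "\<And>z. z \<in> unit_disc \<Longrightarrow> \<phi> z \<in> unit_disc \<and> h (\<phi> z) = h z + 1"
    and p: "1 \<le> p"
    and width: "\<And>w. w \<in> h ` unit_disc \<Longrightarrow> a \<le> Im w \<and> Im w \<le> b"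
    and reg: "interior (closure (h ` unit_disc)) = h ` unit_disc"
    and off: "\<And>w. w \<notin> closure (h ` unit_disc) \<Longrightarrow>
       \<exists>T. connected T \<and> w \<in> T \<and> T \<inter> closure (h ` unit_disc) = {} \<and> (\<exists>v\<in>T. Im v < a \<or> b < Im v)"
    and s12: "s1 < 0" "0 < s2" and s: "\<And>s. s1 < s \<Longrightarrow> s < s2 \<Longrightarrow> hardy p (\<lambda>z. exp (of_real s * h z))"
    and t12: "s1 \<le> t1" "t1 < t2" "t2 \<le> s2"
    and d: "0 < d" and \<sigma>: "\<sigma> = 1 \<or> \<sigma> = (-1::real)"
    and strip: "\<And>w. t0 < \<sigma> * Re w \<Longrightarrow> \<bar>Im w - y0\<bar> < d \<Longrightarrow> w \<in> h ` unit_disc"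
    and \<mu>: "\<mu> \<noteq> 0" and Q: "\<And>s. t1 < s \<Longrightarrow> s < t2 \<Longrightarrow> pi / (2 * d * p) < \<sigma> * (s + ln (cmod \<mu>))"
    and A: "bounded_operator_on (Hp p) (Hp_norm p) A"
    and tw: "\<And>f. f \<in> Hp p \<Longrightarrow> composition_operator \<phi> (A f) = (\<lambda>z. \<mu> * A (composition_operator \<phi> f) z)"
    and f: "f \<in> Hp p"
  shows "A f = (\<lambda>z. 0)"
proof -
  have p0: "0 < p" using p by simp
  have AX: "A f \<in> Hp p" if "f \<in> Hp p" for f using A that unfolding bounded_operator_on_def by blast
  have hexp: "hardy p (\<lambda>z. exp (\<zeta> * h z))" if "s1 < Re \<zeta>" "Re \<zeta> < s2" for \<zeta>
  proof -
    interpret strip_map p "\<bar>a\<bar> + \<bar>b\<bar>" h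
    proof unfold_locales
      fix z assume "z \<in> unit_disc"
      then show "\<bar>Im (h z)\<bar> \<le> \<bar>a\<bar> + \<bar>b\<bar>" using width[of "h z"] by fastforce
    qed (fact p h)+
    have "hardy p (\<lambda>z. 1 * exp (\<zeta> * h z))" by (rule hardy_exp[OF s[OF that], where Q = 1]) auto
    then show ?thesis by simp
  qed
  have img: "A (zero_extension (\<lambda>z. exp (\<zeta> * h z))) z = 0"
    if \<zeta>: "t1 < Re \<zeta>" "Re \<zeta> < t2" and z: "z \<in> unit_disc" for \<zeta> z
  proof -
    define e where "e = zero_extension (\<lambda>z. exp (\<zeta> * h z))"
    define g where "g = A e"
    have eX: "e \<in> Hp p" unfolding e_def by (rule hardy_zero_extension[OF hexp]) (use \<zeta> t12 in auto)
    have gX: "g \<in> Hp p" unfolding g_def by (rule AX[OF eX])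
    have "composition_operator \<phi> e = (\<lambda>z. exp \<zeta> * e z)"
      by (rule ext) (use \<phi> in \<open>auto simp: composition_operator_def e_def zero_extension_def distrib_left exp_add\<close>)
    then have "composition_operator \<phi> g = (\<lambda>z. \<mu> * A (\<lambda>z. exp \<zeta> * e z) z)" using tw[OF eX] by (simp add: g_def)
    moreover have "A (\<lambda>z. exp \<zeta> * e z) = (\<lambda>z. exp \<zeta> * g z)" using A eX unfolding bounded_operator_on_def g_def by blast
    ultimately have "composition_operator \<phi> g = (\<lambda>z. \<mu> * (exp \<zeta> * g z))" by simp
    then have eig: "g (\<phi> u) = \<mu> * (exp \<zeta> * g u)" if "u \<in> unit_disc" for u
      using that by (auto simp: composition_operator_def dest: fun_cong[of _ _ u])
    define Q' where "Q' = exp (\<sigma> * (Re \<zeta> + ln (cmod \<mu>)))"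
    have E: "exp (Re \<zeta> + ln (cmod \<mu>)) = cmod \<mu> * exp (Re \<zeta>)" using \<mu> by (simp add: exp_add mult.commute)
    have "g z = 0"
    proof (rule eigenfunction_zero[OF h inj d \<sigma> strip _ p _ _ z, where Q = Q'])
      show "hardy p g" using gX by (simp add: hardy_iff_Hp)
      show "exp (pi / (2 * d * p)) < Q'" unfolding Q'_def using Q[OF \<zeta>] by simp
      fix u u' assume u: "u \<in> unit_disc" "u' \<in> unit_disc" "h u' = h u + of_real \<sigma>"
      have ng: "cmod (g (\<phi> v)) = exp (Re \<zeta> + ln (cmod \<mu>)) * cmod (g v)" if "v \<in> unit_disc" for v
        unfolding E eig[OF that] norm_mult norm_exp_eq_Re by simp
      from \<sigma> show "cmod (g u') = Q' * cmod (g u)"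
      proof
        assume 1: "\<sigma> = 1"
        then have "h u' = h (\<phi> u)" using u \<phi> by simp
        then have "u' = \<phi> u" by (rule inj_onD[OF inj]) (use u \<phi> in blast)+
        then show ?thesis using ng[OF u(1)] 1 by (simp add: Q'_def)
      next
        assume 1: "\<sigma> = - 1"
        then have "h u = h (\<phi> u')" using u \<phi> by simp
        then have "u = \<phi> u'" by (rule inj_onD[OF inj]) (use u \<phi> in blast)+
        then have "cmod (g u) = exp (Re \<zeta> + ln (cmod \<mu>)) * cmod (g u')" using ng[OF u(2)] by simp
        moreover have "Q' * exp (Re \<zeta> + ln (cmod \<mu>)) = 1" unfolding Q'_def exp_add[symmetric] 1 by simp
        ultimately show ?thesis by (metis mult.assoc mult_1)
      qed
    qed
    then show ?thesis by (simp add: g_def e_def)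
  qed
  have "A f z = 0" if z: "z \<in> unit_disc" for z
  proof -
    obtain C where "hardy_functional p (\<lambda>f. A (zero_extension f) z) C"
      using evaluation_hardy_functional[OF A p z] by metis
    then interpret L: hardy_functional p "\<lambda>f. A (zero_extension f) z" C .
    have "A (zero_extension f) z = 0"
      by (rule L.vanishes_of_exponentials_substrip[OF h inj width s12 s t12 img[OF _ _ z] reg off])
         (use f in \<open>simp_all add: hardy_iff_Hp\<close>)
    then show ?thesis by (simp only: zero_extension_Hp[OF f])
  qed
  moreover have "A f z = 0" if "z \<notin> unit_disc" for z using AX[OF f] that by (simp add: Hp_def)
  ultimately show ?thesis by blast
qed

section \<open>Extended eigenvalues of the composition operator\<close>

text \<open>
  The properties of the Koenigs function on which the spectral argument depends.  The numbers \<open>a\<close> and \<open>b\<close>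
  are the infimum and the supremum of the heights in the Koenigs domain.
\<close>
locale regular_koenigs_domain =
  fixes \<phi> h :: "complex \<Rightarrow> complex" and p a b :: real
  assumes h: "h holomorphic_on unit_disc" and inj: "inj_on h unit_disc"
    and \<phi>: "z \<in> unit_disc \<Longrightarrow> \<phi> z \<in> unit_disc \<and> h (\<phi> z) = h z + 1"
    and p: "1 \<le> p"
    and inv: "w \<in> h ` unit_disc \<Longrightarrow> 0 \<le> t \<Longrightarrow> w + of_real t \<in> h ` unit_disc"
    and ab: "a < b"
    and width: "w \<in> h ` unit_disc \<Longrightarrow> a \<le> Im w \<and> Im w \<le> b"
    and heights: "a < y \<Longrightarrow> y < b \<Longrightarrow> \<exists>w\<in>h ` unit_disc. Im w = y"
    and reg: "interior (closure (h ` unit_disc)) = h ` unit_disc"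
    and off: "w \<notin> closure (h ` unit_disc) \<Longrightarrow>
       \<exists>T. connected T \<and> w \<in> T \<and> T \<inter> closure (h ` unit_disc) = {} \<and> (\<exists>v\<in>T. Im v < a \<or> b < Im v)"
begin

abbreviation "Ext \<equiv> extended_eigenvalues (Hp p) (Hp_norm p) (composition_operator \<phi>)"

lemma p0: "0 < p" using p by simp

lemma ExtE:
  assumes "\<mu> \<in> Ext"
  obtains A f where "bounded_operator_on (Hp p) (Hp_norm p) A" "f \<in> Hp p" "A f \<noteq> (\<lambda>z. 0)"
    "\<And>f. f \<in> Hp p \<Longrightarrow> composition_operator \<phi> (A f) = (\<lambda>z. \<mu> * A (composition_operator \<phi> f) z)"
  using assms unfolding extended_eigenvalues_def by blast

lemma hardy_exp_small:
  assumes "\<bar>s\<bar> * (p * (b - a)) < pi"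
  shows "hardy p (\<lambda>z. exp (of_real s * h z))"
proof (rule hardy_exp_of_angle_bound[OF h p0, where E = 0 and y = "(a + b) / 2" and \<theta> = "\<bar>s\<bar> * (p * (b - a)) / 2"])
  show "\<bar>s\<bar> * (p * (b - a)) / 2 < pi / 2" using assms by (rule divide_strict_right_mono) simp
  show "0 \<le> \<bar>s\<bar> * (p * (b - a)) / 2" using p0 ab by (intro divide_nonneg_pos mult_nonneg_nonneg) auto
  fix z assume z: "z \<in> unit_disc"
  have "\<bar>Im (h z) - (a + b) / 2\<bar> \<le> (b - a) / 2" using width[of "h z"] z by (auto simp: abs_le_iff field_simps)
  then have "(\<bar>s\<bar> * p) * \<bar>Im (h z) - (a + b) / 2\<bar> \<le> (\<bar>s\<bar> * p) * ((b - a) / 2)"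
    using p0 by (intro mult_left_mono) auto
  moreover have "\<bar>p * s * (Im (h z) - (a + b) / 2)\<bar> = (\<bar>s\<bar> * p) * \<bar>Im (h z) - (a + b) / 2\<bar>" using p0 by (simp add: abs_mult)
  moreover have "(\<bar>s\<bar> * p) * ((b - a) / 2) = \<bar>s\<bar> * (p * (b - a)) / 2" by simp
  ultimately have "\<bar>p * s * (Im (h z) - (a + b) / 2)\<bar> \<le> \<bar>s\<bar> * (p * (b - a)) / 2" by (simp only:)
  then show "exp (p * s * Re (h z)) \<le> 0 \<or> \<bar>p * s * (Im (h z) - (a + b) / 2)\<bar> \<le> \<bar>s\<bar> * (p * (b - a)) / 2" ..
qed simp

lemma right_half_strip:
  assumes d: "2 * d < b - a"
  obtains t0 where "\<And>w. t0 < Re w \<Longrightarrow> \<bar>Im w - (a + b) / 2\<bar> < d \<Longrightarrow> w \<in> h ` unit_disc"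
proof -
  define y0 where "y0 = (a + b) / 2"
  have y0: "2 * y0 = a + b" by (simp add: y0_def)
  define K where "K = (\<lambda>y. Complex 0 y) ` {y0 - d..y0 + d}"
  have K: "compact K" unfolding K_def Complex_eq by (intro compact_continuous_image continuous_intros compact_Icc)
  have open_image: "open (h ` unit_disc)" by (rule open_mapping_thm3[OF h open_ball inj])
  have "\<exists>v\<in>h ` unit_disc. Im v = Im w" if "w \<in> K" for w
  proof (rule heights)
    have "y0 - d \<le> Im w" "Im w \<le> y0 + d" using that by (auto simp: K_def)
    then show "a < Im w" "Im w < b" using d y0 by linarith+
  qed
  from shifts_absorb_compact[OF open_image inv K this]
  obtain t0 where t0: "\<And>w t. w \<in> K \<Longrightarrow> t0 \<le> t \<Longrightarrow> w + of_real t \<in> h ` unit_disc" by metis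
  show ?thesis
  proof (rule that[of t0])
    fix w assume w: "t0 < Re w" "\<bar>Im w - (a + b) / 2\<bar> < d"
    have "\<bar>Im w - y0\<bar> < d" using w(2) by (simp only: y0_def)
    then have "Complex 0 (Im w) \<in> K" unfolding K_def by (intro imageI) auto
    from t0[OF this less_imp_le[OF w(1)]] have "Complex 0 (Im w) + of_real (Re w) \<in> h ` unit_disc" .
    moreover have "Complex 0 (Im w) + of_real (Re w) = w" by (simp add: complex_eq_iff)
    ultimately show "w \<in> h ` unit_disc" by (simp only:)
  qed
qed

text \<open>
  The domain is asymptotically as wide as the strip \<open>a < Im w < b\<close> to the right.  The exponentials
  with \<open>Re \<zeta>\<close> just below \<open>\<pi>/(p(b - a))\<close> already have the largest growth along the semiflow that
  functions of the space can have; a factor of modulus greater than \<open>1\<close> is impossible.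
\<close>
lemma extended_eigenvalue_norm_le_1:
  assumes "\<mu> \<in> Ext" shows "cmod \<mu> \<le> 1"
proof (rule ccontr)
  assume "\<not> cmod \<mu> \<le> 1"
  then have \<mu>1: "1 < cmod \<mu>" by simp
  obtain A f where A: "bounded_operator_on (Hp p) (Hp_norm p) A" and f: "f \<in> Hp p" "A f \<noteq> (\<lambda>z. 0)"
    and tw: "\<And>f. f \<in> Hp p \<Longrightarrow> composition_operator \<phi> (A f) = (\<lambda>z. \<mu> * A (composition_operator \<phi> f) z)"
    using ExtE[OF assms] by metis
  define l where "l = ln (cmod \<mu>)"
  have l: "0 < l" using \<mu>1 unfolding l_def by (rule ln_gt_zero)
  define c where "c = pi / (p * (b - a))"
  have pab: "0 < p * (b - a)" using p0 ab by simp
  have c: "0 < c" using pab by (simp add: c_def)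
  have canc: "x / y * y = x" if "0 < y" for x y :: real using that by simp
  have cpab: "c * (p * (b - a)) = pi" unfolding c_def by (rule canc[OF pab])
  \<comment> \<open>a half-width slightly below \<open>(b - a)/2\<close>: the growth bound \<open>\<pi>/(2dp)\<close> is \<open>c + l/2\<close>, while \<open>Re \<zeta> + l\<close> comes close to \<open>c + l\<close>\<close>
  define d where "d = pi / (2 * p * (c + l / 2))"
  have cl: "0 < c + l / 2" using c l by (intro add_pos_pos) auto
  have d: "0 < d" unfolding d_def using p0 cl by (intro divide_pos_pos mult_pos_pos) auto
  have dp: "pi / (2 * d * p) = c + l / 2"
  proof -
    have "x / (2 * (x / (2 * p * y)) * p) = y" if "x \<noteq> 0" "y \<noteq> 0" for x y :: real
      using that p0 by (simp add: field_simps)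
    then show ?thesis unfolding d_def using cl pi_gt_zero by (metis less_irrefl)
  qed
  have "2 * d < b - a"
  proof -
    have "2 * d * p * (c + l / 2) = pi" using dp d p0 by (simp add: divide_eq_eq mult_ac)
    also have "\<dots> = (b - a) * p * c" using cpab by (simp only: mult_ac)
    also have "\<dots> < (b - a) * p * (c + l / 2)" using l pab by (intro mult_strict_left_mono) (auto simp: mult.commute)
    finally have "(2 * d) * (p * (c + l / 2)) < (b - a) * (p * (c + l / 2))" by (simp only: mult.assoc)
    moreover have "0 < p * (c + l / 2)" using p0 cl by (intro mult_pos_pos)
    ultimately show ?thesis by (simp only: mult_less_cancel_right_pos)
  qed
  then obtain t0 where t0: "\<And>w. t0 < Re w \<Longrightarrow> \<bar>Im w - (a + b) / 2\<bar> < d \<Longrightarrow> w \<in> h ` unit_disc"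
    using right_half_strip by metis
  have "A f = (\<lambda>z. 0)"
  proof (rule intertwining_operator_zero[OF h inj \<phi> p width reg off _ _ _ _ _ _ d _ _ _ _ A tw f(1),
        where \<sigma> = 1 and ?s1.0 = "- c" and ?s2.0 = c and ?t2.0 = c and ?t1.0 = "max 0 (c - l / 2)"])
    show "hardy p (\<lambda>z. exp (of_real s * h z))" if "- c < s" "s < c" for s
    proof (rule hardy_exp_small)
      have "\<bar>s\<bar> < c" using that by linarith
      then have "\<bar>s\<bar> * (p * (b - a)) < c * (p * (b - a))" using pab by (rule mult_strict_right_mono)
      then show "\<bar>s\<bar> * (p * (b - a)) < pi" by (simp only: cpab)
    qed
    show "pi / (2 * d * p) < 1 * (s + ln (cmod \<mu>))" if "max 0 (c - l / 2) < s" for s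
    proof -
      have "c - l / 2 < s" using that by simp
      moreover have "l / 2 + l / 2 = l" by simp
      ultimately show ?thesis unfolding dp l_def[symmetric] mult_1 by linarith
    qed
    show "w \<in> h ` unit_disc" if "t0 < 1 * Re w" "\<bar>Im w - (a + b) / 2\<bar> < d" for w
      using t0 that by simp
    show "\<mu> \<noteq> 0" using \<mu>1 by auto
  qed (use c l in auto)
  with f(2) show False by simp
qed

text \<open>
  If the domain contains a horizontal strip, the same comparison can be made along the backward
  orbits in the maximal strip \<open>a' < Im w < b'\<close>, with \<open>Re \<zeta>\<close> just above \<open>-\<pi>/(p(b' - a'))\<close>; the space
  contains these exponentials, as the domain is asymptotically no wider than the strip to the left.
\<close>
lemma extended_eigenvalue_norm_ge_1:
  assumes "\<mu> \<in> Ext" and \<mu>0: "\<mu> \<noteq> 0" and S: "horizontal_strip S" "S \<subseteq> h ` unit_disc"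
  shows "1 \<le> cmod \<mu>"
proof (rule ccontr)
  assume \<mu>1: "\<not> 1 \<le> cmod \<mu>"
  obtain A f where A: "bounded_operator_on (Hp p) (Hp_norm p) A" and f: "f \<in> Hp p" "A f \<noteq> (\<lambda>z. 0)"
    and tw: "\<And>f. f \<in> Hp p \<Longrightarrow> composition_operator \<phi> (A f) = (\<lambda>z. \<mu> * A (composition_operator \<phi> f) z)"
    using ExtE[OF assms(1)] by metis
  define K where "K = closure (h ` unit_disc)"
  have sub: "h ` unit_disc \<subseteq> K" by (simp add: K_def closure_subset)
  obtain c d where cd: "c < d" "S = {w. c < Im w \<and> Im w < d}" using S(1) unfolding horizontal_strip_def by blast
  have Kinv: "w + of_real t \<in> K" if "w \<in> K" "0 \<le> t" for w t
    unfolding K_def by (rule closure_right_invariant[OF inv that[unfolded K_def]])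
  have Kwidth: "a \<le> Im w \<and> Im w \<le> b" if "w \<in> K" for w
    by (rule closure_Im_bounds[OF width that[unfolded K_def]])
  have cdK: "w \<in> K" if "c < Im w" "Im w < d" for w using that S(2) sub cd(2) by blast
  have cK: "closed K" by (simp add: K_def)
  obtain a' b' where ab': "a' < b'" "\<And>w. a' < Im w \<Longrightarrow> Im w < b' \<Longrightarrow> w \<in> K"
    "\<And>\<epsilon>. 0 < \<epsilon> \<Longrightarrow> \<exists>n. \<forall>w\<in>K. Re w < - n \<longrightarrow> a' - \<epsilon> < Im w \<and> Im w < b' + \<epsilon>"
    using maximal_strip[OF cK Kinv Kwidth off[folded K_def] cd(1) cdK] by metis
  have strip: "w \<in> h ` unit_disc" if "a' < Im w" "Im w < b'" for w
  proof -
    have "open ({w. a' < Im w} \<inter> {w. Im w < b'})" by (intro open_Int open_halfspace_Im_gt open_halfspace_Im_lt)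
    then have "{w. a' < Im w} \<inter> {w. Im w < b'} \<subseteq> interior K" by (intro interior_maximal) (use ab'(2) in auto)
    then show ?thesis using that reg by (auto simp: K_def)
  qed
  define l where "l = - ln (cmod \<mu>)"
  have l: "0 < l" using \<mu>1 \<mu>0 ln_less_zero[of "cmod \<mu>"] unfolding l_def by auto
  have pab: "0 < p * (b - a)" "0 < p * (b' - a')" using p0 ab ab'(1) by simp_all
  define c1 where "c1 = pi / (p * (b - a))"
  define c2 where "c2 = pi / (p * (b' - a'))"
  have c: "0 < c1" "0 < c2" using pab by (simp_all add: c1_def c2_def)
  have canc: "x / y * y = x" if "0 < y" for x y :: real using that by simp
  have cpab: "c1 * (p * (b - a)) = pi" "c2 * (p * (b' - a')) = pi"
    unfolding c1_def c2_def by (rule canc[OF pab(1)], rule canc[OF pab(2)])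
  define r where "r = (b' - a') / 2"
  have r: "2 * r = b' - a'" "0 < r" using ab'(1) by (simp_all add: r_def)
  define y0 where "y0 = a' + r"
  have rp: "pi / (2 * r * p) = c2" unfolding r(1) c2_def by (simp add: mult.commute)
  have "A f = (\<lambda>z. 0)"
  proof (rule intertwining_operator_zero[OF h inj \<phi> p width reg off _ _ _ _ _ _ r(2) _ _ _ _ A tw f(1),
        where \<sigma> = "-1" and ?s1.0 = "- c2" and ?s2.0 = c1 and ?t1.0 = "- c2" and ?t2.0 = "min 0 (l - c2)" and ?t0.0 = 0 and ?y0.0 = y0])
    show "hardy p (\<lambda>z. exp (of_real s * h z))" if s: "- c2 < s" "s < c1" for s
    proof (cases "s \<le> 0")
      case True
      show ?thesis
      proof (rule hardy_exp_left[OF h p0 True ab'(1)])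
        have "- s * (p * (b' - a')) < c2 * (p * (b' - a'))" using pab s by (intro mult_strict_right_mono) auto
        then show "- s * (p * (b' - a')) < pi" by (simp only: cpab)
        show "\<exists>n. \<forall>w\<in>h ` unit_disc. Re w < - n \<longrightarrow> a' - \<epsilon> < Im w \<and> Im w < b' + \<epsilon>" if "0 < \<epsilon>" for \<epsilon>
          using ab'(3)[OF that] sub by blast
      qed
    next
      case False
      have "\<bar>s\<bar> * (p * (b - a)) < c1 * (p * (b - a))" using pab s False by (intro mult_strict_right_mono) auto
      then show ?thesis by (intro hardy_exp_small) (simp only: cpab)
    qed
    show "pi / (2 * r * p) < - 1 * (s + ln (cmod \<mu>))" if "s < min 0 (l - c2)" for s
      unfolding rp using that by (simp add: l_def)
    show "w \<in> h ` unit_disc" if "\<bar>Im w - y0\<bar> < r" for w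
      by (rule strip) (use that r(1) in \<open>simp_all add: y0_def\<close>)
  qed (use c l \<mu>0 in auto)
  with f(2) show False by simp
qed

lemma unimodular_extended_eigenvalue:
  assumes "cmod \<mu> = 1" shows "\<mu> \<in> Ext"
proof -
  have \<mu>0: "\<mu> \<noteq> 0" using assms by auto
  define M where "M = \<bar>Im (Ln \<mu>)\<bar> * (\<bar>a\<bar> + \<bar>b\<bar>)"
  have "exp (Ln \<mu>) \<in> Ext"
  proof (rule exponential_multiplier_extended_eigenvalue[OF h \<phi> _ p])
    fix z assume "z \<in> unit_disc"
    then have "\<bar>Im (h z)\<bar> \<le> \<bar>a\<bar> + \<bar>b\<bar>" using width[of "h z"] by fastforce
    then have "\<bar>Im (Ln \<mu>)\<bar> * \<bar>Im (h z)\<bar> \<le> M" unfolding M_def by (intro mult_left_mono) auto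
    moreover have "- (Im (Ln \<mu>) * Im (h z)) \<le> \<bar>Im (Ln \<mu>)\<bar> * \<bar>Im (h z)\<bar>" by (metis abs_ge_minus_self abs_mult)
    ultimately show "Re (Ln \<mu> * h z) \<le> M" using assms \<mu>0 by (simp add: Re_Ln)
  qed
  then show ?thesis using \<mu>0 by simp
qed

text \<open>
  The multiplier \<open>exp (\<zeta> h)\<close> with \<open>\<zeta> = Ln \<mu>\<close> is bounded because \<open>Re \<zeta> \<le> 0\<close> and \<open>Re h\<close> is bounded below.
\<close>
lemma contractive_extended_eigenvalue:
  assumes \<mu>: "cmod \<mu> \<le> 1" "\<mu> \<noteq> 0" and R: "\<And>w. w \<in> h ` unit_disc \<Longrightarrow> R \<le> Re w"
  shows "\<mu> \<in> Ext"
proof -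
  define M where "M = \<bar>Im (Ln \<mu>)\<bar> * (\<bar>a\<bar> + \<bar>b\<bar>)"
  have "exp (Ln \<mu>) \<in> Ext"
  proof (rule exponential_multiplier_extended_eigenvalue[OF h \<phi> _ p])
    fix z assume z: "z \<in> unit_disc"
    then have "\<bar>Im (h z)\<bar> \<le> \<bar>a\<bar> + \<bar>b\<bar>" using width[of "h z"] by fastforce
    then have "\<bar>Im (Ln \<mu>)\<bar> * \<bar>Im (h z)\<bar> \<le> M" unfolding M_def by (intro mult_left_mono) auto
    moreover have "- (Im (Ln \<mu>) * Im (h z)) \<le> \<bar>Im (Ln \<mu>)\<bar> * \<bar>Im (h z)\<bar>" by (metis abs_ge_minus_self abs_mult)
    moreover have "Re (Ln \<mu>) * Re (h z) \<le> Re (Ln \<mu>) * R"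
      using \<mu> R[of "h z"] z by (intro mult_left_mono_neg) (auto simp: Re_Ln)
    ultimately show "Re (Ln \<mu> * h z) \<le> Re (Ln \<mu>) * R + M" by simp
  qed
  then show ?thesis using \<mu> by simp
qed

end

theorem theorem3p10:
  fixes \<phi> :: "complex \<Rightarrow> complex"
    and \<Phi> :: "real \<Rightarrow> complex \<Rightarrow> complex"
    and h :: "complex \<Rightarrow> complex"
    and \<Omega> :: "complex set"
    and p :: real
    and \<rho> :: ereal
  assumes "\<phi> holomorphic_on unit_disc" and "\<phi> ` unit_disc \<subseteq> unit_disc"
    and "hyperbolic_semiflow \<Phi>" and "\<forall>z\<in>unit_disc. \<phi> z = \<Phi> 1 z"
    and "koenigs_function \<Phi> h" and "\<Omega> = h ` unit_disc"
    and "interior (closure \<Omega>) = \<Omega>"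
    and "finite (components (- closure \<Omega>))" and "card (components (- closure \<Omega>)) \<le> 2"
    and "1 \<le> p"
    and "\<rho> = (INF w\<in>\<Omega>. ereal (Re w))"
  shows "((\<nexists>S. horizontal_strip S \<and> S \<subseteq> \<Omega>) \<longrightarrow>
            (\<rho> > -\<infinity> \<longrightarrow>
               extended_eigenvalues (Hp p) (Hp_norm p) (composition_operator \<phi>) = cball 0 1 - {0}) \<and>
            (\<rho> = -\<infinity> \<longrightarrow>
               sphere 0 1 \<subseteq> extended_eigenvalues (Hp p) (Hp_norm p) (composition_operator \<phi>) \<and>
               extended_eigenvalues (Hp p) (Hp_norm p) (composition_operator \<phi>) \<subseteq> cball 0 1 - {0})) \<and>
         ((\<exists>S. horizontal_strip S \<and> S \<subseteq> \<Omega>) \<longrightarrow>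
            extended_eigenvalues (Hp p) (Hp_norm p) (composition_operator \<phi>) = sphere 0 1)"
proof -
  note \<Omega> = assms(6)
  have h: "h holomorphic_on unit_disc" and inj: "inj_on h unit_disc" using assms(5) by (auto simp: koenigs_function_def)
  have \<phi>: "\<phi> z \<in> unit_disc \<and> h (\<phi> z) = h z + 1" if "z \<in> unit_disc" for z
  proof -
    have "\<phi> z = \<Phi> 1 z" "\<phi> z \<in> unit_disc" using assms(2,4) that by blast+
    then show ?thesis using koenigs_shift(1)[OF assms(5), of 1 z] that by simp
  qed
  have inv: "w + of_real t \<in> \<Omega>" if "w \<in> \<Omega>" "0 \<le> t" for w t
    using koenigs_domain_shift[OF assms(5) that(2)] that(1) by (simp add: \<Omega>)
  have o\<Omega>: "open \<Omega>" unfolding \<Omega> by (rule open_mapping_thm3[OF h open_ball inj])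
  have c\<Omega>: "connected \<Omega>" unfolding \<Omega>
    by (intro connected_continuous_image holomorphic_on_imp_continuous_on h) simp
  have h0: "h 0 \<in> \<Omega>" by (simp add: \<Omega>)
  obtain L where L: "\<And>w w'. w \<in> \<Omega> \<Longrightarrow> w' \<in> \<Omega> \<Longrightarrow> Im w - Im w' \<le> L"
    using hyperbolic_koenigs_width_bounded[OF assms(3,5)] by (auto simp: \<Omega>)
  define I where "I = Im ` \<Omega>"
  have bI: "bdd_above I" "bdd_below I"
  proof -
    show "bdd_above I" unfolding I_def by (rule bdd_aboveI2[where M = "Im (h 0) + L"]) (use L[OF _ h0] in \<open>simp add: algebra_simps\<close>)
    show "bdd_below I" unfolding I_def by (rule bdd_belowI2[where m = "Im (h 0) - L"]) (use L[OF h0] in \<open>simp add: algebra_simps\<close>)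
  qed
  have neI: "I \<noteq> {}" using h0 by (auto simp: I_def)
  define a where "a = Inf I"
  define b where "b = Sup I"
  have width: "a \<le> Im w \<and> Im w \<le> b" if "w \<in> \<Omega>" for w
    using that bI by (auto simp: a_def b_def I_def intro: cInf_lower cSup_upper)
  have ab: "a < b"
  proof -
    obtain e where e: "0 < e" "cball (h 0) e \<subseteq> \<Omega>" using o\<Omega> h0 by (meson open_contains_cball)
    have "h 0 + \<i> * of_real e \<in> \<Omega>" using e by (intro subsetD[OF e(2)]) (simp add: dist_norm norm_mult)
    then have "Im (h 0) + e \<le> b" using width by fastforce
    then show ?thesis using width[OF h0] e(1) by linarith
  qed
  have heights: "\<exists>w\<in>\<Omega>. Im w = y" if y: "a < y" "y < b" for y
  proof -
    obtain y1 y2 where "y1 \<in> I" "y1 < y" "y2 \<in> I" "y < y2"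
      using y cInf_less_iff[OF neI bI(2)] less_cSup_iff[OF neI bI(1)] by (auto simp: a_def b_def)
    moreover have "connected I" unfolding I_def by (intro connected_continuous_image c\<Omega> continuous_intros)
    ultimately have "y \<in> I" by (meson connectedD_interval less_imp_le)
    then show ?thesis by (auto simp: I_def)
  qed
  define K where "K = closure \<Omega>"
  have Kinv: "w + of_real t \<in> K" if "w \<in> K" "0 \<le> t" for w t
    unfolding K_def by (rule closure_right_invariant[OF inv that[unfolded K_def]])
  have Kwidth: "a \<le> Im w \<and> Im w \<le> b" if "w \<in> K" for w
    by (rule closure_Im_bounds[OF width that[unfolded K_def]])
  have off: "\<exists>T. connected T \<and> w \<in> T \<and> T \<inter> K = {} \<and> (\<exists>v\<in>T. Im v < a \<or> b < Im v)" if "w \<notin> K" for w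
    by (rule complement_connects_to_half_planes[OF Kinv Kwidth assms(8,9)[folded K_def] that])
  interpret regular_koenigs_domain \<phi> h p a b
    by unfold_locales
       (fact h inj \<phi> assms(10) inv[unfolded \<Omega>] ab width[unfolded \<Omega>] heights[unfolded \<Omega>] assms(7)[unfolded \<Omega>] off[unfolded K_def \<Omega>])+
  have inj\<phi>: "inj_on \<phi> unit_disc"
  proof (rule inj_onI)
    fix z w assume zw: "z \<in> unit_disc" "w \<in> unit_disc" "\<phi> z = \<phi> w"
    then have "h z + 1 = h w + 1" using \<phi> by metis
    then show "z = w" using inj zw by (auto dest: inj_onD)
  qed
  have upper: "Ext \<subseteq> cball 0 1 - {0}"
    using extended_eigenvalue_norm_le_1 zero_not_extended_eigenvalue[OF assms(1,2) inj\<phi>] by auto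
  have circle: "sphere 0 1 \<subseteq> Ext" using unimodular_extended_eigenvalue by auto
  have disc: "cball 0 1 - {0} \<subseteq> Ext" if \<rho>: "\<rho> > -\<infinity>"
  proof
    fix \<mu> :: complex assume \<mu>: "\<mu> \<in> cball 0 1 - {0}"
    have "\<rho> \<le> ereal (Re (h 0))" unfolding assms(11) by (rule INF_lower[OF h0])
    then obtain R where R: "\<rho> = ereal R" using \<rho> by (cases \<rho>) auto
    show "\<mu> \<in> Ext"
    proof (rule contractive_extended_eigenvalue[where R = R])
      fix w assume "w \<in> h ` unit_disc"
      then have "\<rho> \<le> ereal (Re w)" unfolding assms(11) \<Omega> by (rule INF_lower)
      then show "R \<le> Re w" by (simp add: R)
    qed (use \<mu> in auto)
  qed
  have strip: "Ext = sphere 0 1" if "horizontal_strip S" "S \<subseteq> \<Omega>" for S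
  proof (rule antisym[OF subsetI circle])
    fix \<mu> assume \<mu>: "\<mu> \<in> Ext"
    then have "\<mu> \<noteq> 0" "cmod \<mu> \<le> 1" using upper by auto
    moreover have "1 \<le> cmod \<mu>" by (rule extended_eigenvalue_norm_ge_1[OF \<mu> \<open>\<mu> \<noteq> 0\<close> that(1) that(2)[unfolded \<Omega>]])
    ultimately show "\<mu> \<in> sphere 0 1" by simp
  qed
  show ?thesis using upper circle disc strip by blast
qed

end
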